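(* Let $Q=[-1,1]^2$ and let $W(F)=\frac12|F|^2+h_0(\det F)$ for $F\in\mathbb{R}^{2\times2}$. Assume that $h_0$ is strongly convex, $C^2$ where it is finite, satisfies (H1)--(H3) listed in the context, and that for every $\mu>0$ there is $C_\mu>0$ such that $|h_0''(s)|\le C_\mu$ for all $s\in[\mu,+\infty)$. Let $$I_s(\sigma)=\int_QW(\nabla u_\sigma)\,dx,\qquad \mathcal{A}_s=\{\sigma\in W^{1,2}(Q;\mathbb{R}):\ \sigma=0\text{ on }\partial Q_1,\ I_s(\sigma)<+\infty\},$$ where $\partial Q_1=\{(\pm1,t):-1\le t\le1\}$. Then the function $$\nabla\sigma\mapsto W(\nabla u_\sigma)$$ is strongly convex and the minimizer $\sigma$ of $I_s$ in $\mathcal{A}_s$ is unique. Moreover, if there exists $c>0$ such that $$1+\partial_2\sigma(x)\ge c\quad\text{for a.e. }x\in Q,$$ then $\sigma$ belongs to $W^{2,2}(Q\setminus V)$, where $V$ is any compact set whose interior contains the corners $\{(\pm1,\pm1)\}$ of $Q$.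
   Context: For a scalar function $\sigma$ on $Q$, the shear map is $u_\sigma(x)=x+\sigma(x)e_2$ with $e_2=(0,1)$, so $\nabla u_\sigma=\mathbf{1}+e_2\otimes\nabla\sigma$, $\det\nabla u_\sigma=1+\partial_2\sigma$, and $W(\nabla u_\sigma)=\frac12|\mathbf{1}+e_2\otimes\nabla\sigma|^2+h_0(1+\partial_2\sigma)$ is viewed as a function of the vector $\nabla\sigma\in\mathbb{R}^2$. Boundary conditions are in the sense of trace. A function $g$ with values in $(-\infty,+\infty]$ is strongly convex if $g-\frac\lambda2|\cdot|^2$ is convex for some $\lambda>0$. Hypotheses on $h_0:\mathbb{R}\to[0,+\infty]$: (H1) $h_0$ is convex and $h_0\ge0$; (H2) $h_0\in C^3((0,+\infty))$ and for some positive constants $s,c_1,c_2,d_0$: $c_1t^{-s-j}\le(-1)^jh_0^{(j)}(t)\le c_2t^{-s-j}$ for $0<t<d_0$ and $j=0,1,2$; (H3) $h_0(t)=+\infty$ for $t\le0$. *)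

theory Defs
  imports "HOL-Analysis.Analysis"
begin

text \<open>On \<^typ>\<open>ereal\<close> we have \<open>0 * \<infinity> = 0\<close>, so the inequality below is the usual one at the
  endpoints \<open>u = 0\<close> and \<open>v = 0\<close> also where \<open>f\<close> is infinite.\<close>

definition ereal_convex :: "('a::real_vector \<Rightarrow> ereal) \<Rightarrow> bool" where
  "ereal_convex f \<longleftrightarrow> (\<forall>x. f x \<noteq> - \<infinity>) \<and>
     (\<forall>x y u v. 0 \<le> u \<longrightarrow> 0 \<le> v \<longrightarrow> u + v = 1 \<longrightarrow>
        f (u *\<^sub>R x + v *\<^sub>R y) \<le> ereal u * f x + ereal v * f y)"

definition strongly_convex :: "('a::real_normed_vector \<Rightarrow> ereal) \<Rightarrow> bool" where
  "strongly_convex g \<longleftrightarrow>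
     (\<exists>l>0. ereal_convex (\<lambda>x. g x - ereal (l / 2 * (norm x)\<^sup>2)))"

text \<open>\<open>Ck_on k f S\<close> is \<open>f \<in> C\<^sup>k(S)\<close>. It is meant for open \<open>S\<close> only: the derivatives are
  unrestricted derivatives at the points of \<open>S\<close>.\<close>

primrec Ck_on :: "nat \<Rightarrow> ('a::euclidean_space \<Rightarrow> real) \<Rightarrow> 'a set \<Rightarrow> bool" where
  "Ck_on 0 f S \<longleftrightarrow> continuous_on S f"
| "Ck_on (Suc k) f S \<longleftrightarrow> (\<forall>x\<in>S. f differentiable (at x)) \<and>
     (\<forall>b\<in>Basis. Ck_on k (\<lambda>x. frechet_derivative f (at x) b) S)"

definition smooth :: "('a::euclidean_space \<Rightarrow> real) \<Rightarrow> bool" where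
  "smooth f \<longleftrightarrow> (\<forall>k. Ck_on k f UNIV)"

definition test_functions :: "'a::euclidean_space set \<Rightarrow> ('a \<Rightarrow> real) set" where
  "test_functions U = {\<phi>. smooth \<phi> \<and> compact (closure {x. \<phi> x \<noteq> 0}) \<and> closure {x. \<phi> x \<noteq> 0} \<subseteq> U}"

text \<open>Elements of Lebesgue and Sobolev spaces are represented by functions, with almost everywhere
  equality in place of equality. The sets \<open>U\<close> are meant to be open wherever weak derivatives
  are involved.\<close>

definition L2_on :: "'a::euclidean_space set \<Rightarrow> ('a \<Rightarrow> real) set" where
  "L2_on U = {f. f \<in> borel_measurable (lebesgue_on U) \<and>
                 integrable (lebesgue_on U) (\<lambda>x. (f x)\<^sup>2)}"

definition locally_integrable_on :: "'a::euclidean_space set \<Rightarrow> ('a \<Rightarrow> real) \<Rightarrow> bool" where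
  "locally_integrable_on U f \<longleftrightarrow>
     (\<forall>K. compact K \<longrightarrow> K \<subseteq> U \<longrightarrow> integrable (lebesgue_on K) f)"

definition has_weak_partial ::
    "(real^'n) set \<Rightarrow> 'n::finite \<Rightarrow> (real^'n \<Rightarrow> real) \<Rightarrow> (real^'n \<Rightarrow> real) \<Rightarrow> bool" where
  "has_weak_partial U i f g \<longleftrightarrow> locally_integrable_on U f \<and> locally_integrable_on U g \<and>
     (\<forall>\<phi>\<in>test_functions U.
        (LINT x|lebesgue_on U. f x * frechet_derivative \<phi> (at x) (axis i 1)) =
        - (LINT x|lebesgue_on U. g x * \<phi> x))"

text \<open>\<open>sobolev k U\<close> is \<open>W\<^sup>k\<^sup>,\<^sup>2(U)\<close>.\<close>

primrec sobolev :: "nat \<Rightarrow> (real^'n::finite) set \<Rightarrow> (real^'n \<Rightarrow> real) set" where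
  "sobolev 0 U = L2_on U"
| "sobolev (Suc k) U = {f \<in> L2_on U. \<forall>i. \<exists>g \<in> sobolev k U. has_weak_partial U i f g}"

text \<open>An arbitrary representative of the weak gradient, which is determined up to null sets.\<close>

definition weak_grad :: "(real^'n::finite) set \<Rightarrow> (real^'n \<Rightarrow> real) \<Rightarrow> real^'n \<Rightarrow> real^'n" where
  "weak_grad U f = (SOME G. \<forall>i. has_weak_partial U i f (\<lambda>x. G x $ i))"

definition sobolev1_norm :: "(real^'n::finite) set \<Rightarrow> (real^'n \<Rightarrow> real) \<Rightarrow> real" where
  "sobolev1_norm U f =
     sqrt ((LINT x|lebesgue_on U. (f x)\<^sup>2) + (LINT x|lebesgue_on U. (norm (weak_grad U f x))\<^sup>2))"

definition Q :: "(real^2) set" where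
  "Q = {x. \<forall>i. -1 \<le> x $ i \<and> x $ i \<le> 1}"

definition corners :: "(real^2) set" where
  "corners = {x. \<forall>i. x $ i = -1 \<or> x $ i = 1}"

text \<open>\<open>t \<mapsto> \<tau> t\<close> is the trace of \<open>f \<in> W\<^sup>1\<^sup>,\<^sup>2(Q)\<close> on the side \<open>{a} \<times> [-1,1]\<close>, where \<open>a = 1\<close> or
  \<open>a = -1\<close>. The trace operator is the continuous extension to \<open>W\<^sup>1\<^sup>,\<^sup>2(Q)\<close> of the
  restriction map from functions smooth up to the boundary, which are dense, to
  \<open>L\<^sup>2\<close> of the side; the relation below is the graph of this extension.\<close>

definition has_trace :: "(real^2 \<Rightarrow> real) \<Rightarrow> real \<Rightarrow> (real \<Rightarrow> real) \<Rightarrow> bool" where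
  "has_trace f a \<tau> \<longleftrightarrow> f \<in> sobolev 1 (interior Q) \<and> \<tau> \<in> L2_on {-1..1} \<and>
     (\<exists>\<phi> :: nat \<Rightarrow> real^2 \<Rightarrow> real. (\<forall>n. smooth (\<phi> n)) \<and>
        (\<lambda>n. sobolev1_norm (interior Q) (\<lambda>x. \<phi> n x - f x)) \<longlonglongrightarrow> 0 \<and>
        (\<lambda>n. LINT t|lebesgue_on {-1..1}. (\<phi> n (vector [a, t]) - \<tau> t)\<^sup>2) \<longlonglongrightarrow> 0)"

text \<open>The norm on \<^typ>\<open>real^2^2\<close> is the Frobenius norm.\<close>

definition W :: "(real \<Rightarrow> ereal) \<Rightarrow> real^2^2 \<Rightarrow> ereal" where
  "W h0 F = ereal (1 / 2 * (norm F)\<^sup>2) + h0 (det F)"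

definition e2 :: "real^2" where
  "e2 = axis 2 1"

definition tensor :: "real^'m \<Rightarrow> real^'n \<Rightarrow> real^'n^'m" where
  "tensor a b = (\<chi> i j. a $ i * b $ j)"

definition shear :: "(real^2 \<Rightarrow> real) \<Rightarrow> real^2 \<Rightarrow> real^2" where
  "shear \<sigma> x = x + \<sigma> x *\<^sub>R e2"

definition shear_gradient :: "real^2 \<Rightarrow> real^2^2" where
  "shear_gradient \<xi> = mat 1 + tensor e2 \<xi>"

lemma shear_has_derivative:
  assumes "(\<sigma> has_derivative (\<lambda>h. \<xi> \<bullet> h)) (at x)"
  shows "(shear \<sigma> has_derivative (\<lambda>h. shear_gradient \<xi> *v h)) (at x)"
proof -
  have "shear_gradient \<xi> *v h = h + (\<xi> \<bullet> h) *\<^sub>R e2" for h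
    by (simp add: shear_gradient_def tensor_def matrix_vector_mult_add_rdistrib
        vec_eq_iff matrix_vector_mult_def inner_vec_def mat_def sum_2 forall_2 algebra_simps)
  moreover have "((\<lambda>x. x + \<sigma> x *\<^sub>R e2) has_derivative (\<lambda>h. h + (\<xi> \<bullet> h) *\<^sub>R e2)) (at x)"
    by (auto intro!: derivative_eq_intros assms)
  ultimately show ?thesis
    by (simp add: shear_def[abs_def])
qed

lemma det_shear_gradient: "det (shear_gradient \<xi>) = 1 + \<xi> $ 2"
  by (simp add: shear_gradient_def tensor_def e2_def det_2 mat_def axis_def)

definition I_s :: "(real \<Rightarrow> ereal) \<Rightarrow> (real^2 \<Rightarrow> real) \<Rightarrow> ennreal" where
  "I_s h0 \<sigma> =
     (\<integral>\<^sup>+ x. e2ennreal (W h0 (shear_gradient (weak_grad (interior Q) \<sigma> x))) \<partial>lebesgue_on Q)"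

definition A_s :: "(real \<Rightarrow> ereal) \<Rightarrow> (real^2 \<Rightarrow> real) set" where
  "A_s h0 = {\<sigma> \<in> sobolev 1 (interior Q).
     has_trace \<sigma> (-1) (\<lambda>t. 0) \<and> has_trace \<sigma> 1 (\<lambda>t. 0) \<and> I_s h0 \<sigma> < \<infinity>}"

definition minimizer :: "(real \<Rightarrow> ereal) \<Rightarrow> (real^2 \<Rightarrow> real) \<Rightarrow> bool" where
  "minimizer h0 \<sigma> \<longleftrightarrow> is_arg_min (I_s h0) (\<lambda>\<tau>. \<tau> \<in> A_s h0) \<sigma>"

text \<open>\<open>h0_deriv h0 j t\<close> is the \<open>j\<close>-th derivative of \<open>h0\<close> at an interior point \<open>t\<close> of the set where
  \<open>h0\<close> is finite.\<close>

definition h0_deriv :: "(real \<Rightarrow> ereal) \<Rightarrow> nat \<Rightarrow> real \<Rightarrow> real" where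
  "h0_deriv h0 j = (deriv ^^ j) (\<lambda>t. real_of_ereal (h0 t))"

definition H1 :: "(real \<Rightarrow> ereal) \<Rightarrow> bool" where
  "H1 h0 \<longleftrightarrow> ereal_convex h0 \<and> (\<forall>t. 0 \<le> h0 t)"

definition H2 :: "(real \<Rightarrow> ereal) \<Rightarrow> bool" where
  "H2 h0 \<longleftrightarrow> (\<forall>t>0. \<bar>h0 t\<bar> \<noteq> \<infinity>) \<and> Ck_on 3 (\<lambda>t. real_of_ereal (h0 t)) {0<..} \<and>
     (\<exists>s>0. \<exists>c1>0. \<exists>c2>0. \<exists>d0>0. \<forall>t. 0 < t \<and> t < d0 \<longrightarrow> (\<forall>j\<in>{0, 1, 2}.
        c1 * t powr (- s - real j) \<le> (-1) ^ j * h0_deriv h0 j t \<and>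
        (-1) ^ j * h0_deriv h0 j t \<le> c2 * t powr (- s - real j)))"

definition H3 :: "(real \<Rightarrow> ereal) \<Rightarrow> bool" where
  "H3 h0 \<longleftrightarrow> (\<forall>t\<le>0. h0 t = \<infinity>)"

end

theory Submission
  imports Defs
begin

text \<open>The quadratic part of \<open>W\<close> makes the energy uniformly convex in \<open>\<nabla>\<sigma>\<close>. Comparing two
  admissible functions with their midpoint therefore shows that minimizing sequences are Cauchy in
  \<open>W\<^sup>1\<^sup>,\<^sup>2\<close>, by the Poincare inequality, and that minimizers are unique; existence follows
  from Fatou's lemma, without weak compactness.

  The bound \<open>1 + \<partial>\<^sub>2\<sigma> \<ge> c\<close> makes the equation \<open>\<partial>\<^sub>1\<^sub>1\<sigma> + \<partial>\<^sub>2 P = 0\<close>, with \<open>P\<close> a Lipschitz and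
  uniformly monotone function of \<open>\<partial>\<^sub>2\<sigma>\<close>, uniformly elliptic, and difference quotients in direction \<open>i\<close>
  with a cutoff in \<open>x\<^sub>i\<close> alone give \<open>\<partial>\<^sub>i\<nabla>\<sigma>\<close> in \<open>L\<^sup>2\<close> up to the sides parallel to direction \<open>i\<close>.
  The variation \<open>D\<^sub>-\<^sub>h (\<theta> D\<^sub>h \<sigma>)\<close> can be tested directly, with no density argument: its contribution to
  \<open>\<partial>\<^sub>2\<close> is a convex combination of translates of \<open>\<partial>\<^sub>2\<sigma>\<close> and, for \<open>i = 2\<close>, a term which is bounded
  since \<open>\<sigma>\<close> is locally bounded: \<open>x\<^sub>2 + \<sigma>\<close> is increasing in \<open>x\<^sub>2\<close>, and the averages of \<open>\<sigma>\<close> over vertical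
  segments are controlled by \<open>\<integral> |\<partial>\<^sub>1\<sigma>|\<close>. The remaining second derivative is read off from the equation.\<close>

subsection \<open>Smooth functions\<close>

text \<open>The energy is infinite where \<open>1 + \<partial>\<^sub>2\<sigma> \<le> 0\<close>, and
  \<open>h0''\<close> is controlled only away from 0, so a variation in L2 is not enough: along it
  the determinant must stay above c/2 almost everywhere. This dictates the shape of the test
  function, and it is why a bound on \<sigma> itself enters for i = 2, where the cutoff is
  differentiated.

  The second differences use no values from outside Q. The cutoff keeps shifted points away from the
  two sides orthogonal to direction i, and the shift does not change the distance to the other two.
  The zero trace on |x_1| = 1 survives in both directions, while nothing is imposed on the free
  sides. Near a corner no direction is left in which the cutoff equals 1; the strips |x_1| < 1 - r
  and |x_2| < 1 - r cover what remains.

  Weak notions are transported to Borel functions on the plane that vanish off the open square, so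
  that translations act everywhere and preserve Lebesgue measure. Density of test functions in L2 is
  replaced by a Riesz representation on a space of functions that need not be closed.\<close>

lemma frechet_worksI: "f differentiable (at x) \<Longrightarrow> (f has_derivative frechet_derivative f (at x)) (at x)"
  using frechet_derivative_works by blast

lemma frechet_eqI: "(f has_derivative D) (at x) \<Longrightarrow> frechet_derivative f (at x) b = D b"
  using frechet_derivative_at by metis

lemma Ck_on_Suc_imp: "Ck_on (Suc k) f UNIV \<Longrightarrow> Ck_on k f UNIV"
proof (induction k arbitrary: f)
  case 0
  then show ?case
    by (auto intro!: differentiable_imp_continuous_on simp: differentiable_on_def differentiable_at_withinI)
next
  case (Suc k)
  then show ?case by auto
qed

lemma Ck_on_const: "Ck_on k (\<lambda>x::'a::euclidean_space. c) UNIV"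
  by (induction k arbitrary: c) (auto simp: frechet_derivative_const)

lemma frechet_derivative_add_at:
  fixes f g :: "'a::euclidean_space \<Rightarrow> real"
  assumes "f differentiable (at x)" "g differentiable (at x)"
  shows "frechet_derivative (\<lambda>x. f x + g x) (at x) b =
    frechet_derivative f (at x) b + frechet_derivative g (at x) b"
  by (rule frechet_eqI[OF has_derivative_add[OF assms[THEN frechet_worksI]]])

lemma frechet_derivative_mult_at:
  fixes f g :: "'a::euclidean_space \<Rightarrow> real"
  assumes "f differentiable (at x)" "g differentiable (at x)"
  shows "frechet_derivative (\<lambda>x. f x * g x) (at x) b =
    f x * frechet_derivative g (at x) b + frechet_derivative f (at x) b * g x"
  by (rule frechet_eqI[OF has_derivative_mult[OF assms[THEN frechet_worksI]]])

text \<open>A nested product with the constant -1 is a form for which the induction in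
  \<open>Ck_on_inverse\<close> needs only closure under products and constants.\<close>

lemma frechet_derivative_inverse_at:
  fixes f :: "'a::euclidean_space \<Rightarrow> real"
  assumes "f differentiable (at x)" "f x \<noteq> 0"
  shows "frechet_derivative (\<lambda>x. inverse (f x)) (at x) b =
    (-1) * (inverse (f x) * (inverse (f x) * frechet_derivative f (at x) b))"
proof -
  have "((\<lambda>x. inverse (f x)) has_derivative
      (\<lambda>h. - (inverse (f x) * frechet_derivative f (at x) h * inverse (f x)))) (at x)"
    using Deriv.has_derivative_inverse[OF assms(2) frechet_worksI[OF assms(1)]] .
  then show ?thesis by (subst frechet_derivative_at[symmetric]) (auto simp: ac_simps)
qed

lemma frechet_derivative_affine_at:
  fixes f :: "real \<Rightarrow> real" and u :: "'a::euclidean_space"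
  assumes "f differentiable (at (u \<bullet> x + c))"
  shows "((\<lambda>x. f (u \<bullet> x + c)) has_derivative
      (\<lambda>b. (u \<bullet> b) * frechet_derivative f (at (u \<bullet> x + c)) 1)) (at x)"
proof -
  have 1: "((\<lambda>x. u \<bullet> x + c) has_derivative (\<lambda>b. u \<bullet> b)) (at x)"
    by (auto intro!: derivative_eq_intros)
  have "((\<lambda>x. f (u \<bullet> x + c)) has_derivative
      (\<lambda>b. frechet_derivative f (at (u \<bullet> x + c)) (u \<bullet> b))) (at x)"
    using diff_chain_at[OF 1 frechet_worksI[OF assms]] by (simp add: o_def)
  moreover have "frechet_derivative f (at (u \<bullet> x + c)) (u \<bullet> b) =
      (u \<bullet> b) * frechet_derivative f (at (u \<bullet> x + c)) 1" for b
    using linear_scale[OF linear_frechet_derivative[OF assms], of "u \<bullet> b" 1] by simp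
  ultimately show ?thesis by simp
qed

lemma Ck_on_add:
  "Ck_on k f UNIV \<Longrightarrow> Ck_on k g UNIV \<Longrightarrow> Ck_on k (\<lambda>x::'a::euclidean_space. f x + g x) UNIV"
  by (induction k arbitrary: f g) (auto intro: continuous_on_add simp: frechet_derivative_add_at)

lemma Ck_on_mult:
  "Ck_on k f UNIV \<Longrightarrow> Ck_on k g UNIV \<Longrightarrow> Ck_on k (\<lambda>x::'a::euclidean_space. f x * g x) UNIV"
proof (induction k arbitrary: f g)
  case 0
  then show ?case by (auto intro: continuous_on_mult)
next
  case (Suc k)
  then show ?case
    using Ck_on_Suc_imp[OF Suc.prems(1)] Ck_on_Suc_imp[OF Suc.prems(2)]
    by (auto simp: frechet_derivative_mult_at intro!: Ck_on_add)
qed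

lemma Ck_on_inverse:
  "Ck_on k f UNIV \<Longrightarrow> (\<And>x. f x \<noteq> 0) \<Longrightarrow> Ck_on k (\<lambda>x::'a::euclidean_space. inverse (f x)) UNIV"
proof (induction k arbitrary: f)
  case 0
  then show ?case by (auto intro: continuous_on_inverse)
next
  case (Suc k)
  have *: "Ck_on k (\<lambda>x. inverse (f x)) UNIV"
    using Suc Ck_on_Suc_imp by blast
  have "Ck_on k (\<lambda>x. (-1) * (inverse (f x) * (inverse (f x) * frechet_derivative f (at x) b))) UNIV"
    if "b \<in> Basis" for b
    using Suc.prems(1) that by (intro Ck_on_mult Ck_on_const *) auto
  then show ?case
    using Suc.prems by (auto simp: frechet_derivative_inverse_at)
qed

lemma Ck_on_affine:
  fixes u :: "'a::euclidean_space"
  shows "Ck_on k f UNIV \<Longrightarrow> Ck_on k (\<lambda>x. f (u \<bullet> x + c)) UNIV"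
proof (induction k arbitrary: f)
  case 0
  then have "continuous_on UNIV (\<lambda>x. f (u \<bullet> x + c))"
    by (auto intro!: continuous_on_compose2[of UNIV f] continuous_intros)
  then show ?case by simp
next
  case (Suc k)
  have d: "((\<lambda>x. f (u \<bullet> x + c)) has_derivative
      (\<lambda>b. (u \<bullet> b) * frechet_derivative f (at (u \<bullet> x + c)) 1)) (at x)" for x
    using Suc.prems by (intro frechet_derivative_affine_at) auto
  have "frechet_derivative (\<lambda>x. f (u \<bullet> x + c)) (at x) =
     (\<lambda>b. (u \<bullet> b) * frechet_derivative f (at (u \<bullet> x + c)) 1)" for x
    using frechet_derivative_at[OF d] by simp
  moreover have "Ck_on k (\<lambda>x. frechet_derivative f (at x) 1) UNIV"
    using Suc.prems by auto
  ultimately show ?case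
    using d by (auto simp: differentiable_def intro!: Ck_on_mult Ck_on_const Suc.IH)
qed

lemma frechet_derivative_shift_at:
  fixes f :: "'a::euclidean_space \<Rightarrow> real"
  assumes "f differentiable (at (x + v))"
  shows "((\<lambda>x. f (x + v)) has_derivative frechet_derivative f (at (x + v))) (at x)"
proof -
  have 1: "((\<lambda>x. x + v) has_derivative (\<lambda>b. b)) (at x)"
    by (auto intro!: derivative_eq_intros)
  show ?thesis
    using diff_chain_at[OF 1 frechet_worksI[OF assms]] by (simp add: o_def)
qed

lemma Ck_on_shift:
  "Ck_on k f UNIV \<Longrightarrow> Ck_on k (\<lambda>x::'a::euclidean_space. f (x + v)) UNIV"
proof (induction k arbitrary: f)
  case 0
  then have "continuous_on UNIV (\<lambda>x. f (x + v))"
    by (auto intro!: continuous_on_compose2[of UNIV f] continuous_intros)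
  then show ?case by simp
next
  case (Suc k)
  have d: "((\<lambda>x. f (x + v)) has_derivative frechet_derivative f (at (x + v))) (at x)" for x
    using Suc.prems by (intro frechet_derivative_shift_at) auto
  have "frechet_derivative (\<lambda>x. f (x + v)) (at x) = frechet_derivative f (at (x + v))" for x
    using frechet_derivative_at[OF d] by simp
  then show ?case
    using d Suc.prems Suc.IH by (fastforce simp: differentiable_def)
qed

lemma smooth_const [intro]: "smooth (\<lambda>x. c)"
  and smooth_add [intro]: "smooth f \<Longrightarrow> smooth g \<Longrightarrow> smooth (\<lambda>x. f x + g x)"
  and smooth_mult [intro]: "smooth f \<Longrightarrow> smooth g \<Longrightarrow> smooth (\<lambda>x. f x * g x)"
  and smooth_inverse: "smooth f \<Longrightarrow> (\<And>x. f x \<noteq> 0) \<Longrightarrow> smooth (\<lambda>x. inverse (f x))"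
  and smooth_affine: "smooth F \<Longrightarrow> smooth (\<lambda>x. F (u \<bullet> x + c))"
  and smooth_shift: "smooth f \<Longrightarrow> smooth (\<lambda>x. f (x + v))"
  for f g :: "'a::euclidean_space \<Rightarrow> real" and F :: "real \<Rightarrow> real" and u :: 'a
  unfolding smooth_def
  by (auto intro: Ck_on_const Ck_on_add Ck_on_mult Ck_on_inverse Ck_on_affine Ck_on_shift)

lemma smooth_diff [intro]:
  fixes f g :: "'a::euclidean_space \<Rightarrow> real"
  assumes "smooth f" "smooth g"
  shows "smooth (\<lambda>x. f x - g x)"
  using smooth_add[OF assms(1) smooth_mult[OF smooth_const[of "-1"] assms(2)]] by simp

lemma smooth_differentiable: "smooth f \<Longrightarrow> f differentiable (at x)"
  and smooth_frechet: "smooth f \<Longrightarrow> b \<in> Basis \<Longrightarrow> smooth (\<lambda>x. frechet_derivative f (at x) b)"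
  and smooth_continuous: "smooth f \<Longrightarrow> continuous_on S f"
proof -
  show "smooth f \<Longrightarrow> f differentiable (at x)"
    unfolding smooth_def using Ck_on.simps(2)[of 0 f UNIV] by blast
  show "smooth f \<Longrightarrow> b \<in> Basis \<Longrightarrow> smooth (\<lambda>x. frechet_derivative f (at x) b)"
    unfolding smooth_def using Ck_on.simps(2)[of _ f UNIV] by blast
  show "smooth f \<Longrightarrow> continuous_on S f"
    unfolding smooth_def using Ck_on.simps(1)[of f UNIV] continuous_on_subset[of UNIV f S] by blast
qed

section \<open>Partial derivatives of smooth functions\<close>

definition pd :: "'n::finite \<Rightarrow> (real^'n \<Rightarrow> real) \<Rightarrow> real^'n \<Rightarrow> real" where
  "pd i f x = frechet_derivative f (at x) (axis i 1)"

lemma smooth_pd [intro]: "smooth f \<Longrightarrow> smooth (pd i f)"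
  unfolding pd_def by (intro smooth_frechet) (auto simp: axis_in_Basis_iff)

lemma smooth_borel [measurable]: "smooth f \<Longrightarrow> f \<in> borel_measurable borel"
  by (intro borel_measurable_continuous_onI smooth_continuous)

lemma pd_const: "pd i (\<lambda>x. c) x = 0"
  by (simp add: pd_def frechet_derivative_const)

lemma pd_add: "smooth f \<Longrightarrow> smooth g \<Longrightarrow> pd i (\<lambda>x. f x + g x) x = pd i f x + pd i g x"
  unfolding pd_def by (intro frechet_derivative_add_at smooth_differentiable)

lemma pd_mult: "smooth f \<Longrightarrow> smooth g \<Longrightarrow> pd i (\<lambda>x. f x * g x) x = f x * pd i g x + pd i f x * g x"
  unfolding pd_def by (intro frechet_derivative_mult_at smooth_differentiable)

lemma pd_cmult: "smooth (f :: real^'n::finite \<Rightarrow> real) \<Longrightarrow> pd i (\<lambda>x. c * f x) x = c * pd i f x"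
  using pd_mult[OF smooth_const, of f i c x] by (simp add: pd_const)

lemma pd_diff: "smooth f \<Longrightarrow> smooth g \<Longrightarrow> pd i (\<lambda>x. f x - g x) x = pd i f x - pd i g x"
  using pd_add[of f "\<lambda>x. (-1) * g x" i x] pd_cmult[of g i "-1" x] smooth_mult[OF smooth_const[of "-1"], of g]
  by simp

lemma pd_shift: "smooth f \<Longrightarrow> pd i (\<lambda>x. f (x + v)) x = pd i f (x + v)"
  unfolding pd_def
  by (rule frechet_eqI[OF frechet_derivative_shift_at[OF smooth_differentiable]])

lemma inner_axis1: "axis i 1 \<bullet> x = (x::real^'n::finite) $ i"
  by (simp add: inner_axis')

lemma smooth_coord:
  fixes F :: "real \<Rightarrow> real"
  assumes "smooth F"
  shows "smooth (\<lambda>x::real^'n::finite. F (x $ i))"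
  using smooth_affine[OF assms, of "axis i 1 :: real^'n" 0] by (simp add: inner_axis1)

lemma smooth_deriv_exists: "smooth (F :: real \<Rightarrow> real) \<Longrightarrow> (F has_real_derivative deriv F x) (at x)"
  using smooth_differentiable[of F x]
  by (meson DERIV_deriv_iff_real_differentiable)

lemma smooth_deriv: 
  assumes "smooth (F :: real \<Rightarrow> real)" shows "smooth (deriv F)"
proof -
  have "deriv F x = frechet_derivative F (at x) 1" for x
    using frechet_eqI[OF has_field_derivative_imp_has_derivative[OF smooth_deriv_exists[OF assms, of x]]] by simp
  then have "deriv F = (\<lambda>x. frechet_derivative F (at x) 1)" by auto
  then show ?thesis using smooth_frechet[OF assms, of 1] by simp
qed

lemma pd_coord:
  fixes F :: "real \<Rightarrow> real"
  assumes "smooth F"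
  shows "pd j (\<lambda>x::real^'n::finite. F (x $ i)) x = (if j = i then deriv F (x $ i) else 0)"
proof -
  have "((\<lambda>x. F (axis i 1 \<bullet> x + 0)) has_derivative
      (\<lambda>b. (axis i 1 \<bullet> b) * frechet_derivative F (at (axis i 1 \<bullet> x + 0)) 1)) (at x)"
    by (intro frechet_derivative_affine_at smooth_differentiable assms)
  moreover have "frechet_derivative F (at y) 1 = deriv F y" for y
    using frechet_eqI[OF has_field_derivative_imp_has_derivative[OF smooth_deriv_exists[OF assms, of y]]] by simp
  ultimately have "((\<lambda>x. F (x $ i)) has_derivative (\<lambda>b. b $ i * deriv F (x $ i))) (at x)"
    by (simp add: inner_axis1)
  from frechet_eqI[OF this, of "axis j 1"] show ?thesis
    by (auto simp: pd_def axis_def)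
qed

lemma pd_line:
  assumes "smooth f"
  shows "((\<lambda>r. f (x + r *\<^sub>R axis i 1)) has_real_derivative pd i f (x + r *\<^sub>R axis i 1)) (at r)"
proof -
  let ?D = "frechet_derivative f (at (x + r *\<^sub>R axis i 1))"
  have 1: "((\<lambda>r. x + r *\<^sub>R axis i 1) has_derivative (\<lambda>b. b *\<^sub>R axis i 1)) (at r)"
    by (auto intro!: derivative_eq_intros)
  have "((\<lambda>r. f (x + r *\<^sub>R axis i 1)) has_derivative (\<lambda>b. ?D (b *\<^sub>R axis i 1))) (at r)"
    using diff_chain_at[OF 1 frechet_worksI[OF smooth_differentiable[OF assms]]]
    by (simp add: o_def)
  moreover have "?D (b *\<^sub>R axis i 1) = b * ?D (axis i 1)" for b
    using linear_scale[OF linear_frechet_derivative[OF smooth_differentiable[OF assms]]] by simp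
  ultimately show ?thesis
    by (simp add: has_field_derivative_def pd_def mult.commute[of _ "frechet_derivative _ _ _"])
qed

section \<open>A smooth function flat at 0, and smooth cutoffs\<close>

lemma derivative_tower_Ck_on:
  assumes "\<And>n x. (F n has_real_derivative F (Suc n) x) (at x)"
  shows "Ck_on k (F n) UNIV"
proof (induction k arbitrary: n)
  case 0
  then show ?case using DERIV_continuous_on[of UNIV "F n"] assms by (auto simp: has_field_derivative_at_within)
next
  case (Suc k)
  have "frechet_derivative (F n) (at x) 1 = F (Suc n) x" for x
    using frechet_eqI[OF has_field_derivative_imp_has_derivative[OF assms[of n x]]] by simp
  then show ?case
    using Suc assms has_field_derivative_imp_has_derivative[OF assms]
    by (simp add: differentiable_def) blast
qed

text \<open>\<open>flat n\<close> is the n-th derivative of exp(-1/t), extended by 0 to t <= 0. The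
  recursion is the product rule in the variable y = 1/t, where dy/dt = -y^2.\<close>

fun flat_poly :: "nat \<Rightarrow> real poly" where
  "flat_poly 0 = 1"
| "flat_poly (Suc n) = [:0, 0, 1:] * (flat_poly n - pderiv (flat_poly n))"

definition flat :: "nat \<Rightarrow> real \<Rightarrow> real" where
  "flat n t = (if t \<le> 0 then 0 else poly (flat_poly n) (1 / t) * exp (- (1 / t)))"

lemma poly_times_exp_tendsto_0: "((\<lambda>y. poly p y * exp (- y)) \<longlongrightarrow> 0) (at_top :: real filter)"
proof (induction p)
  case 0
  then show ?case by simp
next
  case (pCons a p)
  have a: "((\<lambda>y. a * exp (- y)) \<longlongrightarrow> 0) (at_top :: real filter)"
    by (rule tendsto_mult_right_zero)
      (rule filterlim_compose[OF exp_at_bot filterlim_uminus_at_bot_at_top])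
  have q: "((\<lambda>y. poly q y * exp (- y)) \<longlongrightarrow> 0) (at_top :: real filter)" for q :: "real poly"
  proof -
    have "((\<lambda>y. \<Sum>i\<le>degree q. coeff q i * (y ^ i * exp (- y))) \<longlongrightarrow> (\<Sum>i\<le>degree q. coeff q i * 0)) (at_top :: real filter)"
      using tendsto_power_div_exp_0
      by (intro tendsto_sum tendsto_mult tendsto_const) (auto simp: exp_minus field_simps)
    then show ?thesis by (simp add: poly_altdef sum_distrib_right mult.assoc)
  qed
  then show ?case .
qed

lemma flat_has_derivative: "(flat n has_real_derivative flat (Suc n) t) (at t)"
proof -
  consider "t > 0" | "t < 0" | "t = 0" by linarith
  then show ?thesis
  proof cases
    case 1
    have "((\<lambda>t. poly (flat_poly n) (1 / t) * exp (- (1 / t))) has_real_derivative flat (Suc n) t) (at t)"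
      using 1 unfolding flat_def
      by (auto intro!: derivative_eq_intros DERIV_chain'[OF _ poly_DERIV]
            simp: field_simps power2_eq_square)
    then show ?thesis
      by (rule has_field_derivative_transform_within_open[where S="{0<..}"]) (use 1 in \<open>auto simp: flat_def\<close>)
  next
    case 2
    have "((\<lambda>_. 0) has_real_derivative flat (Suc n) t) (at t)"
      using 2 by (simp add: flat_def)
    then show ?thesis
      by (rule has_field_derivative_transform_within_open[where S="{..<0}"]) (use 2 in \<open>auto simp: flat_def\<close>)
  next
    case 3
    \<comment> \<open>At 0 the right difference quotient is y p(y) exp(-y) with y = 1/t, which tends
      to 0; the left one is 0.\<close>
    have "((\<lambda>t. flat n t / t) \<longlongrightarrow> 0) (at_right 0)"
    proof -
      have "((\<lambda>t. poly ([:0, 1:] * flat_poly n) (inverse t) * exp (- inverse t)) \<longlongrightarrow> 0) (at_right (0::real))"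
        by (rule filterlim_compose[OF poly_times_exp_tendsto_0 filterlim_inverse_at_top_right])
      then show ?thesis
        by (rule Lim_transform_eventually)
          (auto simp: eventually_at_right_less flat_def field_simps intro!: eventually_at_rightI[of 0 1])
    qed
    moreover have "((\<lambda>t. flat n t / t) \<longlongrightarrow> 0) (at_left 0)"
      by (rule Lim_transform_eventually[of "\<lambda>_. 0"])
        (auto simp: flat_def intro!: eventually_at_leftI[of "-1" 0])
    ultimately have "((\<lambda>t. flat n t / t) \<longlongrightarrow> 0) (at 0)"
      by (simp add: filterlim_split_at)
    then show ?thesis
      using 3 by (simp add: DERIV_def flat_def)
  qed
qed

lemma smooth_flat: "smooth (flat 0)"
  unfolding smooth_def using derivative_tower_Ck_on[of flat] flat_has_derivative by blast

lemma flat0: "flat 0 t = (if t \<le> 0 then 0 else exp (- (1 / t)))"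
  by (simp add: flat_def)

definition step :: "real \<Rightarrow> real" where
  "step t = flat 0 t * inverse (flat 0 t + flat 0 (1 - t))"

lemma smooth_real_affine: "smooth (F :: real \<Rightarrow> real) \<Longrightarrow> smooth (\<lambda>t. F (a * t + b))"
  using smooth_affine[of F a b] by simp

text \<open>t and 1 - t are never both nonpositive.\<close>

lemma flat_sum_pos: "flat 0 t + flat 0 (1 - t) > 0"
  by (simp add: flat0 add_pos_pos)

lemma smooth_step: "smooth step"
  unfolding step_def
  by (intro smooth_mult smooth_inverse smooth_add smooth_flat)
    (use smooth_real_affine[OF smooth_flat, of "-1" 1] flat_sum_pos in \<open>auto simp: less_imp_neq[THEN not_sym]\<close>)

lemma step_range: "0 \<le> step t" "step t \<le> 1"
  and step_0: "t \<le> 0 \<Longrightarrow> step t = 0" and step_1: "t \<ge> 1 \<Longrightarrow> step t = 1"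
proof -
  have "flat 0 t \<ge> 0" "flat 0 (1 - t) \<ge> 0" by (auto simp: flat0)
  then show "0 \<le> step t" "step t \<le> 1"
    using flat_sum_pos[of t] by (auto simp: step_def field_simps)
  show "t \<le> 0 \<Longrightarrow> step t = 0" "t \<ge> 1 \<Longrightarrow> step t = 1"
    by (auto simp: step_def flat0)
qed

lemma smooth_cutoff:
  assumes "0 < a" "a < (b::real)"
  obtains X :: "real \<Rightarrow> real" where "smooth X" "\<And>t. 0 \<le> X t" "\<And>t. X t \<le> 1"
    "\<And>t. \<bar>t\<bar> \<le> a \<Longrightarrow> X t = 1" "\<And>t. \<bar>t\<bar> \<ge> b \<Longrightarrow> X t = 0"
proof
  \<comment> \<open>The first factor falls from 1 at t = a to 0 at t = b, the second rises from 0 at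
    t = -b to 1 at t = -a.\<close>
  let ?c = "\<lambda>t. step (- (1 / (b - a)) * t + b / (b - a)) * step ((1 / (b - a)) * t + b / (b - a))"
  show "smooth ?c"
    by (intro smooth_mult smooth_real_affine smooth_step)
  have e: "- (1 / (b - a)) * t + b / (b - a) = (b - t) / (b - a)"
    "(1 / (b - a)) * t + b / (b - a) = (b + t) / (b - a)" for t
    by (auto simp: diff_divide_distrib add_divide_distrib)
  show "0 \<le> ?c t" "?c t \<le> 1" for t
    by (auto intro!: mult_nonneg_nonneg mult_le_one step_range)
  show "?c t = 1" if "\<bar>t\<bar> \<le> a" for t
    unfolding e using that assms by (subst (1 2) step_1) (auto simp: field_simps)
  show "?c t = 0" if "\<bar>t\<bar> \<ge> b" for t
  proof (cases "t \<ge> 0")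
    case True
    then have "(b - t) / (b - a) \<le> 0" using that assms by (auto simp: field_simps)
    then show ?thesis unfolding e by (simp add: step_0)
  next
    case False
    then have "(b + t) / (b - a) \<le> 0" using that assms by (auto simp: field_simps)
    then show ?thesis unfolding e by (simp add: step_0)
  qed
qed

subsection \<open>Square integrable functions\<close>

definition sqi :: "'a measure \<Rightarrow> ('a \<Rightarrow> real) \<Rightarrow> bool" where
  "sqi M f \<longleftrightarrow> f \<in> borel_measurable M \<and> integrable M (\<lambda>x. (f x)\<^sup>2)"

text \<open>The Bochner integral of a non-integrable square is 0, so \<open>nrm\<close> is an L2
  norm only together with \<open>sqi\<close>. Null sets are not divided out.\<close>

definition nrm :: "'a measure \<Rightarrow> ('a \<Rightarrow> real) \<Rightarrow> real" where
  "nrm M f = sqrt (\<integral>x. (f x)\<^sup>2 \<partial>M)"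

lemma sqi_measurable [measurable_dest]: "sqi M f \<Longrightarrow> f \<in> borel_measurable M"
  by (simp add: sqi_def)

lemma sqi_square: "sqi M f \<Longrightarrow> integrable M (\<lambda>x. (f x)\<^sup>2)"
  by (simp add: sqi_def)

lemma nrm_nonneg [simp]: "0 \<le> nrm M f"
  by (simp add: nrm_def)

lemma nrm_square: "(nrm M f)\<^sup>2 = (\<integral>x. (f x)\<^sup>2 \<partial>M)"
  by (simp add: nrm_def)

lemma sqi_mult_integrable:
  assumes "sqi M f" "sqi M g"
  shows "integrable M (\<lambda>x. f x * g x)"
proof (rule Bochner_Integration.integrable_bound)
  show "integrable M (\<lambda>x. (f x)\<^sup>2 + (g x)\<^sup>2)"
    using assms by (auto dest: sqi_square)
  have "\<bar>a * b\<bar> \<le> a\<^sup>2 + b\<^sup>2" for a b :: real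
  proof -
    have "2 * (\<bar>a\<bar> * \<bar>b\<bar>) \<le> a\<^sup>2 + b\<^sup>2"
      using sum_squares_bound[of "\<bar>a\<bar>" "\<bar>b\<bar>"] by simp
    moreover have "0 \<le> \<bar>a\<bar> * \<bar>b\<bar>" by simp
    ultimately show ?thesis unfolding abs_mult by linarith
  qed
  then show "AE x in M. norm (f x * g x) \<le> norm ((f x)\<^sup>2 + (g x)\<^sup>2)"
    by auto
qed (use assms in measurable)

lemma sqi_mono:
  assumes "sqi M g" "f \<in> borel_measurable M" "AE x in M. \<bar>f x\<bar> \<le> \<bar>g x\<bar>"
  shows "sqi M f" "nrm M f \<le> nrm M g"
proof -
  have *: "AE x in M. (f x)\<^sup>2 \<le> (g x)\<^sup>2"
    using assms(3) by eventually_elim (auto simp: abs_le_square_iff)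
  show "sqi M f"
    unfolding sqi_def using * assms
    by (auto intro!: Bochner_Integration.integrable_bound[OF sqi_square[OF assms(1)]])
  then show "nrm M f \<le> nrm M g"
    unfolding nrm_def using assms *
    by (auto intro!: integral_mono_AE real_sqrt_le_mono dest: sqi_square)
qed

lemma sqi_cmult:
  assumes "sqi M f"
  shows "sqi M (\<lambda>x. c * f x)" "nrm M (\<lambda>x. c * f x) = \<bar>c\<bar> * nrm M f"
  using assms by (auto simp: sqi_def nrm_def power_mult_distrib real_sqrt_mult)

lemma sqi_zero [simp]: "sqi M (\<lambda>x. 0)" "nrm M (\<lambda>x. 0) = 0"
  by (auto simp: sqi_def nrm_def)

lemma sqi_add [intro]: 
  assumes "sqi M f" "sqi M g" shows "sqi M (\<lambda>x. f x + g x)"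
  unfolding sqi_def
proof
  show "integrable M (\<lambda>x. (f x + g x)\<^sup>2)"
    using sqi_mult_integrable[OF assms] assms
    by (auto simp: power2_sum mult.assoc sqi_square)
qed (use assms in measurable)

lemma sqi_diff [intro]: "sqi M f \<Longrightarrow> sqi M g \<Longrightarrow> sqi M (\<lambda>x. f x - g x)"
  using sqi_add[OF _ sqi_cmult(1)[where c="-1"], of M f g] by simp

lemma sqi_bounded_mult:
  assumes "sqi M f" "b \<in> borel_measurable M" "\<And>x. \<bar>b x\<bar> \<le> B"
  shows "sqi M (\<lambda>x. b x * f x)" "nrm M (\<lambda>x. b x * f x) \<le> B * nrm M f"
proof -
  have B: "0 \<le> B" using assms(3)[of undefined] by linarith
  have le: "AE x in M. \<bar>b x * f x\<bar> \<le> \<bar>B * f x\<bar>"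
    using assms(3) B by (auto simp: abs_mult intro!: mult_right_mono)
  show "sqi M (\<lambda>x. b x * f x)"
    by (rule sqi_mono(1)[OF sqi_cmult(1)[OF assms(1)] _ le]) (use assms in measurable)
  show "nrm M (\<lambda>x. b x * f x) \<le> B * nrm M f"
    using sqi_mono(2)[OF sqi_cmult(1)[OF assms(1)] _ le] B sqi_cmult(2)[OF assms(1), of B] assms(1,2)
    by simp
qed

lemma integral_square_add:
  assumes "sqi M f" "sqi M g"
  shows "(\<integral>x. (f x + c * g x)\<^sup>2 \<partial>M) = (\<integral>x. (f x)\<^sup>2 \<partial>M) + 2 * c * (\<integral>x. f x * g x \<partial>M) + c\<^sup>2 * (\<integral>x. (g x)\<^sup>2 \<partial>M)"
proof -
  have "(\<lambda>x. (f x + c * g x)\<^sup>2) = (\<lambda>x. (f x)\<^sup>2 + (2 * c) * (f x * g x) + c\<^sup>2 * (g x)\<^sup>2)"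
    by (auto simp: power2_eq_square algebra_simps)
  then show ?thesis
    using sqi_mult_integrable[OF assms] assms[THEN sqi_square] by simp
qed

lemma Cauchy_Schwarz_L2:
  assumes f: "sqi M f" and g: "sqi M g"
  shows "\<bar>\<integral>x. f x * g x \<partial>M\<bar> \<le> nrm M f * nrm M g"
proof -
  define A B C where "A = (\<integral>x. (f x)\<^sup>2 \<partial>M)" and "B = (\<integral>x. f x * g x \<partial>M)" and "C = (\<integral>x. (g x)\<^sup>2 \<partial>M)"
  have AC: "0 \<le> A" "0 \<le> C" by (auto simp: A_def C_def)
  have "B\<^sup>2 \<le> A * C"
  proof (cases "C = 0")
    case True
    then have "AE x in M. (g x)\<^sup>2 = 0"
      using g unfolding C_def by (subst (asm) integral_nonneg_eq_0_iff_AE) (auto dest: sqi_square)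
    then have "AE x in M. f x * g x = 0" by eventually_elim auto
    then have "B = 0" unfolding B_def by (rule integral_eq_zero_AE)
    then show ?thesis using AC by simp
  next
    case False
    \<comment> \<open>The quadratic polynomial \<open>\<integral> (f + t g)\<^sup>2\<close> in t is
      evaluated at its minimum point t = -B/C.\<close>
    have "0 \<le> (\<integral>x. (f x + (- B / C) * g x)\<^sup>2 \<partial>M)" by simp
    also have "\<dots> = A + 2 * (- B / C) * B + (- B / C)\<^sup>2 * C"
      unfolding integral_square_add[OF f g] A_def B_def C_def by simp
    also have "\<dots> = A - B\<^sup>2 / C"
      using False by (simp add: field_simps power2_eq_square)
    finally show ?thesis using AC False by (simp add: field_simps)
  qed
  then have "\<bar>B\<bar> \<le> sqrt (A * C)" by (simp add: real_le_rsqrt)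
  then show ?thesis by (simp add: A_def B_def C_def nrm_def real_sqrt_mult)
qed

lemma nrm_triangle:
  assumes "sqi M f" "sqi M g"
  shows "nrm M (\<lambda>x. f x + g x) \<le> nrm M f + nrm M g"
proof (rule power2_le_imp_le)
  have "(nrm M (\<lambda>x. f x + g x))\<^sup>2 = (nrm M f)\<^sup>2 + 2 * (\<integral>x. f x * g x \<partial>M) + (nrm M g)\<^sup>2"
    using integral_square_add[OF assms, of 1] by (simp add: nrm_square)
  also have "\<dots> \<le> (nrm M f + nrm M g)\<^sup>2"
    using Cauchy_Schwarz_L2[OF assms] by (simp add: power2_sum)
  finally show "(nrm M (\<lambda>x. f x + g x))\<^sup>2 \<le> (nrm M f + nrm M g)\<^sup>2" .
qed simp

lemma nrm_minus_commute: "nrm M (\<lambda>x. f x - g x) = nrm M (\<lambda>x. g x - f x)"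
  by (simp add: nrm_def power2_commute)

lemma nrm_diff_triangle:
  assumes "sqi M f" "sqi M g" "sqi M h"
  shows "nrm M (\<lambda>x. f x - h x) \<le> nrm M (\<lambda>x. f x - g x) + nrm M (\<lambda>x. g x - h x)"
  using nrm_triangle[OF sqi_diff[OF assms(1,2)] sqi_diff[OF assms(2,3)]] by simp

lemma nrm_le_add_diff:
  assumes "sqi M f" "sqi M g"
  shows "nrm M f \<le> nrm M g + nrm M (\<lambda>x. f x - g x)"
  using nrm_triangle[OF assms(2) sqi_diff[OF assms]] by simp

lemma nrm_cong_AE:
  assumes "f \<in> borel_measurable M" "g \<in> borel_measurable M" "AE x in M. f x = g x"
  shows "nrm M f = nrm M g"
  unfolding nrm_def using assms by (auto intro!: arg_cong[where f=sqrt] integral_cong_AE)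

lemma sqi_cong_AE:
  assumes "sqi M f" "g \<in> borel_measurable M" "AE x in M. f x = g x"
  shows "sqi M g"
proof -
  have "AE x in M. \<bar>g x\<bar> \<le> \<bar>f x\<bar>" using assms(3) by eventually_elim simp
  then show ?thesis by (rule sqi_mono(1)[OF assms(1,2)])
qed

lemma nrm_eq_0_AE:
  assumes "sqi M f" "nrm M f = 0" shows "AE x in M. f x = 0"
proof -
  have "(\<integral>x. (f x)\<^sup>2 \<partial>M) = 0" using assms(2) by (simp add: nrm_def)
  then have "AE x in M. (f x)\<^sup>2 = 0"
    using assms(1) by (subst (asm) integral_nonneg_eq_0_iff_AE) (auto dest: sqi_square)
  then show ?thesis by eventually_elim auto
qed

lemma tendsto_inner_L2:
  assumes "\<And>n. sqi M (f n)" "sqi M g" "sqi M k" "(\<lambda>n. nrm M (\<lambda>x. f n x - g x)) \<longlonglongrightarrow> 0"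
  shows "(\<lambda>n. \<integral>x. f n x * k x \<partial>M) \<longlonglongrightarrow> (\<integral>x. g x * k x \<partial>M)"
proof (rule Lim_null_comparison[THEN LIM_zero_cancel])
  have "\<bar>(\<integral>x. f n x * k x \<partial>M) - (\<integral>x. g x * k x \<partial>M)\<bar> \<le> nrm M (\<lambda>x. f n x - g x) * nrm M k" for n
    using Cauchy_Schwarz_L2[OF sqi_diff[OF assms(1,2)] assms(3), of n] sqi_mult_integrable[OF _ assms(3)] assms(1,2)
    by (simp add: left_diff_distrib)
  then show "\<forall>\<^sub>F n in sequentially. norm ((\<integral>x. f n x * k x \<partial>M) - (\<integral>x. g x * k x \<partial>M)) \<le> nrm M (\<lambda>x. f n x - g x) * nrm M k"
    by simp
  show "(\<lambda>n. nrm M (\<lambda>x. f n x - g x) * nrm M k) \<longlonglongrightarrow> 0"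
    by (rule tendsto_mult_left_zero[OF assms(4)])
qed

lemma tendsto_nrm_L2:
  assumes "\<And>n. sqi M (f n)" "sqi M g" "(\<lambda>n. nrm M (\<lambda>x. f n x - g x)) \<longlonglongrightarrow> 0"
  shows "(\<lambda>n. nrm M (f n)) \<longlonglongrightarrow> nrm M g"
proof (rule Lim_null_comparison[THEN LIM_zero_cancel, OF _ assms(3)])
  have "\<bar>nrm M (f n) - nrm M g\<bar> \<le> nrm M (\<lambda>x. f n x - g x)" for n
    using nrm_le_add_diff[OF assms(1,2), of n] nrm_le_add_diff[OF assms(2,1), of n]
    by (simp add: nrm_minus_commute)
  then show "\<forall>\<^sub>F n in sequentially. norm (nrm M (f n) - nrm M g) \<le> nrm M (\<lambda>x. f n x - g x)"
    by simp
qed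

lemma L2_AE_subseq:
  assumes "\<And>n. sqi M (f n)" "sqi M g" "(\<lambda>n. nrm M (\<lambda>x. f n x - g x)) \<longlonglongrightarrow> 0"
  obtains r :: "nat \<Rightarrow> nat" where "strict_mono r" "AE x in M. (\<lambda>n. f (r n) x) \<longlonglongrightarrow> g x"
proof -
  have "(\<lambda>n. \<integral>x. norm ((f n x - g x)\<^sup>2) \<partial>M) \<longlonglongrightarrow> 0"
    using tendsto_power[OF assms(3), of 2] by (simp add: nrm_square)
  then obtain r :: "nat \<Rightarrow> nat" where r: "strict_mono r" "AE x in M. (\<lambda>n. (f (r n) x - g x)\<^sup>2) \<longlonglongrightarrow> 0"
    using tendsto_L1_AE_subseq[of M "\<lambda>n x. (f n x - g x)\<^sup>2"] sqi_square[OF sqi_diff[OF assms(1,2)]] by auto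
  have "AE x in M. (\<lambda>n. f (r n) x) \<longlonglongrightarrow> g x"
    using r(2)
  proof eventually_elim
    case (elim x)
    then have "(\<lambda>n. sqrt ((f (r n) x - g x)\<^sup>2)) \<longlonglongrightarrow> sqrt 0" by (rule tendsto_real_sqrt)
    then show ?case by (simp add: tendsto_rabs_zero_iff LIM_zero_cancel)
  qed
  then show ?thesis using r(1) that by blast
qed

lemma nrm_sum_le:
  fixes n :: nat
  assumes "\<And>i. i < n \<Longrightarrow> sqi M (f i)"
  shows "sqi M (\<lambda>x. \<Sum>i<n. f i x) \<and> nrm M (\<lambda>x. \<Sum>i<n. f i x) \<le> (\<Sum>i<n. nrm M (f i))"
  using assms
proof (induction n)
  case (Suc n)
  then have s: "sqi M (\<lambda>x. \<Sum>i<n. f i x)" "sqi M (f n)"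
      "nrm M (\<lambda>x. \<Sum>i<n. f i x) \<le> (\<Sum>i<n. nrm M (f i))" by auto
  then show ?case using nrm_triangle[OF s(1,2)] by (auto intro!: sqi_add)
qed simp

text \<open>Riesz-Fischer. A subsequence with increments of norm at most 2^-k converges absolutely
  a.e., and Fatou's lemma shows that its pointwise limit is the L2 limit of the whole
  sequence.\<close>

lemma L2_complete:
  assumes f: "\<And>n. sqi M (f n)"
    and cauchy: "\<And>e. e > 0 \<Longrightarrow> \<exists>N. \<forall>m\<ge>N. \<forall>n\<ge>N. nrm M (\<lambda>x. f m x - f n x) < e"
  obtains g where "sqi M g" "(\<lambda>n. nrm M (\<lambda>x. f n x - g x)) \<longlonglongrightarrow> 0"
proof -
  have "\<exists>N. \<forall>m\<ge>N. \<forall>n\<ge>N. nrm M (\<lambda>x. f m x - f n x) < (1/2)^k" for k :: nat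
    by (rule cauchy) simp
  then obtain N where N: "\<And>k m n. m \<ge> N k \<Longrightarrow> n \<ge> N k \<Longrightarrow> nrm M (\<lambda>x. f m x - f n x) < (1/2)^k"
    by metis
  \<comment> \<open>The maximum makes r k at least \<open>N j\<close> for all j <= k, so two
    consecutive indices both lie beyond \<open>N k\<close>; the summand k gives r k >= k, which the
    Fatou argument uses.\<close>
  define r where "r k = k + Max (N ` {..k})" for k
  have rN: "r k \<ge> N j" if "j \<le> k" for j k
  proof -
    have "N j \<le> Max (N ` {..k})" using that by (intro Max_ge) auto
    then show ?thesis by (simp add: r_def)
  qed
  define d where "d k x = f (r (Suc k)) x - f (r k) x" for k x
  have d: "sqi M (d k)" "nrm M (d k) \<le> (1/2)^k" for k
    using N[where k=k and m="r (Suc k)" and n="r k"] rN f unfolding d_def by (auto intro!: less_imp_le)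
  have ad: "sqi M (\<lambda>x. \<bar>d k x\<bar>)" "nrm M (\<lambda>x. \<bar>d k x\<bar>) \<le> (1/2)^k" for k
    using d[of k] by (auto simp: sqi_def nrm_def)
  define S where "S n x = (\<Sum>k<n. \<bar>d k x\<bar>)" for n x
  have S: "sqi M (S n)" "nrm M (S n) \<le> 2" for n
  proof -
    have "nrm M (S n) \<le> (\<Sum>k<n. nrm M (\<lambda>x. \<bar>d k x\<bar>))" "sqi M (S n)"
      unfolding S_def using nrm_sum_le[of n M "\<lambda>k x. \<bar>d k x\<bar>"] ad(1) by auto
    moreover have "(\<Sum>k<n. nrm M (\<lambda>x. \<bar>d k x\<bar>)) \<le> (\<Sum>k<n. (1/2)^k)"
      by (intro sum_mono ad)
    moreover have "(\<Sum>k<n. (1/2)^k :: real) \<le> 2"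
      by (simp add: sum_gp_strict)
    ultimately show "sqi M (S n)" "nrm M (S n) \<le> 2" by auto
  qed
  \<comment> \<open>The partial sums increase and have norm at most 2, so monotone convergence makes
    their supremum finite a.e.\<close>
  have S_mono: "S m x \<le> S n x" if "m \<le> n" for m n x
    unfolding S_def using that by (intro sum_mono2) auto
  have S0: "0 \<le> S n x" for n x by (simp add: S_def sum_nonneg)
  have "(\<integral>\<^sup>+x. (SUP n. ennreal ((S n x)\<^sup>2)) \<partial>M) = (SUP n. \<integral>\<^sup>+x. ennreal ((S n x)\<^sup>2) \<partial>M)"
    using S(1)
    by (intro nn_integral_monotone_convergence_SUP)
      (auto simp: incseq_def le_fun_def intro!: ennreal_leI power_mono S_mono S0 dest: sqi_measurable)
  also have "\<dots> \<le> ennreal 4"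
  proof (rule SUP_least)
    fix n
    have "(\<integral>\<^sup>+x. ennreal ((S n x)\<^sup>2) \<partial>M) = ennreal ((nrm M (S n))\<^sup>2)"
      using S(1)[of n] by (subst nn_integral_eq_integral) (auto simp: nrm_square dest: sqi_square)
    also have "\<dots> \<le> ennreal 4"
      using power_mono[OF S(2)[of n], of 2] by (intro ennreal_leI) simp
    finally show "(\<integral>\<^sup>+x. ennreal ((S n x)\<^sup>2) \<partial>M) \<le> ennreal 4" .
  qed
  finally have "(\<integral>\<^sup>+x. (SUP n. ennreal ((S n x)\<^sup>2)) \<partial>M) \<noteq> \<infinity>"
    by (auto simp: top_unique)
  then have "AE x in M. (SUP n. ennreal ((S n x)\<^sup>2)) \<noteq> \<infinity>"
    using S(1) by (intro nn_integral_PInf_AE) (auto intro!: borel_measurable_SUP dest: sqi_measurable)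
  then have conv: "AE x in M. convergent (\<lambda>n. f (r n) x)"
  proof eventually_elim
    case (elim x)
    then obtain K where K: "(SUP n. ennreal ((S n x)\<^sup>2)) = ennreal K" "K \<ge> 0"
      by (cases "SUP n. ennreal ((S n x)\<^sup>2)") auto
    have S_le: "S n x \<le> K + 1" for n
    proof -
      have "ennreal ((S n x)\<^sup>2) \<le> ennreal K" unfolding K(1)[symmetric] by (rule SUP_upper) simp
      then have "(S n x)\<^sup>2 \<le> K" using K(2) by (simp add: ennreal_le_iff)
      also have "K \<le> (K + 1)\<^sup>2" using K(2) by (simp add: power2_eq_square algebra_simps)
      finally show ?thesis by (rule power2_le_imp_le) (use K(2) in simp)
    qed
    have "summable (\<lambda>k. \<bar>d k x\<bar>)"
    proof (rule bounded_imp_summable)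
      show "(\<Sum>k\<le>n. \<bar>d k x\<bar>) \<le> K + 1" for n
        using S_le[of "Suc n"] by (simp only: S_def lessThan_Suc_atMost)
    qed simp
    then have "summable (\<lambda>k. d k x)" by (rule summable_rabs_cancel)
    then have "convergent (\<lambda>n. \<Sum>k<n. d k x)" by (simp add: summable_iff_convergent)
    moreover have "(\<Sum>k<n. d k x) = f (r n) x - f (r 0) x" for n
      unfolding d_def by (rule sum_lessThan_telescope)
    ultimately have "convergent (\<lambda>n. f (r n) x - f (r 0) x)" by simp
    then show ?case
      using convergent_add[OF _ convergent_const[of "f (r 0) x"]] by fastforce
  qed
  define g where "g x = lim (\<lambda>n. f (r n) x)" for x
  have [measurable]: "f n \<in> borel_measurable M" for n using f by auto
  have [measurable]: "g \<in> borel_measurable M"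
    unfolding g_def by measurable
  have lim: "AE x in M. (\<lambda>n. f (r n) x) \<longlonglongrightarrow> g x"
    using conv by eventually_elim (simp add: g_def convergent_LIMSEQ_iff)
  \<comment> \<open>Fatou along the a.e. convergent subsequence: the Cauchy bound e for
    \<open>f m - f (r n)\<close> passes to \<open>f m - g\<close>.\<close>
  have fin: "(\<integral>\<^sup>+x. ennreal ((f m x - g x)\<^sup>2) \<partial>M) \<le> ennreal (e\<^sup>2)"
    if e: "e > 0" and m: "\<And>n. n \<ge> N0 \<Longrightarrow> nrm M (\<lambda>x. f m x - f n x) < e" for m e N0
  proof -
    have "(\<integral>\<^sup>+x. ennreal ((f m x - g x)\<^sup>2) \<partial>M) = (\<integral>\<^sup>+x. liminf (\<lambda>n. ennreal ((f m x - f (r n) x)\<^sup>2)) \<partial>M)"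
    proof (intro nn_integral_cong_AE)
      show "AE x in M. ennreal ((f m x - g x)\<^sup>2) = liminf (\<lambda>n. ennreal ((f m x - f (r n) x)\<^sup>2))"
        using lim
      proof eventually_elim
        case (elim x)
        then have "(\<lambda>n. ennreal ((f m x - f (r n) x)\<^sup>2)) \<longlonglongrightarrow> ennreal ((f m x - g x)\<^sup>2)"
          by (intro tendsto_intros) 
        then show ?case by (intro lim_imp_Liminf[symmetric]) auto
      qed
    qed
    also have "\<dots> \<le> liminf (\<lambda>n. \<integral>\<^sup>+x. ennreal ((f m x - f (r n) x)\<^sup>2) \<partial>M)"
      by (intro nn_integral_liminf) measurable
    also have "\<dots> \<le> ennreal (e\<^sup>2)"
    proof (rule Liminf_le)
      have "(\<integral>\<^sup>+x. ennreal ((f m x - f (r n) x)\<^sup>2) \<partial>M) \<le> ennreal (e\<^sup>2)" if "n \<ge> N0" for n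
      proof -
        have "(\<integral>\<^sup>+x. ennreal ((f m x - f (r n) x)\<^sup>2) \<partial>M) = ennreal ((nrm M (\<lambda>x. f m x - f (r n) x))\<^sup>2)"
          using sqi_square[OF sqi_diff[OF f[of m] f[of "r n"]]]
          by (subst nn_integral_eq_integral) (auto simp: nrm_square)
        also have "\<dots> \<le> ennreal (e\<^sup>2)"
          using m[of "r n"] that by (intro ennreal_leI power_mono) (auto simp: r_def less_imp_le)
        finally show ?thesis .
      qed
      then show "\<forall>\<^sub>F n in sequentially. (\<integral>\<^sup>+x. ennreal ((f m x - f (r n) x)\<^sup>2) \<partial>M) \<le> ennreal (e\<^sup>2)"
        by (rule eventually_sequentiallyI)
    qed simp
    finally show ?thesis .
  qed
  have nd: "sqi M (\<lambda>x. f m x - g x) \<and> nrm M (\<lambda>x. f m x - g x) \<le> e"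
    if e: "e > 0" and m: "\<And>n. n \<ge> N0 \<Longrightarrow> nrm M (\<lambda>x. f m x - f n x) < e" for m e N0
  proof -
    have le: "(\<integral>\<^sup>+x. ennreal ((f m x - g x)\<^sup>2) \<partial>M) \<le> ennreal (e\<^sup>2)"
      by (rule fin[OF e, of N0]) (rule m)
    have "(\<integral>\<^sup>+x. ennreal (norm ((f m x - g x)\<^sup>2)) \<partial>M) < \<infinity>"
      using le_less_trans[OF le ennreal_less_top] by simp
    then have i: "integrable M (\<lambda>x. (f m x - g x)\<^sup>2)"
      by (intro integrableI_bounded) measurable
    have "ennreal ((nrm M (\<lambda>x. f m x - g x))\<^sup>2) \<le> ennreal (e\<^sup>2)"
      using le i by (subst (asm) nn_integral_eq_integral) (auto simp: nrm_square)
    then have "nrm M (\<lambda>x. f m x - g x) \<le> e"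
      using e by (auto simp: ennreal_le_iff intro: power2_le_imp_le)
    then show ?thesis using i by (simp add: sqi_def)
  qed
  have N0: "nrm M (\<lambda>x. f (N 0) x - f n x) < 1" if "N 0 \<le> n" for n
    using N[of 0 "N 0" n] that by (metis order_refl power_0)
  have "sqi M (\<lambda>x. f (N 0) x - g x)"
    by (rule nd[THEN conjunct1, of 1 "N 0"], rule zero_less_one, erule N0)
  from sqi_diff[OF f[of "N 0"] this] have "sqi M g" by simp
  moreover have "(\<lambda>n. nrm M (\<lambda>x. f n x - g x)) \<longlonglongrightarrow> 0"
  proof (rule LIMSEQ_I)
    fix e :: real assume "e > 0"
    then obtain K where K: "\<And>m n. m \<ge> K \<Longrightarrow> n \<ge> K \<Longrightarrow> nrm M (\<lambda>x. f m x - f n x) < e / 2"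
      using cauchy[of "e/2"] by auto
    have "nrm M (\<lambda>x. f n x - g x) < e" if "n \<ge> K" for n
      using nd[of "e/2" K n, OF _ K[OF that]] \<open>e > 0\<close> by simp
    then show "\<exists>no. \<forall>n\<ge>no. norm (nrm M (\<lambda>x. f n x - g x) - 0) < e" by auto
  qed
  ultimately show ?thesis using that by blast
qed

subsection \<open>Test functions\<close>

lemma test_functionsI:
  assumes "smooth \<phi>" "compact K" "K \<subseteq> U" "\<And>x. x \<notin> K \<Longrightarrow> \<phi> x = 0"
  shows "\<phi> \<in> test_functions U"
proof -
  have "closure {x. \<phi> x \<noteq> 0} \<subseteq> K"
    using assms by (intro closure_minimal compact_imp_closed) auto
  moreover have "compact (closure {x. \<phi> x \<noteq> 0})"
    unfolding compact_closure
    using assms(4) by (intro bounded_subset[OF compact_imp_bounded[OF assms(2)]]) auto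
  ultimately show ?thesis
    using assms(1,3) unfolding test_functions_def by simp
qed

lemma test_functionsE:
  assumes "\<phi> \<in> test_functions U"
  obtains K where "smooth \<phi>" "compact K" "K \<subseteq> U" "\<And>x. x \<notin> K \<Longrightarrow> \<phi> x = 0"
  using assms closure_subset[of "{x. \<phi> x \<noteq> 0}"] unfolding test_functions_def by blast

lemma test_smooth: "\<phi> \<in> test_functions U \<Longrightarrow> smooth \<phi>"
  by (simp add: test_functions_def)

lemma test_mono: "U \<subseteq> V \<Longrightarrow> test_functions U \<subseteq> test_functions V"
  by (auto simp: test_functions_def)

lemma test_add:
  assumes "\<phi> \<in> test_functions U" "\<psi> \<in> test_functions U"
  shows "(\<lambda>x. \<phi> x + \<psi> x) \<in> test_functions U"
proof -
  obtain K L where "smooth \<phi>" "compact K" "K \<subseteq> U" "\<And>x. x \<notin> K \<Longrightarrow> \<phi> x = 0"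
    "smooth \<psi>" "compact L" "L \<subseteq> U" "\<And>x. x \<notin> L \<Longrightarrow> \<psi> x = 0"
    using assms by (elim test_functionsE) blast
  then show ?thesis
    by (intro test_functionsI[where K="K \<union> L"]) auto
qed

lemma test_mult:
  assumes "\<phi> \<in> test_functions U" "smooth \<psi>"
  shows "(\<lambda>x. \<psi> x * \<phi> x) \<in> test_functions U"
  using assms by (elim test_functionsE, intro test_functionsI) auto

lemma test_cmult: "\<phi> \<in> test_functions U \<Longrightarrow> (\<lambda>x. c * \<phi> x) \<in> test_functions U"
  by (intro test_mult smooth_const)

lemma test_zero: "(\<lambda>x. 0) \<in> test_functions U"
  by (intro test_functionsI[where K="{}"]) auto

lemma pd_zero_outside:
  assumes "smooth \<phi>" "closed K" "\<And>x. x \<notin> K \<Longrightarrow> \<phi> x = 0" "x \<notin> K"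
  shows "pd i \<phi> x = 0"
proof -
  have "((\<lambda>x. 0) has_derivative (\<lambda>_. 0)) (at x)" by simp
  then have "(\<phi> has_derivative (\<lambda>_. 0)) (at x)"
    by (rule has_derivative_transform_within_open[where s="- K"]) (use assms in auto)
  then show ?thesis by (simp add: pd_def frechet_eqI)
qed

lemma test_pd: "\<phi> \<in> test_functions U \<Longrightarrow> pd i \<phi> \<in> test_functions U"
  by (elim test_functionsE, intro test_functionsI) (auto intro: pd_zero_outside compact_imp_closed)

lemma test_bounded:
  assumes "\<phi> \<in> test_functions U"
  obtains B where "0 \<le> B" "\<And>x. \<bar>\<phi> x\<bar> \<le> B"
proof -
  obtain K where K: "smooth \<phi>" "compact K" "\<And>x. x \<notin> K \<Longrightarrow> \<phi> x = 0"
    by (rule test_functionsE[OF assms]) blast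
  have "bounded (\<phi> ` K)"
    using K by (intro compact_imp_bounded compact_continuous_image smooth_continuous)
  then obtain B where B: "\<And>x. x \<in> K \<Longrightarrow> \<bar>\<phi> x\<bar> \<le> B"
    unfolding bounded_iff by auto
  have "\<bar>\<phi> x\<bar> \<le> max B 0" for x
    using B[of x] K(3)[of x] by (cases "x \<in> K") auto
  then show ?thesis by (intro that[of "max B 0"]) auto
qed

lemma integrable_bounded_compact:
  fixes f :: "'a::euclidean_space \<Rightarrow> real"
  assumes "f \<in> borel_measurable borel" "compact K" "\<And>x. x \<notin> K \<Longrightarrow> f x = 0" "\<And>x. \<bar>f x\<bar> \<le> B"
  shows "integrable lborel f"
proof (rule Bochner_Integration.integrable_bound)
  show "integrable lborel (\<lambda>x. indicator K x * B)"
    using assms(2) emeasure_compact_finite[of K] compact_imp_closed[of K]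
    by (intro integrable_mult_left integrable_real_indicator) auto
  show "AE x in lborel. norm (f x) \<le> norm (indicator K x * B)"
    using assms(3,4) by (intro AE_I2) (auto simp: indicator_def intro: order_trans[OF _ abs_ge_self])
qed (use assms in auto)

lemma sqi_bounded_compact:
  fixes f :: "'a::euclidean_space \<Rightarrow> real"
  assumes "f \<in> borel_measurable borel" "compact K" "\<And>x. x \<notin> K \<Longrightarrow> f x = 0" "\<And>x. \<bar>f x\<bar> \<le> B"
  shows "sqi lborel f"
  unfolding sqi_def
proof
  have "\<bar>(f x)\<^sup>2\<bar> \<le> B\<^sup>2" for x
    using power_mono[OF assms(4), of x 2] by simp
  then show "integrable lborel (\<lambda>x. (f x)\<^sup>2)"
    using assms by (intro integrable_bounded_compact[where K=K and B="B\<^sup>2"]) auto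
qed (use assms in auto)

lemma sqi_test: "\<phi> \<in> test_functions U \<Longrightarrow> sqi lborel \<phi>"
  by (metis sqi_bounded_compact test_bounded test_functionsE smooth_borel)

section \<open>Smooth approximation of boxes and the fundamental lemma of the calculus of
  variations\<close>

lemma smooth_prod: "finite I \<Longrightarrow> (\<And>i. i \<in> I \<Longrightarrow> smooth (f i)) \<Longrightarrow> smooth (\<lambda>x. \<Prod>i\<in>I. f i x)"
  by (induction rule: finite_induct) auto

text \<open>For c > 0 the value exp(-1/((n + 1) c)) tends to 1. The products are therefore smooth
  functions between 0 and 1 that vanish off the open box and converge pointwise to its indicator;
  they take the place of mollified indicators.\<close>

definition bump :: "nat \<Rightarrow> real^'n::finite \<Rightarrow> real^'n \<Rightarrow> real^'n \<Rightarrow> real" where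
  "bump n a b x = (\<Prod>i\<in>UNIV. flat 0 (real (Suc n) * (x $ i - a $ i)) * flat 0 (real (Suc n) * (b $ i - x $ i)))"

lemma smooth_bump: "smooth (bump n a b)"
proof -
  have "smooth (\<lambda>t. flat 0 (real (Suc n) * (t - c)))" "smooth (\<lambda>t. flat 0 (real (Suc n) * (c - t)))" for c
    using smooth_real_affine[OF smooth_flat, of "real (Suc n)" "- real (Suc n) * c"]
      smooth_real_affine[OF smooth_flat, of "- real (Suc n)" "real (Suc n) * c"]
    by (simp_all add: algebra_simps)
  from this[THEN smooth_coord] show ?thesis
    unfolding bump_def[abs_def] by (intro smooth_prod smooth_mult) auto
qed

lemma bump_zero: "x \<notin> box a b \<Longrightarrow> bump n a b x = 0"
  by (auto simp: bump_def mem_box_cart flat0 not_less mult_le_0_iff)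

lemma bump_range: "0 \<le> bump n a b x" "bump n a b x \<le> 1"
  unfolding bump_def by (auto intro!: prod_nonneg prod_le_1 mult_le_one simp: flat0)

lemma bump_tendsto: "(\<lambda>n. bump n a b x) \<longlonglongrightarrow> indicator (box a b) x"
proof (cases "x \<in> box a b")
  case True
  have f: "(\<lambda>n. flat 0 (real (Suc n) * c)) \<longlonglongrightarrow> 1" if "c > 0" for c
  proof -
    have "(\<lambda>n. exp (- (inverse (real (Suc n)) / c))) \<longlonglongrightarrow> exp (- (0 / c))"
      using that by (intro tendsto_intros LIMSEQ_inverse_real_of_nat) auto
    moreover have "flat 0 (real (Suc n) * c) = exp (- (inverse (real (Suc n)) / c))" for n
    proof -
      have "\<not> real (Suc n) * c \<le> 0" using that by (simp add: not_le)
      then show ?thesis by (simp only: flat0 if_False) (simp add: field_simps)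
    qed
    ultimately show ?thesis by simp
  qed
  have "(\<lambda>n. bump n a b x) \<longlonglongrightarrow> (\<Prod>i\<in>(UNIV::'a set). 1 * 1)"
    unfolding bump_def using True by (intro tendsto_prod tendsto_mult f) (auto simp: mem_box_cart)
  then show ?thesis using True by simp
qed (simp add: bump_zero)

lemma test_bump: "cbox a b \<subseteq> U \<Longrightarrow> bump n a b \<in> test_functions U"
  using box_subset_cbox[of a b]
  by (intro test_functionsI[OF smooth_bump compact_cbox]) (auto intro!: bump_zero)

text \<open>\<open>ennreal\<close> truncates at 0, so \<open>ennreal (g x)\<close> and
  \<open>ennreal (- g x)\<close> are the positive and negative parts. The measures with these
  densities agree on open boxes, an intersection-stable generator, hence everywhere, and uniqueness
  of densities makes the two parts equal a.e.\<close>

lemma AE_zero_if_box_integrals_zero: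
  fixes g :: "'a::euclidean_space \<Rightarrow> real"
  assumes g: "integrable lborel g" and 0: "\<And>a b. (\<integral>x. g x * indicator (box a b) x \<partial>lborel) = 0"
  shows "AE x in lborel. g x = 0"
proof -
  have [measurable]: "g \<in> borel_measurable borel" using g by auto
  have fin: "(\<integral>\<^sup>+x. ennreal \<bar>g x\<bar> \<partial>lborel) < \<infinity>"
    using g by (simp add: integrable_iff_bounded)
  have eq: "(\<integral>\<^sup>+x. ennreal (g x) * indicator (box a b) x \<partial>lborel) =
      (\<integral>\<^sup>+x. ennreal (- g x) * indicator (box a b) x \<partial>lborel)" for a b
  proof -
    have i: "integrable lborel (\<lambda>x. g x * indicator (box a b) x)"
      using g by (intro integrable_real_mult_indicator) auto
    have e: "ennreal (c * indicator (box a b) x) = ennreal c * indicator (box a b) x" for c x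
      by (simp add: indicator_def)
    have le: "(\<integral>\<^sup>+x. ennreal (g x * indicator (box a b) x) \<partial>lborel) < \<infinity>"
      "(\<integral>\<^sup>+x. ennreal (- (g x * indicator (box a b) x)) \<partial>lborel) < \<infinity>"
      by (rule le_less_trans[OF nn_integral_mono fin]; auto simp: indicator_def intro!: ennreal_leI)+
    have "enn2real (\<integral>\<^sup>+x. ennreal (g x * indicator (box a b) x) \<partial>lborel) =
        enn2real (\<integral>\<^sup>+x. ennreal (- (g x * indicator (box a b) x)) \<partial>lborel)"
      using 0[of a b] real_lebesgue_integral_def[OF i] by simp
    then have "(\<integral>\<^sup>+x. ennreal (g x * indicator (box a b) x) \<partial>lborel) =
        (\<integral>\<^sup>+x. ennreal (- (g x * indicator (box a b) x)) \<partial>lborel)"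
      using le by (metis ennreal_enn2real infinity_ennreal_def)
    then show ?thesis using e[of "g _"] e[of "- g _"] by simp
  qed
  have "density lborel (\<lambda>x. ennreal (g x)) = density lborel (\<lambda>x. ennreal (- g x))"
  proof (rule measure_eqI_generator_eq)
    let ?E = "range (\<lambda>(a, b). box a b::'a set)"
    show "Int_stable ?E" by (auto simp: Int_stable_def box_Int_box)
    show "?E \<subseteq> Pow UNIV" "sets (density lborel (\<lambda>x. ennreal (g x))) = sigma_sets UNIV ?E"
      "sets (density lborel (\<lambda>x. ennreal (- g x))) = sigma_sets UNIV ?E"
      by (simp_all add: borel_eq_box sets_eq_imp_space_eq)
    let ?A = "\<lambda>n::nat. box (- (real n *\<^sub>R One)) (real n *\<^sub>R One) :: 'a set"
    show "range ?A \<subseteq> ?E" "(\<Union>i. ?A i) = UNIV"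
      unfolding UN_box_eq_UNIV by auto
    show "emeasure (density lborel (\<lambda>x. ennreal (g x))) (?A i) \<noteq> \<infinity>" for i
    proof -
      have "emeasure (density lborel (\<lambda>x. ennreal (g x))) (?A i) \<le> (\<integral>\<^sup>+x. ennreal \<bar>g x\<bar> \<partial>lborel)"
        by (auto simp: emeasure_density indicator_def intro!: nn_integral_mono ennreal_leI)
      then show ?thesis using fin by auto
    qed
    show "emeasure (density lborel (\<lambda>x. ennreal (g x))) X = emeasure (density lborel (\<lambda>x. ennreal (- g x))) X"
      if "X \<in> ?E" for X
      using that eq by (auto simp: emeasure_density)
  qed
  then have "AE x in lborel. ennreal (g x) = ennreal (- g x)"
    by (intro sigma_finite_measure.density_unique[OF sigma_finite_lborel]) auto
  then show ?thesis
  proof eventually_elim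
    case (elim x)
    then show ?case by (cases "g x \<ge> 0") (auto simp: ennreal_neg ennreal_eq_0_iff not_le)
  qed
qed

text \<open>Bumps on subboxes converge boundedly to indicators, so by dominated convergence f has
  integral 0 over every box inside \<open>box a b\<close>.\<close>

lemma fundamental_lemma_box:
  fixes f :: "real^'n::finite \<Rightarrow> real"
  assumes f: "integrable lborel f"
    and 0: "\<And>\<phi>. \<phi> \<in> test_functions U \<Longrightarrow> (\<integral>x. f x * \<phi> x \<partial>lborel) = 0"
    and U: "cbox a b \<subseteq> U"
  shows "AE x in lborel. x \<in> box a b \<longrightarrow> f x = 0"
proof -
  have [measurable]: "f \<in> borel_measurable borel" using f by auto
  have "AE x in lborel. f x * indicator (box a b) x = 0"
  proof (rule AE_zero_if_box_integrals_zero)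
    show "integrable lborel (\<lambda>x. f x * indicator (box a b) x)"
      using f by (intro integrable_real_mult_indicator) auto
    fix c d
    obtain e1 e2 where e: "box a b \<inter> box c d = box e1 e2" "cbox e1 e2 \<subseteq> cbox a b \<or> box e1 e2 = {}"
    proof -
      let ?e1 = "\<Sum>i\<in>Basis. max (a \<bullet> i) (c \<bullet> i) *\<^sub>R i" and ?e2 = "\<Sum>i\<in>Basis. min (b \<bullet> i) (d \<bullet> i) *\<^sub>R i"
      have "box a b \<inter> box c d = box ?e1 ?e2" by (rule box_Int_box)
      moreover have "cbox ?e1 ?e2 \<subseteq> cbox a b" by (auto simp: mem_box)
      ultimately show ?thesis using that by blast
    qed
    have "(\<integral>x. f x * indicator (box e1 e2) x \<partial>lborel) = 0"
    proof (cases "box e1 e2 = {}")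
      case False
      have "(\<lambda>n. \<integral>x. f x * bump n e1 e2 x \<partial>lborel) \<longlonglongrightarrow> (\<integral>x. f x * indicator (box e1 e2) x \<partial>lborel)"
      proof (rule integral_dominated_convergence[where w="\<lambda>x. \<bar>f x\<bar>"])
        show "(\<lambda>x. f x * bump n e1 e2 x) \<in> borel_measurable lborel" for n
          using smooth_borel[OF smooth_bump] by (intro borel_measurable_times) auto
        show "AE x in lborel. (\<lambda>n. f x * bump n e1 e2 x) \<longlonglongrightarrow> f x * indicator (box e1 e2) x"
          by (intro AE_I2 tendsto_mult tendsto_const bump_tendsto)
        show "AE x in lborel. norm (f x * bump n e1 e2 x) \<le> \<bar>f x\<bar>" for n
          using bump_range[of n e1 e2] by (intro AE_I2) (auto simp: abs_mult intro!: mult_left_le)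
      qed (use f smooth_borel[OF smooth_bump] in auto)
      moreover have "(\<integral>x. f x * bump n e1 e2 x \<partial>lborel) = 0" for n
        using e(2) False U by (intro 0 test_bump) auto
      ultimately show ?thesis by (simp add: LIMSEQ_const_iff)
    qed simp
    moreover have "f x * indicator (box a b) x * indicator (box c d) x = f x * indicator (box e1 e2) x" for x
      using e(1) by (auto simp: indicator_def)
    ultimately show "(\<integral>x. f x * indicator (box a b) x * indicator (box c d) x \<partial>lborel) = 0"
      by (simp only:)
  qed
  then show ?thesis by eventually_elim auto
qed

text \<open>An open set is a countable union of closed boxes, and the boundary of a box is a null
  set.\<close>

lemma AE_open_if_AE_box:
  fixes U :: "'a::euclidean_space set"
  assumes "open U" "\<And>a b. cbox a b \<subseteq> U \<Longrightarrow> AE x in lborel. x \<in> box a b \<longrightarrow> P x"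
  shows "AE x in lborel. x \<in> U \<longrightarrow> P x"
proof -
  obtain D where D: "countable D" "\<And>X. X \<in> D \<Longrightarrow> \<exists>a b. X = cbox a b" "\<Union>D = U"
    using open_countable_Union_open_cbox[OF assms(1)] by metis
  have "AE x in lborel. x \<in> X \<longrightarrow> P x" if XD: "X \<in> D" for X
  proof -
    obtain a b where X: "X = cbox a b" using D(2)[OF XD] by blast
    then have "AE x in lborel. x \<in> box a b \<longrightarrow> P x" using D(3) XD by (intro assms(2)) auto
    moreover have "AE x in lborel. x \<notin> cbox a b - box a b"
      by (rule AE_not_in[OF null_sets_cbox_Diff_box])
    ultimately show ?thesis unfolding X by eventually_elim auto
  qed
  then have "AE x in lborel. \<forall>X\<in>D. x \<in> X \<longrightarrow> P x"
    by (subst AE_ball_countable[OF D(1)]) blast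
  then show ?thesis by eventually_elim (use D(3) in blast)
qed

text \<open>Reduction to the Borel case on each closed box, where a Borel representative of f is
  integrable.\<close>

lemma fundamental_lemma:
  fixes f :: "real^'n::finite \<Rightarrow> real"
  assumes f: "f \<in> borel_measurable lebesgue"
    and loc: "\<And>K. compact K \<Longrightarrow> K \<subseteq> U \<Longrightarrow> integrable lebesgue (\<lambda>x. if x \<in> K then f x else 0)"
    and 0: "\<And>\<phi>. \<phi> \<in> test_functions U \<Longrightarrow> (\<integral>x. f x * \<phi> x \<partial>lebesgue) = 0"
    and U: "open U"
  shows "AE x in lborel. x \<in> U \<longrightarrow> f x = 0"
proof -
  obtain g where g[measurable]: "g \<in> borel_measurable lborel" and fg: "AE x in lborel. f x = g x"
    using completion_ex_borel_measurable_real[OF f] by auto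
  have fg': "AE x in lebesgue. f x = g x" using fg by (rule AE_completion)
  have *: "AE x in lborel. x \<in> U \<longrightarrow> g x = 0"
  proof (rule AE_open_if_AE_box[OF U])
    fix a b assume ab: "cbox a b \<subseteq> U"
    have m: "(\<lambda>x. g x * indicator (cbox a b) x) \<in> borel_measurable lborel" by measurable
    have "integrable lebesgue (\<lambda>x. g x * indicator (cbox a b) x)"
    proof (rule integrable_cong_AE_imp[OF loc[OF compact_cbox ab]])
      show "(\<lambda>x. g x * indicator (cbox a b) x) \<in> borel_measurable lebesgue"
        using m by (intro measurable_completion)
      show "AE x in lebesgue. (if x \<in> cbox a b then f x else 0) = g x * indicator (cbox a b) x"
        using fg' by eventually_elim auto
    qed
    then have "integrable lborel (\<lambda>x. g x * indicator (cbox a b) x)"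
      using integrable_completion[OF m] by simp
    then have "AE x in lborel. x \<in> box a b \<longrightarrow> g x * indicator (cbox a b) x = 0"
    proof (rule fundamental_lemma_box)
      fix \<phi> assume p: "\<phi> \<in> test_functions (cbox a b)"
      have z: "\<phi> x = 0" if "x \<notin> cbox a b" for x
        using that by (metis p subsetD test_functionsE)
      have pm [measurable]: "\<phi> \<in> borel_measurable lborel"
        using smooth_borel[OF test_smooth[OF p]] by simp
      have "(\<integral>x. g x * indicator (cbox a b) x * \<phi> x \<partial>lborel) = (\<integral>x. g x * \<phi> x \<partial>lborel)"
      proof (rule Bochner_Integration.integral_cong[OF refl])
        show "g x * indicator (cbox a b) x * \<phi> x = g x * \<phi> x" for x
          using z[of x] by (cases "x \<in> cbox a b") simp_all
      qed
      also have "\<dots> = (\<integral>x. g x * \<phi> x \<partial>lebesgue)"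
        by (rule integral_completion[symmetric]) measurable
      also have "\<dots> = (\<integral>x. f x * \<phi> x \<partial>lebesgue)"
      proof (rule integral_cong_AE)
        show "AE x in lebesgue. g x * \<phi> x = f x * \<phi> x"
          using fg' by eventually_elim auto
      qed (intro borel_measurable_times f measurable_completion g pm)+
      also have "\<dots> = 0" using 0 p test_mono[OF ab] by blast
      finally show "(\<integral>x. g x * indicator (cbox a b) x * \<phi> x \<partial>lborel) = 0" .
    qed simp
    then show "AE x in lborel. x \<in> box a b \<longrightarrow> g x = 0"
      using box_subset_cbox[of a b] by (auto elim!: eventually_mono simp: indicator_def subset_iff)
  qed
  show ?thesis using * fg by eventually_elim auto
qed

subsection \<open>Representation of bounded functionals\<close>

lemma quadratic_nonneg_imp_zero:
  fixes b c :: real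
  assumes "\<And>t. 0 \<le> t * b + t\<^sup>2 * c"
  shows "b = 0"
proof (rule ccontr)
  assume b: "b \<noteq> 0"
  \<comment> \<open>This point works for either sign of c because c < |c| + 1.\<close>
  define t where "t = - b / (\<bar>c\<bar> + 1)"
  have "t * b + t\<^sup>2 * c = - (b\<^sup>2 / (\<bar>c\<bar> + 1)) + b\<^sup>2 * (c / (\<bar>c\<bar> + 1)\<^sup>2)"
    by (simp add: t_def power2_eq_square)
  also have "\<dots> = b\<^sup>2 * ((c - (\<bar>c\<bar> + 1)) / (\<bar>c\<bar> + 1)\<^sup>2)"
  proof -
    have "\<bar>c\<bar> + 1 \<noteq> 0" by simp
    then show ?thesis by (simp add: diff_divide_distrib right_diff_distrib power2_eq_square)
  qed
  also have "\<dots> < 0"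
    using b by (intro mult_pos_neg divide_neg_pos) (auto simp: zero_less_power2 add_pos_nonneg)
  finally show False using assms[of t] by simp
qed

text \<open>T is a linear space that need not be closed, so the representative is sought in its
  closure: it is the L2 limit of a minimizing sequence for half the squared norm minus l. The
  parallelogram identity makes such a sequence Cauchy, and in the limit the linear term of the
  functional must vanish in every direction of T. As a limit of elements of T, g also inherits the
  norm bound.\<close>

lemma Riesz_L2:
  fixes T :: "('a \<Rightarrow> real) set" and l :: "('a \<Rightarrow> real) \<Rightarrow> real"
  assumes sqi: "\<And>\<phi>. \<phi> \<in> T \<Longrightarrow> sqi M \<phi>"
    and zero: "(\<lambda>x. 0) \<in> T"
    and add: "\<And>\<phi> \<psi>. \<phi> \<in> T \<Longrightarrow> \<psi> \<in> T \<Longrightarrow> (\<lambda>x. \<phi> x + \<psi> x) \<in> T"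
    and cmult: "\<And>c \<phi>. \<phi> \<in> T \<Longrightarrow> (\<lambda>x. c * \<phi> x) \<in> T"
    and ladd: "\<And>\<phi> \<psi>. \<phi> \<in> T \<Longrightarrow> \<psi> \<in> T \<Longrightarrow> l (\<lambda>x. \<phi> x + \<psi> x) = l \<phi> + l \<psi>"
    and lcmult: "\<And>c \<phi>. \<phi> \<in> T \<Longrightarrow> l (\<lambda>x. c * \<phi> x) = c * l \<phi>"
    and bound: "\<And>\<phi>. \<phi> \<in> T \<Longrightarrow> \<bar>l \<phi>\<bar> \<le> C * nrm M \<phi>"
  obtains g where "sqi M g" "\<And>\<phi>. \<phi> \<in> T \<Longrightarrow> l \<phi> = (\<integral>x. g x * \<phi> x \<partial>M)" "nrm M g \<le> \<bar>C\<bar>"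
proof -
  define J where "J \<phi> = (nrm M \<phi>)\<^sup>2 / 2 - l \<phi>" for \<phi>
  have J_lower: "- (C\<^sup>2 / 2) \<le> J \<phi>" if "\<phi> \<in> T" for \<phi>
  proof -
    have "0 \<le> (nrm M \<phi> - C)\<^sup>2" by simp
    then show ?thesis using bound[OF that] by (auto simp: J_def power2_diff abs_le_iff field_simps)
  qed
  define m where "m = Inf (J ` T)"
  have bdd: "bdd_below (J ` T)" using J_lower by (auto intro!: bdd_belowI)
  have m_le: "m \<le> J \<phi>" if "\<phi> \<in> T" for \<phi>
    unfolding m_def using that bdd by (intro cInf_lower) auto
  have "\<exists>\<phi>\<in>T. J \<phi> < m + inverse (real (Suc n))" for n
  proof -
    have "Inf (J ` T) < m + inverse (real (Suc n))" by (simp add: m_def)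
    then show ?thesis using cInf_lessD[of "J ` T"] zero by blast
  qed
  then obtain u where u: "\<And>n. u n \<in> T" "\<And>n. J (u n) < m + inverse (real (Suc n))"
    by metis
  have J_line: "J (\<lambda>x. \<phi> x + t * \<psi> x) = J \<phi> + t * ((\<integral>x. \<phi> x * \<psi> x \<partial>M) - l \<psi>) + t\<^sup>2 * ((nrm M \<psi>)\<^sup>2 / 2)"
    if "\<phi> \<in> T" "\<psi> \<in> T" for \<phi> \<psi> t
    using integral_square_add[OF sqi sqi, OF that, of t] that
    by (simp add: J_def nrm_square ladd lcmult cmult algebra_simps add_divide_distrib diff_divide_distrib)
  \<comment> \<open>At the midpoint of \<phi> and \<psi> the functional equals (J \<phi> + J
    \<psi>)/2 minus one eighth of the squared distance, and this value is at least m.\<close>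
  have para: "(nrm M (\<lambda>x. \<phi> x - \<psi> x))\<^sup>2 \<le> 4 * (J \<phi> - m) + 4 * (J \<psi> - m)"
    if "\<phi> \<in> T" "\<psi> \<in> T" for \<phi> \<psi>
  proof -
    have d: "(\<lambda>x. \<phi> x + (-1) * \<psi> x) \<in> T" "(\<lambda>x. (-1) * \<psi> x) \<in> T" using that add cmult by blast+
    have e: "(\<lambda>x. \<psi> x + (1/2) * (\<phi> x + (-1) * \<psi> x)) \<in> T"
      using add[OF that(2) cmult[OF d(1), of "1/2"]] .
    have 1: "J \<phi> = J \<psi> + ((\<integral>x. \<psi> x * (\<phi> x + (-1) * \<psi> x) \<partial>M) - l (\<lambda>x. \<phi> x + (-1) * \<psi> x))
       + (nrm M (\<lambda>x. \<phi> x + (-1) * \<psi> x))\<^sup>2 / 2"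
      using J_line[OF that(2) d(1), of 1] by simp
    have 2: "J (\<lambda>x. \<psi> x + (1/2) * (\<phi> x + (-1) * \<psi> x)) = J \<psi> +
       (1/2) * ((\<integral>x. \<psi> x * (\<phi> x + (-1) * \<psi> x) \<partial>M) - l (\<lambda>x. \<phi> x + (-1) * \<psi> x))
       + (1/2)\<^sup>2 * ((nrm M (\<lambda>x. \<phi> x + (-1) * \<psi> x))\<^sup>2 / 2)"
      using J_line[OF that(2) d(1), of "1/2"] .
    have "m \<le> J (\<lambda>x. \<psi> x + (1/2) * (\<phi> x + (-1) * \<psi> x))" using m_le[OF e] .
    then have "(nrm M (\<lambda>x. \<phi> x + (-1) * \<psi> x))\<^sup>2 \<le> 4 * (J \<phi> - m) + 4 * (J \<psi> - m)"
      using 1 2 by (simp add: power2_eq_square field_simps)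
    then show ?thesis by simp
  qed
  have su: "sqi M (u n)" for n using sqi u(1) by blast
  have cauchy: "\<exists>N. \<forall>p\<ge>N. \<forall>q\<ge>N. nrm M (\<lambda>x. u p x - u q x) < e" if "e > 0" for e
  proof -
    obtain N where N: "inverse (real (Suc N)) < e\<^sup>2 / 8"
      using reals_Archimedean[of "e\<^sup>2 / 8"] \<open>e > 0\<close> by auto
    have "nrm M (\<lambda>x. u p x - u q x) < e" if "p \<ge> N" "q \<ge> N" for p q
    proof -
      have "inverse (real (Suc p)) \<le> inverse (real (Suc N))" "inverse (real (Suc q)) \<le> inverse (real (Suc N))"
        using that by (auto intro!: le_imp_inverse_le)
      then have "(nrm M (\<lambda>x. u p x - u q x))\<^sup>2 < e\<^sup>2"
        using para[OF u(1) u(1), of p q] u(2)[of p] u(2)[of q] N by argo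
      then show ?thesis using \<open>e > 0\<close> by (simp add: power2_less_imp_less)
    qed
    then show ?thesis by blast
  qed
  obtain g where g: "sqi M g" "(\<lambda>n. nrm M (\<lambda>x. u n x - g x)) \<longlonglongrightarrow> 0"
    by (rule L2_complete[of M u, OF su cauchy])
  have Ju: "(\<lambda>n. J (u n)) \<longlonglongrightarrow> m"
  proof (rule real_tendsto_sandwich[where f="\<lambda>_. m"])
    show "(\<lambda>n. m + inverse (real (Suc n))) \<longlonglongrightarrow> m"
      using tendsto_add[OF tendsto_const LIMSEQ_inverse_real_of_nat, of m] by simp
  qed (use m_le u in \<open>auto intro!: always_eventually less_imp_le\<close>)
  have rep: "l \<psi> = (\<integral>x. g x * \<psi> x \<partial>M)" if psi: "\<psi> \<in> T" for \<psi>
  proof -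
    have "0 \<le> t * ((\<integral>x. g x * \<psi> x \<partial>M) - l \<psi>) + t\<^sup>2 * ((nrm M \<psi>)\<^sup>2 / 2)" for t
    proof -
      have "(\<lambda>n. J (u n) + t * ((\<integral>x. u n x * \<psi> x \<partial>M) - l \<psi>) + t\<^sup>2 * ((nrm M \<psi>)\<^sup>2 / 2))
        \<longlonglongrightarrow> m + t * ((\<integral>x. g x * \<psi> x \<partial>M) - l \<psi>) + t\<^sup>2 * ((nrm M \<psi>)\<^sup>2 / 2)"
        using sqi u(1) psi g by (intro tendsto_intros Ju tendsto_inner_L2) auto
      moreover have "m \<le> J (u n) + t * ((\<integral>x. u n x * \<psi> x \<partial>M) - l \<psi>) + t\<^sup>2 * ((nrm M \<psi>)\<^sup>2 / 2)" for n
        unfolding J_line[OF u(1) psi, symmetric] by (intro m_le add u(1) cmult psi)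
      ultimately have "m \<le> m + t * ((\<integral>x. g x * \<psi> x \<partial>M) - l \<psi>) + t\<^sup>2 * ((nrm M \<psi>)\<^sup>2 / 2)"
        by (intro LIMSEQ_le_const) auto
      then show ?thesis by simp
    qed
    from quadratic_nonneg_imp_zero[OF this] show ?thesis by simp
  qed
  \<comment> \<open>l (u n) is the inner product of u n and g. It tends to the squared norm of g and
    is at most |C| times the norm of u n.\<close>
  have "nrm M g \<le> \<bar>C\<bar>"
  proof -
    have "(\<lambda>n. \<integral>x. u n x * g x \<partial>M) \<longlonglongrightarrow> (\<integral>x. g x * g x \<partial>M)"
      by (intro tendsto_inner_L2 su g)
    moreover have "(\<lambda>n. \<bar>C\<bar> * nrm M (u n)) \<longlonglongrightarrow> \<bar>C\<bar> * nrm M g"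
      by (intro tendsto_intros tendsto_nrm_L2 su g)
    moreover have "(\<integral>x. u n x * g x \<partial>M) \<le> \<bar>C\<bar> * nrm M (u n)" for n
    proof -
      have "(\<integral>x. u n x * g x \<partial>M) = l (u n)" using rep[OF u(1), of n] by (simp add: mult.commute)
      also have "\<dots> \<le> C * nrm M (u n)" using bound[OF u(1), of n] by simp
      also have "\<dots> \<le> \<bar>C\<bar> * nrm M (u n)" by (intro mult_right_mono) auto
      finally show ?thesis .
    qed
    ultimately have "(\<integral>x. g x * g x \<partial>M) \<le> \<bar>C\<bar> * nrm M g" by (intro LIMSEQ_le) auto
    then have "nrm M g * nrm M g \<le> \<bar>C\<bar> * nrm M g" using nrm_square[of M g] by (simp add: power2_eq_square)
    then show ?thesis using nrm_nonneg[of M g] by (cases "nrm M g = 0") (auto simp: mult_le_cancel_right)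
  qed
  with g(1) rep show ?thesis using that by blast
qed

subsection \<open>Translations\<close>

lemma lborel_distr_shift: "distr lborel borel (\<lambda>x. x + v) = (lborel :: 'a::euclidean_space measure)"
proof -
  have "(\<lambda>x. x + v) = (+) v" by auto
  then show ?thesis by (simp add: lborel_distr_plus)
qed

lemma integral_lborel_shift:
  fixes f :: "'a::euclidean_space \<Rightarrow> real"
  assumes "f \<in> borel_measurable borel"
  shows "(\<integral>x. f (x + v) \<partial>lborel) = (\<integral>x. f x \<partial>lborel)"
proof -
  have "(\<integral>x. f x \<partial>lborel) = (\<integral>x. f x \<partial>distr lborel borel (\<lambda>x. x + v))"
    by (simp add: lborel_distr_shift)
  also have "\<dots> = (\<integral>x. f (x + v) \<partial>lborel)"
    using assms by (intro integral_distr) auto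
  finally show ?thesis ..
qed

lemma integrable_lborel_shift:
  fixes f :: "'a::euclidean_space \<Rightarrow> real"
  assumes "integrable lborel f"
  shows "integrable lborel (\<lambda>x. f (x + v))"
proof -
  have "integrable (distr lborel borel (\<lambda>x. x + v)) f"
    using assms by (simp add: lborel_distr_shift)
  then show ?thesis
    using assms by (subst (asm) integrable_distr_eq) auto
qed

lemma sqi_shift:
  fixes f :: "'a::euclidean_space \<Rightarrow> real"
  assumes "sqi lborel f"
  shows "sqi lborel (\<lambda>x. f (x + v))" "nrm lborel (\<lambda>x. f (x + v)) = nrm lborel f"
proof -
  have [measurable]: "f \<in> borel_measurable borel" using sqi_measurable[OF assms] by simp
  show "sqi lborel (\<lambda>x. f (x + v))"
    unfolding sqi_def using integrable_lborel_shift[OF sqi_square[OF assms], of v] by auto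
  show "nrm lborel (\<lambda>x. f (x + v)) = nrm lborel f"
    unfolding nrm_def using integral_lborel_shift[of "\<lambda>x. (f x)\<^sup>2" v] by auto
qed

lemma AE_lborel_shift:
  fixes P :: "'a::euclidean_space \<Rightarrow> bool"
  assumes "AE x in lborel. P x"
  shows "AE x in lborel. P (x + v)"
proof -
  obtain N where N: "\<And>x. x \<in> space lborel - N \<Longrightarrow> P x" "N \<in> null_sets lborel"
    using AE_E3[OF assms] by blast
  have Nb: "N \<in> sets borel" using N(2) by auto
  have "AE x in distr lborel borel (\<lambda>x. x + v). x \<notin> N"
    using AE_not_in[OF N(2)] by (simp only: lborel_distr_shift)
  then have "AE x in lborel. x + v \<notin> N"
    using Nb by (subst (asm) AE_distr_iff) auto
  then show ?thesis by eventually_elim (simp add: N(1))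
qed

lemma difference_quotient_bound:
  fixes f :: "real^'n::finite \<Rightarrow> real"
  assumes "smooth f" "\<And>x. \<bar>pd i f x\<bar> \<le> B"
  shows "\<bar>f (x + h *\<^sub>R axis i 1) - f x\<bar> \<le> B * \<bar>h\<bar>"
proof -
  have "\<bar>f (x + h *\<^sub>R axis i 1) - f (x + 0 *\<^sub>R axis i 1)\<bar> \<le> B * \<bar>h - 0\<bar>"
    using field_differentiable_bound[of UNIV "\<lambda>r. f (x + r *\<^sub>R axis i 1)" "\<lambda>r. pd i f (x + r *\<^sub>R axis i 1)" B h 0]
      pd_line[OF assms(1)] assms(2) by auto
  then show ?thesis by simp
qed

lemma difference_quotient_tendsto:
  fixes f :: "real^'n::finite \<Rightarrow> real"
  assumes "smooth f" "h \<longlonglongrightarrow> 0" "\<And>n. h n \<noteq> 0"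
  shows "(\<lambda>n. (f (x + h n *\<^sub>R axis i 1) - f x) / h n) \<longlonglongrightarrow> pd i f x"
proof -
  have "((\<lambda>k. (f (x + k *\<^sub>R axis i 1) - f x) / k) \<longlongrightarrow> pd i f x) (at 0)"
    using pd_line[OF assms(1), of x i 0] by (simp add: DERIV_def)
  moreover have "filterlim h (at 0) sequentially"
    using assms(2,3) by (simp add: filterlim_at)
  ultimately show ?thesis by (rule filterlim_compose)
qed

text \<open>K' contains every point that a translation of length at most 1 moves into K, so it
  supports all difference quotients, with steps up to 1, of a function supported in K.\<close>

lemma compact_enlarge:
  fixes K :: "'a::euclidean_space set"
  assumes "compact K"
  obtains K' where "compact K'" "K \<subseteq> K'" "\<And>x v. norm v \<le> 1 \<Longrightarrow> x + v \<in> K \<Longrightarrow> x \<in> K'"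
proof
  show "compact {x + y |x y. x \<in> K \<and> y \<in> cball 0 1}"
    by (intro compact_sums assms compact_cball)
  show "K \<subseteq> {x + y |x y. x \<in> K \<and> y \<in> cball 0 1}" by force
  show "x \<in> {x + y |x y. x \<in> K \<and> y \<in> cball 0 1}" if "norm v \<le> 1" "x + v \<in> K" for x v
  proof -
    have "x = (x + v) + (- v)" "- v \<in> cball 0 1" using that by auto
    then show ?thesis using that(2) by blast
  qed
qed

lemma indicator_compact_sqi: "compact (K :: 'a::euclidean_space set) \<Longrightarrow> sqi lborel (indicator K)"
  by (intro sqi_bounded_compact[where K=K and B=1]) (auto simp: compact_imp_closed indicator_def)

text \<open>For steps of size at most 1 the quotients are bounded by the supremum of |pd i \<phi>|
  and supported in one compact set, on which g is integrable; dominated convergence applies.\<close>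

lemma integral_difference_quotient_tendsto:
  fixes g :: "real^'n::finite \<Rightarrow> real"
  assumes p: "\<phi> \<in> test_functions U" and g: "sqi lborel g"
    and h: "h \<longlonglongrightarrow> 0" "\<And>n. h n \<noteq> 0" "\<And>n. \<bar>h n\<bar> \<le> 1"
  shows "(\<lambda>n. \<integral>x. g x * ((\<phi> (x + h n *\<^sub>R axis i 1) - \<phi> x) / h n) \<partial>lborel) \<longlonglongrightarrow> (\<integral>x. g x * pd i \<phi> x \<partial>lborel)"
proof -
  obtain K where K: "smooth \<phi>" "compact K" "K \<subseteq> U" "\<And>x. x \<notin> K \<Longrightarrow> \<phi> x = 0"
    by (rule test_functionsE[OF p]) blast
  obtain K' where K': "compact K'" "K \<subseteq> K'" "\<And>x v. norm v \<le> 1 \<Longrightarrow> x + v \<in> K \<Longrightarrow> x \<in> K'"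
    by (rule compact_enlarge[OF K(2)]) blast
  obtain B where B: "0 \<le> B" "\<And>x. \<bar>pd i \<phi> x\<bar> \<le> B"
    by (rule test_bounded[OF test_pd[OF p]]) blast
  have [measurable]: "g \<in> borel_measurable borel" "\<phi> \<in> borel_measurable borel" "pd i \<phi> \<in> borel_measurable borel"
    using sqi_measurable[OF g] smooth_borel[OF K(1)] smooth_borel[OF smooth_pd[OF K(1)]] by auto
  have bd: "\<bar>(\<phi> (x + h n *\<^sub>R axis i 1) - \<phi> x) / h n\<bar> \<le> indicator K' x * B" for x n
  proof (cases "x \<in> K'")
    case True
    then show ?thesis
      using difference_quotient_bound[OF K(1) B(2), of x "h n"] h(2)[of n] by (simp add: field_simps)
  next
    case False
    then have "x \<notin> K" using K'(2) by auto
    moreover have "x + h n *\<^sub>R axis i 1 \<notin> K"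
      using K'(3)[of "h n *\<^sub>R axis i 1" x] False h(3)[of n] by (auto simp: norm_axis_1)
    ultimately show ?thesis using K(4) False by simp
  qed
  show ?thesis
  proof (rule integral_dominated_convergence[where w="\<lambda>x. \<bar>g x * indicator K' x\<bar> * B"])
    show "integrable lborel (\<lambda>x. \<bar>g x * indicator K' x\<bar> * B)"
      using sqi_mult_integrable[OF g indicator_compact_sqi[OF K'(1)]] by (intro integrable_mult_left integrable_abs)
    show "AE x in lborel. (\<lambda>n. g x * ((\<phi> (x + h n *\<^sub>R axis i 1) - \<phi> x) / h n)) \<longlonglongrightarrow> g x * pd i \<phi> x"
      by (intro AE_I2 tendsto_mult tendsto_const difference_quotient_tendsto K h)
    show "AE x in lborel. norm (g x * ((\<phi> (x + h n *\<^sub>R axis i 1) - \<phi> x) / h n)) \<le> \<bar>g x * indicator K' x\<bar> * B" for n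
    proof (intro AE_I2)
      fix x
      have "\<bar>g x\<bar> * \<bar>(\<phi> (x + h n *\<^sub>R axis i 1) - \<phi> x) / h n\<bar> \<le> \<bar>g x\<bar> * (indicator K' x * B)"
        using bd by (intro mult_left_mono) auto
      then show "norm (g x * ((\<phi> (x + h n *\<^sub>R axis i 1) - \<phi> x) / h n)) \<le> \<bar>g x * indicator K' x\<bar> * B"
        by (simp add: abs_mult mult.assoc)
    qed
  qed measurable
qed

text \<open>By translation invariance every difference quotient has integral 0. The indicator of K'
  brings the integral into the form of \<open>integral_difference_quotient_tendsto\<close>.\<close>

lemma integral_pd_test:
  fixes \<phi> :: "real^'n::finite \<Rightarrow> real"
  assumes p: "\<phi> \<in> test_functions U"
  shows "(\<integral>x. pd i \<phi> x \<partial>lborel) = 0"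
proof -
  obtain K where K: "smooth \<phi>" "compact K" "K \<subseteq> U" "\<And>x. x \<notin> K \<Longrightarrow> \<phi> x = 0"
    by (rule test_functionsE[OF p]) blast
  obtain K' where K': "compact K'" "K \<subseteq> K'" "\<And>x v. norm v \<le> 1 \<Longrightarrow> x + v \<in> K \<Longrightarrow> x \<in> K'"
    by (rule compact_enlarge[OF K(2)]) blast
  define h :: "nat \<Rightarrow> real" where "h n = inverse (real (Suc n))" for n
  have h: "h \<longlonglongrightarrow> 0" "\<And>n. h n \<noteq> 0" "\<And>n. \<bar>h n\<bar> \<le> 1"
    using LIMSEQ_inverse_real_of_nat by (auto simp: h_def[abs_def] field_simps)
  have i: "integrable lborel \<phi>"
    using sqi_mult_integrable[OF sqi_test[OF p] indicator_compact_sqi[OF K(2)]]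
  proof (rule back_subst[where P="integrable lborel"])
    show "(\<lambda>x. \<phi> x * indicat_real K x) = \<phi>" using K(4) by (auto simp: indicator_def fun_eq_iff)
  qed
  have [measurable]: "\<phi> \<in> borel_measurable borel" using K(1) by auto
  have "(\<integral>x. indicator K' x * ((\<phi> (x + h n *\<^sub>R axis i 1) - \<phi> x) / h n) \<partial>lborel) = 0" for n
  proof -
    have "indicator K' x * ((\<phi> (x + h n *\<^sub>R axis i 1) - \<phi> x) / h n) = (\<phi> (x + h n *\<^sub>R axis i 1) - \<phi> x) / h n" for x
    proof (cases "x \<in> K'")
      case False
      then have "x \<notin> K" "x + h n *\<^sub>R axis i 1 \<notin> K"
        using K'(2) K'(3)[of "h n *\<^sub>R axis i 1" x] h(3)[of n] by (auto simp: norm_axis_1)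
      then show ?thesis using K(4) by simp
    qed simp
    then have "(\<integral>x. indicator K' x * ((\<phi> (x + h n *\<^sub>R axis i 1) - \<phi> x) / h n) \<partial>lborel) =
        (\<integral>x. (\<phi> (x + h n *\<^sub>R axis i 1) - \<phi> x) / h n \<partial>lborel)"
      by (intro Bochner_Integration.integral_cong refl)
    also have "\<dots> = 0"
      using i integrable_lborel_shift[OF i] integral_lborel_shift[of \<phi>] by simp
    finally show ?thesis .
  qed
  moreover have "(\<lambda>n. \<integral>x. indicator K' x * ((\<phi> (x + h n *\<^sub>R axis i 1) - \<phi> x) / h n) \<partial>lborel) \<longlonglongrightarrow> (\<integral>x. indicator K' x * pd i \<phi> x \<partial>lborel)"
    by (intro integral_difference_quotient_tendsto[OF p] indicator_compact_sqi K' h)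
  ultimately have "(\<integral>x. indicator K' x * pd i \<phi> x \<partial>lborel) = 0"
    by (simp only: LIMSEQ_const_iff)
  moreover have "indicator K' x * pd i \<phi> x = pd i \<phi> x" for x
    using pd_zero_outside[OF K(1) compact_imp_closed[OF K(2)] K(4), of x i] K'(2) by (auto simp: indicator_def)
  ultimately show ?thesis by simp
qed

lemma integral_by_parts_test:
  fixes \<phi> f :: "real^'n::finite \<Rightarrow> real"
  assumes p: "\<phi> \<in> test_functions U" and f: "smooth f"
  shows "(\<integral>x. f x * pd i \<phi> x \<partial>lborel) = - (\<integral>x. pd i f x * \<phi> x \<partial>lborel)"
proof -
  have s: "smooth \<phi>" using p by (rule test_smooth)
  have t: "(\<lambda>x. f x * pd i \<phi> x) \<in> test_functions U" "(\<lambda>x. pd i f x * \<phi> x) \<in> test_functions U"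
    by (intro test_mult test_pd p f smooth_pd)+
  have int: "integrable lborel u" if u: "u \<in> test_functions U" for u :: "real^'n \<Rightarrow> real"
  proof -
    obtain L where L: "smooth u" "compact L" "L \<subseteq> U" "\<And>x. x \<notin> L \<Longrightarrow> u x = 0"
      by (rule test_functionsE[OF u]) blast
    obtain B where "0 \<le> B" "\<And>x. \<bar>u x\<bar> \<le> B" by (rule test_bounded[OF u]) blast
    then show ?thesis using L smooth_borel[OF L(1)] by (intro integrable_bounded_compact[where K=L]) auto
  qed
  have "0 = (\<integral>x. pd i (\<lambda>x. f x * \<phi> x) x \<partial>lborel)"
    using integral_pd_test[OF test_mult[OF p f]] by simp
  also have "\<dots> = (\<integral>x. f x * pd i \<phi> x + pd i f x * \<phi> x \<partial>lborel)"
    by (simp add: pd_mult[OF f s])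
  also have "\<dots> = (\<integral>x. f x * pd i \<phi> x \<partial>lborel) + (\<integral>x. pd i f x * \<phi> x \<partial>lborel)"
    by (intro Bochner_Integration.integral_add int t)
  finally show ?thesis by simp
qed

subsection \<open>The square and approximation by smooth functions\<close>

abbreviation IQ :: "(real^2) set" where "IQ \<equiv> interior Q"

lemma Q_eq_cbox: "Q = cbox (\<chi> i. -1) (\<chi> i. 1)"
  by (auto simp: Q_def mem_box_cart)

lemma IQ_eq_box: "IQ = box (\<chi> i. -1) (\<chi> i. 1)"
  by (simp add: Q_eq_cbox)

lemma IQ_iff: "x \<in> IQ \<longleftrightarrow> -1 < x $ 1 \<and> x $ 1 < 1 \<and> -1 < x $ 2 \<and> x $ 2 < 1"
  by (auto simp: IQ_eq_box mem_box_cart forall_2)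

lemma IQ_borel [measurable]: "IQ \<in> sets borel"
  by (simp add: IQ_eq_box)

lemma compact_Q: "compact Q"
  by (simp add: Q_eq_cbox)

lemma IQ_subset_Q: "IQ \<subseteq> Q"
  by (rule interior_subset)

lemma continuous_bounded_Q:
  assumes "continuous_on Q f"
  obtains B where "0 \<le> B" "\<And>x. x \<in> Q \<Longrightarrow> \<bar>f x :: real\<bar> \<le> B"
proof -
  have "bounded (f ` Q)"
    using assms compact_Q by (intro compact_imp_bounded compact_continuous_image)
  then obtain B where B: "\<And>x. x \<in> Q \<Longrightarrow> \<bar>f x\<bar> \<le> B"
    unfolding bounded_iff by auto
  show ?thesis by (rule that[of "max B 0"]) (use B in \<open>auto simp: le_max_iff_disj\<close>)
qed

lemma sqi_IQ:
  fixes f :: "real^2 \<Rightarrow> real"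
  assumes "continuous_on UNIV f"
  shows "sqi lborel (\<lambda>x. indicator IQ x * f x)"
proof -
  obtain B where B: "0 \<le> B" "\<And>x. x \<in> Q \<Longrightarrow> \<bar>f x\<bar> \<le> B"
    by (rule continuous_bounded_Q[OF continuous_on_subset[OF assms subset_UNIV]]) blast
  have [measurable]: "f \<in> borel_measurable borel" using assms by (rule borel_measurable_continuous_onI)
  show ?thesis
    by (rule sqi_bounded_compact[OF _ compact_Q, where B=B])
      (use B IQ_subset_Q in \<open>auto simp: indicator_def\<close>)
qed

lemma sqi_IQ_smooth: "smooth f \<Longrightarrow> sqi lborel (\<lambda>x. indicator IQ x * f x)"
  by (intro sqi_IQ smooth_continuous)

lemma vector2_eq: "(vector [y, t] :: real^2) = y *\<^sub>R axis 1 1 + t *\<^sub>R axis 2 1"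
  by (simp add: vec_eq_iff forall_2 axis_def)

lemma sqi_side:
  fixes f :: "real^2 \<Rightarrow> real"
  assumes "smooth f"
  shows "sqi lborel (\<lambda>t. indicator {-1..1} t * f (vector [a, t]))"
proof -
  have c: "continuous_on UNIV (\<lambda>t. f (vector [a, t]))"
    unfolding vector2_eq
    by (intro continuous_on_compose2[OF smooth_continuous[OF assms, of UNIV]] continuous_intros) auto
  have "bounded ((\<lambda>t. f (vector [a, t])) ` {-1..1})"
    by (intro compact_imp_bounded compact_continuous_image continuous_on_subset[OF c]) auto
  then obtain B where "\<forall>x\<in>(\<lambda>t. f (vector [a, t])) ` {-1..1}. norm x \<le> B"
    unfolding bounded_iff by blast
  then have B: "\<bar>f (vector [a, t])\<bar> \<le> B" if "t \<in> {-1..1}" for t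
    using that by (simp del: atLeastAtMost_iff)
  have [measurable]: "(\<lambda>t. f (vector [a, t])) \<in> borel_measurable borel"
    using c by (rule borel_measurable_continuous_onI)
  have "\<bar>indicator {-1..1} t * f (vector [a, t])\<bar> \<le> max B 0" for t
    using B[of t] by (auto simp: indicator_def)
  then show ?thesis
    by (intro sqi_bounded_compact[where K="{-1..1}" and B="max B 0"]) auto
qed

section \<open>Square integrable functions on Q and the zero trace class\<close>

abbreviation cut :: "(real^2 \<Rightarrow> real) \<Rightarrow> real^2 \<Rightarrow> real" where
  "cut f \<equiv> (\<lambda>x. indicator IQ x * f x)"

definition side_norm :: "real \<Rightarrow> (real^2 \<Rightarrow> real) \<Rightarrow> real" where
  "side_norm a f = nrm lborel (\<lambda>t. indicator {-1..1} t * f (vector [a, t]))"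

text \<open>An element of L2(Q) is encoded as a Borel function on the plane that is 0 at every point
  off \<open>IQ\<close>. Translations act on such functions, and their integrals need no restricted
  measure.\<close>

definition L2Q :: "(real^2 \<Rightarrow> real) \<Rightarrow> bool" where
  "L2Q f \<longleftrightarrow> sqi lborel f \<and> (\<forall>x. x \<notin> IQ \<longrightarrow> f x = 0)"

lemma L2Q_sqi: "L2Q f \<Longrightarrow> sqi lborel f"
  and L2Q_zero: "L2Q f \<Longrightarrow> x \<notin> IQ \<Longrightarrow> f x = 0"
  by (auto simp: L2Q_def)

lemma L2Q_add: "L2Q f \<Longrightarrow> L2Q g \<Longrightarrow> L2Q (\<lambda>x. f x + g x)"
  and L2Q_diff: "L2Q f \<Longrightarrow> L2Q g \<Longrightarrow> L2Q (\<lambda>x. f x - g x)"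
  and L2Q_cmult: "L2Q f \<Longrightarrow> L2Q (\<lambda>x. c * f x)"
  and L2Q_smooth: "smooth u \<Longrightarrow> L2Q (cut u)"
  by (auto simp: L2Q_def intro: sqi_cmult(1) sqi_IQ_smooth)

text \<open>\<open>zt a s G\<close>: the pair \<open>(s, G)\<close>, extended by zero outside \<open>Q\<close>, is an element of \<open>W\<^sup>1\<^sup>,\<^sup>2(Q)\<close>
  together with its weak gradient, and its trace vanishes on \<open>{a} \<times> [-1,1]\<close>.\<close>

definition zt :: "real \<Rightarrow> (real^2 \<Rightarrow> real) \<Rightarrow> (2 \<Rightarrow> real^2 \<Rightarrow> real) \<Rightarrow> bool" where
  "zt a s G \<longleftrightarrow> L2Q s \<and> (\<forall>i. L2Q (G i)) \<and>
     (\<forall>e>0. \<exists>\<phi>. smooth \<phi> \<and> nrm lborel (\<lambda>x. cut \<phi> x - s x) < e \<and>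
        (\<forall>i. nrm lborel (\<lambda>x. cut (pd i \<phi>) x - G i x) < e) \<and> side_norm a \<phi> < e)"

lemma zt_L2Q: "zt a s G \<Longrightarrow> L2Q s" "zt a s G \<Longrightarrow> L2Q (G i)"
  by (auto simp: zt_def)

lemma zt_seqE:
  assumes "zt a s G"
  obtains \<phi> :: "nat \<Rightarrow> real^2 \<Rightarrow> real" where "\<And>n. smooth (\<phi> n)"
    "(\<lambda>n. nrm lborel (\<lambda>x. cut (\<phi> n) x - s x)) \<longlonglongrightarrow> 0"
    "\<And>i. (\<lambda>n. nrm lborel (\<lambda>x. cut (pd i (\<phi> n)) x - G i x)) \<longlonglongrightarrow> 0"
    "(\<lambda>n. side_norm a (\<phi> n)) \<longlonglongrightarrow> 0"
proof -
  have "\<exists>\<phi>. smooth \<phi> \<and> nrm lborel (\<lambda>x. cut \<phi> x - s x) < inverse (real (Suc n)) \<and>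
      (\<forall>i. nrm lborel (\<lambda>x. cut (pd i \<phi>) x - G i x) < inverse (real (Suc n))) \<and> side_norm a \<phi> < inverse (real (Suc n))" for n
    using assms unfolding zt_def by auto
  then obtain \<phi> where p: "\<And>n. smooth (\<phi> n)"
    "\<And>n. nrm lborel (\<lambda>x. cut (\<phi> n) x - s x) < inverse (real (Suc n))"
    "\<And>n i. nrm lborel (\<lambda>x. cut (pd i (\<phi> n)) x - G i x) < inverse (real (Suc n))"
    "\<And>n. side_norm a (\<phi> n) < inverse (real (Suc n))"
    using choice[of "\<lambda>n \<phi>. smooth \<phi> \<and> nrm lborel (\<lambda>x. cut \<phi> x - s x) < inverse (real (Suc n)) \<and>
      (\<forall>i. nrm lborel (\<lambda>x. cut (pd i \<phi>) x - G i x) < inverse (real (Suc n))) \<and> side_norm a \<phi> < inverse (real (Suc n))"]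
    by blast
  have lim: "f \<longlonglongrightarrow> 0" if "\<And>n. 0 \<le> f n" "\<And>n. f n < inverse (real (Suc n))" for f :: "nat \<Rightarrow> real"
    by (rule Lim_null_comparison[OF _ LIMSEQ_inverse_real_of_nat])
      (use that in \<open>auto intro!: always_eventually less_imp_le\<close>)
  show ?thesis
    by (rule that[of \<phi>]) (intro p lim nrm_nonneg; simp add: side_norm_def)+
qed

lemma zt_seqI:
  assumes "L2Q s" "\<And>i. L2Q (G i)" "\<And>n. smooth (\<phi> n)"
    "(\<lambda>n. nrm lborel (\<lambda>x. cut (\<phi> n) x - s x)) \<longlonglongrightarrow> 0"
    "\<And>i. (\<lambda>n. nrm lborel (\<lambda>x. cut (pd i (\<phi> n)) x - G i x)) \<longlonglongrightarrow> 0"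
    "(\<lambda>n. side_norm a (\<phi> n)) \<longlonglongrightarrow> 0"
  shows "zt a s G"
  unfolding zt_def
proof (intro conjI allI impI)
  fix e :: real assume "e > 0"
  then have "\<forall>\<^sub>F n in sequentially. nrm lborel (\<lambda>x. cut (\<phi> n) x - s x) < e \<and>
      (nrm lborel (\<lambda>x. cut (pd 1 (\<phi> n)) x - G 1 x) < e \<and>
       nrm lborel (\<lambda>x. cut (pd 2 (\<phi> n)) x - G 2 x) < e) \<and> side_norm a (\<phi> n) < e"
    by (intro eventually_conj order_tendstoD(2)[OF assms(4)] order_tendstoD(2)[OF assms(5)] order_tendstoD(2)[OF assms(6)])
  from eventually_happens'[OF sequentially_bot this]
  show "\<exists>\<phi>. smooth \<phi> \<and> nrm lborel (\<lambda>x. cut \<phi> x - s x) < e \<and>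
        (\<forall>i. nrm lborel (\<lambda>x. cut (pd i \<phi>) x - G i x) < e) \<and> side_norm a \<phi> < e"
    using assms(3) by (auto simp: forall_2)
qed (use assms in auto)

text \<open>The epsilon form of \<open>zt\<close> turns closedness under L2 limits into a diagonal
  argument: a pair within e/2 of the limit is approximated up to e/2. The smallness on the side is a
  property of the smooth approximant and is simply kept.\<close>

lemma zt_closed:
  assumes z: "\<And>n. zt a (s n) (G n)" and L: "L2Q s'" "\<And>i. L2Q (G' i)"
    and lim: "(\<lambda>n. nrm lborel (\<lambda>x. s n x - s' x)) \<longlonglongrightarrow> 0"
      "\<And>i. (\<lambda>n. nrm lborel (\<lambda>x. G n i x - G' i x)) \<longlonglongrightarrow> 0"
  shows "zt a s' G'"
  unfolding zt_def
proof (intro conjI allI impI)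
  fix e :: real assume "e > 0"
  then have e: "e / 2 > 0" by simp
  have "\<forall>\<^sub>F n in sequentially. nrm lborel (\<lambda>x. s n x - s' x) < e / 2 \<and>
      nrm lborel (\<lambda>x. G n 1 x - G' 1 x) < e / 2 \<and> nrm lborel (\<lambda>x. G n 2 x - G' 2 x) < e / 2"
    by (intro eventually_conj order_tendstoD(2)[OF lim(1)] order_tendstoD(2)[OF lim(2)] e)
  then have "\<exists>n. nrm lborel (\<lambda>x. s n x - s' x) < e / 2 \<and>
      nrm lborel (\<lambda>x. G n 1 x - G' 1 x) < e / 2 \<and> nrm lborel (\<lambda>x. G n 2 x - G' 2 x) < e / 2"
    by (rule eventually_happens'[OF sequentially_bot])
  then have "\<exists>n. nrm lborel (\<lambda>x. s n x - s' x) < e / 2 \<and> (\<forall>i. nrm lborel (\<lambda>x. G n i x - G' i x) < e / 2)"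
    unfolding forall_2 .
  then obtain n where n: "nrm lborel (\<lambda>x. s n x - s' x) < e / 2" "\<And>i. nrm lborel (\<lambda>x. G n i x - G' i x) < e / 2"
    by blast
  obtain \<phi> where p: "smooth \<phi>" "nrm lborel (\<lambda>x. cut \<phi> x - s n x) < e / 2"
      "\<And>i. nrm lborel (\<lambda>x. cut (pd i \<phi>) x - G n i x) < e / 2" "side_norm a \<phi> < e / 2"
    using z[of n] e unfolding zt_def by blast
  have "nrm lborel (\<lambda>x. cut \<phi> x - s' x) < e"
    using nrm_diff_triangle[OF sqi_IQ_smooth[OF p(1)] L2Q_sqi[OF zt_L2Q(1)[OF z[of n]]] L2Q_sqi[OF L(1)]] p(2) n(1)
    by simp
  moreover have "nrm lborel (\<lambda>x. cut (pd i \<phi>) x - G' i x) < e" for i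
    using nrm_diff_triangle[OF sqi_IQ_smooth[OF smooth_pd[OF p(1), of i]] L2Q_sqi[OF zt_L2Q(2)[OF z[of n], of i]] L2Q_sqi[OF L(2)[of i]]] p(3)[of i] n(2)[of i]
    by simp
  ultimately show "\<exists>\<phi>. smooth \<phi> \<and> nrm lborel (\<lambda>x. cut \<phi> x - s' x) < e \<and>
        (\<forall>i. nrm lborel (\<lambda>x. cut (pd i \<phi>) x - G' i x) < e) \<and> side_norm a \<phi> < e"
    using p(1,4) e by (intro exI[of _ \<phi>]) auto
qed (use L in auto)

lemma nrm_lincomb_tendsto:
  assumes "\<And>n. sqi M (f n)" "sqi M f'" "\<And>n. sqi M (g n)" "sqi M g'"
    "(\<lambda>n. nrm M (\<lambda>x. f n x - f' x)) \<longlonglongrightarrow> 0" "(\<lambda>n. nrm M (\<lambda>x. g n x - g' x)) \<longlonglongrightarrow> 0"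
    "\<And>n x. h n x - h' x = (f n x - f' x) + c * (g n x - g' x)"
  shows "(\<lambda>n. nrm M (\<lambda>x. h n x - h' x)) \<longlonglongrightarrow> 0"
proof (rule Lim_null_comparison)
  have "nrm M (\<lambda>x. h n x - h' x) \<le> nrm M (\<lambda>x. f n x - f' x) + \<bar>c\<bar> * nrm M (\<lambda>x. g n x - g' x)" for n
    unfolding assms(7)
    using nrm_triangle[OF sqi_diff[OF assms(1,2)] sqi_cmult(1)[OF sqi_diff[OF assms(3,4)]], of n c n]
      sqi_cmult(2)[OF sqi_diff[OF assms(3,4)], of c n] by simp
  then show "\<forall>\<^sub>F n in sequentially. norm (nrm M (\<lambda>x. h n x - h' x))
      \<le> nrm M (\<lambda>x. f n x - f' x) + \<bar>c\<bar> * nrm M (\<lambda>x. g n x - g' x)"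
    by simp
  have "(\<lambda>n. nrm M (\<lambda>x. f n x - f' x) + \<bar>c\<bar> * nrm M (\<lambda>x. g n x - g' x)) \<longlonglongrightarrow> 0 + \<bar>c\<bar> * 0"
    by (intro tendsto_intros assms(5,6))
  then show "(\<lambda>n. nrm M (\<lambda>x. f n x - f' x) + \<bar>c\<bar> * nrm M (\<lambda>x. g n x - g' x)) \<longlonglongrightarrow> 0" by simp
qed

lemma zt_lincomb:
  assumes "zt a s G" "zt a s' G'"
  shows "zt a (\<lambda>x. s x + c * s' x) (\<lambda>i x. G i x + c * G' i x)"
proof -
  obtain \<phi> where p: "\<And>n. smooth (\<phi> n)"
    "(\<lambda>n. nrm lborel (\<lambda>x. cut (\<phi> n) x - s x)) \<longlonglongrightarrow> 0"
    "\<And>i. (\<lambda>n. nrm lborel (\<lambda>x. cut (pd i (\<phi> n)) x - G i x)) \<longlonglongrightarrow> 0"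
    "(\<lambda>n. side_norm a (\<phi> n)) \<longlonglongrightarrow> 0" by (rule zt_seqE[OF assms(1)]) blast
  obtain \<psi> where q: "\<And>n. smooth (\<psi> n)"
    "(\<lambda>n. nrm lborel (\<lambda>x. cut (\<psi> n) x - s' x)) \<longlonglongrightarrow> 0"
    "\<And>i. (\<lambda>n. nrm lborel (\<lambda>x. cut (pd i (\<psi> n)) x - G' i x)) \<longlonglongrightarrow> 0"
    "(\<lambda>n. side_norm a (\<psi> n)) \<longlonglongrightarrow> 0" by (rule zt_seqE[OF assms(2)]) blast
  show ?thesis
  proof (rule zt_seqI[where \<phi>="\<lambda>n x. \<phi> n x + c * \<psi> n x"])
    note L = L2Q_sqi[OF zt_L2Q(1)[OF assms(1)]] L2Q_sqi[OF zt_L2Q(1)[OF assms(2)]]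
      L2Q_sqi[OF zt_L2Q(2)[OF assms(1)]] L2Q_sqi[OF zt_L2Q(2)[OF assms(2)]]
    show "(\<lambda>n. nrm lborel (\<lambda>x. cut (\<lambda>x. \<phi> n x + c * \<psi> n x) x - (s x + c * s' x))) \<longlonglongrightarrow> 0"
      by (rule nrm_lincomb_tendsto[OF sqi_IQ_smooth[OF p(1)] L(1) sqi_IQ_smooth[OF q(1)] L(2) p(2) q(2)])
        (simp add: algebra_simps)
    show "(\<lambda>n. nrm lborel (\<lambda>x. cut (pd i (\<lambda>x. \<phi> n x + c * \<psi> n x)) x - (G i x + c * G' i x))) \<longlonglongrightarrow> 0" for i
      by (rule nrm_lincomb_tendsto[OF sqi_IQ_smooth[OF smooth_pd[OF p(1)]] L(3)
            sqi_IQ_smooth[OF smooth_pd[OF q(1)]] L(4) p(3) q(3)])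
        (simp add: algebra_simps pd_add[OF p(1) smooth_mult[OF smooth_const q(1)]] pd_cmult[OF q(1)])
    have "(\<lambda>n. nrm lborel (\<lambda>t. indicator {-1..1} t * (\<phi> n (vector [a, t]) + c * \<psi> n (vector [a, t])) - 0)) \<longlonglongrightarrow> 0"
    proof (rule nrm_lincomb_tendsto[where c=c, OF sqi_side[OF p(1)] sqi_zero(1) sqi_side[OF q(1)] sqi_zero(1)])
      show "(\<lambda>n. nrm lborel (\<lambda>t. indicator {-1..1} t * \<phi> n (vector [a, t]) - 0)) \<longlonglongrightarrow> 0"
        "(\<lambda>n. nrm lborel (\<lambda>t. indicator {-1..1} t * \<psi> n (vector [a, t]) - 0)) \<longlonglongrightarrow> 0"
        using p(4) q(4) by (simp_all add: side_norm_def)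
    qed (simp add: algebra_simps)
    then show "(\<lambda>n. side_norm a (\<lambda>x. \<phi> n x + c * \<psi> n x)) \<longlonglongrightarrow> 0"
      by (simp add: side_norm_def)
  qed (intro smooth_add smooth_mult smooth_const p q L2Q_add L2Q_cmult zt_L2Q[OF assms(1)] zt_L2Q[OF assms(2)])+
qed

lemma zt_smooth:
  assumes "smooth \<phi>" "\<And>t. t \<in> {-1..1} \<Longrightarrow> \<phi> (vector [a, t]) = 0"
  shows "zt a (cut \<phi>) (\<lambda>i. cut (pd i \<phi>))"
proof (rule zt_seqI[where \<phi>="\<lambda>_. \<phi>"])
  have "(\<lambda>t. indicator {-1..1} t * \<phi> (vector [a, t])) = (\<lambda>t. 0)"
    using assms(2) by (auto simp: indicator_def)
  then show "(\<lambda>n. side_norm a \<phi>) \<longlonglongrightarrow> 0" by (simp add: side_norm_def)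
qed (use assms L2Q_smooth in auto)

text \<open>Integration by parts holds for the smooth approximants, since a test function supported
  in \<open>IQ\<close> does not see their truncation; both sides pass to the limit in L2.\<close>

lemma zt_weak:
  assumes "zt a s G" "\<psi> \<in> test_functions IQ"
  shows "(\<integral>x. s x * pd i \<psi> x \<partial>lborel) = - (\<integral>x. G i x * \<psi> x \<partial>lborel)"
proof -
  obtain \<phi> where p: "\<And>n. smooth (\<phi> n)"
    "(\<lambda>n. nrm lborel (\<lambda>x. cut (\<phi> n) x - s x)) \<longlonglongrightarrow> 0"
    "\<And>i. (\<lambda>n. nrm lborel (\<lambda>x. cut (pd i (\<phi> n)) x - G i x)) \<longlonglongrightarrow> 0"
    "(\<lambda>n. side_norm a (\<phi> n)) \<longlonglongrightarrow> 0" by (rule zt_seqE[OF assms(1)]) blast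
  have z: "\<psi> x = 0" "pd i \<psi> x = 0" if "x \<notin> IQ" for x
  proof -
    obtain K where K: "smooth \<psi>" "compact K" "K \<subseteq> IQ" "\<And>x. x \<notin> K \<Longrightarrow> \<psi> x = 0"
      by (rule test_functionsE[OF assms(2)]) blast
    then show "\<psi> x = 0" "pd i \<psi> x = 0"
      using that pd_zero_outside[OF K(1) compact_imp_closed[OF K(2)] K(4), of x i] by auto
  qed
  have 1: "(\<lambda>n. \<integral>x. cut (\<phi> n) x * pd i \<psi> x \<partial>lborel) \<longlonglongrightarrow> (\<integral>x. s x * pd i \<psi> x \<partial>lborel)"
    by (intro tendsto_inner_L2 sqi_IQ_smooth p L2Q_sqi[OF zt_L2Q(1)[OF assms(1)]] sqi_test[OF test_pd[OF assms(2)]])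
  have 2: "(\<lambda>n. \<integral>x. cut (pd i (\<phi> n)) x * \<psi> x \<partial>lborel) \<longlonglongrightarrow> (\<integral>x. G i x * \<psi> x \<partial>lborel)"
    by (intro tendsto_inner_L2 sqi_IQ_smooth smooth_pd p L2Q_sqi[OF zt_L2Q(2)[OF assms(1)]] sqi_test[OF assms(2)])
  have "cut (\<phi> n) x * pd i \<psi> x = \<phi> n x * pd i \<psi> x" "cut (pd i (\<phi> n)) x * \<psi> x = pd i (\<phi> n) x * \<psi> x" for n x
    using z[of x] by (auto simp: indicator_def)
  then have "(\<integral>x. cut (\<phi> n) x * pd i \<psi> x \<partial>lborel) = - (\<integral>x. cut (pd i (\<phi> n)) x * \<psi> x \<partial>lborel)" for n
    using integral_by_parts_test[OF assms(2) p(1)[of n], of i] by (simp only:)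
  then show ?thesis
    using LIMSEQ_unique[OF 1] tendsto_minus[OF 2] by simp
qed

subsection \<open>The Poincare inequality\<close>

text \<open>The outer variable is the second coordinate, so that the inner integrals in
  \<open>integral_real2\<close> run along horizontal lines, the direction of the Poincare
  inequality.\<close>

lemma lborel_real2: "(lborel :: (real^2) measure) = distr (lborel \<Otimes>\<^sub>M lborel) borel (\<lambda>(t, y). vector [y, t])"
proof (rule lborel_eqI)
  have m: "(\<lambda>(t, y). vector [y, t] :: real^2) \<in> borel_measurable (lborel \<Otimes>\<^sub>M lborel)"
    unfolding vector2_eq by measurable
  fix l u :: "real^2" assume le: "\<And>b. b \<in> Basis \<Longrightarrow> l \<bullet> b \<le> u \<bullet> b"
  have le': "l $ 1 \<le> u $ 1" "l $ 2 \<le> u $ 2"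
    using le[of "axis 1 1"] le[of "axis 2 1"] by (auto simp: inner_axis axis_in_Basis_iff)
  have "(\<lambda>(t, y). vector [y, t] :: real^2) -` box l u \<inter> space (lborel \<Otimes>\<^sub>M lborel) = {l $ 2 <..< u $ 2} \<times> {l $ 1 <..< u $ 1}"
    by (auto simp: mem_box_cart forall_2 space_pair_measure)
  then have "emeasure (distr (lborel \<Otimes>\<^sub>M lborel) borel (\<lambda>(t, y). vector [y, t])) (box l u) =
      emeasure (lborel \<Otimes>\<^sub>M lborel) ({l $ 2 <..< u $ 2} \<times> {l $ 1 <..< u $ 1})"
    using m by (subst emeasure_distr) auto
  also have "\<dots> = ennreal (u $ 2 - l $ 2) * ennreal (u $ 1 - l $ 1)"
    using le' by (subst lborel.emeasure_pair_measure_Times) auto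
  also have "\<dots> = ennreal (\<Prod>b\<in>Basis. (u - l) \<bullet> b)"
  proof -
    have "(\<Prod>b\<in>Basis. (u - l) \<bullet> b) = (\<Prod>i\<in>UNIV. (u - l) $ i)"
      by (simp add: Basis_vec_def UNION_singleton_eq_range prod.reindex inj_on_def axis_eq_axis inner_axis)
    also have "\<dots> = (u $ 1 - l $ 1) * (u $ 2 - l $ 2)"
      by (simp add: UNIV_2)
    finally show ?thesis using le' by (simp add: ennreal_mult' mult.commute)
  qed
  finally show "emeasure (distr (lborel \<Otimes>\<^sub>M lborel) borel (\<lambda>(t, y). vector [y, t])) (box l u) = (\<Prod>b\<in>Basis. (u - l) \<bullet> b)" .
qed simp

lemma integral_real2:
  fixes f :: "real^2 \<Rightarrow> real"
  assumes "integrable lborel f"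
  shows "integrable lborel (\<lambda>t. \<integral>y. f (vector [y, t]) \<partial>lborel)"
    "(\<integral>x. f x \<partial>lborel) = (\<integral>t. (\<integral>y. f (vector [y, t]) \<partial>lborel) \<partial>lborel)"
proof -
  have m: "(\<lambda>(t, y). vector [y, t] :: real^2) \<in> borel_measurable (lborel \<Otimes>\<^sub>M lborel)"
    unfolding vector2_eq by measurable
  have fm: "f \<in> borel_measurable borel" using assms by auto
  have i: "integrable (lborel \<Otimes>\<^sub>M lborel) (\<lambda>(t, y). f (vector [y, t]))"
    using assms unfolding lborel_real2
    by (subst (asm) integrable_distr_eq[OF m fm]) (simp add: split_def)
  show "integrable lborel (\<lambda>t. \<integral>y. f (vector [y, t]) \<partial>lborel)"
    using lborel_pair.integrable_fst'[OF i] by simp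
  have "(\<integral>x. f x \<partial>lborel) = (\<integral>p. (case p of (t, y) \<Rightarrow> f (vector [y, t])) \<partial>(lborel \<Otimes>\<^sub>M lborel))"
    unfolding lborel_real2 by (subst integral_distr[OF m fm]) (simp add: split_def)
  also have "\<dots> = (\<integral>t. (\<integral>y. f (vector [y, t]) \<partial>lborel) \<partial>lborel)"
    using lborel_pair.integral_fst'[OF i] by simp
  finally show "(\<integral>x. f x \<partial>lborel) = (\<integral>t. (\<integral>y. f (vector [y, t]) \<partial>lborel) \<partial>lborel)" .
qed

lemma integral_FTC_Ioo:
  fixes F F' :: "real \<Rightarrow> real"
  assumes "a \<le> b" "\<And>x. (F has_real_derivative F' x) (at x)" "continuous_on UNIV F'"
  shows "(\<integral>x. indicator {a<..<b} x * F' x \<partial>lborel) = F b - F a"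
proof -
  have "(LBINT x=ereal a..ereal b. F' x) = F b - F a"
    using assms
    by (intro interval_integral_FTC_finite)
      (auto intro: continuous_on_subset simp: has_real_derivative_iff_has_vector_derivative has_vector_derivative_at_within)
  then show ?thesis
    using assms(1) by (simp add: interval_integral_Ioo set_lebesgue_integral_def)
qed

lemma smooth_id: "smooth (\<lambda>t::real. t)"
proof -
  let ?F = "\<lambda>n x::real. if n = 0 then x else if n = (1::nat) then 1 else 0"
  have "(?F n has_real_derivative ?F (Suc n) x) (at x)" for n x
    by (cases n) (auto intro!: derivative_eq_intros)
  from derivative_tower_Ck_on[of ?F, OF this, of _ 0] show ?thesis
    by (simp add: smooth_def)
qed

lemma indicator_IQ_vector: "indicator IQ (vector [y, t]) = (indicator {-1<..<1} t * indicator {-1<..<1} y :: real)"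
  by (auto simp: indicator_def IQ_iff)

lemma integrable_cut: "continuous_on UNIV f \<Longrightarrow> integrable lborel (cut f)"
proof -
  assume "continuous_on UNIV f"
  then have "integrable lborel (\<lambda>x. cut f x * cut (\<lambda>_. 1) x)"
    by (intro sqi_mult_integrable sqi_IQ) auto
  moreover have "(\<lambda>x. cut f x * cut (\<lambda>_. 1) x) = cut f"
    by (auto simp: indicator_def)
  ultimately show ?thesis by simp
qed

lemma divergence_IQ:
  assumes "smooth \<psi>"
  shows "(\<integral>x. cut (pd 1 \<psi>) x \<partial>lborel) =
    (\<integral>t. indicator {-1<..<1} t * (\<psi> (vector [1, t]) - \<psi> (vector [-1, t])) \<partial>lborel)"
proof -
  have d: "((\<lambda>r. \<psi> (vector [r, t])) has_real_derivative pd 1 \<psi> (vector [y, t])) (at y)" for y t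
    using pd_line[OF assms, of "t *\<^sub>R axis 2 1" 1 y] by (simp add: vector2_eq add.commute)
  have c: "continuous_on UNIV (\<lambda>r. pd 1 \<psi> (vector [r, t]))" for t
    unfolding vector2_eq
    by (intro continuous_on_compose2[OF smooth_continuous[OF smooth_pd[OF assms], of UNIV]] continuous_intros) auto
  have "(\<integral>x. cut (pd 1 \<psi>) x \<partial>lborel) = (\<integral>t. (\<integral>y. cut (pd 1 \<psi>) (vector [y, t]) \<partial>lborel) \<partial>lborel)"
    by (intro integral_real2 integrable_cut smooth_continuous smooth_pd assms)
  also have "\<dots> = (\<integral>t. indicator {-1<..<1} t * (\<integral>y. indicator {-1<..<1} y * pd 1 \<psi> (vector [y, t]) \<partial>lborel) \<partial>lborel)"
    by (simp add: indicator_IQ_vector mult.assoc)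
  also have "\<dots> = (\<integral>t. indicator {-1<..<1} t * (\<psi> (vector [1, t]) - \<psi> (vector [-1, t])) \<partial>lborel)"
    by (simp add: integral_FTC_Ioo[OF _ d c])
  finally show ?thesis .
qed

text \<open>Divergence theorem for \<open>w \<phi>\<^sup>2\<close> with w = 1 - x_1. As w = 0 on the
  right side, only the left side contributes, where w = 2; as the derivative of w is -1, the
  integral of the square of \<phi> is recovered. The factor 4 is 2 from differentiating the square
  times the bound w <= 2.\<close>

lemma nrm_cut_le:
  assumes "smooth \<phi>"
  shows "(nrm lborel (cut \<phi>))\<^sup>2 \<le> 2 * (side_norm (-1) \<phi>)\<^sup>2 + 4 * (nrm lborel (cut \<phi>) * nrm lborel (cut (pd 1 \<phi>)))"
proof -
  define w where "w x = 1 - x $ 1" for x :: "real^2"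
  have w: "smooth w"
    unfolding w_def[abs_def] using smooth_coord[OF smooth_diff[OF smooth_const smooth_id]] .
  have pw: "pd 1 w x = -1" for x
  proof -
    have "deriv (\<lambda>t. 1 - t) y = (-1 :: real)" for y
      by (rule DERIV_imp_deriv) (auto intro!: derivative_eq_intros)
    then show ?thesis
      unfolding w_def[abs_def] using pd_coord[OF smooth_diff[OF smooth_const smooth_id], of 1 1 1 x] by simp
  qed
  let ?\<psi> = "\<lambda>x. w x * (\<phi> x * \<phi> x)"
  have s: "smooth ?\<psi>" by (intro smooth_mult w assms)
  have pd: "pd 1 ?\<psi> x = - (\<phi> x)\<^sup>2 + 2 * (w x * (\<phi> x * pd 1 \<phi> x))" for x
    using pd_mult[OF w smooth_mult[OF assms assms], of 1 x] pd_mult[OF assms assms, of 1 x] pw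
    by (simp add: power2_eq_square algebra_simps)
  have wb: "\<bar>indicator IQ x * w x\<bar> \<le> 2" for x
    by (auto simp: indicator_def IQ_iff w_def)
  have wm: "(\<lambda>x. indicator IQ x * w x) \<in> borel_measurable lborel"
    using smooth_borel[OF w] by auto
  note s1 = sqi_bounded_mult[OF sqi_IQ_smooth[OF assms] wm wb]
  note s2 = sqi_IQ_smooth[OF smooth_pd[OF assms], of 1]
  have i1: "integrable lborel (\<lambda>x. (cut \<phi> x)\<^sup>2)" by (intro sqi_square sqi_IQ_smooth assms)
  have i2: "integrable lborel (\<lambda>x. indicator IQ x * w x * cut \<phi> x * cut (pd 1 \<phi>) x)"
    by (rule sqi_mult_integrable[OF s1(1) s2])
  have "(\<integral>x. cut (pd 1 ?\<psi>) x \<partial>lborel) = (\<integral>x. - (cut \<phi> x)\<^sup>2 + 2 * (indicator IQ x * w x * cut \<phi> x * cut (pd 1 \<phi>) x) \<partial>lborel)"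
    by (intro Bochner_Integration.integral_cong refl) (auto simp: pd indicator_def)
  also have "\<dots> = - (\<integral>x. (cut \<phi> x)\<^sup>2 \<partial>lborel) + 2 * (\<integral>x. indicator IQ x * w x * cut \<phi> x * cut (pd 1 \<phi>) x \<partial>lborel)"
    using i1 i2 by simp
  finally have 1: "(nrm lborel (cut \<phi>))\<^sup>2 = 2 * (\<integral>x. indicator IQ x * w x * cut \<phi> x * cut (pd 1 \<phi>) x \<partial>lborel)
      - (\<integral>x. cut (pd 1 ?\<psi>) x \<partial>lborel)"
    by (simp add: nrm_square)
  have "(\<integral>x. indicator IQ x * w x * cut \<phi> x * cut (pd 1 \<phi>) x \<partial>lborel) \<le>
      nrm lborel (\<lambda>x. indicator IQ x * w x * cut \<phi> x) * nrm lborel (cut (pd 1 \<phi>))"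
    using Cauchy_Schwarz_L2[OF s1(1) s2] by simp
  also have "\<dots> \<le> 2 * nrm lborel (cut \<phi>) * nrm lborel (cut (pd 1 \<phi>))"
    using s1(2) by (intro mult_right_mono) auto
  finally have 2: "(\<integral>x. indicator IQ x * w x * cut \<phi> x * cut (pd 1 \<phi>) x \<partial>lborel) \<le> 2 * (nrm lborel (cut \<phi>) * nrm lborel (cut (pd 1 \<phi>)))"
    by simp
  have "- (\<integral>x. cut (pd 1 ?\<psi>) x \<partial>lborel) = (\<integral>t. indicator {-1<..<1} t * (2 * (\<phi> (vector [-1, t]))\<^sup>2) \<partial>lborel)"
    unfolding divergence_IQ[OF s] by (simp add: w_def power2_eq_square)
  also have "\<dots> \<le> (\<integral>t. 2 * (indicator {-1..1} t * \<phi> (vector [-1, t]))\<^sup>2 \<partial>lborel)"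
  proof (rule integral_mono')
    show "integrable lborel (\<lambda>t. 2 * (indicator {-1..1} t * \<phi> (vector [-1, t]))\<^sup>2)"
      by (intro integrable_mult_right sqi_square sqi_side assms)
  qed (auto simp: indicator_def)
  also have "\<dots> = 2 * (side_norm (-1) \<phi>)\<^sup>2"
    by (simp add: side_norm_def nrm_square)
  finally show ?thesis using 1 2 by simp
qed

text \<open>In the limit the boundary term vanishes, and the remaining quadratic inequality for the
  norm of s can be divided by that norm.\<close>

lemma Poincare:
  assumes "zt (-1) s G"
  shows "nrm lborel s \<le> 4 * nrm lborel (G 1)"
proof -
  obtain \<phi> where p: "\<And>n. smooth (\<phi> n)"
    "(\<lambda>n. nrm lborel (\<lambda>x. cut (\<phi> n) x - s x)) \<longlonglongrightarrow> 0"
    "\<And>i. (\<lambda>n. nrm lborel (\<lambda>x. cut (pd i (\<phi> n)) x - G i x)) \<longlonglongrightarrow> 0"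
    "(\<lambda>n. side_norm (-1) (\<phi> n)) \<longlonglongrightarrow> 0" by (rule zt_seqE[OF assms]) blast
  have 1: "(\<lambda>n. nrm lborel (cut (\<phi> n))) \<longlonglongrightarrow> nrm lborel s"
    by (intro tendsto_nrm_L2 sqi_IQ_smooth p L2Q_sqi zt_L2Q[OF assms])
  have 2: "(\<lambda>n. nrm lborel (cut (pd 1 (\<phi> n)))) \<longlonglongrightarrow> nrm lborel (G 1)"
    by (intro tendsto_nrm_L2 sqi_IQ_smooth smooth_pd p L2Q_sqi zt_L2Q[OF assms])
  have "(nrm lborel s)\<^sup>2 \<le> 2 * 0\<^sup>2 + 4 * (nrm lborel s * nrm lborel (G 1))"
  proof (rule LIMSEQ_le)
    show "(\<lambda>n. (nrm lborel (cut (\<phi> n)))\<^sup>2) \<longlonglongrightarrow> (nrm lborel s)\<^sup>2"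
      by (intro tendsto_intros 1)
    show "(\<lambda>n. 2 * (side_norm (-1) (\<phi> n))\<^sup>2 + 4 * (nrm lborel (cut (\<phi> n)) * nrm lborel (cut (pd 1 (\<phi> n))))) \<longlonglongrightarrow>
        2 * 0\<^sup>2 + 4 * (nrm lborel s * nrm lborel (G 1))"
      by (intro tendsto_intros 1 2 p(4))
  qed (use nrm_cut_le[OF p(1)] in auto)
  then have "nrm lborel s * nrm lborel s \<le> (4 * nrm lborel (G 1)) * nrm lborel s"
    by (simp add: power2_eq_square ac_simps)
  then show ?thesis
    by (cases "nrm lborel s = 0") (use nrm_nonneg[of lborel s] in \<open>auto simp: mult_le_cancel_right\<close>)
qed

subsection \<open>Borel representatives of Sobolev functions\<close>

lemma borel_measurable_lebesgue_AE:
  fixes f F :: "'a::euclidean_space \<Rightarrow> real"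
  assumes F: "F \<in> borel_measurable lebesgue" and AE: "AE x in lebesgue. f x = F x"
  shows "f \<in> borel_measurable lebesgue"
proof (rule measurableI)
  fix A :: "real set" assume A: "A \<in> sets borel"
    have "AE x in lebesgue. x \<in> F -` A \<inter> space lebesgue \<longleftrightarrow> x \<in> f -` A \<inter> space lebesgue"
    using AE by eventually_elim auto
  then show "f -` A \<inter> space lebesgue \<in> sets lebesgue"
    by (rule completion.in_sets_AE) (use measurable_sets[OF F A] in auto)
qed auto

lemma IQ_lebesgue: "IQ \<in> sets lebesgue" "Q \<in> sets lebesgue"
  by (auto simp: Q_eq_cbox)

text \<open>The bridge between \<open>lebesgue_on IQ\<close>, in which the problem is formulated,
  and \<open>lborel\<close> with Borel functions vanishing off \<open>IQ\<close>. Equality a.e. is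
  enough because Lebesgue measure is complete.\<close>

lemma lebesgue_on_IQ_rep:
  fixes f F :: "real^2 \<Rightarrow> real"
  assumes F: "F \<in> borel_measurable borel" "\<And>x. x \<notin> IQ \<Longrightarrow> F x = 0" and AE: "AE x in lborel. x \<in> IQ \<longrightarrow> f x = F x"
  shows "f \<in> borel_measurable (lebesgue_on IQ)"
    "integrable (lebesgue_on IQ) f \<longleftrightarrow> integrable lborel F"
    "(LINT x|lebesgue_on IQ. f x) = (\<integral>x. F x \<partial>lborel)"
proof -
  have Fm: "F \<in> borel_measurable lborel" using F by simp
  have FL: "F \<in> borel_measurable lebesgue" using Fm by (rule measurable_completion)
  have ae: "AE x in lebesgue. (if x \<in> IQ then f x else 0) = F x"
    using AE_completion[OF AE] by eventually_elim (use F(2) in auto)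
  have fm: "(\<lambda>x. if x \<in> IQ then f x else 0) \<in> borel_measurable lebesgue"
    by (rule borel_measurable_lebesgue_AE[OF FL ae])
  then show "f \<in> borel_measurable (lebesgue_on IQ)" by (rule borel_measurable_if_D)
  show "integrable (lebesgue_on IQ) f \<longleftrightarrow> integrable lborel F"
    using integrable_cong_AE[OF fm FL ae] integrable_completion[OF Fm] Lebesgue_Measure.integrable_restrict_UNIV[OF IQ_lebesgue(1), of f]
    by simp
  show "(LINT x|lebesgue_on IQ. f x) = (\<integral>x. F x \<partial>lborel)"
    using integral_cong_AE[OF fm FL ae] integral_completion[OF Fm] Lebesgue_Measure.integral_restrict_UNIV[OF IQ_lebesgue(1), of f]
    by simp
qed

lemma L2_on_rep:
  assumes "f \<in> L2_on IQ"
  obtains F where "L2Q F" "AE x in lborel. x \<in> IQ \<longrightarrow> f x = F x"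
proof -
  have f: "f \<in> borel_measurable (lebesgue_on IQ)" "integrable (lebesgue_on IQ) (\<lambda>x. (f x)\<^sup>2)"
    using assms by (auto simp: L2_on_def)
  have "(\<lambda>x. if x \<in> IQ then f x else 0) \<in> borel_measurable lebesgue"
    by (rule borel_measurable_if_I[OF f(1) IQ_lebesgue(1)])
  then obtain g where g: "g \<in> borel_measurable lborel" "AE x in lborel. (if x \<in> IQ then f x else 0) = g x"
    using completion_ex_borel_measurable_real by blast
  have gm [measurable]: "g \<in> borel_measurable borel" using g(1) by simp
  have ae: "AE x in lborel. x \<in> IQ \<longrightarrow> f x = cut g x"
    using g(2) by eventually_elim auto
  then have "AE x in lborel. x \<in> IQ \<longrightarrow> (f x)\<^sup>2 = (cut g x)\<^sup>2"
    by eventually_elim auto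
  then have "integrable lborel (\<lambda>x. (cut g x)\<^sup>2)"
    using lebesgue_on_IQ_rep(2)[of "\<lambda>x. (cut g x)\<^sup>2" "\<lambda>x. (f x)\<^sup>2"] f(2) by auto
  then have "L2Q (cut g)" by (auto simp: L2Q_def sqi_def)
  then show ?thesis using ae that by blast
qed

lemma L2Q_imp_L2_on:
  assumes "L2Q F" "AE x in lborel. x \<in> IQ \<longrightarrow> f x = F x"
  shows "f \<in> L2_on IQ"
proof -
  have F: "F \<in> borel_measurable borel" "\<And>x. x \<notin> IQ \<Longrightarrow> F x = 0" "integrable lborel (\<lambda>x. (F x)\<^sup>2)"
    using assms(1) by (auto simp: L2Q_def sqi_def)
  have "AE x in lborel. x \<in> IQ \<longrightarrow> (f x)\<^sup>2 = (F x)\<^sup>2"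
    using assms(2) by eventually_elim auto
  then have "integrable (lebesgue_on IQ) (\<lambda>x. (f x)\<^sup>2)"
    using lebesgue_on_IQ_rep(2)[of "\<lambda>x. (F x)\<^sup>2" "\<lambda>x. (f x)\<^sup>2"] F by auto
  then show ?thesis
    using lebesgue_on_IQ_rep(1)[OF F(1,2) assms(2)] by (simp add: L2_on_def)
qed

lemma L2Q_locally_integrable:
  assumes "L2Q F" "U \<subseteq> IQ" "AE x in lborel. x \<in> IQ \<longrightarrow> f x = F x"
  shows "locally_integrable_on U f"
  unfolding locally_integrable_on_def
proof (intro allI impI)
  fix K assume K: "compact K" "K \<subseteq> U"
  have Km: "K \<in> sets borel" using K(1) by (simp add: compact_imp_closed borel_closed)
  have KL: "K \<in> sets lebesgue" using Km by simp
  have F: "F \<in> borel_measurable borel" using assms(1) by (auto simp: L2Q_def sqi_def)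
  have FK: "(\<lambda>x. F x * indicator K x) \<in> borel_measurable lborel" using F Km by auto
  have i: "integrable lebesgue (\<lambda>x. F x * indicator K x)"
    using sqi_mult_integrable[OF L2Q_sqi[OF assms(1)] indicator_compact_sqi[OF K(1)]] integrable_completion[OF FK] by simp
  have ae: "AE x in lebesgue. (if x \<in> K then f x else 0) = F x * indicator K x"
    using AE_completion[OF assms(3)] by eventually_elim (use K assms(2) in auto)
  have "integrable lebesgue (\<lambda>x. if x \<in> K then f x else 0)"
    using integrable_cong_AE[OF borel_measurable_lebesgue_AE[OF measurable_completion[OF FK] ae] measurable_completion[OF FK] ae] i
    by simp
  then show "integrable (lebesgue_on K) f"
    using Lebesgue_Measure.integrable_restrict_UNIV[OF KL, of f] by simp
qed

lemma test_zero_outside: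
  assumes "\<psi> \<in> test_functions U" "x \<notin> U" shows "\<psi> x = 0"
  using assms(1)
proof (rule test_functionsE)
  fix K assume "K \<subseteq> U" "\<And>x. x \<notin> K \<Longrightarrow> \<psi> x = 0"
  then show ?thesis using assms(2) by blast
qed

lemma lint_IQ_test:
  assumes "L2Q F" "AE x in lborel. x \<in> IQ \<longrightarrow> f x = F x" "\<psi> \<in> test_functions U"
  shows "(LINT x|lebesgue_on IQ. f x * \<psi> x) = (\<integral>x. F x * \<psi> x \<partial>lborel)"
proof (rule lebesgue_on_IQ_rep(3))
  show "(\<lambda>x. F x * \<psi> x) \<in> borel_measurable borel"
    using assms(1) smooth_borel[OF test_smooth[OF assms(3)]] by (auto simp: L2Q_def sqi_def)
  show "AE x in lborel. x \<in> IQ \<longrightarrow> f x * \<psi> x = F x * \<psi> x"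
    using assms(2) by eventually_elim auto
qed (use L2Q_zero[OF assms(1)] in auto)

lemma lint_subset_test:
  assumes "U \<in> sets lebesgue" "U \<subseteq> IQ" "\<psi> \<in> test_functions U"
  shows "(LINT x|lebesgue_on U. f x * \<psi> x) = (LINT x|lebesgue_on IQ. f x * \<psi> x)"
proof -
  have "(\<lambda>x. if x \<in> U then f x * \<psi> x else 0) = (\<lambda>x. if x \<in> IQ then f x * \<psi> x else 0)"
    using assms(2) test_zero_outside[OF assms(3)] by (auto simp: fun_eq_iff)
  then show ?thesis
    using Lebesgue_Measure.integral_restrict_UNIV[OF IQ_lebesgue(1), of "\<lambda>x. f x * \<psi> x"]
      Lebesgue_Measure.integral_restrict_UNIV[OF assms(1), of "\<lambda>x. f x * \<psi> x"] by simp
qed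

lemma has_weak_partialI:
  assumes U: "open U" "U \<subseteq> IQ"
    and F: "L2Q F" "AE x in lborel. x \<in> IQ \<longrightarrow> f x = F x" and G: "L2Q G" "AE x in lborel. x \<in> IQ \<longrightarrow> g x = G x"
    and w: "\<And>\<psi>. \<psi> \<in> test_functions U \<Longrightarrow> (\<integral>x. F x * pd i \<psi> x \<partial>lborel) = - (\<integral>x. G x * \<psi> x \<partial>lborel)"
  shows "has_weak_partial U i f g"
  unfolding has_weak_partial_def
proof (intro conjI ballI)
  fix \<psi> assume p: "\<psi> \<in> test_functions U"
  have Um: "U \<in> sets lebesgue" using U(1) by auto
  have "(LINT x|lebesgue_on U. f x * pd i \<psi> x) = (\<integral>x. F x * pd i \<psi> x \<partial>lborel)"
    using lint_subset_test[OF Um U(2) test_pd[OF p]] lint_IQ_test[OF F test_pd[OF p]] by simp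
  moreover have "(LINT x|lebesgue_on U. g x * \<psi> x) = (\<integral>x. G x * \<psi> x \<partial>lborel)"
    using lint_subset_test[OF Um U(2) p] lint_IQ_test[OF G p] by simp
  ultimately show "(LINT x|lebesgue_on U. f x * frechet_derivative \<psi> (at x) (axis i 1)) = - (LINT x|lebesgue_on U. g x * \<psi> x)"
    using w[OF p] by (simp add: pd_def)
qed (rule L2Q_locally_integrable[OF F(1) U(2) F(2)] L2Q_locally_integrable[OF G(1) U(2) G(2)])+

lemma has_weak_partialD:
  assumes F: "L2Q F" "AE x in lborel. x \<in> IQ \<longrightarrow> f x = F x" and G: "L2Q G" "AE x in lborel. x \<in> IQ \<longrightarrow> g x = G x"
    and w: "has_weak_partial IQ i f g" and p: "\<psi> \<in> test_functions IQ"
  shows "(\<integral>x. F x * pd i \<psi> x \<partial>lborel) = - (\<integral>x. G x * \<psi> x \<partial>lborel)"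
  using w p lint_IQ_test[OF F test_pd[OF p]] lint_IQ_test[OF G p]
  unfolding has_weak_partial_def pd_def by auto

text \<open>Weak derivatives are merely locally integrable, so the difference is first restricted to
  a closed box, where it is integrable and the fundamental lemma applies.\<close>

lemma has_weak_partial_unique:
  fixes f :: "real^2 \<Rightarrow> real"
  assumes w: "has_weak_partial IQ i f g" "has_weak_partial IQ i f g'"
  shows "AE x in lborel. x \<in> IQ \<longrightarrow> g x = g' x"
proof (rule AE_open_if_AE_box)
  fix a b :: "real^2" assume ab: "cbox a b \<subseteq> IQ"
  define d where "d x = (if x \<in> cbox a b then g x - g' x else 0)" for x
  have gi: "integrable (lebesgue_on K) g" "integrable (lebesgue_on K) g'" if "compact K" "K \<subseteq> IQ" for K
    using w that by (auto simp: has_weak_partial_def locally_integrable_on_def)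
  have di: "integrable lebesgue d"
    unfolding d_def using gi[OF compact_cbox ab] by (subst Lebesgue_Measure.integrable_restrict_UNIV) (auto intro: Bochner_Integration.integrable_diff)
  have "AE x in lborel. x \<in> box a b \<longrightarrow> d x = 0"
  proof (rule fundamental_lemma)
    show "d \<in> borel_measurable lebesgue" using di by auto
    show "integrable lebesgue (\<lambda>x. if x \<in> K then d x else 0)" if "compact K" "K \<subseteq> box a b" for K
    proof -
      have "integrable lebesgue (\<lambda>x. indicator K x *\<^sub>R d x)"
        using di that by (intro integrable_mult_indicator) (auto simp: compact_imp_closed)
      moreover have "(\<lambda>x. indicator K x *\<^sub>R d x) = (\<lambda>x. if x \<in> K then d x else 0)"
        by (auto simp: indicator_def)
      ultimately show ?thesis by simp
    qed
    fix \<phi> assume p: "\<phi> \<in> test_functions (box a b)"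
    have p': "\<phi> \<in> test_functions IQ" using p test_mono[of "box a b" IQ] ab box_subset_cbox[of a b] by blast
    obtain K where K: "smooth \<phi>" "compact K" "K \<subseteq> box a b" "\<And>x. x \<notin> K \<Longrightarrow> \<phi> x = 0"
      by (rule test_functionsE[OF p]) blast
    obtain B where B: "0 \<le> B" "\<And>x. \<bar>\<phi> x\<bar> \<le> B" by (rule test_bounded[OF p]) blast
    have int: "integrable (lebesgue_on IQ) (\<lambda>x. u x * \<phi> x)" if "\<And>K. compact K \<Longrightarrow> K \<subseteq> IQ \<Longrightarrow> integrable (lebesgue_on K) u" for u
    proof -
      have "integrable lebesgue (\<lambda>x. if x \<in> cbox a b then u x else 0)"
        using that[OF compact_cbox ab] by (subst Lebesgue_Measure.integrable_restrict_UNIV) auto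
      then have "integrable lebesgue (\<lambda>x. B * (if x \<in> cbox a b then u x else 0))" by simp
      then have "integrable lebesgue (\<lambda>x. (if x \<in> cbox a b then u x else 0) * \<phi> x)"
      proof (rule Bochner_Integration.integrable_bound)
        show "(\<lambda>x. (if x \<in> cbox a b then u x else 0) * \<phi> x) \<in> borel_measurable lebesgue"
          using smooth_borel[OF K(1)]
          by (intro borel_measurable_times
              borel_measurable_integrable[OF \<open>integrable lebesgue (\<lambda>x. if x \<in> cbox a b then u x else 0)\<close>]
              measurable_completion) simp
        show "AE x in lebesgue. norm ((if x \<in> cbox a b then u x else 0) * \<phi> x) \<le> norm (B * (if x \<in> cbox a b then u x else 0))"
          using B by (intro AE_I2) (auto simp: abs_mult mult.commute intro!: mult_right_mono)
      qed
      moreover have "(\<lambda>x. (if x \<in> cbox a b then u x else 0) * \<phi> x) = (\<lambda>x. if x \<in> IQ then u x * \<phi> x else 0)"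
        using test_zero_outside[OF p] test_zero_outside[OF p'] box_subset_cbox[of a b] by (auto simp: fun_eq_iff)
      ultimately show ?thesis
        using Lebesgue_Measure.integrable_restrict_UNIV[OF IQ_lebesgue(1), of "\<lambda>x. u x * \<phi> x"] by simp
    qed
    have "(\<lambda>x. d x * \<phi> x) = (\<lambda>x. if x \<in> IQ then g x * \<phi> x - g' x * \<phi> x else 0)"
      using test_zero_outside[OF p] test_zero_outside[OF p'] box_subset_cbox[of a b]
      by (auto simp: d_def fun_eq_iff left_diff_distrib)
    then have "(\<integral>x. d x * \<phi> x \<partial>lebesgue) = (LINT x|lebesgue_on IQ. g x * \<phi> x - g' x * \<phi> x)"
      using Lebesgue_Measure.integral_restrict_UNIV[OF IQ_lebesgue(1), of "\<lambda>x. g x * \<phi> x - g' x * \<phi> x"] by simp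
    also have "\<dots> = (LINT x|lebesgue_on IQ. g x * \<phi> x) - (LINT x|lebesgue_on IQ. g' x * \<phi> x)"
      by (intro Bochner_Integration.integral_diff int gi)
    also have "\<dots> = 0"
      using w p' unfolding has_weak_partial_def by fastforce
    finally show "(\<integral>x. d x * \<phi> x \<partial>lebesgue) = 0" .
  qed (rule open_box)
  then show "AE x in lborel. x \<in> box a b \<longrightarrow> g x = g' x"
    by eventually_elim (auto simp: d_def dest: subsetD[OF box_subset_cbox] split: if_splits)
qed simp

text \<open>\<open>srep \<sigma> s G\<close>: Borel representatives \<open>s\<close> and \<open>G\<close> of \<open>\<sigma>\<close> and of its weak gradient.\<close>

definition srep :: "(real^2 \<Rightarrow> real) \<Rightarrow> (real^2 \<Rightarrow> real) \<Rightarrow> (2 \<Rightarrow> real^2 \<Rightarrow> real) \<Rightarrow> bool" where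
  "srep \<sigma> s G \<longleftrightarrow> L2Q s \<and> (\<forall>i. L2Q (G i)) \<and> (AE x in lborel. x \<in> IQ \<longrightarrow> \<sigma> x = s x) \<and>
     (\<forall>i. \<forall>\<psi>\<in>test_functions IQ. (\<integral>x. s x * pd i \<psi> x \<partial>lborel) = - (\<integral>x. G i x * \<psi> x \<partial>lborel))"

lemma srep_partial:
  assumes "srep \<sigma> s G" shows "has_weak_partial IQ i \<sigma> (G i)"
  using assms unfolding srep_def by (intro has_weak_partialI[where F=s and G="G i"]) auto

text \<open>\<open>weak_grad\<close> is an arbitrary choice; existence makes the choice a weak
  gradient, and uniqueness identifies it a.e. with G.\<close>

lemma srep_weak_grad:
  assumes "srep \<sigma> s G"
  shows "AE x in lborel. x \<in> IQ \<longrightarrow> (\<forall>i. weak_grad IQ \<sigma> x $ i = G i x)"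
proof -
  have "\<exists>H. \<forall>i. has_weak_partial IQ i \<sigma> (\<lambda>x. H x $ i)"
    using srep_partial[OF assms] by (intro exI[of _ "\<lambda>x. \<chi> i. G i x"]) simp
  then have "\<forall>i. has_weak_partial IQ i \<sigma> (\<lambda>x. weak_grad IQ \<sigma> x $ i)"
    unfolding weak_grad_def by (rule someI_ex)
  then have "AE x in lborel. x \<in> IQ \<longrightarrow> weak_grad IQ \<sigma> x $ i = G i x" for i
    using has_weak_partial_unique[OF _ srep_partial[OF assms]] by blast
  from this[of 1] this[of 2] show ?thesis
    by eventually_elim (auto simp: forall_2)
qed

lemma sobolev1_srep:
  assumes "\<sigma> \<in> sobolev 1 IQ"
  obtains s G where "srep \<sigma> s G"
proof -
  have s1: "\<sigma> \<in> L2_on IQ" "\<forall>i. \<exists>g\<in>L2_on IQ. has_weak_partial IQ i \<sigma> g"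
    using assms unfolding One_nat_def sobolev.simps by auto
  obtain s where s: "L2Q s" "AE x in lborel. x \<in> IQ \<longrightarrow> \<sigma> x = s x"
    using L2_on_rep[OF s1(1)] by blast
  have "\<exists>G. L2Q G \<and> (\<forall>\<psi>\<in>test_functions IQ. (\<integral>x. s x * pd i \<psi> x \<partial>lborel) = - (\<integral>x. G x * \<psi> x \<partial>lborel))" for i
  proof -
    obtain g where g: "g \<in> L2_on IQ" "has_weak_partial IQ i \<sigma> g" using s1(2) by blast
    obtain G where G: "L2Q G" "AE x in lborel. x \<in> IQ \<longrightarrow> g x = G x" using L2_on_rep[OF g(1)] by blast
    show ?thesis using has_weak_partialD[OF s G g(2)] G(1) by blast
  qed
  then obtain G where "\<And>i. L2Q (G i) \<and> (\<forall>\<psi>\<in>test_functions IQ. (\<integral>x. s x * pd i \<psi> x \<partial>lborel) = - (\<integral>x. G i x * \<psi> x \<partial>lborel))"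
    by metis
  then show ?thesis using s that unfolding srep_def by blast
qed

lemma srep_sobolev1:
  assumes "srep \<sigma> s G" shows "\<sigma> \<in> sobolev 1 IQ"
proof -
  have "\<sigma> \<in> L2_on IQ" using assms L2Q_imp_L2_on unfolding srep_def by blast
  moreover have "G i \<in> L2_on IQ" for i
    using assms L2Q_imp_L2_on[of "G i" "G i"] unfolding srep_def by auto
  ultimately show ?thesis
    using srep_partial[OF assms] unfolding One_nat_def sobolev.simps by auto
qed

text \<open>\<open>has_trace\<close> measures \<open>\<phi> n - \<sigma>\<close> in
  \<open>sobolev1_norm\<close>, whose \<open>weak_grad\<close> is a separate choice for every n.
  Representatives of the difference make these norms computable.\<close>

lemma srep_smooth_diff:
  assumes r: "srep \<sigma> s G" and p: "smooth \<phi>"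
  shows "srep (\<lambda>x. \<phi> x - \<sigma> x) (\<lambda>x. cut \<phi> x - s x) (\<lambda>i x. cut (pd i \<phi>) x - G i x)"
  unfolding srep_def
proof (intro conjI allI ballI)
  have L: "L2Q s" "\<And>i. L2Q (G i)" using r by (auto simp: srep_def)
  show "L2Q (\<lambda>x. cut \<phi> x - s x)" "L2Q (\<lambda>x. cut (pd i \<phi>) x - G i x)" for i
    by (intro L2Q_diff L2Q_smooth smooth_pd p L)+
  show "AE x in lborel. x \<in> IQ \<longrightarrow> \<phi> x - \<sigma> x = cut \<phi> x - s x"
    using r unfolding srep_def by (auto elim!: eventually_mono)
  fix i and \<psi> :: "real^2 \<Rightarrow> real" assume t: "\<psi> \<in> test_functions IQ"
  have "cut \<phi> x * pd i \<psi> x = \<phi> x * pd i \<psi> x" "cut (pd i \<phi>) x * \<psi> x = pd i \<phi> x * \<psi> x" for x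
    using test_zero_outside[OF t, of x] test_zero_outside[OF test_pd[OF t], of x i] by (auto simp: indicator_def)
  then have "(\<integral>x. cut \<phi> x * pd i \<psi> x \<partial>lborel) = - (\<integral>x. cut (pd i \<phi>) x * \<psi> x \<partial>lborel)"
    using integral_by_parts_test[OF t p, of i] by (simp only:)
  moreover have "integrable lborel (\<lambda>x. cut \<phi> x * pd i \<psi> x)" "integrable lborel (\<lambda>x. s x * pd i \<psi> x)"
    "integrable lborel (\<lambda>x. cut (pd i \<phi>) x * \<psi> x)" "integrable lborel (\<lambda>x. G i x * \<psi> x)"
    by (intro sqi_mult_integrable sqi_IQ_smooth smooth_pd p L2Q_sqi L sqi_test[OF t] sqi_test[OF test_pd[OF t]])+
  moreover have "(\<integral>x. s x * pd i \<psi> x \<partial>lborel) = - (\<integral>x. G i x * \<psi> x \<partial>lborel)"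
    using r t by (auto simp: srep_def)
  ultimately show "(\<integral>x. (cut \<phi> x - s x) * pd i \<psi> x \<partial>lborel) = - (\<integral>x. (cut (pd i \<phi>) x - G i x) * \<psi> x \<partial>lborel)"
    by (simp add: left_diff_distrib)
qed

lemma sobolev1_norm_srep:
  assumes r: "srep \<sigma> s G"
  shows "sobolev1_norm IQ \<sigma> = sqrt ((nrm lborel s)\<^sup>2 + ((nrm lborel (G 1))\<^sup>2 + (nrm lborel (G 2))\<^sup>2))"
proof -
  have L: "L2Q s" "\<And>i. L2Q (G i)" using r by (auto simp: srep_def)
  have m [measurable]: "s \<in> borel_measurable borel" "G i \<in> borel_measurable borel" for i
    using L by (auto simp: L2Q_def sqi_def)
  have "(LINT x|lebesgue_on IQ. (\<sigma> x)\<^sup>2) = (\<integral>x. (s x)\<^sup>2 \<partial>lborel)"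
  proof (rule lebesgue_on_IQ_rep(3))
    show "AE x in lborel. x \<in> IQ \<longrightarrow> (\<sigma> x)\<^sup>2 = (s x)\<^sup>2"
      using r unfolding srep_def by (auto elim!: eventually_mono)
  qed (use L2Q_zero[OF L(1)] in auto)
  moreover have "(LINT x|lebesgue_on IQ. (norm (weak_grad IQ \<sigma> x))\<^sup>2) = (\<integral>x. (G 1 x)\<^sup>2 + (G 2 x)\<^sup>2 \<partial>lborel)"
  proof (rule lebesgue_on_IQ_rep(3))
    show "AE x in lborel. x \<in> IQ \<longrightarrow> (norm (weak_grad IQ \<sigma> x))\<^sup>2 = (G 1 x)\<^sup>2 + (G 2 x)\<^sup>2"
      using srep_weak_grad[OF r]
      by eventually_elim (simp only: power2_norm_eq_inner, simp add: inner_vec_def sum_2 power2_eq_square)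
  qed (use L2Q_zero[OF L(2)] in auto)
  moreover have "(\<integral>x. (G 1 x)\<^sup>2 + (G 2 x)\<^sup>2 \<partial>lborel) = (\<integral>x. (G 1 x)\<^sup>2 \<partial>lborel) + (\<integral>x. (G 2 x)\<^sup>2 \<partial>lborel)"
    by (intro Bochner_Integration.integral_add sqi_square L2Q_sqi L)
  ultimately show ?thesis by (simp add: sobolev1_norm_def nrm_square)
qed

lemma side_norm_lebesgue:
  assumes "smooth \<phi>"
  shows "(LINT t|lebesgue_on {-1..1}. (\<phi> (vector [a, t]) - 0)\<^sup>2) = (side_norm a \<phi>)\<^sup>2"
proof -
  have m: "(\<lambda>t. (indicator {-1..1} t * \<phi> (vector [a, t]))\<^sup>2) \<in> borel_measurable lborel"
    using sqi_measurable[OF sqi_side[OF assms, of a]] by measurable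
  have "(LINT t|lebesgue_on {-1..1}. (\<phi> (vector [a, t]) - 0)\<^sup>2) = (\<integral>t. (if t \<in> {-1..1} then (\<phi> (vector [a, t]) - 0)\<^sup>2 else 0) \<partial>lebesgue)"
    by (rule Lebesgue_Measure.integral_restrict_UNIV[symmetric]) simp
  also have "\<dots> = (\<integral>t. (indicator {-1..1} t * \<phi> (vector [a, t]))\<^sup>2 \<partial>lebesgue)"
    by (intro Bochner_Integration.integral_cong) (auto simp: indicator_def)
  also have "\<dots> = (\<integral>t. (indicator {-1..1} t * \<phi> (vector [a, t]))\<^sup>2 \<partial>lborel)"
    by (rule integral_completion[OF m])
  finally show ?thesis by (simp add: side_norm_def nrm_square)
qed

lemma sqrt_sum_squares_tendsto_0:
  fixes a b c :: "nat \<Rightarrow> real"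
  assumes "(\<lambda>n. sqrt ((a n)\<^sup>2 + ((b n)\<^sup>2 + (c n)\<^sup>2))) \<longlonglongrightarrow> 0"
  shows "a \<longlonglongrightarrow> 0" "b \<longlonglongrightarrow> 0" "c \<longlonglongrightarrow> 0"
  by (rule Lim_null_comparison[OF _ assms], intro always_eventually allI, simp add: real_le_rsqrt)+

lemma has_trace_imp_zt:
  assumes r: "srep \<sigma> s G" and t: "has_trace \<sigma> a (\<lambda>t. 0)"
  shows "zt a s G"
proof -
  obtain \<phi> :: "nat \<Rightarrow> real^2 \<Rightarrow> real" where p: "\<And>n. smooth (\<phi> n)"
    "(\<lambda>n. sobolev1_norm IQ (\<lambda>x. \<phi> n x - \<sigma> x)) \<longlonglongrightarrow> 0"
    "(\<lambda>n. LINT t|lebesgue_on {-1..1}. (\<phi> n (vector [a, t]) - 0)\<^sup>2) \<longlonglongrightarrow> 0"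
    using t unfolding has_trace_def by blast
  have n: "(\<lambda>n. nrm lborel (\<lambda>x. cut (\<phi> n) x - s x)) \<longlonglongrightarrow> 0"
    "(\<lambda>n. nrm lborel (\<lambda>x. cut (pd 1 (\<phi> n)) x - G 1 x)) \<longlonglongrightarrow> 0"
    "(\<lambda>n. nrm lborel (\<lambda>x. cut (pd 2 (\<phi> n)) x - G 2 x)) \<longlonglongrightarrow> 0"
    using sqrt_sum_squares_tendsto_0[OF p(2)[unfolded sobolev1_norm_srep[OF srep_smooth_diff[OF r p(1)]]]] by simp_all
  have L: "L2Q s" "\<And>i. L2Q (G i)" using r by (auto simp: srep_def)
  have sn: "(\<lambda>n. side_norm a (\<phi> n)) \<longlonglongrightarrow> 0"
  proof -
    have "(\<lambda>n. sqrt ((side_norm a (\<phi> n))\<^sup>2)) \<longlonglongrightarrow> sqrt 0"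
      using p(3) unfolding side_norm_lebesgue[OF p(1)] by (rule tendsto_real_sqrt)
    then show ?thesis by (simp add: side_norm_def)
  qed
  have "(\<lambda>n. nrm lborel (\<lambda>x. cut (pd i (\<phi> n)) x - G i x)) \<longlonglongrightarrow> 0" for i
    using exhaust_2[of i] n(2,3) by auto
  then show ?thesis by (intro zt_seqI[where \<phi>=\<phi>] L p n(1) sn)
qed

lemma zt_srep: "zt a s G \<Longrightarrow> srep s s G"
  unfolding srep_def using zt_weak zt_L2Q by auto

lemma zt_imp_has_trace:
  assumes "zt a s G"
  shows "has_trace s a (\<lambda>t. 0)"
  unfolding has_trace_def
proof (intro conjI)
  have r: "srep s s G" by (rule zt_srep[OF assms])
  show "s \<in> sobolev 1 IQ" by (rule srep_sobolev1[OF r])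
  show "(\<lambda>t. 0) \<in> L2_on {-1..1}" by (auto simp: L2_on_def)
  obtain \<phi> where p: "\<And>n. smooth (\<phi> n)"
    "(\<lambda>n. nrm lborel (\<lambda>x. cut (\<phi> n) x - s x)) \<longlonglongrightarrow> 0"
    "\<And>i. (\<lambda>n. nrm lborel (\<lambda>x. cut (pd i (\<phi> n)) x - G i x)) \<longlonglongrightarrow> 0"
    "(\<lambda>n. side_norm a (\<phi> n)) \<longlonglongrightarrow> 0" by (rule zt_seqE[OF assms]) blast
  have "(\<lambda>n. sobolev1_norm IQ (\<lambda>x. \<phi> n x - s x)) \<longlonglongrightarrow> sqrt (0\<^sup>2 + (0\<^sup>2 + 0\<^sup>2))"
    unfolding sobolev1_norm_srep[OF srep_smooth_diff[OF r p(1)]]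
    by (intro tendsto_intros p)
  moreover have "(\<lambda>n. LINT t|lebesgue_on {-1..1}. (\<phi> n (vector [a, t]) - 0)\<^sup>2) \<longlonglongrightarrow> 0\<^sup>2"
    unfolding side_norm_lebesgue[OF p(1)] by (intro tendsto_intros p)
  ultimately show "\<exists>\<phi>. (\<forall>n. smooth (\<phi> n)) \<and> (\<lambda>n. sobolev1_norm IQ (\<lambda>x. \<phi> n x - s x)) \<longlonglongrightarrow> 0 \<and>
      (\<lambda>n. LINT t|lebesgue_on {-1..1}. (\<phi> n (vector [a, t]) - 0)\<^sup>2) \<longlonglongrightarrow> 0"
    using p(1) by (intro exI[of _ \<phi>]) simp
qed

section \<open>The energy in terms of Borel representatives\<close>

lemma Q_diff_IQ: "Q - IQ \<in> null_sets lborel"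
proof -
  have "Q - IQ = cbox (\<chi> i. -1) (\<chi> i. 1) - box (\<chi> i. -1) (\<chi> i. 1)"
    by (simp only: IQ_eq_box) (simp only: Q_eq_cbox)
  then show ?thesis by (simp only: null_sets_cbox_Diff_box)
qed

lemma AE_lebesgue_on_Q: "(AE x in lebesgue_on Q. P x) \<longleftrightarrow> (AE x in lborel. x \<in> IQ \<longrightarrow> P x)"
proof -
  have "(AE x in lebesgue_on Q. P x) \<longleftrightarrow> (AE x in lebesgue. x \<in> Q \<longrightarrow> P x)"
    using IQ_lebesgue by (simp add: AE_restrict_space_iff)
  also have "\<dots> \<longleftrightarrow> (AE x in lborel. x \<in> Q \<longrightarrow> P x)"
    by (rule AE_completion_iff)
  also have "\<dots> \<longleftrightarrow> (AE x in lborel. x \<in> IQ \<longrightarrow> P x)"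
  proof -
    have "AE x in lborel. x \<notin> Q - IQ"
      by (rule AE_not_in[OF Q_diff_IQ])
    then show ?thesis
      using IQ_subset_Q by (auto elim: eventually_elim2)
  qed
  finally show ?thesis .
qed

definition energy :: "(real \<Rightarrow> ereal) \<Rightarrow> (2 \<Rightarrow> real^2 \<Rightarrow> real) \<Rightarrow> ennreal" where
  "energy h0 G = (\<integral>\<^sup>+x. e2ennreal (W h0 (shear_gradient (\<chi> i. G i x))) * indicator IQ x \<partial>lborel)"

lemma I_s_srep:
  assumes "srep \<sigma> s G"
  shows "I_s h0 \<sigma> = energy h0 G"
proof -
  have "I_s h0 \<sigma> = (\<integral>\<^sup>+x. e2ennreal (W h0 (shear_gradient (weak_grad IQ \<sigma> x))) * indicator Q x \<partial>lebesgue)"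
    unfolding I_s_def using IQ_lebesgue by (subst nn_integral_restrict_space) auto
  also have "\<dots> = (\<integral>\<^sup>+x. e2ennreal (W h0 (shear_gradient (\<chi> i. G i x))) * indicator IQ x \<partial>lebesgue)"
  proof (rule nn_integral_cong_AE)
    have "AE x in lborel. x \<notin> Q - IQ"
      by (rule AE_not_in[OF Q_diff_IQ])
    then have "AE x in lborel. e2ennreal (W h0 (shear_gradient (weak_grad IQ \<sigma> x))) * indicator Q x =
        e2ennreal (W h0 (shear_gradient (\<chi> i. G i x))) * indicator IQ x"
      using srep_weak_grad[OF assms]
    proof eventually_elim
      case (elim x)
      show ?case
      proof (cases "x \<in> IQ")
        case True
        then have "weak_grad IQ \<sigma> x = (\<chi> i. G i x)" using elim by (simp add: vec_eq_iff)
        then show ?thesis using True IQ_subset_Q by auto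
      qed (use elim in auto)
    qed
    then show "AE x in lebesgue. e2ennreal (W h0 (shear_gradient (weak_grad IQ \<sigma> x))) * indicator Q x =
        e2ennreal (W h0 (shear_gradient (\<chi> i. G i x))) * indicator IQ x"
      by (rule AE_completion)
  qed
  also have "\<dots> = energy h0 G"
    unfolding energy_def by (rule nn_integral_completion)
  finally show ?thesis .
qed

text \<open>The two sides may be approximated by different smooth sequences, just as
  \<open>A_s\<close> imposes two separate conditions \<open>has_trace\<close>.\<close>

definition zt2 :: "(real^2 \<Rightarrow> real) \<Rightarrow> (2 \<Rightarrow> real^2 \<Rightarrow> real) \<Rightarrow> bool" where
  "zt2 s G \<longleftrightarrow> zt (-1) s G \<and> zt 1 s G"

lemma A_s_zt2:
  assumes "\<sigma> \<in> A_s h0"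
  obtains s G where "srep \<sigma> s G" "zt2 s G" "I_s h0 \<sigma> = energy h0 G" "energy h0 G < \<infinity>"
proof -
  have \<sigma>: "\<sigma> \<in> sobolev 1 IQ" "has_trace \<sigma> (-1) (\<lambda>t. 0)" "has_trace \<sigma> 1 (\<lambda>t. 0)" "I_s h0 \<sigma> < \<infinity>"
    using assms by (auto simp: A_s_def)
  obtain s G where r: "srep \<sigma> s G" using sobolev1_srep[OF \<sigma>(1)] by blast
  then show ?thesis
    using that[OF r] \<sigma> I_s_srep[OF r, of h0] has_trace_imp_zt[OF r] by (simp add: zt2_def)
qed

lemma zt2_A_s:
  assumes "zt2 s G" "energy h0 G < \<infinity>"
  shows "s \<in> A_s h0" "I_s h0 s = energy h0 G"
proof -
  have r: "srep s s G" using assms(1) zt_srep by (auto simp: zt2_def)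
  show "I_s h0 s = energy h0 G" by (rule I_s_srep[OF r])
  then show "s \<in> A_s h0"
    using assms srep_sobolev1[OF r] zt_imp_has_trace by (auto simp: A_s_def zt2_def)
qed

subsection \<open>The energy density\<close>

locale energy_density =
  fixes h0 :: "real \<Rightarrow> ereal"
  assumes H1: "H1 h0" and H2: "H2 h0" and H3: "H3 h0"
    and bounded_second: "\<forall>\<mu>>0. \<exists>C>0. \<forall>t\<ge>\<mu>. \<bar>h0_deriv h0 2 t\<bar> \<le> C"
begin

text \<open>\<open>real_of_ereal\<close> sends infinity to 0, so h = 0 on t <= 0; with this value
  nonnegativity and Borel measurability hold on the whole line.\<close>

definition h :: "real \<Rightarrow> real" where "h t = real_of_ereal (h0 t)"

lemma h0_pos: "t > 0 \<Longrightarrow> h0 t = ereal (h t)"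
  using H2 by (auto simp: H2_def h_def ereal_real)

lemma h0_nonpos: "t \<le> 0 \<Longrightarrow> h0 t = \<infinity>"
  using H3 by (auto simp: H3_def)

lemma h_nonneg: "0 \<le> h t"
  using H1 by (auto simp: H1_def h_def real_of_ereal_pos)

lemma DERIV_h: "t > 0 \<Longrightarrow> (h has_real_derivative deriv h t) (at t)"
  and DERIV_deriv_h: "t > 0 \<Longrightarrow> (deriv h has_real_derivative deriv (deriv h) t) (at t)"
proof -
  have "Ck_on (Suc (Suc (Suc 0))) h {0<..}"
    using H2 by (simp add: H2_def h_def[abs_def] numeral_3_eq_3)
  then have d: "\<And>t. t > 0 \<Longrightarrow> h differentiable (at t)"
    "\<And>t. t > 0 \<Longrightarrow> (\<lambda>x. frechet_derivative h (at x) 1) differentiable (at t)"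
    by auto
  show *: "(h has_real_derivative deriv h t) (at t)" if "t > 0" for t
    using d(1)[OF that] by (simp add: DERIV_deriv_iff_real_differentiable)
  have e: "frechet_derivative h (at t) 1 = deriv h t" if "t > 0" for t
    using frechet_eqI[OF has_field_derivative_imp_has_derivative[OF *[OF that]]] by simp
  show "(deriv h has_real_derivative deriv (deriv h) t) (at t)" if tp: "t > 0"
  proof -
    obtain D where D: "((\<lambda>x. frechet_derivative h (at x) 1) has_real_derivative D) (at t)"
      using d(2)[OF tp] by (auto simp: real_differentiable_def)
    have "(deriv h has_real_derivative D) (at t)"
      by (rule has_field_derivative_transform_within_open[OF D, of "{0<..}"]) (use tp e in auto)
    then show ?thesis using DERIV_imp_deriv by metis
  qed
qed

lemma h_convex:
  assumes "0 < a" "0 < b" "0 \<le> u" "0 \<le> v" "u + v = 1"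
  shows "h (u * a + v * b) \<le> u * h a + v * h b"
proof -
  have "u * a + v * b > 0"
    using assms by (metis add_nonneg_pos add_pos_nonneg less_eq_real_def mult_pos_pos mult_zero_left add_0 zero_neq_one)
  moreover have "h0 (u * a + v * b) \<le> ereal u * h0 a + ereal v * h0 b"
    using H1 assms by (auto simp: H1_def ereal_convex_def)
  ultimately show ?thesis using assms by (simp add: h0_pos)
qed

lemma convex_on_h: "convex_on {0<..} h"
  by (rule convex_onI) (auto simp: h_convex)

lemma h_tangent: "0 < a \<Longrightarrow> 0 < b \<Longrightarrow> deriv h a * (b - a) \<le> h b - h a"
  by (rule convex_on_imp_above_tangent[OF convex_on_h, of a b])
    (auto simp: interior_open DERIV_h has_field_derivative_at_within)

lemma deriv_h_mono: "0 < a \<Longrightarrow> 0 < b \<Longrightarrow> 0 \<le> (deriv h b - deriv h a) * (b - a)"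
  using h_tangent[of a b] h_tangent[of b a] by (simp add: algebra_simps)

text \<open>The quadratic remainder bound avoids Taylor's formula: the tangent at b bounds the
  remainder by (h'(b) - h'(a)) (b - a), at the cost of C in place of C/2.\<close>

lemma deriv_h_Lipschitz:
  assumes "\<mu> > 0"
  obtains C where "C > 0" "\<And>a b. \<mu> \<le> a \<Longrightarrow> \<mu> \<le> b \<Longrightarrow> \<bar>deriv h b - deriv h a\<bar> \<le> C * \<bar>b - a\<bar>"
    "\<And>a b. \<mu> \<le> a \<Longrightarrow> \<mu> \<le> b \<Longrightarrow> h b - h a - deriv h a * (b - a) \<le> C * (b - a)\<^sup>2"
proof -
  obtain C where C: "C > 0" "\<And>t. t \<ge> \<mu> \<Longrightarrow> \<bar>h0_deriv h0 2 t\<bar> \<le> C"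
    using bounded_second assms by blast
  have e: "h0_deriv h0 2 t = deriv (deriv h) t" for t
    by (simp add: h0_deriv_def h_def[abs_def] numeral_2_eq_2)
  have L: "\<bar>deriv h b - deriv h a\<bar> \<le> C * \<bar>b - a\<bar>" if "\<mu> \<le> a" "\<mu> \<le> b" for a b
  proof -
    have "norm (deriv h b - deriv h a) \<le> C * norm (b - a)"
    proof (rule field_differentiable_bound[where S="{\<mu>..}"])
      show "(deriv h has_field_derivative deriv (deriv h) z) (at z within {\<mu>..})" if "z \<in> {\<mu>..}" for z
        using DERIV_deriv_h[of z] assms that by (auto intro: has_field_derivative_at_within)
    qed (use C e that in auto)
    then show ?thesis by simp
  qed
  have "h b - h a - deriv h a * (b - a) \<le> C * (b - a)\<^sup>2" if "\<mu> \<le> a" "\<mu> \<le> b" for a b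
  proof -
    have "h b - h a - deriv h a * (b - a) \<le> (deriv h b - deriv h a) * (b - a)"
      using h_tangent[of b a] that assms by (simp add: algebra_simps)
    also have "\<dots> \<le> \<bar>deriv h b - deriv h a\<bar> * \<bar>b - a\<bar>"
      by (metis abs_ge_self abs_mult)
    also have "\<dots> \<le> C * \<bar>b - a\<bar> * \<bar>b - a\<bar>"
      using L[OF that] by (intro mult_right_mono) auto
    finally show ?thesis by (simp add: power2_eq_square mult.assoc)
  qed
  then show ?thesis using L C(1) that by blast
qed

text \<open>This is the lower bound in \<open>H2\<close> for j = 0. The blow-up makes
  \<open>dens\<close> continuous where the determinant is 0.\<close>

lemma h_at_right_0: "filterlim h at_top (at_right 0)"
proof -
  obtain s c1 d0 where s: "s > 0" "c1 > 0" "d0 > 0"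
    and lower: "\<And>t. 0 < t \<Longrightarrow> t < d0 \<Longrightarrow> c1 * t powr (- s) \<le> h t"
  proof -
    obtain s c1 c2 d0 where *: "s > 0" "c1 > 0" "d0 > 0" "\<forall>t. 0 < t \<and> t < d0 \<longrightarrow> (\<forall>j\<in>{0, 1, 2}.
        c1 * t powr (- s - real j) \<le> (-1) ^ j * h0_deriv h0 j t \<and>
        (-1) ^ j * h0_deriv h0 j t \<le> c2 * t powr (- s - real j))"
      using H2 unfolding H2_def by blast
    have "c1 * t powr (- s) \<le> h t" if "0 < t" "t < d0" for t
      using *(4)[rule_format, of t 0] that by (simp add: h0_deriv_def h_def)
    then show ?thesis using * that by blast
  qed
  have "filterlim (\<lambda>t. c1 * t powr (- s)) at_top (at_right 0)"
  proof (rule filterlim_tendsto_pos_mult_at_top[OF tendsto_const s(2)])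
    have "filterlim (\<lambda>t. exp (s * ln (inverse t))) at_top (at_right (0::real))"
      by (intro filterlim_compose[OF exp_at_top] filterlim_tendsto_pos_mult_at_top[OF tendsto_const s(1)]
          filterlim_compose[OF ln_at_top filterlim_inverse_at_top_right])
    then show "filterlim (\<lambda>t. t powr (- s)) at_top (at_right (0::real))"
      by (rule filterlim_at_top_mono) (rule eventually_at_rightI[of 0 1], auto simp: powr_def ln_inverse)
  qed
  then show ?thesis
    by (rule filterlim_at_top_mono) (rule eventually_at_rightI[of 0 d0], use lower s in auto)
qed

definition w :: "real \<Rightarrow> real \<Rightarrow> real" where
  "w a b = 1 / 2 * (1 + a\<^sup>2 + (1 + b)\<^sup>2) + h (1 + b)"

lemma w_nonneg: "0 \<le> w a b"
  using h_nonneg[of "1 + b"] by (auto simp: w_def intro!: add_nonneg_nonneg)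

lemma w_pos: "0 < w a b"
  using h_nonneg[of "1 + b"] by (auto simp: w_def intro!: add_pos_nonneg)

lemma norm_shear_gradient: "(norm (shear_gradient \<xi>))\<^sup>2 = 1 + (\<xi> $ 1)\<^sup>2 + (1 + \<xi> $ 2)\<^sup>2"
  unfolding power2_norm_eq_inner
  by (simp add: shear_gradient_def tensor_def e2_def inner_vec_def sum_2 mat_def axis_def power2_eq_square)

lemma W_shear_gradient:
  "W h0 (shear_gradient \<xi>) = (if 1 + \<xi> $ 2 > 0 then ereal (w (\<xi> $ 1) (\<xi> $ 2)) else \<infinity>)"
  by (auto simp: W_def det_shear_gradient norm_shear_gradient h0_pos h0_nonpos w_def)

text \<open>Subtracting half the squared norm of \<xi> leaves 1 + \<xi>_2 + h0(1 + \<xi>_2), where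
  the affine part is what remains of the square of 1 + \<xi>_2. Hence the constant 1 works and
  convexity is inherited from h0.\<close>

lemma strongly_convex_W: "strongly_convex (\<lambda>\<xi>. W h0 (shear_gradient \<xi>))"
  unfolding strongly_convex_def
proof (intro exI[of _ 1] conjI)
  have eq: "W h0 (shear_gradient \<xi>) - ereal (1 / 2 * (norm \<xi>)\<^sup>2) = ereal (1 + \<xi> $ 2) + h0 (1 + \<xi> $ 2)" for \<xi>
  proof -
    have "(norm \<xi>)\<^sup>2 = (\<xi> $ 1)\<^sup>2 + (\<xi> $ 2)\<^sup>2"
      unfolding power2_norm_eq_inner by (simp add: inner_vec_def sum_2 power2_eq_square)
    then show ?thesis
      unfolding W_shear_gradient by (auto simp: h0_pos h0_nonpos w_def power2_eq_square algebra_simps)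
  qed
  show "ereal_convex (\<lambda>\<xi>. W h0 (shear_gradient \<xi>) - ereal (1 / 2 * (norm \<xi>)\<^sup>2))"
    unfolding eq ereal_convex_def
  proof (intro conjI allI impI)
    have nn: "0 \<le> h0 t" for t using H1 by (simp add: H1_def)
    show "ereal (1 + \<xi> $ 2) + h0 (1 + \<xi> $ 2) \<noteq> - \<infinity>" for \<xi> :: "real^2"
      using nn[of "1 + \<xi> $ 2"] by auto
    fix x y :: "real^2" and u v :: real
    assume uv: "0 \<le> u" "0 \<le> v" "u + v = 1"
    have e: "1 + (u *\<^sub>R x + v *\<^sub>R y) $ 2 = u * (1 + x $ 2) + v * (1 + y $ 2)"
      using uv(3) by (simp add: algebra_simps)
    have "h0 (u * (1 + x $ 2) + v * (1 + y $ 2)) \<le> ereal u * h0 (1 + x $ 2) + ereal v * h0 (1 + y $ 2)"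
      using H1 uv by (simp add: H1_def ereal_convex_def)
    then have "ereal (u * (1 + x $ 2) + v * (1 + y $ 2)) + h0 (u * (1 + x $ 2) + v * (1 + y $ 2))
        \<le> ereal (u * (1 + x $ 2) + v * (1 + y $ 2)) + (ereal u * h0 (1 + x $ 2) + ereal v * h0 (1 + y $ 2))"
      by (rule add_left_mono)
    also have "\<dots> = ereal u * (ereal (1 + x $ 2) + h0 (1 + x $ 2)) + ereal v * (ereal (1 + y $ 2) + h0 (1 + y $ 2))"
      using uv nn[of "1 + x $ 2"] nn[of "1 + y $ 2"]
      by (cases "h0 (1 + x $ 2)"; cases "h0 (1 + y $ 2)") (auto simp: algebra_simps)
    finally show "ereal (1 + (u *\<^sub>R x + v *\<^sub>R y) $ 2) + h0 (1 + (u *\<^sub>R x + v *\<^sub>R y) $ 2)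
        \<le> ereal u * (ereal (1 + x $ 2) + h0 (1 + x $ 2)) + ereal v * (ereal (1 + y $ 2) + h0 (1 + y $ 2))"
      unfolding e .
  qed
qed simp

text \<open>The deficit comes from ((a + c)/2)^2 = a^2/2 + c^2/2 - (a - c)^2/4, halved by the factor
  1/2 in \<open>w\<close>; h contributes its convexity.\<close>

lemma w_midpoint:
  assumes "1 + b > 0" "1 + d > 0"
  shows "w ((a + c) / 2) ((b + d) / 2) \<le> w a b / 2 + w c d / 2 - ((a - c)\<^sup>2 + (b - d)\<^sup>2) / 8"
proof -
  have "h (1 / 2 * (1 + b) + 1 / 2 * (1 + d)) \<le> 1 / 2 * h (1 + b) + 1 / 2 * h (1 + d)"
    using assms by (intro h_convex) auto
  moreover have "1 / 2 * (1 + b) + 1 / 2 * (1 + d) = 1 + (b + d) / 2" by (simp add: field_simps)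
  ultimately have "h (1 + (b + d) / 2) \<le> h (1 + b) / 2 + h (1 + d) / 2" by simp
  then show ?thesis
    unfolding w_def by (simp add: power2_eq_square field_simps)
qed

definition dens :: "real \<Rightarrow> real \<Rightarrow> ennreal" where
  "dens a b = (if 1 + b > 0 then ennreal (w a b) else \<infinity>)"

lemma energy_dens: "energy h0 G = (\<integral>\<^sup>+x. dens (G 1 x) (G 2 x) * indicator IQ x \<partial>lborel)"
  unfolding energy_def W_shear_gradient dens_def
  by (intro nn_integral_cong) (auto simp: e2ennreal_ereal e2ennreal_infty)

lemma h_measurable [measurable]: "h \<in> borel_measurable borel"
proof -
  have "continuous_on {0<..} h"
    by (rule DERIV_continuous_on) (auto intro: DERIV_h has_field_derivative_at_within)
  then have "(\<lambda>t. indicator {0<..} t *\<^sub>R h t) \<in> borel_measurable borel"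
    by (intro borel_measurable_continuous_on_indicator) auto
  moreover have "(\<lambda>t. indicator {0<..} t *\<^sub>R h t) = h"
    using h0_nonpos by (auto simp: indicator_def h_def fun_eq_iff not_less)
  ultimately show ?thesis by simp
qed

text \<open>Continuity into [0, infinity], including determinant 0, where the blow-up of h enters.
  It turns a.e. convergence of gradients into convergence of densities, to which Fatou's lemma
  applies.\<close>

lemma dens_tendsto:
  assumes "a \<longlonglongrightarrow> a'" "b \<longlonglongrightarrow> b'"
  shows "(\<lambda>n. dens (a n) (b n)) \<longlonglongrightarrow> dens a' b'"
proof -
  have lim1: "(\<lambda>n. 1 + b n) \<longlonglongrightarrow> 1 + b'" by (intro tendsto_intros assms)
  consider "1 + b' > 0" | "1 + b' < 0" | "1 + b' = 0" by linarith
  then show ?thesis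
  proof cases
    case 1
    have ev: "eventually (\<lambda>n. 1 + b n > 0) sequentially" using order_tendstoD(1)[OF lim1 1] .
    have "(\<lambda>n. h (1 + b n)) \<longlonglongrightarrow> h (1 + b')"
      using DERIV_isCont[OF DERIV_h[OF 1]] lim1 by (rule isCont_tendsto_compose)
    then have "(\<lambda>n. ennreal (w (a n) (b n))) \<longlonglongrightarrow> ennreal (w a' b')"
      unfolding w_def by (intro tendsto_intros assms)
    then have "(\<lambda>n. dens (a n) (b n)) \<longlonglongrightarrow> ennreal (w a' b')"
      by (rule Lim_transform_eventually) (use ev in \<open>eventually_elim, auto simp: dens_def\<close>)
    then show ?thesis using 1 by (simp add: dens_def)
  next
    case 2
    have "eventually (\<lambda>n. 1 + b n < 0) sequentially" using order_tendstoD(2)[OF lim1 2] .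
    then have "eventually (\<lambda>n. \<infinity> = dens (a n) (b n)) sequentially"
      by eventually_elim (auto simp: dens_def)
    then show ?thesis using 2 by (intro Lim_transform_eventually[OF tendsto_const]) (auto simp: dens_def)
  next
    case 3
    have "(\<lambda>n. dens (a n) (b n)) \<longlonglongrightarrow> \<infinity>"
      unfolding infinity_ennreal_def
    proof (rule tendsto_top_iff_ennreal[THEN iffD2, rule_format])
      fix l :: real
      have "eventually (\<lambda>t. l < h t) (at_right 0)"
        using h_at_right_0 by (simp add: filterlim_at_top_dense)
      then obtain d where d: "d > 0" "\<And>t. 0 < t \<Longrightarrow> t < d \<Longrightarrow> l < h t"
        unfolding eventually_at_right_field by auto
      have "eventually (\<lambda>n. 1 + b n < d) sequentially" using order_tendstoD(2)[OF lim1, of d] 3 d(1) by simp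
      then show "eventually (\<lambda>n. ennreal l < dens (a n) (b n)) sequentially"
      proof eventually_elim
        case (elim n)
        show ?case
        proof (cases "1 + b n > 0")
          case True
          have "l < h (1 + b n)" using d(2) True elim by simp
          also have "h (1 + b n) \<le> w (a n) (b n)" by (simp add: w_def)
          finally show ?thesis
            using True w_pos[of "a n" "b n"] by (auto simp: dens_def intro!: ennreal_lessI)
        qed (simp add: dens_def)
      qed
    qed
    then show ?thesis using 3 by (simp add: dens_def)
  qed
qed

lemma w_measurable [measurable]:
  assumes [measurable]: "f \<in> borel_measurable M" "g \<in> borel_measurable M"
  shows "(\<lambda>x. w (f x) (g x)) \<in> borel_measurable M" "(\<lambda>x. dens (f x) (g x)) \<in> borel_measurable M"
  unfolding w_def dens_def by measurable

definition wint :: "(2 \<Rightarrow> real^2 \<Rightarrow> real) \<Rightarrow> real^2 \<Rightarrow> real" where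
  "wint G x = indicator IQ x * w (G 1 x) (G 2 x)"

text \<open>Finite energy for a gradient in L2, in a form that gives access to real integrals; see
  \<open>energy_finite_imp_admissible\<close> and \<open>energy_admissible\<close>.\<close>

definition admissible :: "(2 \<Rightarrow> real^2 \<Rightarrow> real) \<Rightarrow> bool" where
  "admissible G \<longleftrightarrow> (AE x in lborel. x \<in> IQ \<longrightarrow> 1 + G 2 x > 0) \<and> integrable lborel (wint G)"

lemma wint_nonneg: "0 \<le> wint G x"
  by (simp add: wint_def w_nonneg)

lemma energy_admissible:
  assumes "admissible G"
  shows "energy h0 G = ennreal (\<integral>x. wint G x \<partial>lborel)"
proof -
  have "energy h0 G = (\<integral>\<^sup>+x. ennreal (wint G x) \<partial>lborel)"
    unfolding energy_dens
  proof (rule nn_integral_cong_AE)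
    have "AE x in lborel. x \<in> IQ \<longrightarrow> 1 + G 2 x > 0" using assms by (simp add: admissible_def)
    then show "AE x in lborel. dens (G 1 x) (G 2 x) * indicator IQ x = ennreal (wint G x)"
      by eventually_elim (auto simp: dens_def wint_def indicator_def)
  qed
  also have "\<dots> = ennreal (\<integral>x. wint G x \<partial>lborel)"
    using assms by (intro nn_integral_eq_integral) (auto simp: admissible_def wint_nonneg)
  finally show ?thesis .
qed

lemma energy_finite_imp_admissible:
  assumes G: "\<And>i. L2Q (G i)" and fin: "energy h0 G < \<infinity>"
  shows "admissible G"
proof -
  have [measurable]: "G i \<in> borel_measurable borel" for i using G[of i] by (auto simp: L2Q_def sqi_def)
  have "AE x in lborel. dens (G 1 x) (G 2 x) * indicator IQ x \<noteq> \<infinity>"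
    using fin unfolding energy_dens by (intro nn_integral_PInf_AE) auto
  then have ae: "AE x in lborel. x \<in> IQ \<longrightarrow> 1 + G 2 x > 0"
    by eventually_elim (auto simp: dens_def split: if_splits)
  have "(\<integral>\<^sup>+x. ennreal (wint G x) \<partial>lborel) = energy h0 G"
    unfolding energy_dens
  proof (rule nn_integral_cong_AE)
    show "AE x in lborel. ennreal (wint G x) = dens (G 1 x) (G 2 x) * indicator IQ x"
      using ae by eventually_elim (auto simp: dens_def wint_def indicator_def)
  qed
  then have "integrable lborel (wint G)"
    using fin by (intro integrableI_nonneg) (auto simp: wint_nonneg, simp add: wint_def[abs_def])
  then show ?thesis using ae by (simp add: admissible_def)
qed

text \<open>\<open>w_midpoint\<close> integrated. Its right-hand side is integrable and dominates
  the nonnegative density of the midpoint, so the midpoint has finite energy too.\<close>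

lemma midpoint_energy:
  assumes G: "\<And>i. L2Q (G i)" "\<And>i. L2Q (G' i)" and adm: "admissible G" "admissible G'"
  defines "M \<equiv> \<lambda>i x. (G i x + G' i x) / 2"
  shows "admissible M"
    "(\<integral>x. wint M x \<partial>lborel) \<le> (\<integral>x. wint G x \<partial>lborel) / 2 + (\<integral>x. wint G' x \<partial>lborel) / 2
      - ((nrm lborel (\<lambda>x. G 1 x - G' 1 x))\<^sup>2 + (nrm lborel (\<lambda>x. G 2 x - G' 2 x))\<^sup>2) / 8"
proof -
  have [measurable]: "G i \<in> borel_measurable borel" "G' i \<in> borel_measurable borel" for i
    using G[of i] by (auto simp: L2Q_def sqi_def)
  have wm [measurable]: "wint M \<in> borel_measurable borel"
    unfolding wint_def[abs_def] M_def by measurable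
  let ?R = "\<lambda>x. wint G x / 2 + wint G' x / 2 - ((G 1 x - G' 1 x)\<^sup>2 + (G 2 x - G' 2 x)\<^sup>2) / 8"
  have sq: "integrable lborel (\<lambda>x. (G i x - G' i x)\<^sup>2)" for i
    by (intro sqi_square sqi_diff L2Q_sqi G)
  have Ri: "integrable lborel ?R"
    using adm sq by (intro Bochner_Integration.integrable_diff Bochner_Integration.integrable_add integrable_divide_zero)
      (auto simp: admissible_def)
  have pos: "AE x in lborel. x \<in> IQ \<longrightarrow> 1 + G 2 x > 0" "AE x in lborel. x \<in> IQ \<longrightarrow> 1 + G' 2 x > 0"
    using adm by (auto simp: admissible_def)
  have le: "AE x in lborel. wint M x \<le> ?R x"
    using pos
  proof eventually_elim
    case (elim x)
    show ?case
    proof (cases "x \<in> IQ")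
      case True
      then show ?thesis using w_midpoint[of "G 2 x" "G' 2 x" "G 1 x" "G' 1 x"] elim
        by (simp add: wint_def M_def)
    next
      case False
      then show ?thesis using L2Q_zero[OF G(1) False] L2Q_zero[OF G(2) False] by (simp add: wint_def)
    qed
  qed
  have Mi: "integrable lborel (wint M)"
  proof (rule Bochner_Integration.integrable_bound[OF Ri])
    show "AE x in lborel. norm (wint M x) \<le> norm (?R x)"
      using le by eventually_elim (use wint_nonneg[of M] in \<open>auto simp: abs_of_nonneg intro: order_trans[OF _ abs_ge_self]\<close>)
  qed simp
  show "admissible M"
    unfolding admissible_def
  proof
    show "AE x in lborel. x \<in> IQ \<longrightarrow> 1 + M 2 x > 0"
      using pos by eventually_elim (auto simp: M_def field_simps)
  qed (rule Mi)
  have "(\<integral>x. wint M x \<partial>lborel) \<le> (\<integral>x. ?R x \<partial>lborel)"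
    by (rule integral_mono_AE[OF Mi Ri le])
  also have "\<dots> = (\<integral>x. wint G x \<partial>lborel) / 2 + (\<integral>x. wint G' x \<partial>lborel) / 2
      - ((nrm lborel (\<lambda>x. G 1 x - G' 1 x))\<^sup>2 + (nrm lborel (\<lambda>x. G 2 x - G' 2 x))\<^sup>2) / 8"
    using adm sq by (simp add: admissible_def nrm_square)
  finally show "(\<integral>x. wint M x \<partial>lborel) \<le> (\<integral>x. wint G x \<partial>lborel) / 2 + (\<integral>x. wint G' x \<partial>lborel) / 2
      - ((nrm lborel (\<lambda>x. G 1 x - G' 1 x))\<^sup>2 + (nrm lborel (\<lambda>x. G 2 x - G' 2 x))\<^sup>2) / 8" .
qed

subsection \<open>Existence and uniqueness\<close>

lemma zt2_L2Q: "zt2 s G \<Longrightarrow> L2Q s" "zt2 s G \<Longrightarrow> L2Q (G i)"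
  by (auto simp: zt2_def zt_L2Q)

lemma zt2_lincomb: "zt2 s G \<Longrightarrow> zt2 s' G' \<Longrightarrow> zt2 (\<lambda>x. s x + c * s' x) (\<lambda>i x. G i x + c * G' i x)"
  by (auto simp: zt2_def zt_lincomb)

lemma zt2_zero: "zt2 (\<lambda>x. 0) (\<lambda>i x. 0)"
  using zt_smooth[OF smooth_const[of 0]] by (simp add: zt2_def pd_const[abs_def])

lemma zt2_midpoint:
  assumes "zt2 s G" "zt2 s' G'"
  shows "zt2 (\<lambda>x. (s x + s' x) / 2) (\<lambda>i x. (G i x + G' i x) / 2)"
proof -
  have 1: "zt2 (\<lambda>x. s' x + (-1) * s x) (\<lambda>i x. G' i x + (-1) * G i x)"
    by (rule zt2_lincomb[OF assms(2,1)])
  have "s x + (1/2) * (s' x + (-1) * s x) = (s x + s' x) / 2" "G i x + (1/2) * (G' i x + (-1) * G i x) = (G i x + G' i x) / 2" for x i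
    by (simp_all add: field_simps)
  then show ?thesis using zt2_lincomb[OF assms(1) 1, of "1/2"] by (simp only:)
qed

text \<open>m may be any lower bound on the energies: with the infimum the inequality makes
  minimizing sequences Cauchy, with the attained minimum it gives uniqueness.\<close>

lemma strict_minimality:
  assumes z: "zt2 s G" "zt2 s' G'" and adm: "admissible G" "admissible G'"
    and low: "\<And>s G. zt2 s G \<Longrightarrow> admissible G \<Longrightarrow> m \<le> (\<integral>x. wint G x \<partial>lborel)"
  shows "(nrm lborel (\<lambda>x. G i x - G' i x))\<^sup>2 \<le> 4 * ((\<integral>x. wint G x \<partial>lborel) - m) + 4 * ((\<integral>x. wint G' x \<partial>lborel) - m)"
proof -
  note mid = midpoint_energy[OF zt2_L2Q(2)[OF z(1)] zt2_L2Q(2)[OF z(2)] adm]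
  have "m \<le> (\<integral>x. wint (\<lambda>i x. (G i x + G' i x) / 2) x \<partial>lborel)"
    by (rule low[OF zt2_midpoint[OF z] mid(1)])
  then have "(nrm lborel (\<lambda>x. G 1 x - G' 1 x))\<^sup>2 + (nrm lborel (\<lambda>x. G 2 x - G' 2 x))\<^sup>2
      \<le> 4 * ((\<integral>x. wint G x \<partial>lborel) - m) + 4 * ((\<integral>x. wint G' x \<partial>lborel) - m)"
    using mid(2) by argo
  note sum = this zero_le_power2[of "nrm lborel (\<lambda>x. G 1 x - G' 1 x)"] zero_le_power2[of "nrm lborel (\<lambda>x. G 2 x - G' 2 x)"]
  show ?thesis using exhaust_2[of i]
  proof
    assume i: "i = 1"
    show ?thesis unfolding i using sum by argo
  next
    assume i: "i = 2"
    show ?thesis unfolding i using sum by argo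
  qed
qed

lemma L2Q_complete:
  assumes f: "\<And>n. L2Q (f n)"
    and cauchy: "\<And>e. e > 0 \<Longrightarrow> \<exists>N. \<forall>m\<ge>N. \<forall>n\<ge>N. nrm lborel (\<lambda>x. f m x - f n x) < e"
  obtains g where "L2Q g" "(\<lambda>n. nrm lborel (\<lambda>x. f n x - g x)) \<longlonglongrightarrow> 0"
proof -
  obtain g where g: "sqi lborel g" "(\<lambda>n. nrm lborel (\<lambda>x. f n x - g x)) \<longlonglongrightarrow> 0"
    by (rule L2_complete[OF L2Q_sqi[OF f] cauchy])
  have [measurable]: "g \<in> borel_measurable borel" "f n \<in> borel_measurable borel" for n
    using g(1) f[of n] by (auto simp: L2Q_def sqi_def)
  have b: "sqi lborel (cut g)"
    by (rule sqi_mono(1)[OF g(1)]) (auto simp: indicator_def)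
  have "nrm lborel (\<lambda>x. f n x - cut g x) \<le> nrm lborel (\<lambda>x. f n x - g x)" for n
    by (rule sqi_mono(2)[OF sqi_diff[OF L2Q_sqi[OF f] g(1)]])
      (use L2Q_zero[OF f] in \<open>auto simp: indicator_def\<close>)
  then have "(\<lambda>n. nrm lborel (\<lambda>x. f n x - cut g x)) \<longlonglongrightarrow> 0"
    by (intro Lim_null_comparison[OF _ g(2)]) simp
  moreover have "L2Q (cut g)" using b by (simp add: L2Q_def)
  ultimately show ?thesis using that by blast
qed

text \<open>Two successive subsequences, one for each component, give a.e. convergence of the
  gradients and hence of the densities; Fatou's lemma does the rest.\<close>

lemma energy_lsc:
  assumes G: "\<And>n i. L2Q (G n i)" "\<And>i. L2Q (G' i)" and lim: "\<And>i. (\<lambda>n. nrm lborel (\<lambda>x. G n i x - G' i x)) \<longlonglongrightarrow> 0"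
    and e: "(\<lambda>n. energy h0 (G n)) \<longlonglongrightarrow> m"
  shows "energy h0 G' \<le> m"
proof -
  have [measurable]: "G n i \<in> borel_measurable borel" for n i
    using G(1)[of n i] by (auto simp: L2Q_def sqi_def)
  obtain r where r: "strict_mono r" "AE x in lborel. (\<lambda>n. G (r n) 1 x) \<longlonglongrightarrow> G' 1 x"
    by (rule L2_AE_subseq[OF L2Q_sqi[OF G(1)] L2Q_sqi[OF G(2)] lim])
  have "(\<lambda>n. nrm lborel (\<lambda>x. G (r n) 2 x - G' 2 x)) \<longlonglongrightarrow> 0"
    using LIMSEQ_subseq_LIMSEQ[OF lim r(1)] by (simp add: o_def)
  then obtain q where q: "strict_mono q" "AE x in lborel. (\<lambda>n. G (r (q n)) 2 x) \<longlonglongrightarrow> G' 2 x"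
    using L2_AE_subseq[of lborel "\<lambda>n. G (r n) 2" "G' 2", OF L2Q_sqi[OF G(1)] L2Q_sqi[OF G(2)]] by blast
  have "energy h0 G' = (\<integral>\<^sup>+x. liminf (\<lambda>n. dens (G (r (q n)) 1 x) (G (r (q n)) 2 x) * indicator IQ x) \<partial>lborel)"
    unfolding energy_dens
  proof (rule nn_integral_cong_AE)
    show "AE x in lborel. dens (G' 1 x) (G' 2 x) * indicator IQ x =
        liminf (\<lambda>n. dens (G (r (q n)) 1 x) (G (r (q n)) 2 x) * indicator IQ x)"
      using r(2) q(2)
    proof eventually_elim
      case (elim x)
      have "(\<lambda>n. G (r (q n)) 1 x) \<longlonglongrightarrow> G' 1 x"
        using LIMSEQ_subseq_LIMSEQ[OF elim(1) q(1)] by (simp add: o_def)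
      from dens_tendsto[OF this elim(2)]
      have "(\<lambda>n. dens (G (r (q n)) 1 x) (G (r (q n)) 2 x) * indicator IQ x) \<longlonglongrightarrow> dens (G' 1 x) (G' 2 x) * indicator IQ x"
        by (cases "x \<in> IQ") auto
      then show ?case by (intro lim_imp_Liminf[symmetric]) auto
    qed
  qed
  also have "\<dots> \<le> liminf (\<lambda>n. energy h0 (G (r (q n))))"
    unfolding energy_dens by (intro nn_integral_liminf) measurable
  also have "\<dots> = m"
    using LIMSEQ_subseq_LIMSEQ[OF LIMSEQ_subseq_LIMSEQ[OF e r(1)] q(1)]
    by (intro lim_imp_Liminf) (auto simp: o_def)
  finally show ?thesis .
qed

lemma minimizing_pair_exists:
  obtains s G where "zt2 s G" "admissible G"
    "\<And>s' G'. zt2 s' G' \<Longrightarrow> admissible G' \<Longrightarrow> (\<integral>x. wint G x \<partial>lborel) \<le> (\<integral>x. wint G' x \<partial>lborel)"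
proof -
  define E where "E = {\<integral>x. wint G x \<partial>lborel |s G. zt2 s G \<and> admissible G}"
  have ne: "E \<noteq> {}"
  proof -
    have "integrable lborel (wint (\<lambda>i x. 0))"
      using integrable_cut[of "\<lambda>_. w 0 0"] by (simp add: wint_def[abs_def])
    then have "admissible (\<lambda>i x. 0)" by (simp add: admissible_def)
    then show ?thesis using zt2_zero unfolding E_def by blast
  qed
  have bdd: "bdd_below E"
    by (rule bdd_belowI[of _ 0]) (auto simp: E_def intro!: integral_nonneg_AE wint_nonneg)
  define m where "m = Inf E"
  have low: "m \<le> (\<integral>x. wint G x \<partial>lborel)" if "zt2 s G" "admissible G" for s G
    unfolding m_def by (rule cInf_lower[OF _ bdd]) (use that in \<open>auto simp: E_def\<close>)
  have "\<exists>s G. zt2 s G \<and> admissible G \<and> (\<integral>x. wint G x \<partial>lborel) < m + inverse (real (Suc n))" for n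
  proof -
    have "\<exists>e\<in>E. e < m + inverse (real (Suc n))"
      by (rule cInf_lessD[OF ne]) (simp add: m_def)
    then show ?thesis by (auto simp: E_def)
  qed
  then obtain s G where sG: "\<And>n. zt2 (s n) (G n)" "\<And>n. admissible (G n)"
    "\<And>n. (\<integral>x. wint (G n) x \<partial>lborel) < m + inverse (real (Suc n))"
    by metis
  have cauchy: "\<exists>N. \<forall>p\<ge>N. \<forall>q\<ge>N. nrm lborel (\<lambda>x. G p i x - G q i x) < e" if "e > 0" for e i
  proof -
    obtain N where N: "inverse (real (Suc N)) < e\<^sup>2 / 8"
      using reals_Archimedean[of "e\<^sup>2 / 8"] \<open>e > 0\<close> by auto
    have "nrm lborel (\<lambda>x. G p i x - G q i x) < e" if "p \<ge> N" "q \<ge> N" for p q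
    proof -
      have "inverse (real (Suc p)) \<le> inverse (real (Suc N))" "inverse (real (Suc q)) \<le> inverse (real (Suc N))"
        using that by (auto intro!: le_imp_inverse_le)
      moreover have "(nrm lborel (\<lambda>x. G p i x - G q i x))\<^sup>2 \<le>
          4 * ((\<integral>x. wint (G p) x \<partial>lborel) - m) + 4 * ((\<integral>x. wint (G q) x \<partial>lborel) - m)"
        by (rule strict_minimality[OF sG(1) sG(1) sG(2) sG(2)]) (rule low)
      ultimately have "(nrm lborel (\<lambda>x. G p i x - G q i x))\<^sup>2 < e\<^sup>2"
        using sG(3)[of p] sG(3)[of q] N by argo
      then show ?thesis using \<open>e > 0\<close> by (simp add: power2_less_imp_less)
    qed
    then show ?thesis by blast
  qed
  have "\<exists>G'. L2Q G' \<and> (\<lambda>n. nrm lborel (\<lambda>x. G n i x - G' x)) \<longlonglongrightarrow> 0" for i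
  proof -
    obtain g where "L2Q g" "(\<lambda>n. nrm lborel (\<lambda>x. G n i x - g x)) \<longlonglongrightarrow> 0"
      by (rule L2Q_complete[OF zt2_L2Q(2)[OF sG(1)] cauchy])
    then show ?thesis by blast
  qed
  then have "\<forall>i. \<exists>G'. L2Q G' \<and> (\<lambda>n. nrm lborel (\<lambda>x. G n i x - G' x)) \<longlonglongrightarrow> 0" by blast
  from choice[OF this] obtain G' where G': "\<And>i. L2Q (G' i)" "\<And>i. (\<lambda>n. nrm lborel (\<lambda>x. G n i x - G' i x)) \<longlonglongrightarrow> 0"
    by blast
  have "\<exists>N. \<forall>p\<ge>N. \<forall>q\<ge>N. nrm lborel (\<lambda>x. s p x - s q x) < e" if "e > 0" for e
  proof -
    obtain N where N: "\<And>p q. p \<ge> N \<Longrightarrow> q \<ge> N \<Longrightarrow> nrm lborel (\<lambda>x. G p 1 x - G q 1 x) < e / 4"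
      using cauchy[of "e / 4" 1] \<open>e > 0\<close> by auto
    have "nrm lborel (\<lambda>x. s p x - s q x) < e" if "p \<ge> N" "q \<ge> N" for p q
    proof -
      \<comment> \<open>The Poincare inequality transfers the Cauchy property from the first
        derivatives to the functions themselves.\<close>
      have "zt (-1) (\<lambda>x. s p x + (-1) * s q x) (\<lambda>i x. G p i x + (-1) * G q i x)"
        using zt2_lincomb[OF sG(1) sG(1), of p "-1" q] by (simp add: zt2_def)
      from Poincare[OF this] N[OF that] show ?thesis by simp
    qed
    then show ?thesis by blast
  qed
  then obtain s' where s': "L2Q s'" "(\<lambda>n. nrm lborel (\<lambda>x. s n x - s' x)) \<longlonglongrightarrow> 0"
    by (rule L2Q_complete[OF zt2_L2Q(1)[OF sG(1)]])
  have z: "zt2 s' G'"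
    unfolding zt2_def using sG(1) by (auto simp: zt2_def intro!: zt_closed[OF _ s'(1) G'(1) s'(2) G'(2)])
  have "(\<lambda>n. \<integral>x. wint (G n) x \<partial>lborel) \<longlonglongrightarrow> m"
  proof (rule real_tendsto_sandwich[where f="\<lambda>_. m"])
    show "(\<lambda>n. m + inverse (real (Suc n))) \<longlonglongrightarrow> m"
      using tendsto_add[OF tendsto_const LIMSEQ_inverse_real_of_nat, of m] by simp
  qed (use low[OF sG(1,2)] less_imp_le[OF sG(3)] in \<open>auto intro!: always_eventually\<close>)
  then have "(\<lambda>n. energy h0 (G n)) \<longlonglongrightarrow> ennreal m"
    unfolding energy_admissible[OF sG(2)] by (rule tendsto_ennrealI)
  then have le: "energy h0 G' \<le> ennreal m"
    by (rule energy_lsc[OF zt2_L2Q(2)[OF sG(1)] G'(1) G'(2)])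
  then have adm: "admissible G'"
    by (intro energy_finite_imp_admissible G') (auto intro: le_less_trans)
  have m0: "0 \<le> m"
    unfolding m_def by (rule cInf_greatest[OF ne]) (auto simp: E_def intro!: integral_nonneg_AE wint_nonneg)
  have "(\<integral>x. wint G' x \<partial>lborel) \<le> m"
    using le m0 unfolding energy_admissible[OF adm] by (simp add: ennreal_le_iff)
  then show ?thesis
    using that[OF z adm] low by (meson order_trans)
qed

lemma minimizer_pair:
  assumes "minimizer h0 \<sigma>"
  obtains s G where "srep \<sigma> s G" "zt2 s G" "admissible G"
    "\<And>s' G'. zt2 s' G' \<Longrightarrow> admissible G' \<Longrightarrow> (\<integral>x. wint G x \<partial>lborel) \<le> (\<integral>x. wint G' x \<partial>lborel)"
proof -
  have \<sigma>: "\<sigma> \<in> A_s h0" and min: "\<And>\<tau>. \<tau> \<in> A_s h0 \<Longrightarrow> I_s h0 \<sigma> \<le> I_s h0 \<tau>"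
    using assms by (auto simp: minimizer_def is_arg_min_def not_less)
  obtain s G where sG: "srep \<sigma> s G" "zt2 s G" "I_s h0 \<sigma> = energy h0 G" "energy h0 G < \<infinity>"
    by (rule A_s_zt2[OF \<sigma>])
  have adm: "admissible G" by (rule energy_finite_imp_admissible[OF zt2_L2Q(2)[OF sG(2)] sG(4)])
  have "(\<integral>x. wint G x \<partial>lborel) \<le> (\<integral>x. wint G' x \<partial>lborel)" if "zt2 s' G'" "admissible G'" for s' G'
  proof -
    have e: "energy h0 G' = ennreal (\<integral>x. wint G' x \<partial>lborel)" by (rule energy_admissible[OF that(2)])
    have "energy h0 G \<le> energy h0 G'"
      using min[OF zt2_A_s(1)[OF that(1)]] zt2_A_s(2)[OF that(1)] sG(3) e by simp
    then show ?thesis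
      unfolding e energy_admissible[OF adm]
      by (subst (asm) ennreal_le_iff) (auto intro!: integral_nonneg_AE wint_nonneg)
  qed
  then show ?thesis using that sG adm by blast
qed

lemma minimizer_exists: "\<exists>\<sigma>. minimizer h0 \<sigma>"
proof -
  obtain s G where sG: "zt2 s G" "admissible G"
    "\<And>s' G'. zt2 s' G' \<Longrightarrow> admissible G' \<Longrightarrow> (\<integral>x. wint G x \<partial>lborel) \<le> (\<integral>x. wint G' x \<partial>lborel)"
    by (rule minimizing_pair_exists) blast
  have fin: "energy h0 G < \<infinity>" unfolding energy_admissible[OF sG(2)] by simp
  have "I_s h0 s \<le> I_s h0 \<tau>" if \<tau>: "\<tau> \<in> A_s h0" for \<tau>
  proof -
    obtain s' G' where s': "zt2 s' G'" "I_s h0 \<tau> = energy h0 G'" "energy h0 G' < \<infinity>"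
      by (rule A_s_zt2[OF \<tau>])
    have adm: "admissible G'" by (rule energy_finite_imp_admissible[OF zt2_L2Q(2)[OF s'(1)] s'(3)])
    show ?thesis
      unfolding zt2_A_s(2)[OF sG(1) fin] s'(2) energy_admissible[OF sG(2)] energy_admissible[OF adm]
      by (rule ennreal_leI[OF sG(3)[OF s'(1) adm]])
  qed
  then have "minimizer h0 s"
    using zt2_A_s(1)[OF sG(1) fin] by (auto simp: minimizer_def is_arg_min_def not_less)
  then show ?thesis by blast
qed

lemma minimizer_unique:
  assumes "minimizer h0 \<sigma>" "minimizer h0 \<tau>"
  shows "AE x in lebesgue_on Q. \<sigma> x = \<tau> x"
proof -
  obtain s G where s: "srep \<sigma> s G" "zt2 s G" "admissible G"
    "\<And>s' G'. zt2 s' G' \<Longrightarrow> admissible G' \<Longrightarrow> (\<integral>x. wint G x \<partial>lborel) \<le> (\<integral>x. wint G' x \<partial>lborel)"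
    by (rule minimizer_pair[OF assms(1)]) blast
  obtain s' G' where s': "srep \<tau> s' G'" "zt2 s' G'" "admissible G'"
    "\<And>s'' G''. zt2 s'' G'' \<Longrightarrow> admissible G'' \<Longrightarrow> (\<integral>x. wint G' x \<partial>lborel) \<le> (\<integral>x. wint G'' x \<partial>lborel)"
    by (rule minimizer_pair[OF assms(2)]) blast
  have eq: "(\<integral>x. wint G x \<partial>lborel) = (\<integral>x. wint G' x \<partial>lborel)"
    using s(4)[OF s'(2,3)] s'(4)[OF s(2,3)] by simp
  \<comment> \<open>Both energies equal the minimum, so the right-hand side of
    \<open>strict_minimality\<close> is 0. Equality of the derivatives in direction 1 is what the
    Poincare inequality asks for.\<close>
  have "(nrm lborel (\<lambda>x. G 1 x - G' 1 x))\<^sup>2 \<le> 0"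
    using strict_minimality[OF s(2) s'(2) s(3) s'(3) s(4), where i=1] eq by simp
  then have g0: "nrm lborel (\<lambda>x. G 1 x - G' 1 x) = 0" by simp
  have "zt (-1) (\<lambda>x. s x + (-1) * s' x) (\<lambda>i x. G i x + (-1) * G' i x)"
    using zt2_lincomb[OF s(2) s'(2), of "-1"] by (simp add: zt2_def)
  from Poincare[OF this] g0 have "nrm lborel (\<lambda>x. s x - s' x) = 0"
    using nrm_nonneg[of lborel "\<lambda>x. s x - s' x"] by simp
  then have "AE x in lborel. s x - s' x = 0"
    by (rule nrm_eq_0_AE[rotated]) (intro sqi_diff L2Q_sqi zt2_L2Q(1)[OF s(2)] zt2_L2Q(1)[OF s'(2)])
  moreover have "AE x in lborel. x \<in> IQ \<longrightarrow> \<sigma> x = s x" "AE x in lborel. x \<in> IQ \<longrightarrow> \<tau> x = s' x"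
    using s(1) s'(1) by (auto simp: srep_def)
  ultimately show ?thesis
    unfolding AE_lebesgue_on_Q by eventually_elim auto
qed

end

subsection \<open>Difference quotients and weak derivatives\<close>

text \<open>Norm duality without density of test functions: the pairing is represented by some g of
  norm at most C, and the fundamental lemma identifies g with f on U.\<close>

lemma nrm_le_by_test:
  fixes f :: "real^'n::finite \<Rightarrow> real"
  assumes U: "open U" and f: "sqi lborel f" and C: "0 \<le> C"
    and bound: "\<And>\<psi>. \<psi> \<in> test_functions U \<Longrightarrow> \<bar>\<integral>x. f x * \<psi> x \<partial>lborel\<bar> \<le> C * nrm lborel \<psi>"
  shows "nrm lborel (\<lambda>x. indicator U x * f x) \<le> C"
proof -
  have int: "integrable lborel (\<lambda>x. u x * \<psi> x)" if "sqi lborel u" "\<psi> \<in> test_functions U" for u \<psi> :: "real^'n \<Rightarrow> real"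
    by (intro sqi_mult_integrable that(1) sqi_test[OF that(2)])
  obtain g where g: "sqi lborel g" "\<And>\<psi>. \<psi> \<in> test_functions U \<Longrightarrow> (\<integral>x. f x * \<psi> x \<partial>lborel) = (\<integral>x. g x * \<psi> x \<partial>lborel)"
    "nrm lborel g \<le> \<bar>C\<bar>"
  proof (rule Riesz_L2[where T="test_functions U" and M=lborel and l="\<lambda>\<psi>. \<integral>x. f x * \<psi> x \<partial>lborel" and C=C])
    fix \<phi> \<psi> :: "real^'n \<Rightarrow> real" assume t: "\<phi> \<in> test_functions U" "\<psi> \<in> test_functions U"
    show "(\<integral>x. f x * (\<phi> x + \<psi> x) \<partial>lborel) = (\<integral>x. f x * \<phi> x \<partial>lborel) + (\<integral>x. f x * \<psi> x \<partial>lborel)"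
      using int[OF f t(1)] int[OF f t(2)] by (simp add: distrib_left)
  next
    fix c and \<phi> :: "real^'n \<Rightarrow> real" assume t: "\<phi> \<in> test_functions U"
    show "(\<integral>x. f x * (c * \<phi> x) \<partial>lborel) = c * (\<integral>x. f x * \<phi> x \<partial>lborel)"
      using int[OF f t] by (simp add: mult.left_commute)
  qed (auto intro: sqi_test test_zero test_add test_cmult bound)
  have "AE x in lborel. x \<in> U \<longrightarrow> f x - g x = 0"
  proof (rule AE_open_if_AE_box[OF U])
    fix a b assume ab: "cbox a b \<subseteq> U"
    have d: "sqi lborel (\<lambda>x. f x - g x)" by (intro sqi_diff f g)
    have "AE x in lborel. x \<in> box a b \<longrightarrow> (f x - g x) * indicator (cbox a b) x = 0"
    proof (rule fundamental_lemma_box)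
      show "integrable lborel (\<lambda>x. (f x - g x) * indicator (cbox a b) x)"
        by (intro sqi_mult_integrable d indicator_compact_sqi compact_cbox)
      fix \<phi> assume t: "\<phi> \<in> test_functions (cbox a b)"
      have t': "\<phi> \<in> test_functions U" using t test_mono[OF ab] by blast
      have "(f x - g x) * indicator (cbox a b) x * \<phi> x = f x * \<phi> x - g x * \<phi> x" for x
        using test_zero_outside[OF t, of x] by (cases "x \<in> cbox a b") (auto simp: left_diff_distrib)
      then show "(\<integral>x. (f x - g x) * indicator (cbox a b) x * \<phi> x \<partial>lborel) = 0"
        using int[OF f t'] int[OF g(1) t'] g(2)[OF t'] by simp
    qed simp
    then show "AE x in lborel. x \<in> box a b \<longrightarrow> f x - g x = 0"
      by eventually_elim (auto dest: subsetD[OF box_subset_cbox])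
  qed
  then have "AE x in lborel. \<bar>indicator U x * f x\<bar> \<le> \<bar>g x\<bar>"
    by eventually_elim (auto simp: indicator_def)
  moreover have "(\<lambda>x. indicator U x * f x) \<in> borel_measurable lborel"
    using sqi_measurable[OF f] U by auto
  ultimately show ?thesis using sqi_mono(2)[OF g(1)] g(3) C by force
qed

lemma test_shift:
  assumes "\<psi> \<in> test_functions U" "\<And>x. x \<in> U \<Longrightarrow> x + v \<in> V"
  shows "(\<lambda>x. \<psi> (x - v)) \<in> test_functions V"
proof -
  obtain K where K: "smooth \<psi>" "compact K" "K \<subseteq> U" "\<And>x. x \<notin> K \<Longrightarrow> \<psi> x = 0"
    by (rule test_functionsE[OF assms(1)]) blast
  show ?thesis
  proof (rule test_functionsI[where K="(\<lambda>x. x + v) ` K"])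
    show "smooth (\<lambda>x. \<psi> (x - v))" using smooth_shift[OF K(1), of "- v"] by simp
    show "compact ((\<lambda>x. x + v) ` K)" by (intro compact_continuous_image continuous_intros K)
    show "(\<lambda>x. x + v) ` K \<subseteq> V" using K(3) assms(2) by auto
    show "\<psi> (x - v) = 0" if "x \<notin> (\<lambda>x. x + v) ` K" for x
      by (rule K(4)) (use that in \<open>force simp: image_iff\<close>)
  qed
qed

text \<open>The pairing of f with the translate of \<psi> by r is differentiable in r because \<psi>
  is smooth; the bound on this derivative gives the estimate by the mean value inequality. No
  derivative of f is taken.\<close>

lemma shift_pairing_bound:
  fixes f :: "real^'n::finite \<Rightarrow> real"
  assumes f: "sqi lborel f" and t: "\<psi> \<in> test_functions U" and h: "0 \<le> h"
    and bound: "\<And>r. 0 \<le> r \<Longrightarrow> r \<le> h \<Longrightarrow> \<bar>\<integral>x. f x * pd i \<psi> (x - r *\<^sub>R axis i 1) \<partial>lborel\<bar> \<le> B"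
  shows "\<bar>\<integral>x. f x * (\<psi> (x - h *\<^sub>R axis i 1) - \<psi> x) \<partial>lborel\<bar> \<le> B * h"
proof -
  define F where "F r = (\<integral>x. f x * \<psi> (x - r *\<^sub>R axis i 1) \<partial>lborel)" for r
  have ts: "(\<lambda>x. \<psi> (x - r *\<^sub>R axis i 1)) \<in> test_functions UNIV" for r
    by (rule test_shift[OF t]) simp
  have int: "integrable lborel (\<lambda>x. f x * \<psi> (x - r *\<^sub>R axis i 1))" for r
    by (intro sqi_mult_integrable f sqi_test[OF ts])
  have pds: "pd i (\<lambda>x. \<psi> (x - r *\<^sub>R axis i 1)) x = pd i \<psi> (x - r *\<^sub>R axis i 1)" for r x
    using pd_shift[OF test_smooth[OF t], of i "- (r *\<^sub>R axis i 1)" x] by simp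
  have D: "(F has_real_derivative - (\<integral>x. f x * pd i \<psi> (x - r *\<^sub>R axis i 1) \<partial>lborel)) (at r)" for r
    unfolding DERIV_def tendsto_at_iff_sequentially o_def
  proof (intro allI impI)
    fix X :: "nat \<Rightarrow> real" assume X: "\<forall>n. X n \<in> UNIV - {0}" "X \<longlonglongrightarrow> 0"
    have "eventually (\<lambda>n. \<bar>X n\<bar> < 1) sequentially"
      using order_tendstoD(2)[OF tendsto_rabs[OF X(2)], of 1] by simp
    then obtain N where N: "\<And>n. n \<ge> N \<Longrightarrow> \<bar>X n\<bar> < 1"
      unfolding eventually_sequentially by blast
    \<comment> \<open>The sign turns an increase of r into a difference quotient of the translated
      \<psi>, and dropping the first N terms gives |k n| <= 1.\<close>
    define k where "k n = - X (n + N)" for n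
    have k: "k \<longlonglongrightarrow> 0" "\<And>n. k n \<noteq> 0" "\<And>n. \<bar>k n\<bar> \<le> 1"
      unfolding k_def using tendsto_minus[OF LIMSEQ_ignore_initial_segment[OF X(2), of N]] X(1) N
      by (auto intro: less_imp_le)
    have "(\<lambda>n. \<integral>x. f x * ((\<psi> (x + k n *\<^sub>R axis i 1 - r *\<^sub>R axis i 1) - \<psi> (x - r *\<^sub>R axis i 1)) / k n) \<partial>lborel)
        \<longlonglongrightarrow> (\<integral>x. f x * pd i \<psi> (x - r *\<^sub>R axis i 1) \<partial>lborel)"
      using integral_difference_quotient_tendsto[OF ts[of r] f k, where i=i] by (simp add: pds)
    moreover have "(\<integral>x. f x * ((\<psi> (x + k n *\<^sub>R axis i 1 - r *\<^sub>R axis i 1) - \<psi> (x - r *\<^sub>R axis i 1)) / k n) \<partial>lborel)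
        = - ((F (r + X (n + N)) - F r) / X (n + N))" for n
    proof -
      have e: "x + k n *\<^sub>R axis i 1 - r *\<^sub>R axis i 1 = x - (r + X (n + N)) *\<^sub>R axis i 1" for x :: "real^'n"
        by (simp add: k_def algebra_simps)
      have "(\<integral>x. f x * ((\<psi> (x + k n *\<^sub>R axis i 1 - r *\<^sub>R axis i 1) - \<psi> (x - r *\<^sub>R axis i 1)) / k n) \<partial>lborel)
        = (\<integral>x. (f x * \<psi> (x - (r + X (n + N)) *\<^sub>R axis i 1) - f x * \<psi> (x - r *\<^sub>R axis i 1)) / k n \<partial>lborel)"
        unfolding e by (simp add: right_diff_distrib)
      also have "\<dots> = (F (r + X (n + N)) - F r) / k n"
        using int by (simp add: F_def)
      finally show ?thesis by (simp add: k_def)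
    qed
    ultimately have "(\<lambda>n. - ((F (r + X (n + N)) - F r) / X (n + N))) \<longlonglongrightarrow> (\<integral>x. f x * pd i \<psi> (x - r *\<^sub>R axis i 1) \<partial>lborel)"
      by simp
    from tendsto_minus[OF this] have "(\<lambda>n. (F (r + X (n + N)) - F r) / X (n + N)) \<longlonglongrightarrow> - (\<integral>x. f x * pd i \<psi> (x - r *\<^sub>R axis i 1) \<partial>lborel)"
      by simp
    then show "(\<lambda>n. (F (r + X n) - F r) / X n) \<longlonglongrightarrow> - (\<integral>x. f x * pd i \<psi> (x - r *\<^sub>R axis i 1) \<partial>lborel)"
      by (rule LIMSEQ_offset)
  qed
  have "norm (F h - F 0) \<le> B * norm (h - 0)"
  proof (rule field_differentiable_bound[where S="{0..h}"])
    show "(F has_field_derivative - (\<integral>x. f x * pd i \<psi> (x - r *\<^sub>R axis i 1) \<partial>lborel)) (at r within {0..h})" for r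
      by (rule has_field_derivative_at_within[OF D])
  qed (use bound h in auto)
  moreover have "F h - F 0 = (\<integral>x. f x * (\<psi> (x - h *\<^sub>R axis i 1) - \<psi> x) \<partial>lborel)"
    using int[of h] int[of 0] by (simp add: F_def right_diff_distrib)
  ultimately show ?thesis using h by simp
qed

lemma integral_shift_test:
  fixes f :: "real^'n::finite \<Rightarrow> real"
  assumes f: "sqi lborel f" and t: "\<psi> \<in> test_functions U"
  shows "(\<integral>x. (f (x + v) - f x) * \<psi> x \<partial>lborel) = (\<integral>x. f x * (\<psi> (x - v) - \<psi> x) \<partial>lborel)"
proof -
  have ts: "(\<lambda>x. \<psi> (x - v)) \<in> test_functions UNIV" by (rule test_shift[OF t]) simp
  have i: "integrable lborel (\<lambda>x. f (x + v) * \<psi> x)" "integrable lborel (\<lambda>x. f x * \<psi> x)"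
    "integrable lborel (\<lambda>x. f x * \<psi> (x - v))"
    by (intro sqi_mult_integrable sqi_shift f sqi_test[OF t] sqi_test[OF ts])+
  have m: "(\<lambda>x. f x * \<psi> (x - v)) \<in> borel_measurable borel"
    using sqi_measurable[OF f] smooth_borel[OF test_smooth[OF ts]] by simp
  show ?thesis
    using i integral_lborel_shift[OF m, of v] by (simp add: left_diff_distrib right_diff_distrib)
qed

text \<open>A weak derivative bounded on all translates of U by r, 0 <= r <= h, bounds the
  difference on U. The bound is expressed through pairings with translated test functions, so f
  comes without an explicit weak derivative; this allows f to be P, whose derivative is known only
  through the Euler-Lagrange equation.\<close>

lemma translation_estimate:
  fixes f :: "real^'n::finite \<Rightarrow> real"
  assumes U: "open U" and f: "sqi lborel f" and h: "0 \<le> h" and C: "0 \<le> C"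
    and bound: "\<And>\<psi> r. \<psi> \<in> test_functions U \<Longrightarrow> 0 \<le> r \<Longrightarrow> r \<le> h \<Longrightarrow>
      \<bar>\<integral>x. f x * pd i \<psi> (x - r *\<^sub>R axis i 1) \<partial>lborel\<bar> \<le> C * nrm lborel \<psi>"
  shows "nrm lborel (\<lambda>x. indicator U x * (f (x + h *\<^sub>R axis i 1) - f x)) \<le> C * h"
proof (rule nrm_le_by_test[OF U])
  show "sqi lborel (\<lambda>x. f (x + h *\<^sub>R axis i 1) - f x)"
    by (intro sqi_diff sqi_shift f)
  fix \<psi> assume t: "\<psi> \<in> test_functions U"
  show "\<bar>\<integral>x. (f (x + h *\<^sub>R axis i 1) - f x) * \<psi> x \<partial>lborel\<bar> \<le> C * h * nrm lborel \<psi>"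
    using shift_pairing_bound[OF f t h bound[OF t]]
    unfolding integral_shift_test[OF f t] by (simp add: ac_simps)
qed (use h C in simp)

text \<open>A converse of \<open>translation_estimate\<close>. A backward quotient of \<phi>
  corresponds to a forward one of f, which is why the steps are -k n.\<close>

lemma weak_bound_of_difference_quotients:
  fixes f :: "real^'n::finite \<Rightarrow> real"
  assumes f: "sqi lborel f" and t: "\<phi> \<in> test_functions U" and U: "open U" and h0: "0 < h0"
    and bound: "\<And>h. 0 < h \<Longrightarrow> h < h0 \<Longrightarrow> nrm lborel (\<lambda>x. indicator U x * (f (x + h *\<^sub>R axis i 1) - f x)) \<le> C * h"
  shows "\<bar>\<integral>x. f x * pd i \<phi> x \<partial>lborel\<bar> \<le> C * nrm lborel \<phi>"
proof -
  define k where "k n = min (h0 / 2) 1 * inverse (real (Suc n))" for n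
  have k: "0 < k n" "k n < h0" "k n \<le> 1" for n
  proof -
    have le: "inverse (real (Suc n)) \<le> 1" by (simp add: field_simps)
    show "0 < k n" using h0 by (simp add: k_def)
    have "k n \<le> min (h0 / 2) 1 * 1"
      unfolding k_def by (intro mult_left_mono le) (use h0 in simp)
    then show "k n < h0" "k n \<le> 1" using h0 by auto
  qed
  have "k \<longlonglongrightarrow> min (h0 / 2) 1 * 0"
    unfolding k_def by (intro tendsto_intros LIMSEQ_inverse_real_of_nat)
  then have lim: "(\<lambda>n. - k n) \<longlonglongrightarrow> 0" using tendsto_minus by fastforce
  have "(\<lambda>n. \<integral>x. f x * ((\<phi> (x + (- k n) *\<^sub>R axis i 1) - \<phi> x) / (- k n)) \<partial>lborel) \<longlonglongrightarrow> (\<integral>x. f x * pd i \<phi> x \<partial>lborel)"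
  proof (rule integral_difference_quotient_tendsto[OF t f lim])
    show "- k n \<noteq> 0" "\<bar>- k n\<bar> \<le> 1" for n using k(1,3)[of n] by auto
  qed
  from tendsto_rabs[OF this]
  show ?thesis
  proof (rule LIMSEQ_le_const2, intro exI[of _ 0] allI impI)
    fix n
    let ?d = "\<lambda>x. f (x + k n *\<^sub>R axis i 1) - f x"
    have "(\<integral>x. f x * ((\<phi> (x + (- k n) *\<^sub>R axis i 1) - \<phi> x) / (- k n)) \<partial>lborel) =
        - (\<integral>x. f x * (\<phi> (x - k n *\<^sub>R axis i 1) - \<phi> x) \<partial>lborel) / k n"
      by simp
    also have "\<dots> = - (\<integral>x. ?d x * \<phi> x \<partial>lborel) / k n"
      unfolding integral_shift_test[OF f t] ..
    also have "(\<integral>x. ?d x * \<phi> x \<partial>lborel) = (\<integral>x. (indicator U x * ?d x) * \<phi> x \<partial>lborel)"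
    proof (intro Bochner_Integration.integral_cong refl)
      show "?d x * \<phi> x = (indicator U x * ?d x) * \<phi> x" for x
        using test_zero_outside[OF t, of x] by (cases "x \<in> U") auto
    qed
    finally have e0: "(\<integral>x. f x * ((\<phi> (x + (- k n) *\<^sub>R axis i 1) - \<phi> x) / (- k n)) \<partial>lborel) =
        - (\<integral>x. (indicator U x * ?d x) * \<phi> x \<partial>lborel) / k n" .
    have e: "\<bar>\<integral>x. f x * ((\<phi> (x + (- k n) *\<^sub>R axis i 1) - \<phi> x) / (- k n)) \<partial>lborel\<bar> =
        \<bar>\<integral>x. (indicator U x * ?d x) * \<phi> x \<partial>lborel\<bar> / k n"
      unfolding e0 by (simp only: abs_divide abs_minus_cancel abs_of_pos[OF k(1)])
    have s: "sqi lborel (\<lambda>x. indicator U x * ?d x)"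
    proof (rule sqi_bounded_mult(1)[where B=1])
      show "indicator U \<in> borel_measurable lborel" using U by (intro borel_measurable_indicator) auto
    qed (auto intro!: sqi_diff sqi_shift f simp: indicator_def)
    have "\<bar>\<integral>x. (indicator U x * ?d x) * \<phi> x \<partial>lborel\<bar> \<le> nrm lborel (\<lambda>x. indicator U x * ?d x) * nrm lborel \<phi>"
      by (rule Cauchy_Schwarz_L2[OF s sqi_test[OF t]])
    also have "\<dots> \<le> C * k n * nrm lborel \<phi>"
      by (intro mult_right_mono bound k) simp
    finally show "\<bar>\<integral>x. f x * ((\<phi> (x + (- k n) *\<^sub>R axis i 1) - \<phi> x) / (- k n)) \<partial>lborel\<bar> \<le> C * nrm lborel \<phi>"
      unfolding e using k(1)[of n] by (simp add: field_simps)
  qed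
qed

subsection \<open>Localised second differences\<close>

text \<open>With \<open>v = h e\<^sub>i\<close> and \<open>\<beta> = \<theta>(x\<^sub>i)\<close>, \<open>ddiff \<beta> v s\<close> is \<open>h\<^sup>2\<close> times the test function
  \<open>D\<^sub>-\<^sub>h (\<theta> D\<^sub>h s)\<close> of the difference quotient method.\<close>

definition wdiff :: "('a::real_vector \<Rightarrow> real) \<Rightarrow> 'a \<Rightarrow> ('a \<Rightarrow> real) \<Rightarrow> 'a \<Rightarrow> real" where
  "wdiff \<beta> v f x = \<beta> x * (f (x + v) - f x)"

definition ddiff :: "('a::real_vector \<Rightarrow> real) \<Rightarrow> 'a \<Rightarrow> ('a \<Rightarrow> real) \<Rightarrow> 'a \<Rightarrow> real" where
  "ddiff \<beta> v f x = wdiff \<beta> v f x - wdiff \<beta> v f (x - v)"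

text \<open>In this form f plus t times the second difference is a combination of the values at x, x
  + v and x - v whose weights sum to 1. For \<beta> with values in [0, 1] and 0 < t <= 1/2 they are
  nonnegative, which is how the determinant stays above c.\<close>

lemma ddiff_eq: "ddiff \<beta> v f x = \<beta> x * (f (x + v) - f x) + \<beta> (x - v) * (f (x - v) - f x)"
  by (simp add: ddiff_def wdiff_def algebra_simps)

lemma ddiff_diff: "ddiff \<beta> v (\<lambda>x. f x - g x) x = ddiff \<beta> v f x - ddiff \<beta> v g x"
  by (simp add: ddiff_def wdiff_def algebra_simps)

lemma sqi_wdiff:
  fixes f :: "'a::euclidean_space \<Rightarrow> real"
  assumes f: "sqi lborel f" and b: "\<beta> \<in> borel_measurable borel" "\<And>x. \<bar>\<beta> x\<bar> \<le> B"
  shows "sqi lborel (wdiff \<beta> v f)" "nrm lborel (wdiff \<beta> v f) \<le> 2 * B * nrm lborel f"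
    "sqi lborel (ddiff \<beta> v f)" "nrm lborel (ddiff \<beta> v f) \<le> 4 * B * nrm lborel f"
proof -
  have B: "0 \<le> B" using b(2)[of 0] by linarith
  have d: "sqi lborel (\<lambda>x. f (x + v) - f x)" by (intro sqi_diff sqi_shift f)
  have nd: "nrm lborel (\<lambda>x. f (x + v) - f x) \<le> 2 * nrm lborel f"
    using nrm_triangle[OF sqi_shift(1)[OF f, of v] sqi_cmult(1)[OF f, of "-1"]]
      sqi_shift(2)[OF f, of v] sqi_cmult(2)[OF f, of "-1"] by simp
  show 1: "sqi lborel (wdiff \<beta> v f)"
    unfolding wdiff_def[abs_def] by (rule sqi_bounded_mult(1)[OF d _ b(2)]) (use b in simp)
  have "nrm lborel (wdiff \<beta> v f) \<le> B * nrm lborel (\<lambda>x. f (x + v) - f x)"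
    unfolding wdiff_def[abs_def] by (rule sqi_bounded_mult(2)[OF d _ b(2)]) (use b in simp)
  also have "\<dots> \<le> B * (2 * nrm lborel f)" by (intro mult_left_mono nd B)
  finally show 2: "nrm lborel (wdiff \<beta> v f) \<le> 2 * B * nrm lborel f" by simp
  have 3: "sqi lborel (\<lambda>x. wdiff \<beta> v f (x - v))" "nrm lborel (\<lambda>x. wdiff \<beta> v f (x - v)) = nrm lborel (wdiff \<beta> v f)"
    using sqi_shift[OF 1, of "- v"] by simp_all
  show "sqi lborel (ddiff \<beta> v f)"
    unfolding ddiff_def[abs_def] by (intro sqi_diff 1 3)
  show "nrm lborel (ddiff \<beta> v f) \<le> 4 * B * nrm lborel f"
    using nrm_triangle[OF 1 sqi_cmult(1)[OF 3(1), of "-1"]] sqi_cmult(2)[OF 3(1), of "-1"] 2 3(2)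
    unfolding ddiff_def[abs_def] by simp
qed

text \<open>Discrete integration by parts: in the translated half of \<open>ddiff\<close> the
  translation is moved onto V.\<close>

lemma integral_ddiff:
  fixes f V :: "'a::euclidean_space \<Rightarrow> real"
  assumes f: "sqi lborel f" and V: "sqi lborel V" and b: "\<beta> \<in> borel_measurable borel" "\<And>x. \<bar>\<beta> x\<bar> \<le> B"
  shows "(\<integral>x. V x * ddiff \<beta> v f x \<partial>lborel) = - (\<integral>x. wdiff \<beta> v f x * (V (x + v) - V x) \<partial>lborel)"
proof -
  note w = sqi_wdiff(1)[OF f b, of v]
  have ws: "sqi lborel (\<lambda>x. wdiff \<beta> v f (x - v))" using sqi_shift(1)[OF w, of "- v"] by simp
  have i: "integrable lborel (\<lambda>x. V x * wdiff \<beta> v f x)" "integrable lborel (\<lambda>x. V x * wdiff \<beta> v f (x - v))"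
    "integrable lborel (\<lambda>x. V (x + v) * wdiff \<beta> v f x)"
    by (intro sqi_mult_integrable V w ws sqi_shift)+
  have m: "(\<lambda>x. V x * wdiff \<beta> v f (x - v)) \<in> borel_measurable borel" using i(2) by simp
  have "(\<integral>x. V x * ddiff \<beta> v f x \<partial>lborel) = (\<integral>x. V x * wdiff \<beta> v f x \<partial>lborel) - (\<integral>x. V (x + v) * wdiff \<beta> v f x \<partial>lborel)"
    using i integral_lborel_shift[OF m, of v] by (simp add: ddiff_def right_diff_distrib)
  moreover have "(\<integral>x. wdiff \<beta> v f x * (V (x + v) - V x) \<partial>lborel) =
      (\<integral>x. V (x + v) * wdiff \<beta> v f x - V x * wdiff \<beta> v f x \<partial>lborel)"
    by (intro Bochner_Integration.integral_cong) (auto simp: algebra_simps)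
  ultimately show ?thesis using i by simp
qed

locale strip_weight =
  fixes i :: 2 and a h :: real
  assumes a: "0 < a" "a < 1" and h: "0 < h" "h < 1 - a"
begin

abbreviation "v \<equiv> h *\<^sub>R axis i 1 :: real^2"

lemma coord_shift: "(x + v) $ i = x $ i + h" "(x - v) $ i = x $ i - h"
  "j \<noteq> i \<Longrightarrow> (x + v) $ j = x $ j" "j \<noteq> i \<Longrightarrow> (x - v) $ j = x $ j"
  by (auto simp: axis_def)

lemma IQ_all: "x \<in> IQ \<longleftrightarrow> (\<forall>j. \<bar>x $ j\<bar> < 1)"
  by (auto simp: IQ_iff forall_2 abs_less_iff)

text \<open>Since h < 1 - a, both points satisfy the condition on coordinate i, so membership in
  \<open>IQ\<close> is decided by the other coordinate, which the shift leaves unchanged.\<close>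

lemma strip_shift: "\<bar>x $ i\<bar> < a \<Longrightarrow> x + v \<in> IQ \<longleftrightarrow> x \<in> IQ"
  "\<bar>(x - v) $ i\<bar> < a \<Longrightarrow> x - v \<in> IQ \<longleftrightarrow> x \<in> IQ"
proof -
  have 1: "x + v \<in> IQ \<longleftrightarrow> x \<in> IQ" if "\<bar>x $ i\<bar> < a" for x
  proof -
    have "\<bar>(x + v) $ j\<bar> < 1 \<longleftrightarrow> \<bar>x $ j\<bar> < 1" for j
      using that h a coord_shift(1)[where x=x] coord_shift(3)[where x=x and j=j] by (cases "j = i") auto
    then show ?thesis unfolding IQ_all by blast
  qed
  show "\<bar>x $ i\<bar> < a \<Longrightarrow> x + v \<in> IQ \<longleftrightarrow> x \<in> IQ" by (rule 1)
  show "\<bar>(x - v) $ i\<bar> < a \<Longrightarrow> x - v \<in> IQ \<longleftrightarrow> x \<in> IQ" using 1[of "x - v"] by simp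
qed

text \<open>Where only one of the two points of a difference lies in \<open>IQ\<close>, the weight
  vanishes. Truncation therefore commutes with the operator, without any extension across the
  boundary, even at the sides parallel to direction i.\<close>

lemma cut_ddiff:
  assumes "\<And>t. \<bar>t\<bar> \<ge> a \<Longrightarrow> \<alpha> t = 0"
  shows "cut (ddiff (\<lambda>x. \<alpha> (x $ i)) v u) = ddiff (\<lambda>x. \<alpha> (x $ i)) v (cut u)"
proof
  fix x
  have "\<alpha> (x $ i) = 0 \<or> (x + v \<in> IQ \<longleftrightarrow> x \<in> IQ)" using assms[of "x $ i"] strip_shift(1)[of x] by force
  moreover have "\<alpha> ((x - v) $ i) = 0 \<or> (x - v \<in> IQ \<longleftrightarrow> x \<in> IQ)" using assms[of "(x - v) $ i"] strip_shift(2)[of x] by force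
  ultimately show "cut (ddiff (\<lambda>x. \<alpha> (x $ i)) v u) x = ddiff (\<lambda>x. \<alpha> (x $ i)) v (cut u) x"
    unfolding ddiff_eq by (cases "x \<in> IQ") (auto simp: indicator_def)
qed

lemma cut_ddiff_at:
  assumes "\<And>t. \<bar>t\<bar> \<ge> a \<Longrightarrow> \<alpha> t = 0"
  shows "indicator IQ x * ddiff (\<lambda>x. \<alpha> (x $ i)) v u x = ddiff (\<lambda>x. \<alpha> (x $ i)) v (cut u) x"
  using fun_cong[OF cut_ddiff[of \<alpha> u, OF assms]] by simp

lemma L2Q_ddiff:
  assumes "\<And>t. \<bar>t\<bar> \<ge> a \<Longrightarrow> \<alpha> t = 0" "\<alpha> \<in> borel_measurable borel" "\<And>t. \<bar>\<alpha> t\<bar> \<le> B" "L2Q f"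
  shows "L2Q (ddiff (\<lambda>x. \<alpha> (x $ i)) v f)"
proof -
  have "cut f = f" using L2Q_zero[OF assms(4)] by (auto simp: indicator_def fun_eq_iff)
  then have "ddiff (\<lambda>x. \<alpha> (x $ i)) v f x = 0" if "x \<notin> IQ" for x
    using cut_ddiff[of \<alpha> f, OF assms(1)] that by (metis (no_types, lifting) indicator_simps(2) mult_zero_left)
  moreover have "sqi lborel (ddiff (\<lambda>x. \<alpha> (x $ i)) v f)"
    by (rule sqi_wdiff(3)[OF L2Q_sqi[OF assms(4)], where B=B]) (use assms in auto)
  ultimately show ?thesis by (simp add: L2Q_def)
qed

lemma smooth_ddiff:
  assumes "smooth \<theta>" "smooth u"
  shows "smooth (ddiff (\<lambda>x. \<theta> (x $ i)) v u)"
    "pd j (ddiff (\<lambda>x. \<theta> (x $ i)) v u) x = ddiff (\<lambda>x. \<theta> (x $ i)) v (pd j u) x +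
      (if j = i then ddiff (\<lambda>x. deriv \<theta> (x $ i)) v u x else 0)"
proof -
  have t: "smooth (\<lambda>x::real^2. \<theta> (x $ i))" by (rule smooth_coord[OF assms(1)])
  have us: "smooth (\<lambda>x. u (x + v))" by (rule smooth_shift[OF assms(2)])
  have w: "smooth (wdiff (\<lambda>x. \<theta> (x $ i)) v u)"
    unfolding wdiff_def[abs_def] by (intro smooth_mult t smooth_diff us assms)
  have ws: "smooth (\<lambda>x. wdiff (\<lambda>x. \<theta> (x $ i)) v u (x - v))"
    using smooth_shift[OF w, of "- v"] by simp
  have pw: "pd j (wdiff (\<lambda>x. \<theta> (x $ i)) v u) x = wdiff (\<lambda>x. \<theta> (x $ i)) v (pd j u) x +
      (if j = i then wdiff (\<lambda>x. deriv \<theta> (x $ i)) v u x else 0)" for x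
    unfolding wdiff_def[abs_def]
    by (simp add: pd_mult[OF t smooth_diff[OF us assms(2)]] pd_diff[OF us assms(2)] pd_shift[OF assms(2)] pd_coord[OF assms(1)])
  show "smooth (ddiff (\<lambda>x. \<theta> (x $ i)) v u)"
    unfolding ddiff_def[abs_def] by (rule smooth_diff[OF w ws])
  show "pd j (ddiff (\<lambda>x. \<theta> (x $ i)) v u) x = ddiff (\<lambda>x. \<theta> (x $ i)) v (pd j u) x +
      (if j = i then ddiff (\<lambda>x. deriv \<theta> (x $ i)) v u x else 0)"
    unfolding ddiff_def[abs_def]
    using pd_diff[OF w ws, of j x] pd_shift[OF w, of j "- v" x] by (simp add: pw)
qed

text \<open>For i = 1 both weights vanish on the side, as h < 1 - a. For i = 2 the operator acts
  within the side as a one-dimensional second difference, which is bounded in L2.\<close>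

lemma side_norm_ddiff:
  assumes z: "\<And>t. \<bar>t\<bar> \<ge> a \<Longrightarrow> \<alpha> t = 0" and b: "\<alpha> \<in> borel_measurable borel" "\<And>t. \<bar>\<alpha> t\<bar> \<le> B"
    and u: "smooth u" and side: "\<bar>y\<bar> = 1"
  shows "side_norm y (ddiff (\<lambda>x. \<alpha> (x $ i)) v u) \<le> 4 * B * side_norm y u"
proof (cases "i = 1")
  case True
  have B: "0 \<le> B" using b(2)[of 0] by linarith
  have "\<alpha> y = 0" "\<alpha> (y - h) = 0" using z[of y] z[of "y - h"] side h by (auto simp: abs_if split: if_splits)
  then have "ddiff (\<lambda>x. \<alpha> (x $ i)) v u (vector [y, t]) = 0" for t
    unfolding ddiff_eq using coord_shift(2)[of "vector [y, t]"] True by simp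
  then have "side_norm y (ddiff (\<lambda>x. \<alpha> (x $ i)) v u) = 0" by (simp add: side_norm_def)
  then show ?thesis using B by (simp add: side_norm_def)
next
  case False
  then have i: "i = 2" using exhaust_2[of i] by auto
  let ?f = "\<lambda>t. indicator {-1..1} t * u (vector [y, t])"
  have vv: "vector [y, t] + v = vector [y, t + h]" "vector [y, t] - v = vector [y, t - h]" for t
    by (auto simp: vec_eq_iff forall_2 i axis_def)
  have "indicator {-1..1} t * ddiff (\<lambda>x. \<alpha> (x $ i)) v u (vector [y, t]) = ddiff \<alpha> h ?f t" for t
  proof -
    have 1: "\<alpha> t = 0 \<or> (t \<in> {-1..1} \<and> t + h \<in> {-1..1})" using z[of t] h a by (cases "\<bar>t\<bar> < a") auto
    have 2: "\<alpha> (t - h) = 0 \<or> (t \<in> {-1..1} \<and> t - h \<in> {-1..1})" using z[of "t - h"] h a by (cases "\<bar>t - h\<bar> < a") auto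
    show ?thesis unfolding ddiff_eq vv using 1 2 i by (auto simp: indicator_def)
  qed
  then have "side_norm y (ddiff (\<lambda>x. \<alpha> (x $ i)) v u) = nrm lborel (ddiff \<alpha> h ?f)"
    by (simp add: side_norm_def)
  also have "\<dots> \<le> 4 * B * nrm lborel ?f"
    by (rule sqi_wdiff(4)[OF sqi_side[OF u] b])
  finally show ?thesis by (simp add: side_norm_def)
qed

text \<open>The operator is applied to the smooth approximants. Norms grow at most by 4 times the
  bound on the weight, so the limits and the zero trace are inherited.\<close>

lemma zt_ddiff:
  assumes th: "smooth \<theta>" "\<And>t. \<bar>t\<bar> \<ge> a \<Longrightarrow> \<theta> t = 0" "\<And>t. \<bar>\<theta> t\<bar> \<le> B"
    and dth: "\<And>t. \<bar>t\<bar> \<ge> a \<Longrightarrow> deriv \<theta> t = 0" "\<And>t. \<bar>deriv \<theta> t\<bar> \<le> B'"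
    and z: "zt y s G" and side: "\<bar>y\<bar> = 1"
  shows "zt y (ddiff (\<lambda>x. \<theta> (x $ i)) v s)
    (\<lambda>j x. ddiff (\<lambda>x. \<theta> (x $ i)) v (G j) x + (if j = i then ddiff (\<lambda>x. deriv \<theta> (x $ i)) v s x else 0))"
proof -
  obtain \<phi> where p: "\<And>n. smooth (\<phi> n)"
    "(\<lambda>n. nrm lborel (\<lambda>x. cut (\<phi> n) x - s x)) \<longlonglongrightarrow> 0"
    "\<And>i. (\<lambda>n. nrm lborel (\<lambda>x. cut (pd i (\<phi> n)) x - G i x)) \<longlonglongrightarrow> 0"
    "(\<lambda>n. side_norm y (\<phi> n)) \<longlonglongrightarrow> 0" by (rule zt_seqE[OF z]) blast
  have tm: "\<theta> \<in> borel_measurable borel" "deriv \<theta> \<in> borel_measurable borel"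
    using smooth_borel[OF th(1)] smooth_borel[OF smooth_deriv[OF th(1)]] by auto
  have lim: "(\<lambda>n. nrm lborel (\<lambda>x. ddiff (\<lambda>x. \<alpha> (x $ i)) v (cut (f n)) x - ddiff (\<lambda>x. \<alpha> (x $ i)) v g x)) \<longlonglongrightarrow> 0"
    if "\<alpha> \<in> borel_measurable borel" "\<And>t. \<bar>\<alpha> t\<bar> \<le> A" "\<And>n. smooth (f n)" "L2Q g"
      "(\<lambda>n. nrm lborel (\<lambda>x. cut (f n) x - g x)) \<longlonglongrightarrow> 0" for \<alpha> A g and f :: "nat \<Rightarrow> real^2 \<Rightarrow> real"
  proof (rule Lim_null_comparison)
    have "nrm lborel (ddiff (\<lambda>x. \<alpha> (x $ i)) v (\<lambda>x. cut (f n) x - g x)) \<le> 4 * A * nrm lborel (\<lambda>x. cut (f n) x - g x)" for n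
      by (rule sqi_wdiff(4)[OF sqi_diff[OF sqi_IQ_smooth[OF that(3)] L2Q_sqi[OF that(4)]]]) (use that(1,2) in auto)
    then show "\<forall>\<^sub>F n in sequentially. norm (nrm lborel (\<lambda>x. ddiff (\<lambda>x. \<alpha> (x $ i)) v (cut (f n)) x - ddiff (\<lambda>x. \<alpha> (x $ i)) v g x))
        \<le> 4 * A * nrm lborel (\<lambda>x. cut (f n) x - g x)"
      by (simp add: ddiff_diff[symmetric])
    show "(\<lambda>n. 4 * A * nrm lborel (\<lambda>x. cut (f n) x - g x)) \<longlonglongrightarrow> 0"
      by (rule tendsto_mult_right_zero[OF that(5)])
  qed
  note L = zt_L2Q[OF z]
  have lim2: "(\<lambda>n. nrm lborel (\<lambda>x. cut (ddiff (\<lambda>x. deriv \<theta> (x $ i)) v (\<phi> n)) x - ddiff (\<lambda>x. deriv \<theta> (x $ i)) v s x)) \<longlonglongrightarrow> 0"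
    by (simp only: cut_ddiff_at[of "deriv \<theta>", OF dth(1)], rule lim[OF tm(2) dth(2) p(1) L(1) p(2)])
  have lim3: "(\<lambda>n. nrm lborel (\<lambda>x. cut (ddiff (\<lambda>x. \<theta> (x $ i)) v (pd j (\<phi> n))) x - ddiff (\<lambda>x. \<theta> (x $ i)) v (G j) x)) \<longlonglongrightarrow> 0" for j
    by (simp only: cut_ddiff_at[of \<theta>, OF th(2)], rule lim[OF tm(1) th(3) smooth_pd[OF p(1)] L(2) p(3)])
  have cutL: "L2Q (ddiff (\<lambda>x. deriv \<theta> (x $ i)) v s)" "L2Q (ddiff (\<lambda>x. \<theta> (x $ i)) v s)" "L2Q (ddiff (\<lambda>x. \<theta> (x $ i)) v (G j))" for j
    using L2Q_ddiff[of "deriv \<theta>", OF dth(1) tm(2) dth(2) L(1)] L2Q_ddiff[of \<theta>, OF th(2) tm(1) th(3) L(1)]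
      L2Q_ddiff[of \<theta>, OF th(2) tm(1) th(3) L(2)] by auto
  show ?thesis
  proof (rule zt_seqI[where \<phi>="\<lambda>n. ddiff (\<lambda>x. \<theta> (x $ i)) v (\<phi> n)"])
    show "L2Q (ddiff (\<lambda>x. \<theta> (x $ i)) v s)" by (rule cutL)
    show "L2Q (\<lambda>x. ddiff (\<lambda>x. \<theta> (x $ i)) v (G j) x + (if j = i then ddiff (\<lambda>x. deriv \<theta> (x $ i)) v s x else 0))" for j
      using L2Q_add[OF cutL(3)[of j] cutL(1)] cutL(3)[of j] by (cases "j = i") simp_all
    show "smooth (ddiff (\<lambda>x. \<theta> (x $ i)) v (\<phi> n))" for n by (rule smooth_ddiff[OF th(1) p(1)])
    show "(\<lambda>n. nrm lborel (\<lambda>x. cut (ddiff (\<lambda>x. \<theta> (x $ i)) v (\<phi> n)) x - ddiff (\<lambda>x. \<theta> (x $ i)) v s x)) \<longlonglongrightarrow> 0"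
      by (simp only: cut_ddiff_at[of \<theta>, OF th(2)], rule lim[OF tm(1) th(3) p(1) L(1) p(2)])
    show "(\<lambda>n. nrm lborel (\<lambda>x. cut (pd j (ddiff (\<lambda>x. \<theta> (x $ i)) v (\<phi> n))) x -
        (ddiff (\<lambda>x. \<theta> (x $ i)) v (G j) x + (if j = i then ddiff (\<lambda>x. deriv \<theta> (x $ i)) v s x else 0)))) \<longlonglongrightarrow> 0" for j
    proof (cases "j = i")
      case True
      have sm: "sqi lborel (cut (ddiff (\<lambda>x. \<theta> (x $ i)) v (pd j (\<phi> n))))" for n
        by (intro sqi_IQ_smooth smooth_ddiff(1) th smooth_pd p)
      have sm2: "sqi lborel (cut (ddiff (\<lambda>x. deriv \<theta> (x $ i)) v (\<phi> n)))" for n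
        by (intro sqi_IQ_smooth smooth_ddiff(1) smooth_deriv th p)
      show ?thesis
        by (rule nrm_lincomb_tendsto[where c=1, OF sm L2Q_sqi[OF cutL(3)[of j]] sm2 L2Q_sqi[OF cutL(1)] lim3[of j] lim2])
          (simp add: smooth_ddiff(2)[OF th(1) p(1)] True algebra_simps)
    next
      case False
      then show ?thesis using lim3[of j] by (simp add: smooth_ddiff(2)[OF th(1) p(1)])
    qed
    show "(\<lambda>n. side_norm y (ddiff (\<lambda>x. \<theta> (x $ i)) v (\<phi> n))) \<longlonglongrightarrow> 0"
    proof (rule Lim_null_comparison)
      show "\<forall>\<^sub>F n in sequentially. norm (side_norm y (ddiff (\<lambda>x. \<theta> (x $ i)) v (\<phi> n))) \<le> 4 * B * side_norm y (\<phi> n)"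
        using side_norm_ddiff[OF th(2) tm(1) th(3) p(1) side] by (auto simp: side_norm_def)
      show "(\<lambda>n. 4 * B * side_norm y (\<phi> n)) \<longlonglongrightarrow> 0" by (rule tendsto_mult_right_zero[OF p(4)])
    qed
  qed
qed

end

subsection \<open>Local boundedness\<close>

lemma integrable_Ioo: "continuous_on UNIV g \<Longrightarrow> integrable lborel (\<lambda>x::real. indicator {a<..<b} x * (g x :: real))"
proof -
  assume g: "continuous_on UNIV g"
  then have "bounded (g ` {a..b})"
    by (intro compact_imp_bounded compact_continuous_image continuous_on_subset[OF g]) auto
  then obtain B where "\<forall>x\<in>g ` {a..b}. norm x \<le> B" unfolding bounded_iff by blast
  then have B: "\<bar>g x\<bar> \<le> B" if "a < x" "x < b" for x using that by simp
  have [measurable]: "g \<in> borel_measurable borel" using g by (rule borel_measurable_continuous_onI)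
  show ?thesis
    by (rule integrable_bounded_compact[where K="{a..b}" and B="max B 0"])
      (use B in \<open>auto simp: indicator_def le_max_iff_disj\<close>)
qed

text \<open>Since f' >= -1 - max(0, -(f' + 1)), f drops between x and a point y of (x, x + \<delta>)
  by at most \<delta> plus the last integral; averaging over y bounds f(x). The last integral
  measures the failure of f' >= -1, an inequality that smooth approximants do not inherit.\<close>

lemma one_sided_derivative_bound:
  fixes f f' :: "real \<Rightarrow> real"
  assumes d: "\<And>x. (f has_real_derivative f' x) (at x)" and c: "continuous_on UNIV f'"
    and x: "0 < \<delta>" "-1 \<le> x" "x + \<delta> \<le> 1"
  shows "f x \<le> (\<integral>t. indicator {-1<..<1} t * \<bar>f t\<bar> \<partial>lborel) / \<delta> + \<delta> +
    (\<integral>t. indicator {-1<..<1} t * max 0 (- (f' t + 1)) \<partial>lborel)"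
proof -
  define E where "E = (\<integral>t. indicator {-1<..<1} t * max 0 (- (f' t + 1)) \<partial>lborel)"
  have fc: "continuous_on UNIV f" by (rule DERIV_continuous_on) (rule has_field_derivative_at_within[OF d])
  have ei: "integrable lborel (\<lambda>t. indicator {-1<..<1} t * max 0 (- (f' t + 1)))"
    by (intro integrable_Ioo continuous_intros c)
  have ii: "integrable lborel (\<lambda>t. indicator {x<..<y} t * k)" for y k :: real
    by (intro integrable_Ioo continuous_intros)
  have iv: "(\<integral>t. indicator {x<..<y} t * k \<partial>lborel) = (y - x) * k" if "x \<le> y" for y k :: real
    using that by (simp add: mult.commute)
  have low: "f x - \<delta> - E \<le> f y" if "x < y" "y < x + \<delta>" for y
  proof -
    have "(\<integral>t. indicator {x<..<y} t * (-1) \<partial>lborel) - E \<le> (\<integral>t. indicator {x<..<y} t * f' t \<partial>lborel)"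
      unfolding E_def Bochner_Integration.integral_diff[OF ii ei, symmetric]
    proof (rule integral_mono)
      show "integrable lborel (\<lambda>t. indicator {x<..<y} t * (-1) - indicator {-1<..<1} t * max 0 (- (f' t + 1)))"
        by (intro Bochner_Integration.integrable_diff ii ei)
      show "integrable lborel (\<lambda>t. indicator {x<..<y} t * f' t)" by (rule integrable_Ioo[OF c])
      fix t
      have "t \<in> {x<..<y} \<Longrightarrow> t \<in> {-1<..<1}" using that x by auto
      then show "indicator {x<..<y} t * (-1) - indicator {-1<..<1} t * max 0 (- (f' t + 1)) \<le> indicator {x<..<y} t * f' t"
        by (cases "t \<in> {x<..<y}") (auto simp: indicator_def max_def)
    qed
    moreover have "(\<integral>t. indicator {x<..<y} t * f' t \<partial>lborel) = f y - f x"
      using that by (intro integral_FTC_Ioo d c) auto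
    moreover have "(\<integral>t. indicator {x<..<y} t * (-1) \<partial>lborel) = (y - x) * (-1)"
      using that by (intro iv) auto
    ultimately show ?thesis using that by simp
  qed
  have "\<delta> * (f x - \<delta> - E) = (\<integral>t. indicator {x<..<x + \<delta>} t * (f x - \<delta> - E) \<partial>lborel)"
    using x(1) by (subst iv) auto
  also have "\<dots> \<le> (\<integral>t. indicator {-1<..<1} t * \<bar>f t\<bar> \<partial>lborel)"
  proof (rule integral_mono)
    show "integrable lborel (\<lambda>t. indicator {-1<..<1} t * \<bar>f t\<bar>)" by (intro integrable_Ioo continuous_intros fc)
    fix t
    have *: "t \<in> {x<..<x + \<delta>} \<Longrightarrow> t \<in> {-1<..<1}" using x by auto
    show "indicator {x<..<x + \<delta>} t * (f x - \<delta> - E) \<le> indicator {-1<..<1} t * \<bar>f t\<bar>"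
    proof (cases "t \<in> {x<..<x + \<delta>}")
      case True
      then show ?thesis using low[of t] * by (auto simp: indicator_def)
    qed (auto simp: indicator_def)
  qed (rule ii)
  finally have "f x - \<delta> - E \<le> (\<integral>t. indicator {-1<..<1} t * \<bar>f t\<bar> \<partial>lborel) / \<delta>"
    using x(1) by (simp add: field_simps)
  then show ?thesis by (simp add: E_def)
qed

text \<open>The lower bound is the upper bound for -f(-t), whose derivative f'(-t) obeys the same
  one-sided condition.\<close>

lemma one_sided_derivative_abs_bound:
  fixes f f' :: "real \<Rightarrow> real"
  assumes d: "\<And>x. (f has_real_derivative f' x) (at x)" and c: "continuous_on UNIV f'"
    and x: "0 < \<delta>" "\<bar>x\<bar> \<le> 1 - \<delta>"
  shows "\<bar>f x\<bar> \<le> (\<integral>t. indicator {-1<..<1} t * \<bar>f t\<bar> \<partial>lborel) / \<delta> + \<delta> +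
    (\<integral>t. indicator {-1<..<1} t * max 0 (- (f' t + 1)) \<partial>lborel)"
proof -
  have refl: "(\<integral>t. indicator {-1<..<1} t * g (- t) \<partial>lborel) = (\<integral>t. indicator {-1<..<1} t * g t \<partial>lborel)" for g :: "real \<Rightarrow> real"
  proof -
    have "(\<integral>t. indicator {-1<..<1} t * g t \<partial>lborel) = (\<integral>t. indicator {-1<..<1} (- t) * g (- t) \<partial>lborel)"
      using lborel_integral_real_affine[of "-1" "\<lambda>t. indicator {-1<..<1} t * g t" 0] by simp
    also have "\<dots> = (\<integral>t. indicator {-1<..<1} t * g (- t) \<partial>lborel)"
      by (intro Bochner_Integration.integral_cong) (auto simp: indicator_def)
    finally show ?thesis ..
  qed
  have d2: "((\<lambda>t. - f (- t)) has_real_derivative f' (- t)) (at t)" for t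
    using DERIV_minus[OF DERIV_chain2[OF d[of "- t"] DERIV_minus[OF DERIV_ident]]] by simp
  have c2: "continuous_on UNIV (\<lambda>t. f' (- t))"
    by (intro continuous_on_compose2[OF c] continuous_intros) auto
  have "- f (- (- x)) \<le> (\<integral>t. indicator {-1<..<1} t * \<bar>f t\<bar> \<partial>lborel) / \<delta> + \<delta> +
    (\<integral>t. indicator {-1<..<1} t * max 0 (- (f' t + 1)) \<partial>lborel)"
    using one_sided_derivative_bound[OF d2 c2 x(1), of "- x"] x
      refl[of "\<lambda>t. \<bar>f t\<bar>"] refl[of "\<lambda>t. max 0 (- (f' t + 1))"] by simp
  moreover have "f x \<le> (\<integral>t. indicator {-1<..<1} t * \<bar>f t\<bar> \<partial>lborel) / \<delta> + \<delta> +
    (\<integral>t. indicator {-1<..<1} t * max 0 (- (f' t + 1)) \<partial>lborel)"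
    using x by (intro one_sided_derivative_bound[OF d c]) auto
  ultimately show ?thesis by simp
qed

lemma continuous_slice:
  assumes "continuous_on UNIV (u :: real^2 \<Rightarrow> real)"
  shows "continuous_on UNIV (\<lambda>t. u (vector [y, t]))" "continuous_on UNIV (\<lambda>y. u (vector [y, t]))"
  unfolding vector2_eq by (intro continuous_on_compose2[OF assms] continuous_intros; simp)+

lemma integral_real2_swap:
  fixes f :: "real^2 \<Rightarrow> real"
  assumes "integrable lborel f"
  shows "integrable lborel (\<lambda>y. \<integral>t. f (vector [y, t]) \<partial>lborel)"
    "(\<integral>x. f x \<partial>lborel) = (\<integral>y. (\<integral>t. f (vector [y, t]) \<partial>lborel) \<partial>lborel)"
proof -
  have m: "(\<lambda>(t, y). vector [y, t] :: real^2) \<in> borel_measurable (lborel \<Otimes>\<^sub>M lborel)"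
    unfolding vector2_eq by measurable
  have fm: "f \<in> borel_measurable borel" using assms by auto
  have i: "integrable (lborel \<Otimes>\<^sub>M lborel) (\<lambda>(t, y). f (vector [y, t]))"
    using assms unfolding lborel_real2
    by (subst (asm) integrable_distr_eq[OF m fm]) (simp add: split_def)
  have i': "integrable (lborel \<Otimes>\<^sub>M lborel) (\<lambda>(y, t). f (vector [y, t]))"
    using lborel_pair.integrable_product_swap[OF i] by (simp add: split_def)
  show "integrable lborel (\<lambda>y. \<integral>t. f (vector [y, t]) \<partial>lborel)"
    using lborel_pair.integrable_fst'[OF i'] by simp
  have "(\<integral>x. f x \<partial>lborel) = (\<integral>t. (\<integral>y. f (vector [y, t]) \<partial>lborel) \<partial>lborel)"
    by (rule integral_real2(2)[OF assms])
  also have "\<dots> = (\<integral>y. (\<integral>t. f (vector [y, t]) \<partial>lborel) \<partial>lborel)"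
    using lborel_pair.Fubini_integral[OF i'] by simp
  finally show "(\<integral>x. f x \<partial>lborel) = (\<integral>y. (\<integral>t. f (vector [y, t]) \<partial>lborel) \<partial>lborel)" .
qed

text \<open>The value |\<phi>(y, t)| is at most |\<phi>(-1, t)| plus the integral of |pd 1 \<phi>|
  along the horizontal line at height t; integrate over t. The bound is uniform in y and holds on
  every vertical segment.\<close>

lemma slice_integral_bound:
  assumes p: "smooth \<phi>" and y: "-1 < y" "y < 1"
  shows "(\<integral>t. indicator {-1<..<1} t * \<bar>\<phi> (vector [y, t])\<bar> \<partial>lborel) \<le>
    (\<integral>t. indicator {-1<..<1} t * \<bar>\<phi> (vector [-1, t])\<bar> \<partial>lborel) + (\<integral>x. \<bar>cut (pd 1 \<phi>) x\<bar> \<partial>lborel)"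
proof -
  have pc: "continuous_on UNIV (pd 1 \<phi>)" by (intro smooth_continuous smooth_pd p)
  have d: "((\<lambda>r. \<phi> (vector [r, t])) has_real_derivative pd 1 \<phi> (vector [r, t])) (at r)" for r t
    using pd_line[OF p, of "t *\<^sub>R axis 2 1" 1 r] by (simp add: vector2_eq add.commute)
  have ai: "integrable lborel (\<lambda>x. \<bar>cut (pd 1 \<phi>) x\<bar>)"
    by (intro integrable_abs integrable_cut pc)
  have e: "(\<integral>r. \<bar>cut (pd 1 \<phi>) (vector [r, t])\<bar> \<partial>lborel) = indicator {-1<..<1} t * (\<integral>r. indicator {-1<..<1} r * \<bar>pd 1 \<phi> (vector [r, t])\<bar> \<partial>lborel)" for t
    by (simp add: indicator_IQ_vector abs_mult mult.assoc)
  have le: "\<bar>\<phi> (vector [y, t])\<bar> \<le> \<bar>\<phi> (vector [-1, t])\<bar> + (\<integral>r. indicator {-1<..<1} r * \<bar>pd 1 \<phi> (vector [r, t])\<bar> \<partial>lborel)" for t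
  proof -
    have c: "continuous_on UNIV (\<lambda>r. pd 1 \<phi> (vector [r, t]))" by (rule continuous_slice[OF pc])
    have "\<phi> (vector [y, t]) - \<phi> (vector [-1, t]) = (\<integral>r. indicator {-1<..<y} r * pd 1 \<phi> (vector [r, t]) \<partial>lborel)"
      using y by (intro integral_FTC_Ioo[symmetric] d c) auto
    moreover have "\<bar>\<integral>r. indicator {-1<..<y} r * pd 1 \<phi> (vector [r, t]) \<partial>lborel\<bar> \<le> (\<integral>r. indicator {-1<..<1} r * \<bar>pd 1 \<phi> (vector [r, t])\<bar> \<partial>lborel)"
    proof (rule order_trans[OF integral_abs_bound], rule integral_mono)
      show "integrable lborel (\<lambda>r. \<bar>indicator {-1<..<y} r * pd 1 \<phi> (vector [r, t])\<bar>)"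
        by (intro integrable_abs integrable_Ioo c)
      show "integrable lborel (\<lambda>r. indicator {-1<..<1} r * \<bar>pd 1 \<phi> (vector [r, t])\<bar>)"
        by (intro integrable_Ioo continuous_intros c)
    qed (use y in \<open>auto simp: indicator_def\<close>)
    ultimately show ?thesis by linarith
  qed
  have "(\<integral>t. indicator {-1<..<1} t * \<bar>\<phi> (vector [y, t])\<bar> \<partial>lborel) \<le>
      (\<integral>t. indicator {-1<..<1} t * \<bar>\<phi> (vector [-1, t])\<bar> + (\<integral>r. \<bar>cut (pd 1 \<phi>) (vector [r, t])\<bar> \<partial>lborel) \<partial>lborel)"
  proof (rule integral_mono)
    show "integrable lborel (\<lambda>t. indicator {-1<..<1} t * \<bar>\<phi> (vector [y, t])\<bar>)"
      by (intro integrable_Ioo continuous_intros continuous_slice smooth_continuous p)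
    show "integrable lborel (\<lambda>t. indicator {-1<..<1} t * \<bar>\<phi> (vector [-1, t])\<bar> + (\<integral>r. \<bar>cut (pd 1 \<phi>) (vector [r, t])\<bar> \<partial>lborel))"
      by (intro Bochner_Integration.integrable_add integrable_Ioo continuous_intros continuous_slice smooth_continuous p integral_real2(1)[OF ai])
    show "indicator {-1<..<1} t * \<bar>\<phi> (vector [y, t])\<bar> \<le>
        indicator {-1<..<1} t * \<bar>\<phi> (vector [-1, t])\<bar> + (\<integral>r. \<bar>cut (pd 1 \<phi>) (vector [r, t])\<bar> \<partial>lborel)" for t
      unfolding e using le[of t] by (auto simp: indicator_def)
  qed
  also have "\<dots> = (\<integral>t. indicator {-1<..<1} t * \<bar>\<phi> (vector [-1, t])\<bar> \<partial>lborel) + (\<integral>x. \<bar>cut (pd 1 \<phi>) x\<bar> \<partial>lborel)"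
    unfolding integral_real2(2)[OF ai]
    by (intro Bochner_Integration.integral_add integrable_Ioo continuous_intros continuous_slice smooth_continuous p integral_real2(1)[OF ai])
  finally show ?thesis .
qed

lemma L2Q_L1_le:
  assumes "L2Q f"
  shows "integrable lborel (\<lambda>x. \<bar>f x\<bar>)" "(\<integral>x. \<bar>f x\<bar> \<partial>lborel) \<le> nrm lborel (indicator Q) * nrm lborel f"
proof -
  have a: "sqi lborel (\<lambda>x. \<bar>f x\<bar>)" "nrm lborel (\<lambda>x. \<bar>f x\<bar>) = nrm lborel f"
    using L2Q_sqi[OF assms] by (auto simp: sqi_def nrm_def)
  note q = indicator_compact_sqi[OF compact_Q]
  have e: "\<bar>f x\<bar> = indicator Q x * \<bar>f x\<bar>" for x
    using L2Q_zero[OF assms, of x] IQ_subset_Q by (cases "x \<in> Q") auto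
  show "integrable lborel (\<lambda>x. \<bar>f x\<bar>)"
    by (subst e) (rule sqi_mult_integrable[OF q a(1)])
  show "(\<integral>x. \<bar>f x\<bar> \<partial>lborel) \<le> nrm lborel (indicator Q) * nrm lborel f"
    using Cauchy_Schwarz_L2[OF q a(1)] a(2) by (subst e) simp
qed

text \<open>The estimate is made for smooth approximants, where the defect of the constraint along
  the vertical line through x is a function of x_1 alone. This defect tends to 0 in L1, hence a.e.
  along a subsequence, and the bound survives in the limit.\<close>

lemma locally_bounded:
  assumes z: "zt (-1) s G" and low: "\<And>x. x \<in> IQ \<Longrightarrow> 0 \<le> 1 + G 2 x" and b: "b < 1"
  obtains M where "AE x in lborel. x \<in> IQ \<longrightarrow> \<bar>x $ 2\<bar> \<le> b \<longrightarrow> \<bar>s x\<bar> \<le> M"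
proof -
  define \<delta> where "\<delta> = 1 - b"
  have \<delta>: "\<delta> > 0" using b by (simp add: \<delta>_def)
  obtain \<phi> where p: "\<And>n. smooth (\<phi> n)"
    "(\<lambda>n. nrm lborel (\<lambda>x. cut (\<phi> n) x - s x)) \<longlonglongrightarrow> 0"
    "\<And>i. (\<lambda>n. nrm lborel (\<lambda>x. cut (pd i (\<phi> n)) x - G i x)) \<longlonglongrightarrow> 0"
    "(\<lambda>n. side_norm (-1) (\<phi> n)) \<longlonglongrightarrow> 0" by (rule zt_seqE[OF z]) blast
  note L = zt_L2Q[OF z]
  define k where "k = nrm lborel (indicator {-1..1::real})"
  define K where "K = nrm lborel (indicator Q)"
  define e where "e n x = max 0 (- (pd 2 (\<phi> n) x + 1))" for n x
  have ec: "continuous_on UNIV (e n)" for n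
    unfolding e_def by (intro continuous_intros smooth_continuous smooth_pd p)
  define E where "E n y = (\<integral>t. indicator {-1<..<1} t * e n (vector [y, t]) \<partial>lborel)" for n y
  define A where "A n = k * side_norm (-1) (\<phi> n) + K * nrm lborel (cut (pd 1 (\<phi> n)))" for n
  have bound: "\<bar>\<phi> n x\<bar> \<le> A n / \<delta> + \<delta> + E n (x $ 1)" if x: "x \<in> IQ" "\<bar>x $ 2\<bar> \<le> b" for n x
  proof -
    have xe: "x = vector [x $ 1, x $ 2]" by (simp add: vec_eq_iff forall_2)
    have d: "((\<lambda>t. \<phi> n (vector [x $ 1, t])) has_real_derivative pd 2 (\<phi> n) (vector [x $ 1, t])) (at t)" for t
      using pd_line[OF p(1), of n "x $ 1 *\<^sub>R axis 1 1" 2 t] by (simp add: vector2_eq)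
    have "\<bar>\<phi> n (vector [x $ 1, x $ 2])\<bar> \<le> (\<integral>t. indicator {-1<..<1} t * \<bar>\<phi> n (vector [x $ 1, t])\<bar> \<partial>lborel) / \<delta> + \<delta> + E n (x $ 1)"
      unfolding E_def e_def
      by (rule one_sided_derivative_abs_bound[OF d continuous_slice(1)[OF smooth_continuous[OF smooth_pd[OF p(1)]]] \<delta>])
        (use x in \<open>auto simp: \<delta>_def\<close>)
    moreover have "(\<integral>t. indicator {-1<..<1} t * \<bar>\<phi> n (vector [x $ 1, t])\<bar> \<partial>lborel) \<le> A n"
    proof -
      have "(\<integral>t. indicator {-1<..<1} t * \<bar>\<phi> n (vector [-1, t])\<bar> \<partial>lborel) \<le> k * side_norm (-1) (\<phi> n)"
      proof -
        let ?g = "\<lambda>t. \<bar>indicator {-1..1} t * \<phi> n (vector [-1, t])\<bar>"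
        have g: "sqi lborel ?g" "nrm lborel ?g = side_norm (-1) (\<phi> n)"
          using sqi_side[OF p(1), of n "-1"] by (auto simp: sqi_def nrm_def side_norm_def)
        have i: "sqi lborel (indicator {-1..1::real})" by (rule indicator_compact_sqi) simp
        have "(\<integral>t. indicator {-1<..<1} t * \<bar>\<phi> n (vector [-1, t])\<bar> \<partial>lborel) \<le> (\<integral>t. indicator {-1..1} t * ?g t \<partial>lborel)"
        proof (rule integral_mono[OF _ sqi_mult_integrable[OF i g(1)]])
          show "integrable lborel (\<lambda>t. indicator {-1<..<1} t * \<bar>\<phi> n (vector [-1, t])\<bar>)"
            by (intro integrable_Ioo continuous_intros continuous_slice smooth_continuous p)
        qed (auto simp: indicator_def)
        also have "\<dots> \<le> k * side_norm (-1) (\<phi> n)"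
          using Cauchy_Schwarz_L2[OF i g(1)] g(2) by (simp add: k_def)
        finally show ?thesis .
      qed
      moreover have "(\<integral>x. \<bar>cut (pd 1 (\<phi> n)) x\<bar> \<partial>lborel) \<le> K * nrm lborel (cut (pd 1 (\<phi> n)))"
        unfolding K_def by (intro L2Q_L1_le L2Q_smooth smooth_pd p)
      ultimately show ?thesis
        using slice_integral_bound[OF p(1), of "x $ 1" n] x(1) by (simp add: A_def IQ_iff)
    qed
    ultimately show ?thesis
      using \<delta> divide_right_mono[of _ "A n" \<delta>] xe by fastforce
  qed
  have eb: "integrable lborel (cut (e n))" for n by (rule integrable_cut[OF ec])
  have Ei: "(\<integral>t. cut (e n) (vector [y, t]) \<partial>lborel) = indicator {-1<..<1} y * E n y" for n y
  proof -
    have "cut (e n) (vector [y, t]) = indicator {-1<..<1} y * (indicator {-1<..<1} t * e n (vector [y, t]))" for t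
      by (simp add: indicator_IQ_vector)
    then show ?thesis by (simp only: E_def integral_mult_right_zero)
  qed
  have E0: "0 \<le> E n y" for n y
    unfolding E_def by (intro integral_nonneg_AE) (auto simp: e_def indicator_def)
  have Em [measurable]: "(\<lambda>y. indicator {-1<..<1} y * E n y) \<in> borel_measurable borel" for n
    using integral_real2_swap(1)[OF eb[of n]] unfolding Ei by auto
  \<comment> \<open>The defect regarded as a function on the square, so that its a.e. convergence
    and that of the approximants refer to the same measure. The factor 2 in \<open>rint\<close> is
    the length of the vertical interval.\<close>
  define r where "r n x = indicator {-1<..<1} (x $ 2) * (indicator {-1<..<1} (x $ 1) * E n (x $ 1))" for n and x :: "real^2"
  have ri: "integrable lborel (r n)" for n
  proof -
    obtain B where B: "0 \<le> B" "\<And>x. x \<in> Q \<Longrightarrow> \<bar>e n x\<bar> \<le> B"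
      by (rule continuous_bounded_Q[OF continuous_on_subset[OF ec[of n] subset_UNIV]]) blast
    have "E n y \<le> 2 * B" if y: "-1 < y" "y < 1" for y
    proof -
      have "E n y \<le> (\<integral>t. indicator {-1<..<1} (t::real) * B \<partial>lborel)"
        unfolding E_def
      proof (rule integral_mono)
        fix t :: real
        show "indicator {-1<..<1} t * e n (vector [y, t]) \<le> indicator {-1<..<1} t * B"
          using B(2)[of "vector [y, t]"] y by (auto simp: indicator_def Q_def forall_2)
      qed (intro integrable_Ioo continuous_intros continuous_slice ec)+
      then show ?thesis by simp
    qed
    then have rb: "\<bar>r n x\<bar> \<le> 2 * B" for x
      using E0[of n "x $ 1"] B(1) by (auto simp: r_def indicator_def)
    have rm: "r n \<in> borel_measurable borel"
      unfolding r_def[abs_def] by measurable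
    show ?thesis
      by (rule integrable_bounded_compact[OF rm compact_Q _ rb])
        (use IQ_subset_Q in \<open>force simp: r_def indicator_def Q_def forall_2\<close>)
  qed
  have rint: "(\<integral>x. norm (r n x) \<partial>lborel) = 2 * (\<integral>x. cut (e n) x \<partial>lborel)" for n
  proof -
    have "norm (r n x) = r n x" for x using E0 by (simp add: r_def)
    then have "(\<integral>x. norm (r n x) \<partial>lborel) = (\<integral>t. (\<integral>y. r n (vector [y, t]) \<partial>lborel) \<partial>lborel)"
      using integral_real2(2)[OF ri] by simp
    also have "\<dots> = 2 * (\<integral>y. indicator {-1<..<1} y * E n y \<partial>lborel)"
      by (simp add: r_def)
    also have "\<dots> = 2 * (\<integral>x. cut (e n) x \<partial>lborel)"
      using integral_real2_swap(2)[OF eb] unfolding Ei by simp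
    finally show ?thesis .
  qed
  have "(\<lambda>n. \<integral>x. norm (r n x) \<partial>lborel) \<longlonglongrightarrow> 0"
  proof (rule Lim_null_comparison)
    \<comment> \<open>Because \<open>1 + G 2 \<ge> 0\<close>, the defect is at most the distance
      between \<open>G 2\<close> and the derivative of the approximant.\<close>
    have le: "(\<integral>x. cut (e n) x \<partial>lborel) \<le> K * nrm lborel (\<lambda>x. cut (pd 2 (\<phi> n)) x - G 2 x)" for n
    proof -
      have l: "L2Q (\<lambda>x. cut (pd 2 (\<phi> n)) x - G 2 x)" by (intro L2Q_diff L2Q_smooth smooth_pd p L)
      have "(\<integral>x. cut (e n) x \<partial>lborel) \<le> (\<integral>x. \<bar>cut (pd 2 (\<phi> n)) x - G 2 x\<bar> \<partial>lborel)"
      proof (rule integral_mono[OF eb L2Q_L1_le(1)[OF l]])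
        show "cut (e n) x \<le> \<bar>cut (pd 2 (\<phi> n)) x - G 2 x\<bar>" for x
          using low[of x] by (cases "x \<in> IQ") (auto simp: e_def)
      qed
      also have "\<dots> \<le> K * nrm lborel (\<lambda>x. cut (pd 2 (\<phi> n)) x - G 2 x)"
        unfolding K_def by (rule L2Q_L1_le(2)[OF l])
      finally show ?thesis .
    qed
    show "\<forall>\<^sub>F n in sequentially. norm (\<integral>x. norm (r n x) \<partial>lborel) \<le> 2 * (K * nrm lborel (\<lambda>x. cut (pd 2 (\<phi> n)) x - G 2 x))"
    proof (intro always_eventually allI)
      fix n
      have "0 \<le> (\<integral>x. norm (r n x) \<partial>lborel)" by (intro integral_nonneg_AE) simp
      then have "norm (\<integral>x. norm (r n x) \<partial>lborel) = (\<integral>x. norm (r n x) \<partial>lborel)"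
        unfolding real_norm_def by (rule abs_of_nonneg)
      also have "\<dots> = 2 * (\<integral>x. cut (e n) x \<partial>lborel)" by (rule rint)
      finally show "norm (\<integral>x. norm (r n x) \<partial>lborel) \<le> 2 * (K * nrm lborel (\<lambda>x. cut (pd 2 (\<phi> n)) x - G 2 x))"
        using le[of n] by linarith
    qed
    show "(\<lambda>n. 2 * (K * nrm lborel (\<lambda>x. cut (pd 2 (\<phi> n)) x - G 2 x))) \<longlonglongrightarrow> 0"
      by (intro tendsto_mult_right_zero p)
  qed
  then obtain q where q: "strict_mono q" "AE x in lborel. (\<lambda>n. r (q n) x) \<longlonglongrightarrow> 0"
    using tendsto_L1_AE_subseq[of lborel r, OF ri] by blast
  have pq: "(\<lambda>n. nrm lborel (\<lambda>x. cut (\<phi> (q n)) x - s x)) \<longlonglongrightarrow> 0"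
    using LIMSEQ_subseq_LIMSEQ[OF p(2) q(1)] by (simp add: o_def)
  obtain m where m: "strict_mono m" "AE x in lborel. (\<lambda>n. cut (\<phi> (q (m n))) x) \<longlonglongrightarrow> s x"
    by (rule L2_AE_subseq[OF sqi_IQ_smooth[OF p(1)] L2Q_sqi[OF L(1)] pq])
  have "(\<lambda>n. nrm lborel (cut (pd 1 (\<phi> n)))) \<longlonglongrightarrow> nrm lborel (G 1)"
    by (intro tendsto_nrm_L2 sqi_IQ_smooth smooth_pd p L2Q_sqi L)
  then have "A \<longlonglongrightarrow> k * 0 + K * nrm lborel (G 1)"
    unfolding A_def by (intro tendsto_intros p)
  then have "(\<lambda>n. A (q (m n))) \<longlonglongrightarrow> k * 0 + K * nrm lborel (G 1)"
    using LIMSEQ_subseq_LIMSEQ[OF LIMSEQ_subseq_LIMSEQ[OF _ q(1)] m(1)] by (fastforce simp: o_def)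
  note Al = this
  have "AE x in lborel. x \<in> IQ \<longrightarrow> \<bar>x $ 2\<bar> \<le> b \<longrightarrow> \<bar>s x\<bar> \<le> (k * 0 + K * nrm lborel (G 1)) / \<delta> + \<delta> + 0"
    using q(2) m(2)
  proof eventually_elim
    case (elim x)
    show ?case
    proof (intro impI)
      assume x: "x \<in> IQ" "\<bar>x $ 2\<bar> \<le> b"
      have rl: "(\<lambda>n. r (q (m n)) x) \<longlonglongrightarrow> 0"
        using LIMSEQ_subseq_LIMSEQ[OF elim(1) m(1)] by (simp add: o_def)
      show "\<bar>s x\<bar> \<le> (k * 0 + K * nrm lborel (G 1)) / \<delta> + \<delta> + 0"
      proof (rule LIMSEQ_le)
        show "(\<lambda>n. \<bar>cut (\<phi> (q (m n))) x\<bar>) \<longlonglongrightarrow> \<bar>s x\<bar>" by (rule tendsto_rabs[OF elim(2)])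
        show "(\<lambda>n. A (q (m n)) / \<delta> + \<delta> + r (q (m n)) x) \<longlonglongrightarrow> (k * 0 + K * nrm lborel (G 1)) / \<delta> + \<delta> + 0"
          using \<delta> by (intro tendsto_intros Al rl) auto
        have "r n x = E n (x $ 1)" for n using x(1) by (simp add: r_def IQ_iff)
        then show "\<exists>N. \<forall>n\<ge>N. \<bar>cut (\<phi> (q (m n))) x\<bar> \<le> A (q (m n)) / \<delta> + \<delta> + r (q (m n)) x"
          using bound[OF x] x(1) by simp
      qed
    qed
  qed
  then show ?thesis by (rule that)
qed

subsection \<open>The difference quotient estimate for the minimizer\<close>

text \<open>The bound \<open>det_ge\<close> is required at every point of \<open>IQ\<close>, so that
  inequalities between gradients at translated points have no exceptional sets;
  \<open>minimizer_sobolev2\<close> arranges it by changing the gradient on a null set.\<close>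

locale regular_minimizer = energy_density +
  fixes s :: "real^2 \<Rightarrow> real" and G :: "2 \<Rightarrow> real^2 \<Rightarrow> real" and c :: real
  assumes zt2: "zt2 s G" and adm: "admissible G"
    and minimal: "\<And>s' G'. zt2 s' G' \<Longrightarrow> admissible G' \<Longrightarrow> (\<integral>x. wint G x \<partial>lborel) \<le> (\<integral>x. wint G' x \<partial>lborel)"
    and c: "c > 0" and det_ge: "\<And>x. x \<in> IQ \<Longrightarrow> c \<le> 1 + G 2 x"
begin

lemma z: "zt (-1) s G" "zt 1 s G"
  using zt2 by (auto simp: zt2_def)

lemma Gm [measurable]: "G i \<in> borel_measurable borel"
  using zt2_L2Q(2)[OF zt2, of i] by (auto simp: L2Q_def sqi_def)

lemma G_sqi: "sqi lborel (G i)" and s_sqi: "sqi lborel s"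
  using zt2_L2Q[OF zt2] L2Q_sqi by auto

text \<open>The second component of the stress, \<open>\<partial>W / \<partial>\<xi>\<^sub>2\<close> at \<open>\<nabla>\<sigma>\<close>.\<close>

definition P :: "real^2 \<Rightarrow> real" where
  "P x = indicator IQ x * (1 + G 2 x + deriv h (1 + G 2 x))"

lemma P_monotone: "x \<in> IQ \<Longrightarrow> y \<in> IQ \<Longrightarrow> (G 2 x - G 2 y)\<^sup>2 \<le> (P x - P y) * (G 2 x - G 2 y)"
  using deriv_h_mono[of "1 + G 2 y" "1 + G 2 x"] det_ge[of x] det_ge[of y] c
  by (simp add: P_def power2_eq_square algebra_simps)

text \<open>The normalization \<open>1 \<le> L\<close> lets one constant serve for both components
  of the stress, the first being \<open>G 1\<close> itself.\<close>

lemma P_Lipschitz: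
  obtains L where "1 \<le> L" "\<And>x y. x \<in> IQ \<Longrightarrow> y \<in> IQ \<Longrightarrow> \<bar>P x - P y\<bar> \<le> L * \<bar>G 2 x - G 2 y\<bar>"
proof -
  obtain C where C: "C > 0" "\<And>a b. c \<le> a \<Longrightarrow> c \<le> b \<Longrightarrow> \<bar>deriv h b - deriv h a\<bar> \<le> C * \<bar>b - a\<bar>"
    by (rule deriv_h_Lipschitz[OF c]) blast
  have "\<bar>P x - P y\<bar> \<le> (1 + C) * \<bar>G 2 x - G 2 y\<bar>" if "x \<in> IQ" "y \<in> IQ" for x y
    using C(2)[OF det_ge[OF that(2)] det_ge[OF that(1)]] that by (simp add: P_def distrib_right)
  then show ?thesis using C(1) that[of "1 + C"] by simp
qed

lemma L2Q_P: "L2Q P"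
proof -
  obtain C where C: "C > 0" "\<And>a b. c \<le> a \<Longrightarrow> c \<le> b \<Longrightarrow> \<bar>deriv h b - deriv h a\<bar> \<le> C * \<bar>b - a\<bar>"
    by (rule deriv_h_Lipschitz[OF c]) blast
  have "continuous_on {0<..} (deriv h)"
    by (rule DERIV_continuous_on) (auto intro: DERIV_deriv_h has_field_derivative_at_within)
  then have [measurable]: "(\<lambda>t. indicator {0<..} t *\<^sub>R deriv h t) \<in> borel_measurable borel"
    by (intro borel_measurable_continuous_on_indicator) auto
  \<comment> \<open>The derivative of h is controlled on t > 0 only, so measurability is taken from
    its truncation to that range, in which the determinant stays.\<close>
  have e: "P = (\<lambda>x. indicator IQ x * (1 + G 2 x + indicator {0<..} (1 + G 2 x) *\<^sub>R deriv h (1 + G 2 x)))"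
    using det_ge c by (fastforce simp: P_def indicator_def fun_eq_iff)
  have Pm: "P \<in> borel_measurable borel"
    unfolding e by measurable
  define D where "D = 1 + \<bar>deriv h c\<bar> + C * \<bar>1 - c\<bar>"
  have le: "\<bar>P x\<bar> \<le> \<bar>cut (\<lambda>_. D) x + (1 + C) * \<bar>G 2 x\<bar>\<bar>" for x
  proof (cases "x \<in> IQ")
    case True
    have "\<bar>deriv h (1 + G 2 x) - deriv h c\<bar> \<le> C * \<bar>1 + G 2 x - c\<bar>"
      using C(2)[OF order_refl det_ge[OF True]] .
    also have "\<dots> \<le> C * (\<bar>1 - c\<bar> + \<bar>G 2 x\<bar>)" using C(1) by (intro mult_left_mono) auto
    finally show ?thesis using True by (simp add: P_def D_def algebra_simps)
  qed (simp add: P_def)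
  have "sqi lborel (\<lambda>x. cut (\<lambda>_. D) x + (1 + C) * \<bar>G 2 x\<bar>)"
    using G_sqi[of 2] by (intro sqi_add sqi_cmult(1) sqi_IQ) (auto simp: sqi_def)
  then have "sqi lborel P"
    by (rule sqi_mono(1)) (simp_all add: Pm le)
  then show ?thesis by (simp add: L2Q_def P_def)
qed

text \<open>A one-sided bound on the determinant along the variation suffices, and it may decrease
  linearly with slope M. For small t it stays above c/2, where h has a quadratic remainder bound, so
  the energy increases by at most t A + t^2 B, with A the asserted sum. Minimality and t -> 0 give A
  >= 0.\<close>

lemma variational_inequality:
  assumes zK: "zt2 \<phi> K" and M: "0 \<le> M" and t1: "0 < t1"
    and ae: "\<And>t. 0 < t \<Longrightarrow> t \<le> t1 \<Longrightarrow> AE x in lborel. x \<in> IQ \<longrightarrow> c - t * M \<le> 1 + G 2 x + t * K 2 x"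
  shows "0 \<le> (\<integral>x. G 1 x * K 1 x \<partial>lborel) + (\<integral>x. P x * K 2 x \<partial>lborel)"
proof -
  obtain C where C: "C > 0" "\<And>a b. c / 2 \<le> a \<Longrightarrow> c / 2 \<le> b \<Longrightarrow> h b - h a - deriv h a * (b - a) \<le> C * (b - a)\<^sup>2"
    by (rule deriv_h_Lipschitz[of "c / 2"]) (use c in auto)
  have K_sqi: "sqi lborel (K i)" for i by (rule L2Q_sqi[OF zt2_L2Q(2)[OF zK]])
  have Km [measurable]: "K i \<in> borel_measurable borel" for i
    using K_sqi[of i] by (auto simp: sqi_def)
  define A where "A = (\<integral>x. G 1 x * K 1 x \<partial>lborel) + (\<integral>x. P x * K 2 x \<partial>lborel)"
  define B where "B = 1 / 2 * (\<integral>x. (K 1 x)\<^sup>2 \<partial>lborel) + (1 / 2 + C) * (\<integral>x. (K 2 x)\<^sup>2 \<partial>lborel)"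
  \<comment> \<open>Using M + 1 instead of M keeps the quotient meaningful for M = 0; the choice
    gives t0 M <= c/2.\<close>
  define t0 where "t0 = min t1 (c / (2 * (M + 1)))"
  have t0: "0 < t0" "t0 \<le> t1" "t0 * M \<le> c / 2"
  proof -
    show "0 < t0" "t0 \<le> t1" using t1 c M by (auto simp: t0_def)
    have "t0 * M \<le> c / (2 * (M + 1)) * M" using M by (intro mult_right_mono) (auto simp: t0_def)
    also have "\<dots> \<le> c / 2" using M c by (simp add: field_simps)
    finally show "t0 * M \<le> c / 2" .
  qed
  have main: "0 \<le> A + t * B" if t: "0 < t" "t \<le> t0" for t
  proof -
    let ?G = "\<lambda>i x. G i x + t * K i x"
    let ?R = "\<lambda>x. wint G x + t * (G 1 x * K 1 x + P x * K 2 x) + t\<^sup>2 * (1 / 2 * (K 1 x)\<^sup>2 + (1 / 2 + C) * (K 2 x)\<^sup>2)"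
    have "t * M \<le> t0 * M" using t M by (intro mult_right_mono) auto
    then have tM: "t * M \<le> c / 2" using t0(3) by simp
    have ae': "AE x in lborel. x \<in> IQ \<longrightarrow> c / 2 \<le> 1 + G 2 x + t * K 2 x"
      using ae[of t] t t0(2) tM by (auto elim!: eventually_mono)
    have le: "AE x in lborel. wint ?G x \<le> ?R x"
      using ae'
    proof eventually_elim
      case (elim x)
      show ?case
      proof (cases "x \<in> IQ")
        case True
        have "h (1 + G 2 x + t * K 2 x) - h (1 + G 2 x) - deriv h (1 + G 2 x) * (t * K 2 x) \<le> C * (t * K 2 x)\<^sup>2"
          using C(2)[of "1 + G 2 x" "1 + G 2 x + t * K 2 x"] elim True det_ge[OF True] c by simp
        then show ?thesis
          using True by (simp add: wint_def w_def P_def power2_eq_square algebra_simps)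
      next
        case False
        then show ?thesis
          using L2Q_zero[OF zt2_L2Q(2)[OF zt2] False] L2Q_zero[OF zt2_L2Q(2)[OF zK] False] by (simp add: wint_def P_def)
      qed
    qed
    have i: "integrable lborel (\<lambda>x. G 1 x * K 1 x)" "integrable lborel (\<lambda>x. P x * K 2 x)"
        "integrable lborel (\<lambda>x. (K j x)\<^sup>2)" "integrable lborel (wint G)" for j
      using adm by (auto intro!: sqi_mult_integrable sqi_square K_sqi G_sqi L2Q_sqi[OF L2Q_P] simp: admissible_def)
    have Ri: "integrable lborel ?R"
      by (intro Bochner_Integration.integrable_add integrable_mult_right i)
    have wm [measurable]: "wint ?G \<in> borel_measurable borel"
      unfolding wint_def[abs_def] by measurable
    have Gi: "integrable lborel (wint ?G)"
    proof (rule Bochner_Integration.integrable_bound[OF Ri])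
      show "AE x in lborel. norm (wint ?G x) \<le> norm (?R x)"
        using le by eventually_elim (use wint_nonneg[of ?G] in \<open>auto simp: abs_of_nonneg intro: order_trans[OF _ abs_ge_self]\<close>)
    qed simp
    have ad: "admissible ?G"
      unfolding admissible_def
    proof
      show "AE x in lborel. x \<in> IQ \<longrightarrow> 1 + (G 2 x + t * K 2 x) > 0"
        using ae' by eventually_elim (use c in auto)
    qed (rule Gi)
    have "(\<integral>x. wint G x \<partial>lborel) \<le> (\<integral>x. wint ?G x \<partial>lborel)"
      by (rule minimal[OF zt2_lincomb[OF zt2 zK] ad])
    also have "\<dots> \<le> (\<integral>x. ?R x \<partial>lborel)"
      by (rule integral_mono_AE[OF Gi Ri le])
    also have "\<dots> = (\<integral>x. wint G x \<partial>lborel) + t * A + t\<^sup>2 * B"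
      using i by (simp add: A_def B_def)
    finally have "0 \<le> t * (A + t * B)" by (simp add: power2_eq_square algebra_simps)
    then show ?thesis using t(1) by (simp add: zero_le_mult_iff)
  qed
  have "(\<lambda>n. A + (t0 * inverse (real (Suc n))) * B) \<longlonglongrightarrow> A + (t0 * 0) * B"
    by (intro tendsto_intros LIMSEQ_inverse_real_of_nat)
  moreover have "0 \<le> A + (t0 * inverse (real (Suc n))) * B" for n
  proof (rule main)
    show "0 < t0 * inverse (real (Suc n))" using t0(1) by simp
    have "t0 * inverse (real (Suc n)) \<le> t0 * 1" using t0(1) by (intro mult_left_mono) (auto simp: field_simps)
    then show "t0 * inverse (real (Suc n)) \<le> t0" by simp
  qed
  ultimately have "0 \<le> A + (t0 * 0) * B" by (intro LIMSEQ_le_const) auto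
  then show ?thesis by (simp add: A_def)
qed

text \<open>The derivative of a test function is bounded, so \<open>variational_inequality\<close>
  applies to \<psi> and to -\<psi>.\<close>

lemma Euler_Lagrange:
  assumes t: "\<psi> \<in> test_functions IQ"
  shows "(\<integral>x. G 1 x * pd 1 \<psi> x \<partial>lborel) = - (\<integral>x. P x * pd 2 \<psi> x \<partial>lborel)"
proof -
  have le: "0 \<le> (\<integral>x. G 1 x * pd 1 \<psi> x \<partial>lborel) + (\<integral>x. P x * pd 2 \<psi> x \<partial>lborel)"
    if t: "\<psi> \<in> test_functions IQ" for \<psi>
  proof -
    obtain B where B: "0 \<le> B" "\<And>x. \<bar>pd 2 \<psi> x\<bar> \<le> B" by (rule test_bounded[OF test_pd[OF t]]) blast
    have v: "\<psi> (vector [a, r]) = 0" if "\<bar>a\<bar> = 1" for a r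
      by (rule test_zero_outside[OF t]) (use that in \<open>auto simp: IQ_iff abs_if split: if_splits\<close>)
    have zp: "zt2 (cut \<psi>) (\<lambda>i. cut (pd i \<psi>))"
      unfolding zt2_def by (intro conjI zt_smooth test_smooth[OF t] v) auto
    have "0 \<le> (\<integral>x. G 1 x * cut (pd 1 \<psi>) x \<partial>lborel) + (\<integral>x. P x * cut (pd 2 \<psi>) x \<partial>lborel)"
    proof (rule variational_inequality[OF zp B(1) zero_less_one], intro AE_I2 impI)
      fix r :: real and x assume r: "0 < r" and x: "x \<in> IQ"
      have "r * (- pd 2 \<psi> x) \<le> r * B" using r B(2)[of x] by (intro mult_left_mono) auto
      then show "c - r * B \<le> 1 + G 2 x + r * cut (pd 2 \<psi>) x" using x det_ge[OF x] by simp
    qed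
    moreover have "cut (pd i \<psi>) x = pd i \<psi> x" for i x
      using test_zero_outside[OF test_pd[OF t], of x i] by (cases "x \<in> IQ") auto
    ultimately show ?thesis by simp
  qed
  have s: "smooth \<psi>" by (rule test_smooth[OF t])
  have "pd i (\<lambda>x. (-1) * \<psi> x) x = - pd i \<psi> x" for i x
    using pd_cmult[OF s, of i "-1" x] by simp
  then have "0 \<le> - (\<integral>x. G 1 x * pd 1 \<psi> x \<partial>lborel) - (\<integral>x. P x * pd 2 \<psi> x \<partial>lborel)"
    using le[OF test_cmult[OF t, of "-1"]] by simp
  then show ?thesis using le[OF t] by simp
qed

lemma translate_weak_derivative:
  assumes t: "\<psi> \<in> test_functions U" and U: "\<And>x. x \<in> U \<Longrightarrow> x + r *\<^sub>R axis i 1 \<in> IQ"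
  shows "\<bar>\<integral>x. s x * pd i \<psi> (x - r *\<^sub>R axis i 1) \<partial>lborel\<bar> \<le> nrm lborel (G i) * nrm lborel \<psi>"
proof -
  let ?\<psi> = "\<lambda>x. \<psi> (x - r *\<^sub>R axis i 1)"
  have ts: "?\<psi> \<in> test_functions IQ" by (rule test_shift[OF t U])
  have "(\<integral>x. s x * pd i ?\<psi> x \<partial>lborel) = - (\<integral>x. G i x * ?\<psi> x \<partial>lborel)"
    by (rule zt_weak[OF z(1) ts])
  moreover have "pd i ?\<psi> x = pd i \<psi> (x - r *\<^sub>R axis i 1)" for x
    using pd_shift[OF test_smooth[OF t], of i "- (r *\<^sub>R axis i 1)" x] by simp
  moreover have "nrm lborel ?\<psi> = nrm lborel \<psi>"
    using sqi_shift(2)[OF sqi_test[OF t], of "- (r *\<^sub>R axis i 1)"] by simp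
  ultimately show ?thesis
    using Cauchy_Schwarz_L2[OF G_sqi sqi_test[OF ts], of i] by simp
qed

lemma open_strip: "open {x \<in> IQ. \<bar>x $ i\<bar> < a}"
proof -
  have "open {x :: real^2. \<bar>x $ i\<bar> < a}" by (intro open_Collect_less continuous_intros)
  then have "open (IQ \<inter> {x :: real^2. \<bar>x $ i\<bar> < a})" by (intro open_Int) auto
  then show ?thesis by (simp add: Int_def)
qed

text \<open>The test function yields the weighted square of the differences of the gradient, up to a
  term in which the cutoff is differentiated. Young's inequality absorbs part of that term and
  leaves the L2 norm of the difference of s, which is of order h.\<close>

lemma difference_estimate:
  assumes a: "0 < a'" "a' < a" "a < 1"
    and bdd: "i = 2 \<Longrightarrow> AE x in lborel. x \<in> IQ \<longrightarrow> \<bar>x $ 2\<bar> \<le> (1 + a) / 2 \<longrightarrow> \<bar>s x\<bar> \<le> M"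
  obtains C where "0 \<le> C" "\<And>h j. 0 < h \<Longrightarrow> h < (1 - a) / 2 \<Longrightarrow>
    nrm lborel (\<lambda>x. indicator {x \<in> IQ. \<bar>x $ i\<bar> < a'} x * (G j (x + h *\<^sub>R axis i 1) - G j x)) \<le> C * h"
proof -
  obtain X :: "real \<Rightarrow> real" where X: "smooth X" "\<And>t. 0 \<le> X t" "\<And>t. X t \<le> 1"
    "\<And>t. \<bar>t\<bar> \<le> a' \<Longrightarrow> X t = 1" "\<And>t. \<bar>t\<bar> \<ge> a \<Longrightarrow> X t = 0"
    by (rule smooth_cutoff[OF a(1,2)]) blast
  have dX: "(X has_real_derivative deriv X t) (at t)" for t by (rule smooth_deriv_exists[OF X(1)])
  obtain B where B: "0 \<le> B" "\<And>t. \<bar>deriv X t\<bar> \<le> B"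
  proof -
    have dz: "deriv X t = 0" if "t \<notin> {-a..a}" for t
    proof -
      have "((\<lambda>_. 0) has_real_derivative 0) (at t)" by simp
      then have "(X has_real_derivative 0) (at t)"
        by (rule has_field_derivative_transform_within_open[of _ _ _ "- {-a..a}"]) (use that X(5) in \<open>auto simp: abs_if\<close>)
      then show ?thesis by (rule DERIV_imp_deriv)
    qed
    have "deriv X \<in> test_functions UNIV"
      by (rule test_functionsI[OF smooth_deriv[OF X(1)], of "{-a..a}"]) (use dz in auto)
    then show ?thesis using that by (rule test_bounded)
  qed
  \<comment> \<open>The cutoff is a square so that its derivative 2 X X' still carries a factor X,
    which the absorption in \<open>RS\<close> needs.\<close>
  define \<theta> where "\<theta> t = X t * X t" for t
  have th: "smooth \<theta>" "\<And>t. \<bar>t\<bar> \<ge> a \<Longrightarrow> \<theta> t = 0" "\<And>t. \<bar>\<theta> t\<bar> \<le> 1" "\<And>t. 0 \<le> \<theta> t"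
    using X by (auto simp: \<theta>_def[abs_def] abs_mult intro!: mult_le_one)
  have dth: "deriv \<theta> t = 2 * (X t * deriv X t)" for t
    unfolding \<theta>_def[abs_def] using DERIV_mult[OF dX dX, of t] by (intro DERIV_imp_deriv) simp
  have dth0: "deriv \<theta> t = 0" if "\<bar>t\<bar> \<ge> a" for t using X(5)[OF that] by (simp add: dth)
  have dthB: "\<bar>deriv \<theta> t\<bar> \<le> 2 * B" for t
    using mult_mono[OF X(3)[of t] B(2)[of t]] X(2)[of t] by (simp add: dth abs_mult)
  have tm: "\<theta> \<in> borel_measurable borel" "deriv \<theta> \<in> borel_measurable borel" "X \<in> borel_measurable borel"
    using smooth_borel th(1) smooth_deriv[OF th(1)] X(1) by auto
  obtain L where L: "1 \<le> L" "\<And>x y. x \<in> IQ \<Longrightarrow> y \<in> IQ \<Longrightarrow> \<bar>P x - P y\<bar> \<le> L * \<bar>G 2 x - G 2 y\<bar>"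
    by (rule P_Lipschitz) blast
  \<comment> \<open>The square root of 4 (B L)^2 N^2, with N at most h times the norm of
    \<open>G i\<close>, gives C h.\<close>
  define C where "C = 2 * B * L * nrm lborel (G i)"
  have C0: "0 \<le> C" using B(1) L(1) by (simp add: C_def)
  have "nrm lborel (\<lambda>x. indicator {x \<in> IQ. \<bar>x $ i\<bar> < a'} x * (G j (x + h *\<^sub>R axis i 1) - G j x)) \<le> C * h"
    if hh: "0 < h" "h < (1 - a) / 2" for h j
  proof -
    interpret strip_weight i a h by unfold_locales (use a hh in auto)
    define Ea where "Ea = {x \<in> IQ. \<bar>x $ i\<bar> < a}"
    define N where "N = nrm lborel (\<lambda>x. indicator Ea x * (s (x + v) - s x))"
    have N: "N \<le> nrm lborel (G i) * h"
      unfolding N_def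
    proof (rule translation_estimate)
      show "open Ea" unfolding Ea_def by (rule open_strip)
      fix \<psi> and r :: real assume ps: "\<psi> \<in> test_functions Ea" and r: "0 \<le> r" "r \<le> h"
      show "\<bar>\<integral>x. s x * pd i \<psi> (x - r *\<^sub>R axis i 1) \<partial>lborel\<bar> \<le> nrm lborel (G i) * nrm lborel \<psi>"
      proof (rule translate_weak_derivative[OF ps])
        fix x assume x: "x \<in> Ea"
        show "x + r *\<^sub>R axis i 1 \<in> IQ"
        proof (cases "r = 0")
          case True
          then show ?thesis using x by (simp add: Ea_def)
        next
          case False
          interpret sr: strip_weight i a r by unfold_locales (use a hh r False in auto)
          show ?thesis using x sr.strip_shift(1)[of x] by (auto simp: Ea_def)
        qed
      qed
    qed (use s_sqi hh in auto)
    have N0: "0 \<le> N" by (simp add: N_def)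
    \<comment> \<open>The stress, which the variational inequality pairs with the gradient of the
      test function.\<close>
    define V where "V j = (if j = 1 then G 1 else P)" for j :: 2
    have V: "sqi lborel (V j)" for j using G_sqi L2Q_sqi[OF L2Q_P] by (simp add: V_def)
    let ?b = "\<lambda>x. \<theta> (x $ i)" and ?b' = "\<lambda>x. deriv \<theta> (x $ i)"
    have bm: "?b \<in> borel_measurable borel" "?b' \<in> borel_measurable borel" using tm by auto
    have bB: "\<bar>?b x\<bar> \<le> 1" "\<bar>?b' x\<bar> \<le> 2 * B" for x by (rule th(3) dthB)+
    define K where "K j x = ddiff ?b v (G j) x + (if j = i then ddiff ?b' v s x else 0)" for j x
    have zK: "zt2 (ddiff ?b v s) K"
      unfolding zt2_def K_def[abs_def]
      by (intro conjI zt_ddiff[OF th(1,2,3) dth0 dthB] z) auto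
    define DG where "DG j x = G j (x + v) - G j x" for j x
    define DV where "DV j x = V j (x + v) - V j x" for j x
    define Ds where "Ds x = s (x + v) - s x" for x
    have D_sqi: "sqi lborel (DG j)" "sqi lborel (DV j)" "sqi lborel Ds" for j
      unfolding DG_def[abs_def] DV_def[abs_def] Ds_def[abs_def] by (intro sqi_diff sqi_shift G_sqi V s_sqi)+
    have VI: "0 \<le> (\<integral>x. G 1 x * K 1 x \<partial>lborel) + (\<integral>x. P x * K 2 x \<partial>lborel)"
    proof -
      \<comment> \<open>For t <= 1/2 the weights p and q are at most 1/2, so the perturbed
        determinant is a convex combination of three values, each at least c where its weight is not
        0.\<close>
      have inner: "c \<le> 1 + G 2 x + t * ddiff ?b v (G 2) x" if t: "0 < t" "t \<le> 1 / 2" and x: "x \<in> IQ" for t x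
      proof -
        define p q where "p = t * ?b x" and "q = t * ?b (x - v)"
        have pq: "0 \<le> p" "0 \<le> q" "p \<le> 1 / 2" "q \<le> 1 / 2"
          using t th(4)[of "x $ i"] th(4)[of "(x - v) $ i"] th(3)[of "x $ i"] th(3)[of "(x - v) $ i"]
            mult_mono[of t "1/2" "?b x" 1] mult_mono[of t "1/2" "?b (x - v)" 1]
          by (auto simp: p_def q_def)
        have "p * c \<le> p * (1 + G 2 (x + v))"
        proof (cases "\<bar>x $ i\<bar> < a")
          case True
          then show ?thesis using strip_shift(1)[OF True] x pq by (intro mult_left_mono det_ge) auto
        qed (use th(2) in \<open>simp add: p_def\<close>)
        moreover have "q * c \<le> q * (1 + G 2 (x - v))"
        proof (cases "\<bar>(x - v) $ i\<bar> < a")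
          case True
          then show ?thesis using strip_shift(2)[OF True] x pq by (intro mult_left_mono det_ge) auto
        next
          case False
          then have "q = 0" using th(2)[of "(x - v) $ i"] by (simp add: q_def)
          then show ?thesis by simp
        qed
        moreover have "(1 - p - q) * c \<le> (1 - p - q) * (1 + G 2 x)"
          using pq by (intro mult_left_mono det_ge x) auto
        moreover have "1 + G 2 x + t * ddiff ?b v (G 2) x =
            (1 - p - q) * (1 + G 2 x) + p * (1 + G 2 (x + v)) + q * (1 + G 2 (x - v))"
          by (simp add: ddiff_eq p_def q_def algebra_simps)
        moreover have "c = (1 - p - q) * c + p * c + q * c" by (simp add: algebra_simps)
        ultimately show ?thesis by linarith
      qed
      \<comment> \<open>The differentiated cutoff contributes two products of a weight at most 2 B
        with a difference at most 2 |M|. A shift by h < (1 - a)/2 takes |x_2| < a into |x_2| <= (1 +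
        a)/2, where s is bounded.\<close>
      have outer: "AE x in lborel. x \<in> IQ \<longrightarrow> \<bar>ddiff ?b' v s x\<bar> \<le> 8 * B * \<bar>M\<bar>" if i: "i = 2"
      proof -
        note b1 = bdd[OF i]
        note b2 = AE_lborel_shift[OF b1, of v] AE_lborel_shift[OF b1, of "- v"]
        show ?thesis using b1 b2
        proof eventually_elim
          case (elim x)
          show ?case
          proof
            assume x: "x \<in> IQ"
            have 1: "\<bar>?b' x * (s (x + v) - s x)\<bar> \<le> 2 * B * (2 * \<bar>M\<bar>)"
            proof (cases "\<bar>x $ i\<bar> < a")
              case True
              have "\<bar>s x\<bar> \<le> M" using elim(1) x True i a by auto
              moreover have "\<bar>s (x + v)\<bar> \<le> M"
              proof -
                have "\<bar>x $ i + h\<bar> \<le> (1 + a) / 2" using True hh unfolding abs_le_iff abs_less_iff by argo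
                then show ?thesis
                  using elim(2) x strip_shift(1)[OF True] i coord_shift(1)[of x] by simp
              qed
              ultimately have "\<bar>s (x + v) - s x\<bar> \<le> 2 * \<bar>M\<bar>" by linarith
              then show ?thesis unfolding abs_mult using bB(2)[of x] B(1) by (intro mult_mono) auto
            next
              case False
              then show ?thesis using dth0[of "x $ i"] B(1) by simp
            qed
            have 2: "\<bar>?b' (x - v) * (s (x - v) - s x)\<bar> \<le> 2 * B * (2 * \<bar>M\<bar>)"
            proof (cases "\<bar>(x - v) $ i\<bar> < a")
              case True
              have "\<bar>s x\<bar> \<le> M"
              proof -
                have "\<bar>x $ i\<bar> \<le> (1 + a) / 2"
                  using True hh unfolding coord_shift(2) abs_le_iff abs_less_iff by argo
                then show ?thesis using elim(1) x i by simp
              qed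
              moreover have "\<bar>s (x - v)\<bar> \<le> M"
                using elim(3) x strip_shift(2)[OF True] True i a by auto
              ultimately have "\<bar>s (x - v) - s x\<bar> \<le> 2 * \<bar>M\<bar>" by linarith
              then show ?thesis unfolding abs_mult using bB(2)[of "x - v"] B(1) by (intro mult_mono) auto
            next
              case False
              then have "?b' (x - v) = 0" by (intro dth0) simp
              then show ?thesis using B(1) by simp
            qed
            show "\<bar>ddiff ?b' v s x\<bar> \<le> 8 * B * \<bar>M\<bar>"
              unfolding ddiff_eq using 1 2 by linarith
          qed
        qed
      qed
      show ?thesis
      proof (rule variational_inequality[OF zK, of "8 * B * \<bar>M\<bar>" "1 / 2"])
        fix t :: real assume t: "0 < t" "t \<le> 1 / 2"
        show "AE x in lborel. x \<in> IQ \<longrightarrow> c - t * (8 * B * \<bar>M\<bar>) \<le> 1 + G 2 x + t * K 2 x"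
        proof (cases "i = 2")
          case True
          show ?thesis using outer[OF True]
          proof eventually_elim
            case (elim x)
            show ?case
            proof
              assume x: "x \<in> IQ"
              have "t * (- ddiff ?b' v s x) \<le> t * (8 * B * \<bar>M\<bar>)"
                using elim x t by (intro mult_left_mono) auto
              then show "c - t * (8 * B * \<bar>M\<bar>) \<le> 1 + G 2 x + t * K 2 x"
                using inner[OF t x] True by (simp add: K_def distrib_left)
            qed
          qed
        next
          case False
          have nn: "0 \<le> t * (8 * B * \<bar>M\<bar>)" using t B(1) by simp
          have K2: "K 2 x = ddiff ?b v (G 2) x" for x using False by (simp add: K_def)
          show ?thesis
          proof (intro AE_I2 impI)
            fix x assume "x \<in> IQ"
            from inner[OF t this] nn show "c - t * (8 * B * \<bar>M\<bar>) \<le> 1 + G 2 x + t * K 2 x"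
              unfolding K2 by linarith
          qed
        qed
      qed (use B(1) in auto)
    qed
    \<comment> \<open>T is the coercive part of the tested inequality, R the error from
      differentiating the cutoff.\<close>
    define T where "T j x = wdiff ?b v (G j) x * DV j x" for j x
    define R where "R x = wdiff ?b' v s x * DV i x" for x
    have w_sqi: "sqi lborel (wdiff ?b v (G j))" "sqi lborel (wdiff ?b' v s)" for j
      by (rule sqi_wdiff(1)[OF G_sqi bm(1) bB(1)] sqi_wdiff(1)[OF s_sqi bm(2) bB(2)])+
    have Ti: "integrable lborel (T j)" "integrable lborel R" for j
      unfolding T_def[abs_def] R_def[abs_def] by (intro sqi_mult_integrable w_sqi D_sqi)+
    have VK: "(\<integral>x. V j x * K j x \<partial>lborel) = - (\<integral>x. T j x \<partial>lborel) - (if j = i then \<integral>x. R x \<partial>lborel else 0)" for j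
    proof -
      have 1: "(\<integral>x. V j x * ddiff ?b v (G j) x \<partial>lborel) = - (\<integral>x. T j x \<partial>lborel)"
        unfolding T_def DV_def by (rule integral_ddiff[OF G_sqi V bm(1) bB(1)])
      have 2: "(\<integral>x. V i x * ddiff ?b' v s x \<partial>lborel) = - (\<integral>x. R x \<partial>lborel)"
        unfolding R_def DV_def by (rule integral_ddiff[OF s_sqi V bm(2) bB(2)])
      have i1: "integrable lborel (\<lambda>x. V j x * ddiff ?b v (G j) x)" "integrable lborel (\<lambda>x. V i x * ddiff ?b' v s x)"
        by (intro sqi_mult_integrable V sqi_wdiff(3)[OF G_sqi bm(1) bB(1)] sqi_wdiff(3)[OF s_sqi bm(2) bB(2)])+
      show ?thesis
      proof (cases "j = i")
        case True
        have "(\<integral>x. V j x * K j x \<partial>lborel) = (\<integral>x. V j x * ddiff ?b v (G j) x + V i x * ddiff ?b' v s x \<partial>lborel)"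
          using True by (simp add: K_def distrib_left)
        then show ?thesis using True 1 2 i1 by simp
      next
        case False
        then show ?thesis using 1 by (simp add: K_def)
      qed
    qed
    have sumT: "(\<integral>x. T 1 x \<partial>lborel) + (\<integral>x. T 2 x \<partial>lborel) \<le> - (\<integral>x. R x \<partial>lborel)"
    proof -
      have "0 \<le> (\<integral>x. V 1 x * K 1 x \<partial>lborel) + (\<integral>x. V 2 x * K 2 x \<partial>lborel)" using VI by (simp add: V_def)
      then show ?thesis unfolding VK using exhaust_2[of i] by (auto split: if_splits)
    qed
    define S where "S j x = (X (x $ i) * DG j x)\<^sup>2" for j x
    have S_sqi: "sqi lborel (\<lambda>x. X (x $ i) * DG j x)" for j
      by (rule sqi_bounded_mult(1)[OF D_sqi(1), where B=1]) (use tm(3) X in auto)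
    have Si: "integrable lborel (S j)" for j
      unfolding S_def[abs_def] by (rule sqi_square[OF S_sqi])
    \<comment> \<open>For j = 1 this is an equality, for j = 2 it is the monotonicity of P.\<close>
    have ST: "S j x \<le> T j x" for j x
    proof (cases "\<bar>x $ i\<bar> < a \<and> j = 2")
      case True
      show ?thesis
      proof (cases "x \<in> IQ")
        case xi: True
        then have "x + v \<in> IQ" using strip_shift(1)[of x] True by blast
        from P_monotone[OF this xi] have "X (x $ i) * X (x $ i) * (DG 2 x)\<^sup>2 \<le> X (x $ i) * X (x $ i) * (DV 2 x * DG 2 x)"
          by (intro mult_left_mono) (auto simp: DV_def DG_def V_def X(2))
        then show ?thesis using True by (simp add: S_def T_def wdiff_def DG_def \<theta>_def power2_eq_square ac_simps)
      next
        case False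
        then have "x + v \<notin> IQ" using strip_shift(1)[of x] True by blast
        then have "DG j x = 0" using False L2Q_zero[OF zt2_L2Q(2)[OF zt2]] by (simp add: DG_def)
        then show ?thesis by (simp add: S_def T_def wdiff_def DG_def)
      qed
    next
      case False
      then have "X (x $ i) = 0 \<or> j = 1" using X(5)[of "x $ i"] exhaust_2[of j] by force
      then show ?thesis
        by (auto simp: S_def T_def wdiff_def DG_def DV_def V_def \<theta>_def power2_eq_square ac_simps)
    qed
    \<comment> \<open>Young's inequality in the form 2 p q <= p^2/2 + 2 q^2, with the factor X that
      survives in \<theta>' put into p.\<close>
    have RS: "- R x \<le> S i x / 2 + 2 * (B * L)\<^sup>2 * (indicator Ea x * Ds x)\<^sup>2" for x
    proof (cases "\<bar>x $ i\<bar> < a")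
      case True
      show ?thesis
      proof (cases "x \<in> IQ")
        case xi: True
        then have xv: "x + v \<in> IQ" using strip_shift(1)[OF True] by blast
        have DVL: "\<bar>DV i x\<bar> \<le> L * \<bar>DG i x\<bar>"
        proof (cases "i = 1")
          case True
          have "1 * \<bar>DG 1 x\<bar> \<le> L * \<bar>DG 1 x\<bar>" using L(1) by (intro mult_right_mono) auto
          then show ?thesis using True by (simp add: DV_def DG_def V_def)
        next
          case False
          then have "i = 2" using exhaust_2[of i] by blast
          then show ?thesis using L(2)[OF xv xi] by (simp add: DV_def DG_def V_def)
        qed
        define p q where "p = X (x $ i) * \<bar>DG i x\<bar>" and "q = B * L * \<bar>Ds x\<bar>"
        have "- R x \<le> \<bar>?b' x\<bar> * \<bar>Ds x\<bar> * \<bar>DV i x\<bar>"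
          unfolding R_def wdiff_def Ds_def[symmetric] abs_mult[symmetric] by linarith
        also have "\<dots> \<le> (2 * (X (x $ i) * B)) * \<bar>Ds x\<bar> * (L * \<bar>DG i x\<bar>)"
        proof (intro mult_mono DVL mult_right_mono)
          show "\<bar>?b' x\<bar> \<le> 2 * (X (x $ i) * B)"
            using X(2) B by (auto simp: dth abs_mult intro!: mult_left_mono)
        qed (use X(2) B(1) L(1) in auto)
        also have "\<dots> = 2 * (p * q)" by (simp add: p_def q_def)
        also have "\<dots> \<le> p\<^sup>2 / 2 + 2 * q\<^sup>2"
        proof -
          have "0 \<le> (p - 2 * q)\<^sup>2" by simp
          then show ?thesis by (simp add: power2_eq_square field_simps)
        qed
        also have "\<dots> = S i x / 2 + 2 * (B * L)\<^sup>2 * (indicator Ea x * Ds x)\<^sup>2"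
          using xi True by (simp add: p_def q_def S_def Ea_def power_mult_distrib)
        finally show ?thesis .
      next
        case False
        then have "x + v \<notin> IQ" using strip_shift(1)[OF True] by blast
        then have "R x = 0" using False L2Q_zero[OF zt2_L2Q(1)[OF zt2]] by (simp add: R_def wdiff_def)
        then show ?thesis by (simp add: S_def)
      qed
    next
      case False
      then have "R x = 0" using dth0[of "x $ i"] by (simp add: R_def wdiff_def)
      then show ?thesis by (simp add: S_def)
    qed
    have E_sqi: "sqi lborel (\<lambda>x. indicator Ea x * Ds x)"
    proof (rule sqi_bounded_mult(1)[OF D_sqi(3), where B=1])
      have "open Ea" unfolding Ea_def by (rule open_strip)
      then show "indicator Ea \<in> borel_measurable lborel" by (intro borel_measurable_indicator) auto
    qed (auto simp: indicator_def)
    have "- (\<integral>x. R x \<partial>lborel) = (\<integral>x. - R x \<partial>lborel)" by simp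
    also have "\<dots> \<le> (\<integral>x. S i x / 2 + 2 * (B * L)\<^sup>2 * (indicator Ea x * Ds x)\<^sup>2 \<partial>lborel)"
      by (rule integral_mono[OF _ _ RS])
        (use Ti Si sqi_square[OF E_sqi] in auto)
    also have "\<dots> = (\<integral>x. S i x \<partial>lborel) / 2 + 2 * (B * L)\<^sup>2 * N\<^sup>2"
      using Si sqi_square[OF E_sqi] by (simp add: N_def nrm_square Ds_def)
    finally have up: "- (\<integral>x. R x \<partial>lborel) \<le> (\<integral>x. S i x \<partial>lborel) / 2 + 2 * (B * L)\<^sup>2 * N\<^sup>2" .
    have S0: "0 \<le> (\<integral>x. S j x \<partial>lborel)" for j by (simp add: S_def)
    have SiT: "(\<integral>x. S j x \<partial>lborel) \<le> (\<integral>x. T j x \<partial>lborel)" for j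
      by (intro integral_mono Si Ti ST)
    \<comment> \<open>After integration S 1 + S 2 is at most S i / 2 + 2 (B L)^2 N^2, and the half
      of S i is absorbed on the left.\<close>
    have Sj: "(\<integral>x. S j x \<partial>lborel) \<le> 4 * (B * L)\<^sup>2 * N\<^sup>2"
    proof -
      have "i = 1 \<or> i = 2" "j = 1 \<or> j = 2" by (rule exhaust_2)+
      then show ?thesis
        using up sumT SiT[of 1] SiT[of 2] S0[of 1] S0[of 2] by auto
    qed
    have "(nrm lborel (\<lambda>x. indicator {x \<in> IQ. \<bar>x $ i\<bar> < a'} x * DG j x))\<^sup>2 \<le> (\<integral>x. S j x \<partial>lborel)"
      unfolding nrm_square
    proof (rule integral_mono[OF _ Si])
      have m: "indicator {x \<in> IQ. \<bar>x $ i\<bar> < a'} \<in> borel_measurable lborel"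
        using open_strip[of i a'] by (intro borel_measurable_indicator) auto
      show "integrable lborel (\<lambda>x. (indicator {x \<in> IQ. \<bar>x $ i\<bar> < a'} x * DG j x)\<^sup>2)"
        by (intro sqi_square sqi_bounded_mult(1)[OF D_sqi(1) m, where B=1]) (auto simp: indicator_def)
      show "(indicator {x \<in> IQ. \<bar>x $ i\<bar> < a'} x * DG j x)\<^sup>2 \<le> S j x" for x
        using X(4)[of "x $ i"] by (auto simp: S_def indicator_def)
    qed
    also have "\<dots> \<le> 4 * (B * L)\<^sup>2 * N\<^sup>2" by (rule Sj)
    also have "\<dots> = (2 * B * L * N)\<^sup>2" by (simp add: power2_eq_square)
    also have "\<dots> \<le> (C * h)\<^sup>2"
    proof (rule power_mono)
      have "2 * B * L * N \<le> 2 * B * L * (nrm lborel (G i) * h)"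
        using B(1) L(1) by (intro mult_left_mono N) auto
      then show "2 * B * L * N \<le> C * h" by (simp add: C_def)
    qed (use B(1) L(1) N0 in auto)
    finally have "nrm lborel (\<lambda>x. indicator {x \<in> IQ. \<bar>x $ i\<bar> < a'} x * DG j x) \<le> C * h"
      by (rule power2_le_imp_le) (use C0 hh in simp)
    then show ?thesis by (simp only: DG_def)
  qed
  then show ?thesis by (rule that[OF C0])
qed

end

subsection \<open>Second weak derivatives\<close>

context regular_minimizer
begin

text \<open>Both sides are minus the integral of s times a second derivative of \<phi>. In place of
  symmetry of second derivatives, the proof uses that a difference quotient in direction j commutes
  with \<open>pd i\<close>.\<close>

lemma mixed_derivatives:
  assumes t: "\<phi> \<in> test_functions IQ"
  shows "(\<integral>x. G i x * pd j \<phi> x \<partial>lborel) = (\<integral>x. G j x * pd i \<phi> x \<partial>lborel)"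
proof -
  obtain K where K: "smooth \<phi>" "compact K" "K \<subseteq> IQ" "\<And>x. x \<notin> K \<Longrightarrow> \<phi> x = 0"
    by (rule test_functionsE[OF t]) blast
  have tK: "\<phi> \<in> test_functions K" by (rule test_functionsI[OF K(1,2) order_refl K(4)])
  \<comment> \<open>A margin around the support: translates of \<phi> by less than e are still test
    functions in \<open>IQ\<close>.\<close>
  obtain e where e: "e > 0" "(\<Union>x\<in>K. ball x e) \<subseteq> IQ"
    by (rule compact_subset_open_imp_ball_epsilon_subset[OF K(2) open_interior K(3)])
  define k where "k n = min (e / 2) 1 * inverse (real (Suc n))" for n
  have k: "0 < k n" "k n < e" "k n \<le> 1" for n
  proof -
    have le: "inverse (real (Suc n)) \<le> 1" by (simp add: field_simps)
    show "0 < k n" using e(1) by (simp add: k_def)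
    have "k n \<le> min (e / 2) 1 * 1"
      unfolding k_def by (intro mult_left_mono le) (use e(1) in simp)
    then show "k n < e" "k n \<le> 1" using e(1) by auto
  qed
  have "k \<longlonglongrightarrow> min (e / 2) 1 * 0"
    unfolding k_def by (intro tendsto_intros LIMSEQ_inverse_real_of_nat)
  then have lim: "k \<longlonglongrightarrow> 0" by simp
  have k': "k n \<noteq> 0" "\<bar>k n\<bar> \<le> 1" for n using k(1,3)[of n] by auto
  let ?D = "\<lambda>n u x. (u (x + k n *\<^sub>R axis j 1) - u x) / k n"
  have shift: "(\<lambda>x. \<phi> (x + k n *\<^sub>R axis j 1)) \<in> test_functions IQ" for n
  proof -
    have "x + (- (k n *\<^sub>R axis j 1)) \<in> IQ" if "x \<in> K" for x
    proof -
      have "x + (- (k n *\<^sub>R axis j 1)) \<in> ball x e" using k(1,2)[of n] by (simp add: dist_norm)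
      then show ?thesis using e(2) that by blast
    qed
    from test_shift[OF tK, of "- (k n *\<^sub>R axis j 1)", OF this] show ?thesis by simp
  qed
  have D: "?D n \<phi> \<in> test_functions IQ" for n
    using test_cmult[OF test_add[OF shift[of n] test_cmult[OF t, of "-1"]], of "1 / k n"] by simp
  have pdD: "pd i (?D n \<phi>) x = ?D n (pd i \<phi>) x" for n x
  proof -
    have s: "smooth (\<lambda>x. \<phi> (x + k n *\<^sub>R axis j 1))" by (rule smooth_shift[OF K(1)])
    have "pd i (\<lambda>x. (1 / k n) * (\<phi> (x + k n *\<^sub>R axis j 1) - \<phi> x)) x = (1 / k n) * (pd i \<phi> (x + k n *\<^sub>R axis j 1) - pd i \<phi> x)"
      by (subst pd_cmult[OF smooth_diff[OF s K(1)]]) (simp only: pd_diff[OF s K(1)] pd_shift[OF K(1)])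
    then show ?thesis by simp
  qed
  have 1: "(\<lambda>n. \<integral>x. G i x * ?D n \<phi> x \<partial>lborel) \<longlonglongrightarrow> (\<integral>x. G i x * pd j \<phi> x \<partial>lborel)"
    by (rule integral_difference_quotient_tendsto[OF t G_sqi lim k'])
  have 2: "(\<lambda>n. \<integral>x. s x * ?D n (pd i \<phi>) x \<partial>lborel) \<longlonglongrightarrow> (\<integral>x. s x * pd j (pd i \<phi>) x \<partial>lborel)"
    by (rule integral_difference_quotient_tendsto[OF test_pd[OF t] s_sqi lim k'])
  have eq: "(\<integral>x. s x * ?D n (pd i \<phi>) x \<partial>lborel) = - (\<integral>x. G i x * ?D n \<phi> x \<partial>lborel)" for n
    using zt_weak[OF z(1) D[of n], of i] by (simp only: pdD)
  have "(\<integral>x. s x * pd j (pd i \<phi>) x \<partial>lborel) = - (\<integral>x. G i x * pd j \<phi> x \<partial>lborel)"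
    using LIMSEQ_unique[OF 2[unfolded eq] tendsto_minus[OF 1]] .
  moreover have "(\<integral>x. s x * pd j (pd i \<phi>) x \<partial>lborel) = - (\<integral>x. G j x * pd i \<phi> x \<partial>lborel)"
    by (rule zt_weak[OF z(1) test_pd[OF t]])
  ultimately show ?thesis by simp
qed

lemma strip_subset: "test_functions {x \<in> IQ. \<bar>x $ i\<bar> < a} \<subseteq> test_functions IQ"
  by (rule test_mono) auto

lemma tangential_difference:
  assumes a': "0 < a'" "a' < 1"
  obtains C \<epsilon> where "0 \<le> C" "0 < \<epsilon>" "\<epsilon> < 1 - a'" "\<And>h j. 0 < h \<Longrightarrow> h < \<epsilon> \<Longrightarrow>
    nrm lborel (\<lambda>x. indicator {x \<in> IQ. \<bar>x $ i\<bar> < a'} x * (G j (x + h *\<^sub>R axis i 1) - G j x)) \<le> C * h"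
proof -
  \<comment> \<open>Halfway to 1: the cutoff drops between a' and a, and the height (1 + a)/2 up to
    which s must be bounded is still below 1.\<close>
  define a where "a = (a' + 1) / 2"
  have a: "a' < a" "a < 1" using a' by (auto simp: a_def)
  have nn: "0 \<le> 1 + G 2 x" if "x \<in> IQ" for x using det_ge[OF that] c by simp
  obtain M where M: "AE x in lborel. x \<in> IQ \<longrightarrow> \<bar>x $ 2\<bar> \<le> (1 + a) / 2 \<longrightarrow> \<bar>s x\<bar> \<le> M"
    by (rule locally_bounded[OF z(1) nn, of "(1 + a) / 2"]) (use a in auto)
  obtain C where "0 \<le> C" "\<And>h j. 0 < h \<Longrightarrow> h < (1 - a) / 2 \<Longrightarrow>
    nrm lborel (\<lambda>x. indicator {x \<in> IQ. \<bar>x $ i\<bar> < a'} x * (G j (x + h *\<^sub>R axis i 1) - G j x)) \<le> C * h"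
    by (rule difference_estimate[OF a'(1) a M]) blast
  then show ?thesis using a by (intro that[of C "(1 - a) / 2"]) auto
qed

lemma tangential_bound:
  assumes a': "0 < a'" "a' < 1"
  obtains C where "0 \<le> C" "\<And>j \<phi>. \<phi> \<in> test_functions {x \<in> IQ. \<bar>x $ i\<bar> < a'} \<Longrightarrow>
    \<bar>\<integral>x. G j x * pd i \<phi> x \<partial>lborel\<bar> \<le> C * nrm lborel \<phi>"
proof -
  obtain C \<epsilon> where C: "0 \<le> C" "0 < \<epsilon>" "\<epsilon> < 1 - a'" "\<And>h j. 0 < h \<Longrightarrow> h < \<epsilon> \<Longrightarrow>
    nrm lborel (\<lambda>x. indicator {x \<in> IQ. \<bar>x $ i\<bar> < a'} x * (G j (x + h *\<^sub>R axis i 1) - G j x)) \<le> C * h"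
    by (rule tangential_difference[OF a']) blast
  show ?thesis
    by (rule that[OF C(1)]) (rule weak_bound_of_difference_quotients[OF G_sqi _ open_strip C(2) C(4)])
qed

lemma strip_shift_IQ:
  assumes "x \<in> IQ" "\<bar>x $ i\<bar> < a'" "0 \<le> r" "r \<le> 1 - a'"
  shows "x + r *\<^sub>R axis i 1 \<in> IQ"
proof -
  have "\<bar>(x + r *\<^sub>R axis i 1) $ k\<bar> < 1" for k
    using assms exhaust_2[of k] by (cases "k = i") (auto simp: IQ_iff axis_def abs_less_iff)
  from this[of 1] this[of 2] show ?thesis
    unfolding IQ_iff abs_less_iff by linarith
qed

text \<open>Away from the free sides the differences of \<open>G 2\<close> in direction 2 are
  controlled, hence those of P, which is Lipschitz in \<open>G 2\<close>. The Euler-Lagrange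
  equation turns the resulting bound on the derivative of P into one on the derivative of
  \<open>G 1\<close> in direction 1.\<close>

lemma normal_bound_Dirichlet:
  assumes a': "0 < a'" "a' < 1"
  obtains C where "0 \<le> C" "\<And>\<phi>. \<phi> \<in> test_functions {x \<in> IQ. \<bar>x $ 2\<bar> < a'} \<Longrightarrow>
    \<bar>\<integral>x. G 1 x * pd 1 \<phi> x \<partial>lborel\<bar> \<le> C * nrm lborel \<phi>"
proof -
  obtain C \<epsilon> where C: "0 \<le> C" "0 < \<epsilon>" "\<epsilon> < 1 - a'" "\<And>h j. 0 < h \<Longrightarrow> h < \<epsilon> \<Longrightarrow>
    nrm lborel (\<lambda>x. indicator {x \<in> IQ. \<bar>x $ 2\<bar> < a'} x * (G j (x + h *\<^sub>R axis 2 1) - G j x)) \<le> C * h"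
    by (rule tangential_difference[OF a', of 2]) blast
  obtain L where L: "1 \<le> L" "\<And>x y. x \<in> IQ \<Longrightarrow> y \<in> IQ \<Longrightarrow> \<bar>P x - P y\<bar> \<le> L * \<bar>G 2 x - G 2 y\<bar>"
    by (rule P_Lipschitz) blast
  let ?U = "{x \<in> IQ. \<bar>x $ 2\<bar> < a'}"
  have m: "indicator ?U \<in> borel_measurable lborel"
    using open_strip[of 2 a'] by (intro borel_measurable_indicator) auto
  have Pd: "nrm lborel (\<lambda>x. indicator ?U x * (P (x + h *\<^sub>R axis 2 1) - P x)) \<le> (L * C) * h" if h: "0 < h" "h < \<epsilon>" for h
  proof -
    let ?g = "\<lambda>x. indicator ?U x * (G 2 (x + h *\<^sub>R axis 2 1) - G 2 x)"
    have g: "sqi lborel ?g"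
      by (rule sqi_bounded_mult(1)[OF sqi_diff[OF sqi_shift(1)[OF G_sqi] G_sqi] m, where B=1]) (auto simp: indicator_def)
    have p: "sqi lborel (\<lambda>x. indicator ?U x * (P (x + h *\<^sub>R axis 2 1) - P x))"
      by (rule sqi_bounded_mult(1)[OF sqi_diff[OF sqi_shift(1) ] m, where B=1]) (auto intro: L2Q_sqi[OF L2Q_P] simp: indicator_def)
    have "\<bar>indicator ?U x * (P (x + h *\<^sub>R axis 2 1) - P x)\<bar> \<le> \<bar>L * ?g x\<bar>" for x
    proof (cases "x \<in> ?U")
      case True
      then have "x + h *\<^sub>R axis 2 1 \<in> IQ" using h C(3) by (intro strip_shift_IQ[of x 2 a']) auto
      then show ?thesis using True L(2)[of "x + h *\<^sub>R axis 2 1" x] L(1) by (simp add: abs_mult)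
    qed simp
    then have "nrm lborel (\<lambda>x. indicator ?U x * (P (x + h *\<^sub>R axis 2 1) - P x)) \<le> nrm lborel (\<lambda>x. L * ?g x)"
      using sqi_measurable[OF p] by (intro sqi_mono(2) sqi_cmult(1)[OF g]) auto
    also have "\<dots> = L * nrm lborel ?g" using sqi_cmult(2)[OF g, of L] L(1) by simp
    also have "\<dots> \<le> L * (C * h)" using L(1) by (intro mult_left_mono C(4) h) auto
    finally show ?thesis by simp
  qed
  show ?thesis
  proof (rule that[of "L * C"])
    fix \<phi> assume t: "\<phi> \<in> test_functions ?U"
    then have "\<bar>\<integral>x. P x * pd 2 \<phi> x \<partial>lborel\<bar> \<le> (L * C) * nrm lborel \<phi>"
      by (rule weak_bound_of_difference_quotients[OF L2Q_sqi[OF L2Q_P] _ open_strip C(2) Pd])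
    then show "\<bar>\<integral>x. G 1 x * pd 1 \<phi> x \<partial>lborel\<bar> \<le> (L * C) * nrm lborel \<phi>"
      using Euler_Lagrange[of \<phi>] t strip_subset by (auto simp: subset_iff)
  qed (use L(1) C(1) in simp)
qed

text \<open>Near the free sides \<open>\<partial>\<^sub>2 P = - \<partial>\<^sub>1\<^sub>1 \<sigma>\<close> is square integrable, and since \<open>P\<close> is a uniformly
  monotone function of \<open>\<partial>\<^sub>2 \<sigma>\<close> its differences control those of \<open>\<partial>\<^sub>2 \<sigma>\<close>.\<close>

lemma normal_bound_Neumann:
  assumes C: "0 \<le> C" "\<And>\<phi>. \<phi> \<in> test_functions {x \<in> IQ. \<bar>x $ 1\<bar> < a'} \<Longrightarrow>
    \<bar>\<integral>x. G 1 x * pd 1 \<phi> x \<partial>lborel\<bar> \<le> C * nrm lborel \<phi>"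
    and t: "\<phi> \<in> test_functions {x \<in> IQ. \<bar>x $ 1\<bar> < a'}"
  shows "\<bar>\<integral>x. G 2 x * pd 2 \<phi> x \<partial>lborel\<bar> \<le> C * nrm lborel \<phi>"
proof -
  obtain K where K: "smooth \<phi>" "compact K" "K \<subseteq> {x \<in> IQ. \<bar>x $ 1\<bar> < a'}" "\<And>x. x \<notin> K \<Longrightarrow> \<phi> x = 0"
    by (rule test_functionsE[OF t]) blast
  \<comment> \<open>The compact support of \<phi> keeps a positive distance to the free sides and
    can be shifted upwards by less than 1 - b. Only the admissible shifts depend on b, the constant
    C does not.\<close>
  obtain b where b: "b < 1" "\<And>x. x \<in> K \<Longrightarrow> \<bar>x $ 2\<bar> < b"
  proof (cases "K = {}")
    case True
    then show ?thesis using that[of 0] by auto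
  next
    case False
    have "continuous_on K (\<lambda>x. \<bar>x $ 2\<bar>)" by (intro continuous_intros)
    from continuous_attains_sup[OF K(2) False this] obtain y where y: "y \<in> K" "\<forall>x\<in>K. \<bar>x $ 2\<bar> \<le> \<bar>y $ 2\<bar>" by blast
    have y1: "\<bar>y $ 2\<bar> < 1" using y(1) K(3) by (auto simp: IQ_iff abs_less_iff)
    then have "\<bar>x $ 2\<bar> < (1 + \<bar>y $ 2\<bar>) / 2" if "x \<in> K" for x using y(2) that by fastforce
    then show ?thesis using y1 by (intro that[of "(1 + \<bar>y $ 2\<bar>) / 2"]) auto
  qed
  define U where "U = {x \<in> IQ. \<bar>x $ 1\<bar> < a'} \<inter> {x \<in> IQ. \<bar>x $ 2\<bar> < b}"
  have U: "open U" unfolding U_def by (intro open_Int open_strip)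
  have tU: "\<phi> \<in> test_functions U"
    by (rule test_functionsI[OF K(1,2) _ K(4)]) (use K(3) b(2) in \<open>auto simp: U_def\<close>)
  show ?thesis
  proof (rule weak_bound_of_difference_quotients[OF G_sqi tU U])
    show "0 < 1 - b" using b by simp
    fix h assume h: "0 < h" "h < 1 - b"
    have shift: "x + r *\<^sub>R axis 2 1 \<in> IQ" if "x \<in> U" "0 \<le> r" "r \<le> h" for x r
      by (rule strip_shift_IQ[of _ _ b]) (use that h in \<open>auto simp: U_def\<close>)
    have m: "indicator U \<in> borel_measurable lborel"
      using U by (intro borel_measurable_indicator) auto
    have p: "sqi lborel (\<lambda>x. indicator U x * (P (x + h *\<^sub>R axis 2 1) - P x))"
      by (rule sqi_bounded_mult(1)[OF sqi_diff[OF sqi_shift(1)] m, where B=1]) (auto intro: L2Q_sqi[OF L2Q_P] simp: indicator_def)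
    have g: "sqi lborel (\<lambda>x. indicator U x * (G 2 (x + h *\<^sub>R axis 2 1) - G 2 x))"
      by (rule sqi_bounded_mult(1)[OF sqi_diff[OF sqi_shift(1)[OF G_sqi] G_sqi] m, where B=1]) (auto simp: indicator_def)
    have "\<bar>indicator U x * (G 2 (x + h *\<^sub>R axis 2 1) - G 2 x)\<bar> \<le> \<bar>indicator U x * (P (x + h *\<^sub>R axis 2 1) - P x)\<bar>" for x
    proof (cases "x \<in> U")
      case True
      let ?p = "P (x + h *\<^sub>R axis 2 1) - P x" and ?g = "G 2 (x + h *\<^sub>R axis 2 1) - G 2 x"
      have "?g\<^sup>2 \<le> ?p * ?g"
        by (rule P_monotone) (use shift[OF True] True h in \<open>auto simp: U_def\<close>)
      then have le: "\<bar>?g\<bar> * \<bar>?g\<bar> \<le> \<bar>?p\<bar> * \<bar>?g\<bar>"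
        unfolding abs_mult[symmetric] by (simp add: power2_eq_square)
      have "\<bar>?g\<bar> \<le> \<bar>?p\<bar>"
      proof (cases "?g = 0")
        case False
        then show ?thesis by (intro mult_right_le_imp_le[OF le]) simp
      qed simp
      then show ?thesis using True by simp
    qed simp
    then have "nrm lborel (\<lambda>x. indicator U x * (G 2 (x + h *\<^sub>R axis 2 1) - G 2 x))
        \<le> nrm lborel (\<lambda>x. indicator U x * (P (x + h *\<^sub>R axis 2 1) - P x))"
      using sqi_measurable[OF g] by (intro sqi_mono(2)[OF p]) auto
    also have "\<dots> \<le> C * h"
    proof (rule translation_estimate[OF U L2Q_sqi[OF L2Q_P]])
      fix \<psi> and r :: real assume ps: "\<psi> \<in> test_functions U" and r: "0 \<le> r" "r \<le> h"
      let ?\<psi> = "\<lambda>x. \<psi> (x - r *\<^sub>R axis 2 1)"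
      have ts: "?\<psi> \<in> test_functions {x \<in> IQ. \<bar>x $ 1\<bar> < a'}"
        by (rule test_shift[OF ps]) (use shift r in \<open>auto simp: U_def axis_def\<close>)
      have "pd 2 ?\<psi> x = pd 2 \<psi> (x - r *\<^sub>R axis 2 1)" for x
        using pd_shift[OF test_smooth[OF ps], of 2 "- (r *\<^sub>R axis 2 1)" x] by simp
      moreover have "nrm lborel ?\<psi> = nrm lborel \<psi>"
        using sqi_shift(2)[OF sqi_test[OF ps], of "- (r *\<^sub>R axis 2 1)"] by simp
      moreover have "\<bar>\<integral>x. P x * pd 2 ?\<psi> x \<partial>lborel\<bar> \<le> C * nrm lborel ?\<psi>"
        using C(2)[OF ts] Euler_Lagrange[OF subsetD[OF strip_subset ts]] by simp
      ultimately show "\<bar>\<integral>x. P x * pd 2 \<psi> (x - r *\<^sub>R axis 2 1) \<partial>lborel\<bar> \<le> C * nrm lborel \<psi>"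
        by simp
    qed (use h C(1) in auto)
    finally show "nrm lborel (\<lambda>x. indicator U x * (G 2 (x + h *\<^sub>R axis 2 1) - G 2 x)) \<le> C * h" .
  qed
qed

text \<open>Tangential differences bound the derivatives of both components in direction i, symmetry
  bounds every derivative of \<open>G i\<close>, and the one remaining case j = k \<noteq> i comes
  from the equation.\<close>

lemma strip_bound:
  assumes a': "0 < a'" "a' < 1"
  obtains C where "0 \<le> C" "\<And>j k \<phi>. \<phi> \<in> test_functions {x \<in> IQ. \<bar>x $ i\<bar> < a'} \<Longrightarrow>
    \<bar>\<integral>x. G j x * pd k \<phi> x \<partial>lborel\<bar> \<le> C * nrm lborel \<phi>"
proof -
  let ?T = "test_functions {x \<in> IQ. \<bar>x $ i\<bar> < a'}"
  obtain C1 where C1: "0 \<le> C1" "\<And>j \<phi>. \<phi> \<in> ?T \<Longrightarrow> \<bar>\<integral>x. G j x * pd i \<phi> x \<partial>lborel\<bar> \<le> C1 * nrm lborel \<phi>"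
    by (rule tangential_bound[OF a', of i]) blast
  have mix: "\<bar>\<integral>x. G i x * pd j \<phi> x \<partial>lborel\<bar> \<le> C1 * nrm lborel \<phi>" if "\<phi> \<in> ?T" for j \<phi>
    using C1(2)[OF that, of j] mixed_derivatives[OF subsetD[OF strip_subset that], of i j] by simp
  obtain C2 where C2: "0 \<le> C2" "\<And>j \<phi>. \<phi> \<in> ?T \<Longrightarrow> j \<noteq> i \<Longrightarrow> \<bar>\<integral>x. G j x * pd j \<phi> x \<partial>lborel\<bar> \<le> C2 * nrm lborel \<phi>"
  proof (cases "i = 1")
    case True
    have "\<bar>\<integral>x. G j x * pd j \<phi> x \<partial>lborel\<bar> \<le> C1 * nrm lborel \<phi>" if "\<phi> \<in> ?T" "j \<noteq> i" for j \<phi>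
      using normal_bound_Neumann[OF C1(1), of a' \<phi>] C1(2)[where j=1] that True exhaust_2[of j] by auto
    then show ?thesis using that[OF C1(1)] by blast
  next
    case False
    then have i: "i = 2" using exhaust_2[of i] by blast
    obtain C where C: "0 \<le> C" "\<And>\<phi>. \<phi> \<in> test_functions {x \<in> IQ. \<bar>x $ 2\<bar> < a'} \<Longrightarrow>
        \<bar>\<integral>x. G 1 x * pd 1 \<phi> x \<partial>lborel\<bar> \<le> C * nrm lborel \<phi>"
      by (rule normal_bound_Dirichlet[OF a']) blast
    have "\<bar>\<integral>x. G j x * pd j \<phi> x \<partial>lborel\<bar> \<le> C * nrm lborel \<phi>" if "\<phi> \<in> ?T" "j \<noteq> i" for j \<phi>
      using C(2)[of \<phi>] that i exhaust_2[of j] by auto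
    then show ?thesis using that[OF C(1)] by blast
  qed
  have "\<bar>\<integral>x. G j x * pd k \<phi> x \<partial>lborel\<bar> \<le> max C1 C2 * nrm lborel \<phi>" if t: "\<phi> \<in> ?T" for j k \<phi>
  proof -
    have le: "C1 * nrm lborel \<phi> \<le> max C1 C2 * nrm lborel \<phi>" "C2 * nrm lborel \<phi> \<le> max C1 C2 * nrm lborel \<phi>"
      by (intro mult_right_mono; simp)+
    consider "k = i" | "j = i" | "k \<noteq> i" "j \<noteq> i" by blast
    then show ?thesis
    proof cases
      case 1
      then show ?thesis using C1(2)[OF t, of j] le(1) by simp
    next
      case 2
      then show ?thesis using mix[OF t, of k] le(1) by simp
    next
      case 3
      then have "j = k" using exhaust_2[of i] exhaust_2[of j] exhaust_2[of k] by auto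
      then show ?thesis using C2(2)[OF t, of k] 3 le(2) by simp
    qed
  qed
  then show ?thesis using C1(1) by (intro that[of "max C1 C2"]) auto
qed

text \<open>A partition of unity in x_2 distributes \<phi> over the two strips. The bounds involve
  only the L2 norm of the test function, so multiplication by a cutoff costs no derivative.\<close>

lemma second_derivatives_bounded:
  assumes r: "0 < r" "r < 1" and U: "U \<subseteq> IQ" "\<And>x. x \<in> U \<Longrightarrow> \<bar>x $ 1\<bar> < 1 - r \<or> \<bar>x $ 2\<bar> < 1 - r"
  obtains C where "0 \<le> C" "\<And>j k \<phi>. \<phi> \<in> test_functions U \<Longrightarrow>
    \<bar>\<integral>x. G j x * pd k \<phi> x \<partial>lborel\<bar> \<le> C * nrm lborel \<phi>"
proof -
  obtain X :: "real \<Rightarrow> real" where X: "smooth X" "\<And>t. 0 \<le> X t" "\<And>t. X t \<le> 1"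
    "\<And>t. \<bar>t\<bar> \<le> 1 - r \<Longrightarrow> X t = 1" "\<And>t. \<bar>t\<bar> \<ge> 1 - r / 2 \<Longrightarrow> X t = 0"
    by (rule smooth_cutoff[of "1 - r" "1 - r / 2"]) (use r in auto)
  obtain C1 where C1: "0 \<le> C1" "\<And>j k \<phi>. \<phi> \<in> test_functions {x \<in> IQ. \<bar>x $ 1\<bar> < 1 - r} \<Longrightarrow>
    \<bar>\<integral>x. G j x * pd k \<phi> x \<partial>lborel\<bar> \<le> C1 * nrm lborel \<phi>"
    by (rule strip_bound[of "1 - r" 1]) (use r in auto)
  \<comment> \<open>The open strip |x_2| < 1 - r/4 leaves room around the closed set |x_2| <= 1 -
    r/2 that carries the first piece. On the second piece |x_2| >= 1 - r, which forces |x_1| < 1 - r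
    in U.\<close>
  obtain C2 where C2: "0 \<le> C2" "\<And>j k \<phi>. \<phi> \<in> test_functions {x \<in> IQ. \<bar>x $ 2\<bar> < 1 - r / 4} \<Longrightarrow>
    \<bar>\<integral>x. G j x * pd k \<phi> x \<partial>lborel\<bar> \<le> C2 * nrm lborel \<phi>"
    by (rule strip_bound[of "1 - r / 4" 2]) (use r in auto)
  have "\<bar>\<integral>x. G j x * pd k \<phi> x \<partial>lborel\<bar> \<le> (C1 + C2) * nrm lborel \<phi>" if t: "\<phi> \<in> test_functions U" for j k \<phi>
  proof -
    obtain K where K: "smooth \<phi>" "compact K" "K \<subseteq> U" "\<And>x. x \<notin> K \<Longrightarrow> \<phi> x = 0"
      by (rule test_functionsE[OF t]) blast
    let ?b = "\<lambda>x::real^2. X (x $ 2)"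
    have b: "smooth ?b" by (rule smooth_coord[OF X(1)])
    have b1: "smooth (\<lambda>x. 1 - ?b x)" by (intro smooth_diff smooth_const b)
    have bm: "?b \<in> borel_measurable lborel" "(\<lambda>x. 1 - ?b x) \<in> borel_measurable lborel"
      using smooth_borel[OF b] smooth_borel[OF b1] by auto
    have s: "smooth (\<lambda>x. ?b x * \<phi> x)" "smooth (\<lambda>x. (1 - ?b x) * \<phi> x)"
      by (intro smooth_mult b b1 K(1))+
    have c1: "closed {x :: real^2. 1 - r \<le> \<bar>x $ 2\<bar>}" "closed {x :: real^2. \<bar>x $ 2\<bar> \<le> 1 - r / 2}"
      by (intro closed_Collect_le continuous_intros)+
    have t2: "(\<lambda>x. ?b x * \<phi> x) \<in> test_functions {x \<in> IQ. \<bar>x $ 2\<bar> < 1 - r / 4}"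
    proof (rule test_functionsI[OF s(1) compact_Int_closed[OF K(2) c1(2)]])
      show "K \<inter> {x. \<bar>x $ 2\<bar> \<le> 1 - r / 2} \<subseteq> {x \<in> IQ. \<bar>x $ 2\<bar> < 1 - r / 4}"
        using K(3) U(1) r by auto
      show "?b x * \<phi> x = 0" if "x \<notin> K \<inter> {x. \<bar>x $ 2\<bar> \<le> 1 - r / 2}" for x
        using that K(4)[of x] X(5)[of "x $ 2"] by (cases "x \<in> K") auto
    qed
    have t1: "(\<lambda>x. (1 - ?b x) * \<phi> x) \<in> test_functions {x \<in> IQ. \<bar>x $ 1\<bar> < 1 - r}"
    proof (rule test_functionsI[OF s(2) compact_Int_closed[OF K(2) c1(1)]])
      show "K \<inter> {x. 1 - r \<le> \<bar>x $ 2\<bar>} \<subseteq> {x \<in> IQ. \<bar>x $ 1\<bar> < 1 - r}"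
        using K(3) U by force
      show "(1 - ?b x) * \<phi> x = 0" if "x \<notin> K \<inter> {x. 1 - r \<le> \<bar>x $ 2\<bar>}" for x
        using that K(4)[of x] X(4)[of "x $ 2"] by (cases "x \<in> K") auto
    qed
    have ps: "sqi lborel \<phi>" by (rule sqi_test[OF t])
    have n: "nrm lborel (\<lambda>x. ?b x * \<phi> x) \<le> 1 * nrm lborel \<phi>" "nrm lborel (\<lambda>x. (1 - ?b x) * \<phi> x) \<le> 1 * nrm lborel \<phi>"
      by (rule sqi_bounded_mult(2)[OF ps bm(1)] sqi_bounded_mult(2)[OF ps bm(2)]; use X(2,3) in \<open>simp add: abs_le_iff\<close>)+
    have "pd k \<phi> x = pd k (\<lambda>x. ?b x * \<phi> x) x + pd k (\<lambda>x. (1 - ?b x) * \<phi> x) x" for x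
      using pd_add[OF s, of k x] by (simp add: algebra_simps)
    then have "(\<integral>x. G j x * pd k \<phi> x \<partial>lborel) =
        (\<integral>x. G j x * pd k (\<lambda>x. ?b x * \<phi> x) x + G j x * pd k (\<lambda>x. (1 - ?b x) * \<phi> x) x \<partial>lborel)"
      by (simp add: distrib_left)
    also have "\<dots> = (\<integral>x. G j x * pd k (\<lambda>x. ?b x * \<phi> x) x \<partial>lborel) + (\<integral>x. G j x * pd k (\<lambda>x. (1 - ?b x) * \<phi> x) x \<partial>lborel)"
      by (intro Bochner_Integration.integral_add sqi_mult_integrable G_sqi sqi_test[OF test_pd[OF t1]] sqi_test[OF test_pd[OF t2]])
    finally have "\<bar>\<integral>x. G j x * pd k \<phi> x \<partial>lborel\<bar> \<le>
        C2 * nrm lborel (\<lambda>x. ?b x * \<phi> x) + C1 * nrm lborel (\<lambda>x. (1 - ?b x) * \<phi> x)"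
      using C1(2)[OF t1, of j k] C2(2)[OF t2, of j k] by linarith
    also have "\<dots> \<le> C2 * (1 * nrm lborel \<phi>) + C1 * (1 * nrm lborel \<phi>)"
      by (intro add_mono mult_left_mono n C1 C2)
    finally show ?thesis by (simp add: distrib_right)
  qed
  then show ?thesis using C1(1) C2(1) by (intro that[of "C1 + C2"]) auto
qed

end

section \<open>Removing the corners and returning to minimizers\<close>

lemma corners_neighbourhood:
  assumes "corners \<subseteq> interior V"
  obtains r where "0 < r" "r < 1" "\<And>x. x \<in> Q \<Longrightarrow> 1 - r \<le> \<bar>x $ 1\<bar> \<Longrightarrow> 1 - r \<le> \<bar>x $ 2\<bar> \<Longrightarrow> x \<in> V"
proof -
  have "corners \<subseteq> {vector [-1, -1], vector [-1, 1], vector [1, -1], vector [1, 1]}"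
    by (auto simp: corners_def vec_eq_iff forall_2)
  then have "compact corners"
    by (intro finite_imp_compact) (auto intro: finite_subset)
  then obtain e where e: "e > 0" "(\<Union>x\<in>corners. ball x e) \<subseteq> interior V"
    by (rule compact_subset_open_imp_ball_epsilon_subset[OF _ open_interior assms])
  \<comment> \<open>A point whose two coordinates are within r of those of a corner has distance at
    most 2 r < e from it.\<close>
  define r where "r = min (1 / 2) (e / 4)"
  have r: "0 < r" "r < 1" "2 * r < e" using e(1) by (auto simp: r_def)
  have "x \<in> V" if x: "x \<in> Q" "1 - r \<le> \<bar>x $ 1\<bar>" "1 - r \<le> \<bar>x $ 2\<bar>" for x
  proof -
    define y :: "real^2" where "y = (\<chi> i. if 0 \<le> x $ i then 1 else -1)"
    have yc: "y \<in> corners" by (auto simp: corners_def y_def)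
    have d: "\<bar>(y - x) $ i\<bar> \<le> r" for i
      using x exhaust_2[of i] by (auto simp: y_def Q_def forall_2)
    have "norm (y - x) \<le> (\<Sum>i\<in>UNIV. \<bar>(y - x) $ i\<bar>)" by (rule norm_le_l1_cart)
    also have "\<dots> \<le> r + r" unfolding sum_2 by (intro add_mono d)
    finally have "x \<in> ball y e" using r(3) by (simp add: dist_norm)
    then show ?thesis using e(2) yc interior_subset by blast
  qed
  then show ?thesis using r that by blast
qed

lemma L2_on_subset:
  assumes F: "L2Q F" "AE x in lborel. x \<in> IQ \<longrightarrow> f x = F x" and U: "open U" "U \<subseteq> IQ"
  shows "f \<in> L2_on U"
proof -
  have f: "f \<in> borel_measurable (lebesgue_on IQ)" "integrable (lebesgue_on IQ) (\<lambda>x. (f x)\<^sup>2)"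
    using L2Q_imp_L2_on[OF F] by (auto simp: L2_on_def)
  have Um: "U \<in> sets lebesgue" using U(1) by auto
  have "integrable lebesgue (\<lambda>x. if x \<in> IQ then (f x)\<^sup>2 else 0)"
    using f(2) Lebesgue_Measure.integrable_restrict_UNIV[OF IQ_lebesgue(1), of "\<lambda>x. (f x)\<^sup>2"] by simp
  from integrable_mult_indicator[OF Um this]
  have "integrable lebesgue (\<lambda>x. indicator U x *\<^sub>R (if x \<in> IQ then (f x)\<^sup>2 else 0))" .
  moreover have "(\<lambda>x. indicator U x *\<^sub>R (if x \<in> IQ then (f x)\<^sup>2 else 0)) = (\<lambda>x. if x \<in> U then (f x)\<^sup>2 else 0)"
    using U(2) by (auto simp: indicator_def fun_eq_iff)
  ultimately have "integrable (lebesgue_on U) (\<lambda>x. (f x)\<^sup>2)"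
    using Lebesgue_Measure.integrable_restrict_UNIV[OF Um, of "\<lambda>x. (f x)\<^sup>2"] by simp
  moreover have "f \<in> borel_measurable (lebesgue_on U)"
    by (rule measurable_restrict_mono[OF f(1) U(2)])
  ultimately show ?thesis by (simp add: L2_on_def)
qed

text \<open>The bounded functional is represented by \<open>Riesz_L2\<close>; truncating the
  representative to \<open>IQ\<close> does not change its pairing with test functions supported in
  U.\<close>

lemma weak_partial_exists:
  assumes F: "L2Q F" and U: "open U" "U \<subseteq> IQ"
    and bound: "\<And>\<phi>. \<phi> \<in> test_functions U \<Longrightarrow> \<bar>\<integral>x. F x * pd k \<phi> x \<partial>lborel\<bar> \<le> C * nrm lborel \<phi>"
  obtains g where "L2Q g" "has_weak_partial U k F g"
proof -
  have int: "integrable lborel (\<lambda>x. F x * pd k \<phi> x)" if "\<phi> \<in> test_functions U" for \<phi>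
    by (intro sqi_mult_integrable L2Q_sqi[OF F] sqi_test[OF test_pd[OF that]])
  obtain g where g: "sqi lborel g"
    "\<And>\<phi>. \<phi> \<in> test_functions U \<Longrightarrow> - (\<integral>x. F x * pd k \<phi> x \<partial>lborel) = (\<integral>x. g x * \<phi> x \<partial>lborel)"
  proof (rule Riesz_L2[where T="test_functions U" and M=lborel and C=C and l="\<lambda>\<phi>. - (\<integral>x. F x * pd k \<phi> x \<partial>lborel)"])
    fix \<phi> \<psi> :: "real^2 \<Rightarrow> real" assume t: "\<phi> \<in> test_functions U" "\<psi> \<in> test_functions U"
    show "- (\<integral>x. F x * pd k (\<lambda>x. \<phi> x + \<psi> x) x \<partial>lborel) = - (\<integral>x. F x * pd k \<phi> x \<partial>lborel) + - (\<integral>x. F x * pd k \<psi> x \<partial>lborel)"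
      using int[OF t(1)] int[OF t(2)] by (simp add: pd_add[OF t[THEN test_smooth]] distrib_left)
  next
    fix c and \<phi> :: "real^2 \<Rightarrow> real" assume t: "\<phi> \<in> test_functions U"
    show "- (\<integral>x. F x * pd k (\<lambda>x. c * \<phi> x) x \<partial>lborel) = c * - (\<integral>x. F x * pd k \<phi> x \<partial>lborel)"
      using int[OF t] by (simp add: pd_cmult[OF test_smooth[OF t]] mult.left_commute)
  qed (auto intro: sqi_test test_zero test_add test_cmult bound)
  have gm: "g \<in> borel_measurable borel" using g(1) by (auto simp: sqi_def)
  have cg: "L2Q (cut g)"
    using sqi_mono(1)[OF g(1), of "cut g"] gm by (auto simp: L2Q_def indicator_def)
  have "has_weak_partial U k F (cut g)"
  proof (rule has_weak_partialI[OF U F _ cg])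
    fix \<psi> assume t: "\<psi> \<in> test_functions U"
    have "cut g x * \<psi> x = g x * \<psi> x" for x
      using test_zero_outside[OF t, of x] U(2) by (cases "x \<in> IQ") auto
    then have "(\<integral>x. cut g x * \<psi> x \<partial>lborel) = (\<integral>x. g x * \<psi> x \<partial>lborel)"
      by (simp only:)
    then show "(\<integral>x. F x * pd k \<psi> x \<partial>lborel) = - (\<integral>x. cut g x * \<psi> x \<partial>lborel)"
      using g(2)[OF t] by linarith
  qed auto
  then show ?thesis using that cg by blast
qed

lemma (in regular_minimizer) sobolev2:
  assumes rep: "srep \<sigma> s G" and V: "compact V" "corners \<subseteq> interior V"
  shows "\<sigma> \<in> sobolev 2 (IQ - V)"
proof -
  have U: "open (IQ - V)" "IQ - V \<subseteq> IQ" using V(1) by (auto intro: open_Diff compact_imp_closed)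
  obtain r where r: "0 < r" "r < 1" "\<And>x. x \<in> Q \<Longrightarrow> 1 - r \<le> \<bar>x $ 1\<bar> \<Longrightarrow> 1 - r \<le> \<bar>x $ 2\<bar> \<Longrightarrow> x \<in> V"
    by (rule corners_neighbourhood[OF V(2)]) blast
  have strips: "\<bar>x $ 1\<bar> < 1 - r \<or> \<bar>x $ 2\<bar> < 1 - r" if "x \<in> IQ - V" for x
    using r(3)[of x] that IQ_subset_Q by force
  have "\<exists>C. \<forall>j k. \<forall>\<phi>\<in>test_functions (IQ - V). \<bar>\<integral>x. G j x * pd k \<phi> x \<partial>lborel\<bar> \<le> C * nrm lborel \<phi>"
    by (rule second_derivatives_bounded[OF r(1,2) U(2) strips]) auto
  then obtain C where C: "\<And>j k \<phi>. \<phi> \<in> test_functions (IQ - V) \<Longrightarrow>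
      \<bar>\<integral>x. G j x * pd k \<phi> x \<partial>lborel\<bar> \<le> C * nrm lborel \<phi>"
    by blast
  note L = zt2_L2Q[OF zt2]
  have sob1: "G i \<in> sobolev 1 (IQ - V)" for i
  proof -
    have "\<exists>g\<in>L2_on (IQ - V). has_weak_partial (IQ - V) k (G i) g" for k
    proof -
      obtain g where "L2Q g" "has_weak_partial (IQ - V) k (G i) g"
        by (rule weak_partial_exists[OF L(2) U C]) blast
      then show ?thesis using L2_on_subset[of g g, OF _ _ U] by auto
    qed
    then show ?thesis
      using L2_on_subset[of "G i" "G i", OF L(2) _ U] unfolding One_nat_def sobolev.simps by auto
  qed
  have ae: "AE x in lborel. x \<in> IQ \<longrightarrow> \<sigma> x = s x" using rep by (simp add: srep_def)
  have "has_weak_partial (IQ - V) i \<sigma> (G i)" for i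
  proof (rule has_weak_partialI[OF U L(1) ae L(2)])
    fix \<psi> assume "\<psi> \<in> test_functions (IQ - V)"
    then show "(\<integral>x. s x * pd i \<psi> x \<partial>lborel) = - (\<integral>x. G i x * \<psi> x \<partial>lborel)"
      by (intro zt_weak[OF z(1)] subsetD[OF test_mono[OF U(2)]])
  qed simp
  moreover have "\<sigma> \<in> L2_on (IQ - V)" by (rule L2_on_subset[OF L(1) ae U])
  ultimately show ?thesis
    using sob1 unfolding numeral_2_eq_2 sobolev.simps(2)[of "Suc 0"] by (auto simp: One_nat_def simp del: sobolev.simps)
qed

text \<open>\<open>zt_closed\<close> for a constant sequence, since \<open>nrm\<close> ignores null
  sets.\<close>

lemma zt_cong_AE:
  assumes z: "zt a s G" and G': "\<And>i. L2Q (G' i)" "\<And>i. AE x in lborel. G i x = G' i x"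
  shows "zt a s G'"
proof (rule zt_closed[where s="\<lambda>_. s" and G="\<lambda>_. G", OF z zt_L2Q(1)[OF z] G'(1)])
  have "nrm lborel (\<lambda>x. G i x - G' i x) = nrm lborel (\<lambda>x::real^2. 0)" for i
  proof (rule nrm_cong_AE)
    show "(\<lambda>x. G i x - G' i x) \<in> borel_measurable lborel"
      using sqi_measurable[OF L2Q_sqi[OF zt_L2Q(2)[OF z]]] sqi_measurable[OF L2Q_sqi[OF G'(1)]]
      by (intro borel_measurable_diff)
    show "AE x in lborel. G i x - G' i x = 0" using G'(2)[of i] by eventually_elim simp
  qed simp
  then show "(\<lambda>_. nrm lborel (\<lambda>x. G i x - G' i x)) \<longlonglongrightarrow> 0" for i by simp
qed simp

context energy_density
begin

lemma minimizer_sobolev2: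
  assumes min: "minimizer h0 \<sigma>" and c: "c > 0"
    and det: "AE x in lebesgue_on Q. 1 + weak_grad IQ \<sigma> x $ 2 \<ge> c"
    and V: "compact V" "corners \<subseteq> interior V"
  shows "\<sigma> \<in> sobolev 2 (IQ - V)"
proof -
  obtain s G where sG: "srep \<sigma> s G" "zt2 s G" "admissible G"
    "\<And>s' G'. zt2 s' G' \<Longrightarrow> admissible G' \<Longrightarrow> (\<integral>x. wint G x \<partial>lborel) \<le> (\<integral>x. wint G' x \<partial>lborel)"
    by (rule minimizer_pair[OF min]) blast
  have Gm [measurable]: "G i \<in> borel_measurable borel" for i
    using zt2_L2Q(2)[OF sG(2), of i] by (auto simp: L2Q_def sqi_def)
  \<comment> \<open>Raising the second component to at least c - 1 alters it only on the null set
    where the determinant bound fails; afterwards the bound holds at every point of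
    \<open>IQ\<close>.\<close>
  define G' where "G' i x = (if i = 2 \<and> x \<in> IQ then max (G i x) (c - 1) else G i x)" for i x
  have G'm [measurable]: "G' i \<in> borel_measurable borel" for i
    unfolding G'_def[abs_def] by (cases "i = 2") simp_all
  have aeG: "AE x in lborel. G i x = G' i x" for i
    using det[unfolded AE_lebesgue_on_Q] srep_weak_grad[OF sG(1)]
    by eventually_elim (auto simp: G'_def max_def)
  have L': "L2Q (G' i)" for i
  proof -
    have "sqi lborel (G' i)"
      by (rule sqi_cong_AE[OF L2Q_sqi[OF zt2_L2Q(2)[OF sG(2)]] _ aeG]) simp
    then show ?thesis using L2Q_zero[OF zt2_L2Q(2)[OF sG(2)]] by (simp add: L2Q_def G'_def)
  qed
  have zt': "zt2 s G'"
    using sG(2) unfolding zt2_def by (auto intro: zt_cong_AE[OF _ L' aeG])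
  have wae: "AE x in lborel. wint G x = wint G' x"
    using aeG[of 1] aeG[of 2] by eventually_elim (simp add: wint_def)
  have wm: "wint G \<in> borel_measurable lborel" "wint G' \<in> borel_measurable lborel"
    unfolding wint_def[abs_def] by measurable
  have wi: "(\<integral>x. wint G x \<partial>lborel) = (\<integral>x. wint G' x \<partial>lborel)"
    by (rule integral_cong_AE[OF wm wae])
  have adm': "admissible G'"
    unfolding admissible_def
  proof
    show "AE x in lborel. x \<in> IQ \<longrightarrow> 1 + G' 2 x > 0"
      using c by (intro AE_I2) (auto simp: G'_def max_def)
    show "integrable lborel (wint G')"
      using sG(3) integrable_cong_AE[OF wm wae] by (simp add: admissible_def)
  qed
  interpret regular_minimizer h0 s G' c
  proof
    show "(\<integral>x. wint G' x \<partial>lborel) \<le> (\<integral>x. wint H x \<partial>lborel)" if "zt2 t H" "admissible H" for t H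
      using sG(4)[OF that] wi by simp
    show "c \<le> 1 + G' 2 x" if "x \<in> IQ" for x using that by (auto simp: G'_def max_def)
  qed (use zt' adm' c in auto)
  have "srep \<sigma> s G'"
    using zt_srep[OF z(1)] sG(1) by (simp add: srep_def)
  then show ?thesis by (rule sobolev2[OF _ V])
qed

end

theorem lemma18:
  fixes h0 :: "real \<Rightarrow> ereal"
  assumes "strongly_convex h0"
    and "Ck_on 2 (\<lambda>t. real_of_ereal (h0 t)) {t. \<bar>h0 t\<bar> \<noteq> \<infinity>}"
    and "H1 h0" and "H2 h0" and "H3 h0"
    and "\<forall>\<mu>>0. \<exists>C>0. \<forall>t\<ge>\<mu>. \<bar>h0_deriv h0 2 t\<bar> \<le> C"
  shows "strongly_convex (\<lambda>\<xi>. W h0 (shear_gradient \<xi>)) \<and>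
    (\<exists>\<sigma>. minimizer h0 \<sigma>) \<and>
    (\<forall>\<sigma> \<tau>. minimizer h0 \<sigma> \<longrightarrow> minimizer h0 \<tau> \<longrightarrow> (AE x in lebesgue_on Q. \<sigma> x = \<tau> x)) \<and>
    (\<forall>\<sigma>. minimizer h0 \<sigma> \<longrightarrow>
       (\<exists>c>0. AE x in lebesgue_on Q. 1 + weak_grad (interior Q) \<sigma> x $ 2 \<ge> c) \<longrightarrow>
       (\<forall>V. compact V \<longrightarrow> corners \<subseteq> interior V \<longrightarrow> \<sigma> \<in> sobolev 2 (interior Q - V)))"
proof -
  interpret energy_density h0
    using assms(3-6) by unfold_locales
  show ?thesis
    using strongly_convex_W minimizer_exists minimizer_unique minimizer_sobolev2 by blast
qed

end
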